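(* Let $n\ge 1$ be an integer and let $F:\mathbb R^2\to\mathbb C$ be a complex valued function. Then $F$ operates in $M^{1,1}(\mathbb R^n)$ if and only if $F$ is real analytic on $\mathbb R^2$ and $F(0)=0$.
   Context: For a fixed nonzero window $g\in\mathcal S(\mathbb R^n)$ (Schwartz space), the short time Fourier transform of a tempered distribution $f$ on $\mathbb R^n$ is $V_gf(x,w)=\langle f, M_wT_xg\rangle=\int_{\mathbb R^n} f(t)\overline{g(t-x)}e^{-2\pi i w\cdot t}\,dt$, $(x,w)\in\mathbb R^{2n}$, where $T_xg(t)=g(t-x)$ and $M_wg(t)=e^{2\pi i w\cdot t}g(t)$. The modulation space $M^{1,1}(\mathbb R^n)$ is the space of tempered distributions $f$ with $\|f\|_{M^{1,1}}=\int_{\mathbb R^n}\int_{\mathbb R^n}|V_gf(x,w)|\,dx\,dw<\infty$; different windows give the same space with equivalent norms. Elements of $M^{1,1}(\mathbb R^n)$ are identified with continuous functions. $F$ operates in $M^{1,1}(\mathbb R^n)$ means: $F(f_1,f_2)\in M^{1,1}(\mathbb R^n)$ (the function $x\mapsto F(f_1(x),f_2(x))$) whenever $f=f_1+if_2\in M^{1,1}(\mathbb R^n)$ with $f_1=\mathrm{Re}(f)$, $f_2=\mathrm{Im}(f)$. $F$ is real analytic on $\mathbb R^2$ if for every $(s_0,t_0)\in\mathbb R^2$ there are $a_{jk}\in\mathbb C$ such that $F(s,t)=\sum_{j,k=0}^\infty a_{jk}(s-s_0)^j(t-t_0)^k$, the series converging absolutely for all $(s,t)$ in some neighbourhood of $(s_0,t_0)$.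 *)

theory Defs
  imports "HOL-Analysis.Analysis"
begin

section \<open>Schwartz functions and tempered distributions\<close>

definition partial_deriv :: "'a \<Rightarrow> ('a::euclidean_space \<Rightarrow> complex) \<Rightarrow> 'a \<Rightarrow> complex" where
  "partial_deriv b f = (\<lambda>x. frechet_derivative f (at x) b)"

text \<open>Multi-indices are encoded by lists of standard basis vectors: \<open>partial_derivs [b1, ..., bm] f\<close>
  is the partial derivative of order \<open>m\<close> in the directions \<open>b1, ..., bm\<close>.\<close>

definition partial_derivs :: "'a list \<Rightarrow> ('a::euclidean_space \<Rightarrow> complex) \<Rightarrow> 'a \<Rightarrow> complex" where
  "partial_derivs bs f = foldr partial_deriv bs f"

definition smooth :: "('a::euclidean_space \<Rightarrow> complex) \<Rightarrow> bool" where
  "smooth f \<longleftrightarrow> (\<forall>bs \<in> lists Basis. \<forall>x. partial_derivs bs f differentiable (at x))"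

definition schwartz :: "('a::euclidean_space \<Rightarrow> complex) set" where
  "schwartz = {\<phi>. smooth \<phi> \<and>
     (\<forall>k. \<forall>bs \<in> lists Basis.
        bounded (range (\<lambda>x. (1 + norm x) ^ k * cmod (partial_derivs bs \<phi> x))))}"

text \<open>An increasing sequence of norms defining the Frechet topology of the Schwartz space. The
  supremum is only meaningful (finite) for Schwartz functions.\<close>

definition schwartz_norm :: "nat \<Rightarrow> ('a::euclidean_space \<Rightarrow> complex) \<Rightarrow> real" where
  "schwartz_norm N \<phi> =
     (SUP (bs, x) \<in> {bs \<in> lists Basis. length bs \<le> N} \<times> UNIV.
        (1 + norm x) ^ N * cmod (partial_derivs bs \<phi> x))"

text \<open>Tempered distributions are the continuous linear functionals on the Schwartz space. They are
  represented by functionals on all functions whose values off the Schwartz space are immaterial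
  and therefore fixed to be \<open>undefined\<close>.\<close>

definition tempered_distribution :: "(('a::euclidean_space \<Rightarrow> complex) \<Rightarrow> complex) \<Rightarrow> bool" where
  "tempered_distribution u \<longleftrightarrow>
     u \<in> extensional schwartz \<and>
     (\<forall>\<phi> \<in> schwartz. \<forall>\<psi> \<in> schwartz. u (\<lambda>x. \<phi> x + \<psi> x) = u \<phi> + u \<psi>) \<and>
     (\<forall>c. \<forall>\<phi> \<in> schwartz. u (\<lambda>x. c * \<phi> x) = c * u \<phi>) \<and>
     (\<exists>C N. \<forall>\<phi> \<in> schwartz. cmod (u \<phi>) \<le> C * schwartz_norm N \<phi>)"

definition induces :: "('a::euclidean_space \<Rightarrow> complex) \<Rightarrow> (('a \<Rightarrow> complex) \<Rightarrow> complex) \<Rightarrow> bool" where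
  "induces f u \<longleftrightarrow>
     (\<forall>\<phi> \<in> schwartz. integrable lborel (\<lambda>t. f t * \<phi> t) \<and> u \<phi> = (\<integral>t. f t * \<phi> t \<partial>lborel))"

section \<open>The short time Fourier transform and the modulation space\<close>

definition translate :: "'a \<Rightarrow> ('a::euclidean_space \<Rightarrow> complex) \<Rightarrow> 'a \<Rightarrow> complex" where
  "translate x g = (\<lambda>t. g (t - x))"

definition modulate :: "'a \<Rightarrow> ('a::euclidean_space \<Rightarrow> complex) \<Rightarrow> 'a \<Rightarrow> complex" where
  "modulate w g = (\<lambda>t. exp (2 * of_real pi * \<i> * of_real (w \<bullet> t)) * g t)"

text \<open>The pairing in the short time Fourier transform extends the \<open>L\<^sup>2\<close> inner product, hence is
  conjugate linear in the second argument, whereas distributions are linear functionals.\<close>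

definition sesqui_pairing :: "(('a \<Rightarrow> complex) \<Rightarrow> complex) \<Rightarrow> ('a \<Rightarrow> complex) \<Rightarrow> complex" where
  "sesqui_pairing u \<phi> = u (\<lambda>t. cnj (\<phi> t))"

definition stft ::
    "('a::euclidean_space \<Rightarrow> complex) \<Rightarrow> (('a \<Rightarrow> complex) \<Rightarrow> complex) \<Rightarrow> 'a \<Rightarrow> 'a \<Rightarrow> complex" where
  "stft g u x w = sesqui_pairing u (modulate w (translate x g))"

definition M11 ::
    "('a::euclidean_space \<Rightarrow> complex) \<Rightarrow> (('a \<Rightarrow> complex) \<Rightarrow> complex) set" where
  "M11 g = {u. tempered_distribution u \<and>
     (\<integral>\<^sup>+ x. \<integral>\<^sup>+ w. ennreal (cmod (stft g u x w)) \<partial>lborel \<partial>lborel) < \<infinity>}"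

text \<open>Elements of the modulation space identified with continuous functions.\<close>

definition M11_fun :: "('a::euclidean_space \<Rightarrow> complex) \<Rightarrow> ('a \<Rightarrow> complex) set" where
  "M11_fun g = {f. continuous_on UNIV f \<and> (\<exists>u \<in> M11 g. induces f u)}"

definition operates_in_M11 ::
    "('a::euclidean_space \<Rightarrow> complex) \<Rightarrow> (real \<times> real \<Rightarrow> complex) \<Rightarrow> bool" where
  "operates_in_M11 g F \<longleftrightarrow>
     (\<forall>f \<in> M11_fun g. (\<lambda>x. F (Re (f x), Im (f x))) \<in> M11_fun g)"

section \<open>Real analyticity on the plane\<close>

definition real_analytic :: "(real \<times> real \<Rightarrow> complex) \<Rightarrow> bool" where
  "real_analytic F \<longleftrightarrow>
     (\<forall>s0 t0. \<exists>a :: nat \<Rightarrow> nat \<Rightarrow> complex. \<exists>U. open U \<and> (s0, t0) \<in> U \<and>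
        (\<forall>(s, t) \<in> U.
           (\<lambda>(j, k). cmod (a j k * of_real (s - s0) ^ j * of_real (t - t0) ^ k)) summable_on UNIV \<and>
           ((\<lambda>(j, k). a j k * of_real (s - s0) ^ j * of_real (t - t0) ^ k) has_sum F (s, t)) UNIV))"

end

theory Submission imports Defs "HOL-Probability.Sinc_Integral"
begin

text \<open>Sufficiency. Multiplication by a bounded function acts on the modulation space through its norm
  as a multiplier of the Fourier algebra. For \<open>f\<close> in the modulation space, the oscillation
  \<open>f - f t0\<close>, cut off by a narrow bump at \<open>t0\<close>, has small multiplier norm, and so has \<open>f\<close> cut off far
  away from the origin. The power series of \<open>F\<close> therefore converges as a series of multipliers near
  every point. Finitely many points suffice on a compact set; near infinity \<open>F (0, 0) = 0\<close> yields a bound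
  proportional to the local norm of \<open>f\<close>, which is integrable over the window position.

  Necessity. A gliding hump shows that \<open>F\<close> is continuous and that, for \<open>f\<close> of small norm and supported in
  a fixed small ball, the localized function \<open>F (p0 + f)\<close> pairs with a test function \<open>\<phi>\<close> by at most a
  constant times the supremum of the Fourier transform of \<open>\<phi>\<close>. Apply this to
  \<open>f = e * (cos (v + \<alpha>) + \<i> * cos (v + \<beta>))\<close>, where \<open>(m + n) * v\<close> is a sum of \<open>m + n\<close> cosines, and
  average over \<open>\<alpha>\<close> and \<open>\<beta>\<close>: what remains is the Chebyshev coefficient of \<open>F\<close> of index \<open>(m, n)\<close> times
  \<open>cis ((m + n) * v)\<close>. If the frequencies of the cosines increase fast enough, the Fourier transform of
  \<open>cis ((m + n) * v)\<close> times a bump function is at most a constant times \<open>(127 / 128) ^ (m + n)\<close>. Hence the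
  Chebyshev coefficients decay exponentially and \<open>F\<close> is real analytic.\<close>

text \<open>The obstacle to sufficiency is that the power series of \<open>F\<close> converges only
  on small arguments, whereas an element of the space has no reason to be small in norm.
  Localization makes the argument small but produces a continuum of pieces, whose norms must be
  integrable over the window position; hence the insistence on a bound linear in the local norm near
  infinity.

  Necessity rests on a gap between two norms. The function \<open>v\<close> is an average of quarter
  cosines, so its multiplier bound is 1/4 and that of \<open>cis v\<close> is
  \<open>exp (1/4)\<close>, however many frequencies enter. Thus all test functions stay in one
  fixed small ball. But \<open>cis ((m + n) * v)\<close> is a product of \<open>m + n\<close>
  factors in the manner of a Riesz product, and each factor of large enough frequency shrinks the
  supremum of the transform by a fixed ratio. Cosines keep the arguments of \<open>F\<close> in a
  small square, and their phases make the problem periodic, so Fourier coefficients in the phases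
  are Chebyshev coefficients on the square. Two independent phases over the same \<open>v\<close>
  separate the two indices.\<close>

section \<open>Interchange of integrals and affine substitution\<close>

lemma fubini_swap:
  fixes f :: "'a::euclidean_space \<Rightarrow> 'b::euclidean_space \<Rightarrow> complex"
  assumes [measurable]: "case_prod f \<in> borel_measurable (borel \<Otimes>\<^sub>M borel)"
    and fin: "(\<integral>\<^sup>+x. \<integral>\<^sup>+y. ennreal (cmod (f x y)) \<partial>lborel \<partial>lborel) < \<infinity>"
  shows "(\<integral>x. \<integral>y. f x y \<partial>lborel \<partial>lborel) = (\<integral>y. \<integral>x. f x y \<partial>lborel \<partial>lborel)"
proof -
  have "integrable (lborel \<Otimes>\<^sub>M lborel) (case_prod f)"
  proof (rule integrableI_bounded)
    have "(\<integral>\<^sup>+z. ennreal (norm (case_prod f z)) \<partial>(lborel \<Otimes>\<^sub>M lborel))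
        = (\<integral>\<^sup>+x. \<integral>\<^sup>+y. ennreal (norm (case_prod f (x, y))) \<partial>lborel \<partial>lborel)"
      by (rule lborel.nn_integral_fst[symmetric]) simp
    then show "(\<integral>\<^sup>+z. ennreal (norm (case_prod f z)) \<partial>(lborel \<Otimes>\<^sub>M lborel)) < \<infinity>"
      using fin by simp
  qed simp
  from lborel_pair.Fubini_integral[OF this] show ?thesis by simp
qed

lemma nn_fubini_swap:
  fixes f :: "'a::euclidean_space \<Rightarrow> 'b::euclidean_space \<Rightarrow> ennreal"
  assumes [measurable]: "case_prod f \<in> borel_measurable (borel \<Otimes>\<^sub>M borel)"
  shows "(\<integral>\<^sup>+x. \<integral>\<^sup>+y. f x y \<partial>lborel \<partial>lborel) = (\<integral>\<^sup>+y. \<integral>\<^sup>+x. f x y \<partial>lborel \<partial>lborel)"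
  by (rule lborel_pair.Fubini'[symmetric]) simp

lemma nn_integral_affine:
  fixes f :: "'a::euclidean_space \<Rightarrow> ennreal"
  assumes [measurable]: "f \<in> borel_measurable borel" and "c \<noteq> 0"
  shows "(\<integral>\<^sup>+x. f x \<partial>lborel) = ennreal (\<bar>c\<bar> ^ DIM('a)) * (\<integral>\<^sup>+x. f (t + c *\<^sub>R x) \<partial>lborel)"
  by (subst lborel_affine[OF \<open>c \<noteq> 0\<close>, of t])
     (simp add: nn_integral_density nn_integral_distr nn_integral_cmult)

lemma integral_affine:
  fixes f :: "'a::euclidean_space \<Rightarrow> complex"
  assumes [measurable]: "f \<in> borel_measurable borel" and "c \<noteq> 0"
  shows "(\<integral>x. f x \<partial>lborel) = \<bar>c\<bar> ^ DIM('a) *\<^sub>R (\<integral>x. f (t + c *\<^sub>R x) \<partial>lborel)"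
  by (subst lborel_affine[OF \<open>c \<noteq> 0\<close>, of t])
     (simp add: integral_density integral_distr)

lemma integrable_affine:
  fixes f :: "'a::euclidean_space \<Rightarrow> complex"
  assumes f: "integrable lborel f" and c: "c \<noteq> 0"
  shows "integrable lborel (\<lambda>x. f (t + c *\<^sub>R x))"
proof (rule integrableI_bounded)
  have [measurable]: "f \<in> borel_measurable borel" using f by simp
  show "(\<lambda>x. f (t + c *\<^sub>R x)) \<in> borel_measurable lborel" by simp
  have "(\<integral>\<^sup>+x. ennreal (cmod (f x)) \<partial>lborel) < \<infinity>"
    using f by (simp add: integrable_iff_bounded)
  then show "(\<integral>\<^sup>+x. ennreal (cmod (f (t + c *\<^sub>R x))) \<partial>lborel) < \<infinity>"
    by (subst (asm) nn_integral_affine[OF _ c, of _ t])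
       (use c in \<open>auto simp: ennreal_mult_less_top less_top ennreal_mult_eq_top_iff top_unique\<close>)
qed

lemma nn_integral_shift:
  fixes f :: "'a::euclidean_space \<Rightarrow> ennreal"
  assumes "f \<in> borel_measurable borel"
  shows "(\<integral>\<^sup>+x. f (x - t) \<partial>lborel) = (\<integral>\<^sup>+x. f x \<partial>lborel)"
  using nn_integral_affine[OF assms, of 1 "- t"] by simp

lemma nn_integral_reflect:
  fixes f :: "'a::euclidean_space \<Rightarrow> ennreal"
  assumes "f \<in> borel_measurable borel"
  shows "(\<integral>\<^sup>+x. f (t - x) \<partial>lborel) = (\<integral>\<^sup>+x. f x \<partial>lborel)"
  using nn_integral_affine[OF assms, of "-1" "t"] by simp

lemma integral_shift:
  fixes f :: "'a::euclidean_space \<Rightarrow> complex"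
  assumes "f \<in> borel_measurable borel"
  shows "(\<integral>x. f (x - t) \<partial>lborel) = (\<integral>x. f x \<partial>lborel)"
  using integral_affine[OF assms, of 1 "- t"] by simp

lemma integral_reflect:
  fixes f :: "'a::euclidean_space \<Rightarrow> complex"
  assumes "f \<in> borel_measurable borel"
  shows "(\<integral>x. f (t - x) \<partial>lborel) = (\<integral>x. f x \<partial>lborel)"
  using integral_affine[OF assms, of "-1" "t"] by simp

lemma integrable_shift:
  fixes f :: "'a::euclidean_space \<Rightarrow> complex"
  assumes "integrable lborel f"
  shows "integrable lborel (\<lambda>x. f (x - t))"
  using integrable_affine[OF assms, of 1 "- t"] by simp

lemma isCont_cis [continuous_intros]: "continuous F f \<Longrightarrow> continuous F (\<lambda>x. cis (f x))"
  unfolding cis_conv_exp by (intro continuous_intros)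

lemma borel_measurable_cis [measurable]: "cis \<in> borel_measurable borel"
  by (intro borel_measurable_continuous_onI continuous_intros)

lemma borel_measurable_cnj [measurable]: "cnj \<in> borel_measurable borel"
  by (intro borel_measurable_continuous_onI continuous_intros)

section \<open>The Fourier transform\<close>

text \<open>A Bochner integral, hence total, with value 0 where the integrand is not integrable.
  With 2 pi in the exponent the inversion formula carries no constant, and the sign agrees with the
  conjugated modulation of \<open>stft\<close>.\<close>

definition fourier :: "('a::euclidean_space \<Rightarrow> complex) \<Rightarrow> 'a \<Rightarrow> complex" where
  "fourier h w = (\<integral>t. h t * cis (- (2 * pi * (w \<bullet> t))) \<partial>lborel)"

text \<open>The Fourier algebra norm. Values in \<open>ennreal\<close> allow inequalities to be
  stated and Tonelli to be applied before finiteness is known.\<close>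

abbreviation fnorm :: "('a::euclidean_space \<Rightarrow> complex) \<Rightarrow> ennreal" where
  "fnorm h \<equiv> (\<integral>\<^sup>+w. ennreal (cmod (fourier h w)) \<partial>lborel)"

lemma integrable_mult_cis:
  assumes "integrable lborel h" and [measurable]: "f \<in> borel_measurable borel"
  shows "integrable lborel (\<lambda>t::'a::euclidean_space. h t * cis (f t))"
  by (rule Bochner_Integration.integrable_bound[OF assms(1)])
     (use assms(1) in \<open>auto simp: norm_mult\<close>)

lemma integrable_mult_bounded:
  fixes h u :: "'a::euclidean_space \<Rightarrow> complex"
  assumes "integrable lborel h" and [measurable]: "u \<in> borel_measurable borel"
    and "\<And>t. cmod (u t) \<le> B"
  shows "integrable lborel (\<lambda>t. u t * h t)"
proof (rule Bochner_Integration.integrable_bound)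
  show "integrable lborel (\<lambda>t. B * cmod (h t))" using assms(1) by simp
  show "AE t in lborel. norm (u t * h t) \<le> norm (B * cmod (h t))"
    using assms(3) by (intro AE_I2) (auto simp: norm_mult abs_mult intro!: mult_right_mono order_trans[OF _ abs_ge_self])
qed (use assms(1) in simp)

lemma norm_fourier_le: "cmod (fourier h w) \<le> (\<integral>t. cmod (h t) \<partial>lborel)"
  unfolding fourier_def by (rule order_trans[OF integral_norm_bound]) (simp add: norm_mult)

lemma borel_measurable_fourier [measurable (raw)]:
  fixes h :: "'b \<Rightarrow> 'a::euclidean_space \<Rightarrow> complex"
  assumes [measurable]: "case_prod h \<in> borel_measurable (M \<Otimes>\<^sub>M borel)" "f \<in> borel_measurable M"
  shows "(\<lambda>x. fourier (h x) (f x)) \<in> borel_measurable M"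
  unfolding fourier_def by measurable

lemma fourier_add:
  assumes "integrable lborel h" "integrable lborel k"
  shows "fourier (\<lambda>t. h t + k t) w = fourier h w + fourier k w"
  unfolding fourier_def using assms by (simp add: distrib_right integrable_mult_cis)

lemma fourier_cmult: "fourier (\<lambda>t. c * h t) w = c * fourier h w"
  unfolding fourier_def by (simp add: mult.assoc)

lemma fourier_cnj: "fourier (\<lambda>t. cnj (h t)) w = cnj (fourier h (- w))"
  by (simp add: fourier_def cis_cnj flip: Bochner_Integration.integral_cnj)

lemma fourier_cis: "fourier (\<lambda>t. cis (2 * pi * (v \<bullet> t)) * h t) w = fourier h (w - v)"
proof -
  have "cis (2 * pi * (v \<bullet> t)) * h t * cis (- (2 * pi * (w \<bullet> t))) = h t * cis (- (2 * pi * ((w - v) \<bullet> t)))" for t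
  proof -
    have "cis (- (2 * pi * ((w - v) \<bullet> t))) = cis (2 * pi * (v \<bullet> t)) * cis (- (2 * pi * (w \<bullet> t)))"
      unfolding cis_mult by (simp add: algebra_simps)
    then show ?thesis by simp
  qed
  then show ?thesis unfolding fourier_def by presburger
qed

lemma fourier_translate:
  assumes [measurable]: "h \<in> borel_measurable borel"
  shows "fourier (\<lambda>t. h (t - x)) w = cis (- (2 * pi * (w \<bullet> x))) * fourier h w"
proof -
  have "fourier (\<lambda>t. h (t - x)) w = (\<integral>t. (\<lambda>s. h s * cis (- (2 * pi * (w \<bullet> (s + x))))) (t - x) \<partial>lborel)"
    unfolding fourier_def by simp
  also have "\<dots> = (\<integral>s. h s * cis (- (2 * pi * (w \<bullet> (s + x)))) \<partial>lborel)"
    by (rule integral_shift) measurable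
  also have "\<dots> = (\<integral>s. cis (- (2 * pi * (w \<bullet> x))) * (h s * cis (- (2 * pi * (w \<bullet> s)))) \<partial>lborel)"
  proof (intro Bochner_Integration.integral_cong refl)
    fix s
    have "cis (- (2 * pi * (w \<bullet> (s + x)))) = cis (- (2 * pi * (w \<bullet> x))) * cis (- (2 * pi * (w \<bullet> s)))"
      unfolding cis_mult by (simp add: algebra_simps)
    then show "h s * cis (- (2 * pi * (w \<bullet> (s + x)))) = cis (- (2 * pi * (w \<bullet> x))) * (h s * cis (- (2 * pi * (w \<bullet> s))))"
      by simp
  qed
  also have "\<dots> = cis (- (2 * pi * (w \<bullet> x))) * fourier h w"
    unfolding fourier_def by simp
  finally show ?thesis .
qed

lemma fourier_scale:
  fixes h :: "'a::euclidean_space \<Rightarrow> complex"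
  assumes [measurable]: "h \<in> borel_measurable borel" and "c > 0"
  shows "fourier (\<lambda>t. h (t /\<^sub>R c)) w = c ^ DIM('a) *\<^sub>R fourier h (c *\<^sub>R w)"
proof -
  have "fourier (\<lambda>t. h (t /\<^sub>R c)) w = \<bar>c\<bar> ^ DIM('a) *\<^sub>R (\<integral>t. h ((0 + c *\<^sub>R t) /\<^sub>R c) * cis (- (2 * pi * (w \<bullet> (0 + c *\<^sub>R t)))) \<partial>lborel)"
    unfolding fourier_def using assms by (intro integral_affine) auto
  then show ?thesis using \<open>c > 0\<close> by (simp add: fourier_def)
qed

text \<open>A dilation stretches the transform and multiplies it by the compensating Jacobian.
  Because of this invariance, bumps of shrinking radius keep one and the same norm.\<close>

lemma fnorm_scale:
  fixes h :: "'a::euclidean_space \<Rightarrow> complex"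
  assumes [measurable]: "h \<in> borel_measurable borel" and "c > 0"
  shows "fnorm (\<lambda>t. h (t /\<^sub>R c)) = fnorm h"
proof -
  have "fnorm h = ennreal (\<bar>c\<bar> ^ DIM('a)) * (\<integral>\<^sup>+x. ennreal (cmod (fourier h (0 + c *\<^sub>R x))) \<partial>lborel)"
    using assms by (intro nn_integral_affine) auto
  also have "\<dots> = fnorm (\<lambda>t. h (t /\<^sub>R c))"
    using \<open>c > 0\<close> by (simp add: fourier_scale ennreal_mult nn_integral_cmult)
  finally show ?thesis by simp
qed

lemma fnorm_cnj:
  fixes h :: "'a::euclidean_space \<Rightarrow> complex"
  assumes [measurable]: "h \<in> borel_measurable borel"
  shows "fnorm (\<lambda>t. cnj (h t)) = fnorm h"
  using nn_integral_reflect[of "\<lambda>w. ennreal (cmod (fourier h w))" 0] by (simp add: fourier_cnj)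

lemma fnorm_translate:
  assumes "h \<in> borel_measurable borel"
  shows "fnorm (\<lambda>t. h (t - x)) = fnorm h"
  using assms by (simp add: fourier_translate norm_mult)

lemma fnorm_cis:
  assumes [measurable]: "h \<in> borel_measurable borel"
  shows "fnorm (\<lambda>t. cis (2 * pi * (v \<bullet> t)) * h t) = fnorm h"
  using nn_integral_shift[of "\<lambda>w. ennreal (cmod (fourier h w))" v] by (simp add: fourier_cis)

lemma fnorm_cmult:
  assumes [measurable]: "h \<in> borel_measurable borel"
  shows "fnorm (\<lambda>t. c * h t) = ennreal (cmod c) * fnorm h"
  by (simp add: fourier_cmult norm_mult ennreal_mult nn_integral_cmult)

lemma fnorm_add_le:
  assumes "integrable lborel h" "integrable lborel k"
  shows "fnorm (\<lambda>t. h t + k t) \<le> fnorm h + fnorm k"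
proof -
  have [measurable]: "h \<in> borel_measurable borel" "k \<in> borel_measurable borel" using assms by auto
  have "fnorm (\<lambda>t. h t + k t) \<le> (\<integral>\<^sup>+w. ennreal (cmod (fourier h w)) + ennreal (cmod (fourier k w)) \<partial>lborel)"
    by (intro nn_integral_mono) (simp add: fourier_add assms norm_triangle_ineq flip: ennreal_plus)
  also have "\<dots> = fnorm h + fnorm k" by (intro nn_integral_add) auto
  finally show ?thesis .
qed

section \<open>An integrable product weight\<close>

lemma nn_integral_inverse_1_plus_square: "(\<integral>\<^sup>+x. ennreal (1 / (1 + x\<^sup>2)) \<partial>lborel) = ennreal pi"
proof -
  have "integrable lborel (\<lambda>x::real. inverse (1 + x\<^sup>2))"
    using integrable_inverse_1_plus_square by (simp add: set_integrable_def einterval_def)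
  moreover have "(\<integral>x. inverse (1 + (x::real)\<^sup>2) \<partial>lborel) = pi"
    using LBINT_inverse_1_plus_square
    by (simp add: interval_lebesgue_integral_def set_lebesgue_integral_def einterval_def)
  ultimately show ?thesis
    by (subst nn_integral_eq_integral) (auto simp: inverse_eq_divide)
qed

text \<open>A tensor product rather than a radial weight: its integral factorizes into powers of pi,
  it is the profile of the transform of \<open>abel\<close>, and Fourier decay can be gained one
  coordinate at a time.\<close>

definition decay :: "'a::euclidean_space \<Rightarrow> real" where
  "decay x = (\<Prod>b\<in>Basis. 1 / (1 + (x \<bullet> b)\<^sup>2))"

lemma decay_pos [simp]: "decay x > 0"
  unfolding decay_def by (intro prod_pos ballI) (auto intro!: divide_pos_pos add_pos_nonneg)

lemma decay_nonneg [simp]: "decay x \<ge> 0"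
  using decay_pos[of x] by linarith

lemma decay_le_1 [simp]: "decay x \<le> 1"
  unfolding decay_def by (intro prod_le_1) (auto simp: divide_le_eq_1 add_pos_nonneg)

lemma decay_uminus [simp]: "decay (- x) = decay x"
  unfolding decay_def by simp

lemma continuous_on_decay [continuous_intros]: "continuous_on A decay"
  unfolding decay_def by (intro continuous_intros) (auto simp: add_nonneg_eq_0_iff)

lemma borel_measurable_decay [measurable]: "decay \<in> borel_measurable borel"
  by (intro borel_measurable_continuous_onI continuous_intros)

lemma nn_integral_decay: "(\<integral>\<^sup>+x. ennreal (decay (x::'a::euclidean_space)) \<partial>lborel) = ennreal (pi ^ DIM('a))"
proof -
  have "(\<integral>\<^sup>+x. ennreal (decay (x::'a)) \<partial>lborel) = (\<integral>\<^sup>+x. (\<Prod>b\<in>Basis. ennreal (1 / (1 + ((x::'a) \<bullet> b)\<^sup>2))) \<partial>lborel)"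
    unfolding decay_def by (simp add: prod_ennreal)
  also have "\<dots> = (\<Prod>b\<in>(Basis::'a set). \<integral>\<^sup>+x. ennreal (1 / (1 + x\<^sup>2)) \<partial>lborel)"
    by (rule nn_integral_lborel_prod) auto
  also have "\<dots> = ennreal (pi ^ DIM('a))"
    by (simp add: nn_integral_inverse_1_plus_square ennreal_power)
  finally show ?thesis .
qed

lemma integrable_decay: "integrable lborel (decay :: 'a::euclidean_space \<Rightarrow> real)"
  by (rule integrableI_bounded) (simp_all add: nn_integral_decay)

lemma integral_decay: "(\<integral>x. decay (x::'a::euclidean_space) \<partial>lborel) = pi ^ DIM('a)"
  using nn_integral_decay[where 'a='a] nn_integral_eq_integral[OF integrable_decay[where 'a='a]]
  by (simp add: Bochner_Integration.integral_nonneg)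

text \<open>Each of the \<open>DIM('a)\<close> factors \<open>1 + (x \<bullet> b)\<^sup>2\<close> is
  at most \<open>(1 + norm x)\<^sup>2\<close>, whence the exponent. It turns polynomial Schwartz
  bounds into bounds by \<open>decay\<close>.\<close>

lemma decay_lower_bound: "inverse ((1 + norm (x::'a::euclidean_space)) ^ (2 * DIM('a))) \<le> decay x"
proof -
  have "inverse ((1 + norm x) ^ (2 * DIM('a))) = (\<Prod>b\<in>(Basis::'a set). 1 / (1 + norm x)\<^sup>2)"
    by (simp add: power_mult power_divide inverse_eq_divide)
  also have "\<dots> \<le> decay x"
    unfolding decay_def
  proof (intro prod_mono conjI divide_left_mono)
    fix b :: 'a assume "b \<in> Basis"
    then have "(x \<bullet> b)\<^sup>2 \<le> (norm x)\<^sup>2"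
      by (intro abs_le_square_iff[THEN iffD1]) (simp add: Basis_le_norm)
    then show "1 + (x \<bullet> b)\<^sup>2 \<le> (1 + norm x)\<^sup>2"
      by (simp add: power2_sum add_increasing2)
  qed (auto intro!: mult_pos_pos add_pos_nonneg simp: add_nonneg_eq_0_iff)
  finally show ?thesis .
qed

text \<open>In each coordinate the square of \<open>x\<close> is at most twice that of
  \<open>x - v\<close> plus twice that of \<open>v\<close>, and the latter is at most 1; this gives
  the factor 3. The lemma provides a majorant common to all small translates of a transform.\<close>

lemma decay_shift:
  fixes x v :: "'a::euclidean_space"
  assumes "norm v \<le> 1"
  shows "decay (x - v) \<le> 3 ^ DIM('a) * decay x"
proof -
  have "decay (x - v) \<le> (\<Prod>b\<in>(Basis::'a set). 3 * (1 / (1 + (x \<bullet> b)\<^sup>2)))"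
    unfolding decay_def
  proof (intro prod_mono conjI)
    fix b :: 'a assume b: "b \<in> Basis"
    have v: "(v \<bullet> b)\<^sup>2 \<le> 1"
      using Basis_le_norm[OF b, of v] assms by (intro abs_square_le_1[THEN iffD2]) linarith
    have "2 * ((x - v) \<bullet> b)\<^sup>2 + 2 * (v \<bullet> b)\<^sup>2 - (x \<bullet> b)\<^sup>2 = ((x \<bullet> b) - 2 * (v \<bullet> b))\<^sup>2"
      by (simp add: inner_diff_left power2_eq_square algebra_simps)
    then have "(x \<bullet> b)\<^sup>2 \<le> 2 * ((x - v) \<bullet> b)\<^sup>2 + 2 * (v \<bullet> b)\<^sup>2"
      by (smt (verit) zero_le_power2)
    moreover have "1 + X \<le> 3 * (1 + A)" if "X \<le> 2 * A + 2 * V" "V \<le> 1" "0 \<le> A" for X A V :: real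
      using that by argo
    ultimately have "1 + (x \<bullet> b)\<^sup>2 \<le> 3 * (1 + ((x - v) \<bullet> b)\<^sup>2)"
      using v zero_le_power2[of "(x - v) \<bullet> b"] by blast
    then show "1 / (1 + ((x - v) \<bullet> b)\<^sup>2) \<le> 3 * (1 / (1 + (x \<bullet> b)\<^sup>2))"
      by (simp add: divide_simps add_nonneg_eq_0_iff zero_le_mult_iff add_pos_nonneg)
  qed auto
  then show ?thesis by (simp only: prod.distrib prod_constant decay_def)
qed

lemma integral_lborel_prod:
  fixes f :: "'a::euclidean_space \<Rightarrow> real \<Rightarrow> complex"
  assumes "\<And>b. b \<in> Basis \<Longrightarrow> integrable lborel (f b)"
  shows "(\<integral>x. (\<Prod>b\<in>Basis. f b (x \<bullet> b)) \<partial>lborel) = (\<Prod>b\<in>Basis. \<integral>x. f b x \<partial>lborel)"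
proof -
  interpret product_sigma_finite "\<lambda>_::'a. lborel :: real measure" by standard
  have [measurable]: "f b \<in> borel_measurable borel" if "b \<in> Basis" for b
    using assms[OF that] by simp
  have "(\<integral>x. (\<Prod>b\<in>Basis. f b (x \<bullet> b)) \<partial>lborel)
     = (\<integral>y. (\<Prod>b\<in>Basis. f b ((\<Sum>b\<in>Basis. y b *\<^sub>R b) \<bullet> b)) \<partial>(\<Pi>\<^sub>M b\<in>Basis. lborel))"
    by (subst lborel_eq, subst integral_distr) auto
  also have "\<dots> = (\<integral>y. (\<Prod>b\<in>Basis. f b (y b)) \<partial>(\<Pi>\<^sub>M b\<in>Basis. lborel))"
    by (intro Bochner_Integration.integral_cong prod.cong refl) simp
  also have "\<dots> = (\<Prod>b\<in>Basis. \<integral>x. f b x \<partial>lborel)"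
    by (intro product_integral_prod assms) auto
  finally show ?thesis .
qed

lemma integrable_lborel_prod:
  fixes f :: "'a::euclidean_space \<Rightarrow> real \<Rightarrow> complex"
  assumes "\<And>b. b \<in> Basis \<Longrightarrow> integrable lborel (f b)"
  shows "integrable lborel (\<lambda>x. \<Prod>b\<in>Basis. f b (x \<bullet> b))"
proof (rule integrableI_bounded)
  have [measurable]: "f b \<in> borel_measurable borel" if "b \<in> Basis" for b
    using assms[OF that] by simp
  show "(\<lambda>x. \<Prod>b\<in>Basis. f b (x \<bullet> b)) \<in> borel_measurable lborel" by simp
  have "(\<integral>\<^sup>+x. ennreal (norm (\<Prod>b\<in>Basis. f b (x \<bullet> b))) \<partial>lborel)
      = (\<integral>\<^sup>+x. (\<Prod>b\<in>Basis. ennreal (norm (f b (x \<bullet> b)))) \<partial>lborel)"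
    by (simp add: prod_norm[symmetric] prod_ennreal)
  also have "\<dots> = (\<integral>\<^sup>+x. (\<Prod>b\<in>Basis. (if b \<in> Basis then ennreal (norm (f b (x \<bullet> b))) else 0)) \<partial>lborel)"
    by (intro nn_integral_cong prod.cong) auto
  also have "\<dots> = (\<Prod>b\<in>Basis. \<integral>\<^sup>+x. (if b \<in> Basis then ennreal (norm (f b x)) else 0) \<partial>lborel)"
    by (rule nn_integral_lborel_prod) auto
  also have "\<dots> < \<infinity>"
    using assms by (auto simp: integrable_iff_bounded less_top[symmetric] ennreal_prod_eq_top)
  finally show "(\<integral>\<^sup>+x. ennreal (norm (\<Prod>b\<in>Basis. f b (x \<bullet> b))) \<partial>lborel) < \<infinity>" .
qed

section \<open>The transform of the two-sided exponential\<close>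

text \<open>On each half-line the integrand has an explicit primitive; the halves contribute the
  reciprocals of \<open>a + \<i> * \<omega>\<close> and \<open>a - \<i> * \<omega>\<close>.\<close>

lemma exp_abs_integral:
  fixes a \<omega> :: real
  assumes a: "a > 0"
  shows "integrable lborel (\<lambda>t. complex_of_real (exp (- a * \<bar>t\<bar>)) * cis (- (\<omega> * t)))" (is ?int)
    and "(\<integral>t. complex_of_real (exp (- a * \<bar>t\<bar>)) * cis (- (\<omega> * t)) \<partial>lborel) = of_real (2 * a / (a\<^sup>2 + \<omega>\<^sup>2))" (is ?val)
proof -
  let ?f = "\<lambda>\<omega> t. complex_of_real (exp (- a * t)) * cis (- (\<omega> * t))"
  let ?p = "\<lambda>\<omega> t. indicator {0<..} t *\<^sub>R ?f \<omega> t"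
  have lim: "((\<lambda>t. exp (- a * t)) \<longlongrightarrow> 0) at_top"
    using a by real_asymp
  have "set_integrable lborel (einterval 0 \<infinity>) (\<lambda>t. exp (- a * t))"
  proof (rule interval_integral_FTC_nonneg)
    show "((\<lambda>t. - exp (- a * t) / a) has_real_derivative exp (- a * t)) (at t)" for t
      using a by (auto intro!: derivative_eq_intros)
    show "(((\<lambda>t. - exp (- a * t) / a) \<circ> real_of_ereal) \<longlongrightarrow> - 1 / a) (at_right 0)"
      unfolding ereal_tendsto_simps zero_ereal_def using a by (auto intro!: tendsto_eq_intros)
    show "(((\<lambda>t. - exp (- a * t) / a) \<circ> real_of_ereal) \<longlongrightarrow> 0) (at_left \<infinity>)"
      unfolding ereal_tendsto_simps using a by real_asymp
  qed auto
  then have e: "integrable lborel (\<lambda>t. indicator {0<..} t *\<^sub>R exp (- a * t))"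
    by (simp add: set_integrable_def einterval_def greaterThan_def)
  have p: "integrable lborel (?p \<omega>)" for \<omega>
    by (rule Bochner_Integration.integrable_bound[OF e]) (auto simp: norm_mult)
  have pv: "(\<integral>t. ?p \<omega> t \<partial>lborel) = 1 / (a + \<i> * \<omega>)" for \<omega>
  proof -
    define c where "c = a + \<i> * \<omega>"
    define F where "F = (\<lambda>t. - exp (- c * of_real t) / c)"
    have nz: "c \<noteq> 0" using a by (auto simp: complex_eq_iff c_def)
    have fe: "?f \<omega> t = exp (- c * of_real t)" for t
      unfolding c_def cis_conv_exp exp_of_real[symmetric] mult_exp_exp by (simp add: algebra_simps)
    have "(LBINT t=0..\<infinity>. ?f \<omega> t) = 0 - (- 1 / c)"
    proof (rule interval_integral_FTC_integrable)
      show "(F has_vector_derivative ?f \<omega> t) (at t)" for t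
        unfolding F_def fe using nz
        by (auto intro!: derivative_eq_intros has_vector_derivative_real_field)
      show "set_integrable lborel (einterval 0 \<infinity>) (?f \<omega>)"
        using p by (simp add: set_integrable_def einterval_def greaterThan_def)
      have "isCont F 0" unfolding F_def using nz by (intro continuous_intros) auto
      then have "(F \<longlongrightarrow> F 0) (at_right 0)"
        by (metis filterlim_at_split isCont_def)
      then show "((F \<circ> real_of_ereal) \<longlongrightarrow> - 1 / c) (at_right 0)"
        unfolding ereal_tendsto_simps zero_ereal_def by (simp add: F_def)
      have "((\<lambda>t. exp (- a * t) / cmod c) \<longlongrightarrow> 0) at_top"
        using lim by (intro tendsto_divide_zero)
      then have "(F \<longlongrightarrow> 0) at_top"
        by (rule Lim_null_comparison[rotated])
           (auto simp: F_def norm_divide c_def)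
      then show "((F \<circ> real_of_ereal) \<longlongrightarrow> 0) (at_left \<infinity>)"
        unfolding ereal_tendsto_simps .
    qed (auto intro!: continuous_intros)
    then show ?thesis
      by (simp add: c_def interval_lebesgue_integral_def set_lebesgue_integral_def einterval_def greaterThan_def)
  qed
  let ?q = "\<lambda>t. ?p (- \<omega>) (0 - t)"
  have [measurable]: "?p \<omega> \<in> borel_measurable borel" for \<omega> by measurable
  have q: "integrable lborel ?q"
    using integrable_affine[OF p[of "- \<omega>"], of "-1" 0] by simp
  \<comment> \<open>The two open half-lines miss the point 0, so the decomposition holds only almost
    everywhere.\<close>
  have eq: "AE t in lborel. complex_of_real (exp (- a * \<bar>t\<bar>)) * cis (- (\<omega> * t)) = ?p \<omega> t + ?q t"
    using AE_lborel_singleton[of "0::real"] by eventually_elim (auto simp: indicator_def)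
  have pq: "integrable lborel (\<lambda>t. ?p \<omega> t + ?q t)"
    by (intro Bochner_Integration.integrable_add p q)
  show ?int
    by (subst integrable_cong_AE[OF _ _ eq]) (use pq in auto)
  have "(\<integral>t. complex_of_real (exp (- a * \<bar>t\<bar>)) * cis (- (\<omega> * t)) \<partial>lborel) = (\<integral>t. ?p \<omega> t + ?q t \<partial>lborel)"
    by (rule integral_cong_AE[OF _ _ eq]) measurable
  also have "\<dots> = (\<integral>t. ?p \<omega> t \<partial>lborel) + (\<integral>t. ?q t \<partial>lborel)"
    by (intro Bochner_Integration.integral_add p q)
  also have "(\<integral>t. ?q t \<partial>lborel) = (\<integral>t. ?p (- \<omega>) t \<partial>lborel)"
    by (rule integral_reflect) measurable
  also have "(\<integral>t. ?p \<omega> t \<partial>lborel) + (\<integral>t. ?p (- \<omega>) t \<partial>lborel) = of_real (2 * a / (a\<^sup>2 + \<omega>\<^sup>2))"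
  proof -
    have nz: "a + \<i> * \<omega> \<noteq> 0" "a - \<i> * \<omega> \<noteq> 0" using a by (auto simp: complex_eq_iff)
    have "(a + \<i> * \<omega>) * (a - \<i> * \<omega>) = of_real (a\<^sup>2 + \<omega>\<^sup>2)"
      by (simp add: algebra_simps power2_eq_square)
    then show ?thesis unfolding pv using nz
      by (simp add: add_frac_eq)
  qed
  finally show ?val .
qed

section \<open>Fourier inversion\<close>

text \<open>The Abel summation kernel. The rate \<open>2 * pi * e\<close> makes its transform,
  rescaled by \<open>e\<close>, exactly a multiple of \<open>decay\<close>.\<close>

definition abel :: "real \<Rightarrow> 'a::euclidean_space \<Rightarrow> real" where
  "abel e w = (\<Prod>b\<in>Basis. exp (- (2 * pi * e) * \<bar>w \<bullet> b\<bar>))"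

lemma abel_nonneg: "0 \<le> abel e w"
  unfolding abel_def by (intro prod_nonneg) auto

lemma abel_le_1: "e \<ge> 0 \<Longrightarrow> abel e w \<le> 1"
  unfolding abel_def by (intro prod_le_1) auto

lemma continuous_on_abel: "continuous_on A (abel e)"
  unfolding abel_def by (intro continuous_intros)

lemma borel_measurable_abel [measurable]: "abel e \<in> borel_measurable borel"
  by (intro borel_measurable_continuous_onI continuous_on_abel)

lemma abel_tendsto: "(e \<longlongrightarrow> 0) F \<Longrightarrow> ((\<lambda>j. abel (e j) w) \<longlongrightarrow> 1) F"
  unfolding abel_def by (auto intro!: tendsto_eq_intros)

text \<open>Evaluating at \<open>e *\<^sub>R s\<close> leaves a profile in \<open>s\<close> that
  depends on \<open>e\<close> only through a power, which the Jacobian of the later substitution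
  cancels.\<close>

lemma
  fixes e :: real
  assumes e: "e > 0"
  shows integrable_abel: "integrable lborel (\<lambda>w::'a::euclidean_space. complex_of_real (abel e w))"
    and fourier_abel: "fourier (\<lambda>w::'a. complex_of_real (abel e w)) (e *\<^sub>R s) = of_real (decay s / (pi * e) ^ DIM('a))"
proof -
  let ?f = "\<lambda>s b t. complex_of_real (exp (- (2 * pi * e) * \<bar>t\<bar>)) * cis (- (2 * pi * (s \<bullet> b) * t))"
  have eq: "complex_of_real (abel e w) * cis (- (2 * pi * (s \<bullet> w))) = (\<Prod>b\<in>Basis. ?f s b (w \<bullet> b))" for w s :: 'a
  proof -
    have "cis (- (2 * pi * (s \<bullet> w))) = (\<Prod>b\<in>Basis. cis (- (2 * pi * (s \<bullet> b) * (w \<bullet> b))))"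
      by (subst euclidean_inner)
         (simp add: cis_conv_exp exp_sum[symmetric] sum_distrib_left sum_negf mult_ac)
    then show ?thesis by (simp add: abel_def prod.distrib)
  qed
  have int: "integrable lborel (?f s b)" for s b :: 'a
    using exp_abs_integral(1)[of "2 * pi * e" "2 * pi * (s \<bullet> b)"] e by (simp add: mult_ac)
  have "integrable lborel (\<lambda>w::'a. complex_of_real (abel e w) * cis (- (2 * pi * (0 \<bullet> w))))"
    unfolding eq by (rule integrable_lborel_prod) (rule int)
  then show "integrable lborel (\<lambda>w::'a. complex_of_real (abel e w))" by simp
  have "fourier (\<lambda>w::'a. complex_of_real (abel e w)) (e *\<^sub>R s) = (\<Prod>b\<in>Basis. \<integral>t. ?f (e *\<^sub>R s) b t \<partial>lborel)"
    unfolding fourier_def eq by (rule integral_lborel_prod) (rule int)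
  also have "\<dots> = (\<Prod>b\<in>(Basis::'a set). of_real (1 / (1 + (s \<bullet> b)\<^sup>2) / (pi * e)))"
  proof (rule prod.cong[OF refl])
    fix b :: 'a assume "b \<in> Basis"
    have "(\<integral>t. ?f (e *\<^sub>R s) b t \<partial>lborel) = of_real (2 * (2 * pi * e) / ((2 * pi * e)\<^sup>2 + (2 * pi * e * (s \<bullet> b))\<^sup>2))"
      using exp_abs_integral(2)[of "2 * pi * e" "2 * pi * e * (s \<bullet> b)"] e by (simp add: mult_ac)
    also have "2 * (2 * pi * e) / ((2 * pi * e)\<^sup>2 + (2 * pi * e * (s \<bullet> b))\<^sup>2) = 1 / (1 + (s \<bullet> b)\<^sup>2) / (pi * e)"
    proof -
      have "(2 * pi * e)\<^sup>2 + (2 * pi * e * (s \<bullet> b))\<^sup>2 = 2 * (2 * pi * e) * ((1 + (s \<bullet> b)\<^sup>2) * (pi * e))"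
        by (simp add: power2_eq_square algebra_simps)
      then show ?thesis using e by (simp only:) simp
    qed
    finally show "(\<integral>t. ?f (e *\<^sub>R s) b t \<partial>lborel) = of_real (1 / (1 + (s \<bullet> b)\<^sup>2) / (pi * e))" .
  qed
  also have "\<dots> = of_real (decay s / (pi * e) ^ DIM('a))"
    by (simp add: decay_def prod_dividef prod.distrib)
  finally show "fourier (\<lambda>w::'a. complex_of_real (abel e w)) (e *\<^sub>R s) = of_real (decay s / (pi * e) ^ DIM('a))" .
qed

text \<open>Abel summation: with the factor \<open>abel (e j)\<close> the double integral converges
  absolutely. As \<open>e j\<close> tends to 0 the integral \<open>J j\<close> tends to the
  inversion integral, while after Fubini it is an average of \<open>u\<close> near \<open>x\<close>
  and tends to \<open>u x\<close>.\<close>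

theorem fourier_inversion:
  fixes u :: "'a::euclidean_space \<Rightarrow> complex"
  assumes cont: "continuous_on UNIV u" and B: "\<And>t. cmod (u t) \<le> B"
    and u: "integrable lborel u" and fu: "integrable lborel (fourier u)"
  shows "u x = (\<integral>w. fourier u w * cis (2 * pi * (w \<bullet> x)) \<partial>lborel)"
proof -
  define e where "e j = inverse (real (Suc j))" for j
  have e: "e j > 0" for j by (simp add: e_def)
  have e0: "e \<longlonglongrightarrow> 0" unfolding e_def by (rule LIMSEQ_inverse_real_of_nat)
  have [measurable]: "u \<in> borel_measurable borel" using u by simp
  define J where "J j = (\<integral>w. fourier u w * abel (e j) w * cis (2 * pi * (w \<bullet> x)) \<partial>lborel)" for j
  have J1: "J \<longlonglongrightarrow> (\<integral>w. fourier u w * cis (2 * pi * (w \<bullet> x)) \<partial>lborel)"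
    unfolding J_def
  proof (rule integral_dominated_convergence[where w="\<lambda>w. cmod (fourier u w)"])
    show "AE w in lborel. (\<lambda>j. fourier u w * abel (e j) w * cis (2 * pi * (w \<bullet> x)))
       \<longlonglongrightarrow> fourier u w * cis (2 * pi * (w \<bullet> x))"
      by (intro AE_I2) (auto intro!: tendsto_eq_intros abel_tendsto[OF e0])
    show "AE w in lborel. norm (fourier u w * abel (e j) w * cis (2 * pi * (w \<bullet> x))) \<le> cmod (fourier u w)" for j
      using abel_le_1[OF less_imp_le[OF e]]
      by (intro AE_I2) (auto simp: norm_mult abs_of_nonneg[OF abel_nonneg] intro!: mult_left_le)
  qed (use fu in auto)
  \<comment> \<open>Fubini moves the transform onto the kernel; substituting
    \<open>x + e j *\<^sub>R s\<close> for \<open>t\<close> then removes \<open>e j\<close> from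
    everything but the argument of \<open>u\<close>.\<close>
  have J2: "J j = (\<integral>s. u (x + e j *\<^sub>R s) * of_real (decay s / pi ^ DIM('a)) \<partial>lborel)" for j
  proof -
    let ?k = "\<lambda>w::'a. complex_of_real (abel (e j) w)"
    have "J j = (\<integral>w. \<integral>t. u t * (?k w * cis (- (2 * pi * ((t - x) \<bullet> w)))) \<partial>lborel \<partial>lborel)"
      unfolding J_def
    proof (intro Bochner_Integration.integral_cong refl)
      fix w
      have *: "u t * (?k w * cis (- (2 * pi * ((t - x) \<bullet> w))))
         = u t * cis (- (2 * pi * (w \<bullet> t))) * (?k w * cis (2 * pi * (w \<bullet> x)))" for t
      proof -
        have "cis (- (2 * pi * ((t - x) \<bullet> w))) = cis (- (2 * pi * (w \<bullet> t))) * cis (2 * pi * (w \<bullet> x))"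
          unfolding cis_mult by (simp add: algebra_simps inner_commute)
        then show ?thesis by simp
      qed
      show "fourier u w * ?k w * cis (2 * pi * (w \<bullet> x)) = (\<integral>t. u t * (?k w * cis (- (2 * pi * ((t - x) \<bullet> w)))) \<partial>lborel)"
        unfolding * fourier_def integral_mult_left_zero by (simp only: mult.assoc)
    qed
    also have "\<dots> = (\<integral>t. \<integral>w. u t * (?k w * cis (- (2 * pi * ((t - x) \<bullet> w)))) \<partial>lborel \<partial>lborel)"
    proof (rule fubini_swap)
      have "(\<integral>\<^sup>+w. \<integral>\<^sup>+t. ennreal (cmod (u t * (?k w * cis (- (2 * pi * ((t - x) \<bullet> w)))))) \<partial>lborel \<partial>lborel)
          = (\<integral>\<^sup>+w. (\<integral>\<^sup>+t. ennreal (cmod (u t)) \<partial>lborel) * ennreal (cmod (?k w)) \<partial>lborel)"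
        by (simp add: norm_mult ennreal_mult nn_integral_multc)
      also have "\<dots> = (\<integral>\<^sup>+t. ennreal (cmod (u t)) \<partial>lborel) * (\<integral>\<^sup>+w. ennreal (cmod (?k w)) \<partial>lborel)"
        by (intro nn_integral_cmult) simp
      also have "\<dots> < \<infinity>"
        using u integrable_abel[OF e, of j, where 'a='a] unfolding integrable_iff_bounded
        by (simp add: ennreal_mult_less_top)
      finally show "(\<integral>\<^sup>+w. \<integral>\<^sup>+t. ennreal (cmod (u t * (?k w * cis (- (2 * pi * ((t - x) \<bullet> w)))))) \<partial>lborel \<partial>lborel) < \<infinity>" .
    qed measurable
    also have "\<dots> = (\<integral>t. u t * fourier ?k (t - x) \<partial>lborel)"
      unfolding fourier_def by simp
    also have "\<dots> = \<bar>e j\<bar> ^ DIM('a) *\<^sub>R (\<integral>s. u (x + e j *\<^sub>R s) * fourier ?k ((x + e j *\<^sub>R s) - x) \<partial>lborel)"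
      using e[of j] by (intro integral_affine) auto
    also have "\<dots> = (\<integral>s. e j ^ DIM('a) *\<^sub>R (u (x + e j *\<^sub>R s) * fourier ?k (e j *\<^sub>R s)) \<partial>lborel)"
      using e[of j] by simp
    also have "\<dots> = (\<integral>s. u (x + e j *\<^sub>R s) * of_real (decay s / pi ^ DIM('a)) \<partial>lborel)"
      unfolding fourier_abel[OF e] using e[of j]
      by (intro Bochner_Integration.integral_cong refl) (simp add: scaleR_conv_of_real power_mult_distrib)
    finally show ?thesis .
  qed
  have J3: "(\<lambda>j. \<integral>s. u (x + e j *\<^sub>R s) * of_real (decay s / pi ^ DIM('a)) \<partial>lborel)
     \<longlonglongrightarrow> (\<integral>s. u x * of_real (decay (s::'a) / pi ^ DIM('a)) \<partial>lborel)"
  proof (rule integral_dominated_convergence[where w="\<lambda>s. B * (decay (s::'a) / pi ^ DIM('a))"])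
    have "isCont u x" using cont by (simp add: continuous_on_eq_continuous_at)
    then show "AE s in lborel. (\<lambda>j. u (x + e j *\<^sub>R s) * of_real (decay s / pi ^ DIM('a)))
       \<longlonglongrightarrow> u x * of_real (decay s / pi ^ DIM('a))"
      by (intro AE_I2 tendsto_mult_right isCont_tendsto_compose[of _ u])
         (auto intro!: tendsto_eq_intros e0)
    show "AE s in lborel. norm (u (x + e j *\<^sub>R s) * of_real (decay s / pi ^ DIM('a))) \<le> B * (decay s / pi ^ DIM('a))" for j
      using B by (intro AE_I2) (auto simp: norm_mult norm_divide norm_power intro!: mult_right_mono divide_right_mono)
  qed (auto intro!: integrable_decay)
  have J4: "(\<integral>s. u x * of_real (decay (s::'a) / pi ^ DIM('a)) \<partial>lborel) = u x"
    by (simp only: integral_mult_right_zero integral_complex_of_real integral_divide_zero integral_decay) simp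
  from J3 have "J \<longlonglongrightarrow> u x" unfolding J2[symmetric] J4 .
  with J1 show ?thesis using LIMSEQ_unique by blast
qed

lemma fourier_unique_zero:
  fixes u :: "'a::euclidean_space \<Rightarrow> complex"
  assumes "continuous_on UNIV u" "\<And>t. cmod (u t) \<le> B" and u: "integrable lborel u" and z: "fnorm u = 0"
  shows "u x = 0"
proof -
  have [measurable]: "u \<in> borel_measurable borel" using u by simp
  have ae: "AE w in lborel. fourier u w = 0"
    using z by (subst (asm) nn_integral_0_iff_AE) auto
  have "integrable lborel (fourier u)"
    by (rule integrableI_bounded) (simp_all add: z)
  then have "u x = (\<integral>w. fourier u w * cis (2 * pi * (w \<bullet> x)) \<partial>lborel)"
    by (rule fourier_inversion[OF assms(1,2) u])
  also have "\<dots> = (\<integral>w. 0 \<partial>(lborel :: 'a measure))"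
  proof (rule integral_cong_AE)
    show "AE w in lborel. fourier u w * cis (2 * pi * (w \<bullet> x)) = 0"
      using ae by eventually_elim simp
  qed auto
  finally show ?thesis by simp
qed

section \<open>Multipliers\<close>

text \<open>A bound \<open>r\<close> is recorded in place of an infimum. The pointwise bound is
  included because it gives integrability of products and keeps arguments inside the domain of
  convergence of a power series.\<close>

definition multiplier :: "('a::euclidean_space \<Rightarrow> complex) \<Rightarrow> real \<Rightarrow> bool" where
  "multiplier u r \<longleftrightarrow> u \<in> borel_measurable borel \<and> (\<forall>t. cmod (u t) \<le> r) \<and>
     (\<forall>v. integrable lborel v \<longrightarrow> fnorm (\<lambda>t. u t * v t) \<le> ennreal r * fnorm v)"

lemma multiplierD:
  assumes "multiplier u r"
  shows "u \<in> borel_measurable borel" "cmod (u t) \<le> r"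
    "integrable lborel v \<Longrightarrow> fnorm (\<lambda>t. u t * v t) \<le> ennreal r * fnorm v"
    "integrable lborel v \<Longrightarrow> integrable lborel (\<lambda>t. u t * v t)" "0 \<le> r"
proof -
  show "u \<in> borel_measurable borel" "cmod (u t) \<le> r"
    "integrable lborel v \<Longrightarrow> fnorm (\<lambda>t. u t * v t) \<le> ennreal r * fnorm v"
    using assms by (auto simp: multiplier_def)
  show "integrable lborel v \<Longrightarrow> integrable lborel (\<lambda>t. u t * v t)"
    using assms by (intro integrable_mult_bounded[where B=r]) (auto simp: multiplier_def)
  have "cmod (u undefined) \<le> r" using assms by (auto simp: multiplier_def)
  then show "0 \<le> r" using norm_ge_zero order_trans by blast
qed

lemma multiplier_mono: "multiplier u r \<Longrightarrow> r \<le> s \<Longrightarrow> multiplier u s"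
  unfolding multiplier_def
  by (meson order_trans mult_right_mono ennreal_leI zero_le)

lemma multiplier_const: "multiplier (\<lambda>_. c) (cmod c)"
  unfolding multiplier_def
proof (intro conjI allI impI)
  fix u :: "'a \<Rightarrow> complex" assume "integrable lborel u"
  then have "u \<in> borel_measurable borel" by simp
  from fnorm_cmult[OF this] show "fnorm (\<lambda>t. c * u t) \<le> ennreal (cmod c) * fnorm u" by simp
qed simp_all

lemma multiplier_cis: "multiplier (\<lambda>t. cis (2 * pi * (v \<bullet> t))) 1"
  unfolding multiplier_def
proof (intro conjI allI impI)
  fix u :: "'a \<Rightarrow> complex" assume "integrable lborel u"
  then have "u \<in> borel_measurable borel" by simp
  from fnorm_cis[OF this] show "fnorm (\<lambda>t. cis (2 * pi * (v \<bullet> t)) * u t) \<le> ennreal 1 * fnorm u" by simp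
qed simp_all

lemma multiplier_mult:
  assumes "multiplier u r" "multiplier u' r'"
  shows "multiplier (\<lambda>t. u t * u' t) (r * r')"
  unfolding multiplier_def
proof (intro conjI allI impI)
  note u = multiplierD[OF assms(1)] and u' = multiplierD[OF assms(2)]
  show "(\<lambda>t. u t * u' t) \<in> borel_measurable borel" using u(1) u'(1) by simp
  show "cmod (u t * u' t) \<le> r * r'" for t
    using u(2,5) u'(2,5) by (auto simp: norm_mult intro!: mult_mono)
  fix v :: "'a \<Rightarrow> complex" assume v: "integrable lborel v"
  have "fnorm (\<lambda>t. u t * u' t * v t) \<le> ennreal r * fnorm (\<lambda>t. u' t * v t)"
    using u(3)[OF u'(4)[OF v]] by (simp add: mult.assoc)
  also have "\<dots> \<le> ennreal r * (ennreal r' * fnorm v)"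
    by (intro mult_left_mono u'(3) v) auto
  finally show "fnorm (\<lambda>t. u t * u' t * v t) \<le> ennreal (r * r') * fnorm v"
    using u(5) u'(5) by (simp add: ennreal_mult mult.assoc)
qed

lemma multiplier_add:
  assumes "multiplier u r" "multiplier u' r'"
  shows "multiplier (\<lambda>t. u t + u' t) (r + r')"
  unfolding multiplier_def
proof (intro conjI allI impI)
  note u = multiplierD[OF assms(1)] and u' = multiplierD[OF assms(2)]
  show "(\<lambda>t. u t + u' t) \<in> borel_measurable borel" using u(1) u'(1) by simp
  show "cmod (u t + u' t) \<le> r + r'" for t
    using u(2)[of t] u'(2)[of t] norm_triangle_ineq[of "u t" "u' t"] by linarith
  fix v :: "'a \<Rightarrow> complex" assume v: "integrable lborel v"
  have "fnorm (\<lambda>t. u t * v t + u' t * v t) \<le> fnorm (\<lambda>t. u t * v t) + fnorm (\<lambda>t. u' t * v t)"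
    by (intro fnorm_add_le u(4) u'(4) v)
  also have "\<dots> \<le> ennreal r * fnorm v + ennreal r' * fnorm v"
    by (intro add_mono u(3) u'(3) v)
  finally show "fnorm (\<lambda>t. (u t + u' t) * v t) \<le> ennreal (r + r') * fnorm v"
    using u(5) u'(5) by (simp add: distrib_right ennreal_plus)
qed

lemma multiplier_cnj:
  assumes "multiplier u r"
  shows "multiplier (\<lambda>t. cnj (u t)) r"
  unfolding multiplier_def
proof (intro conjI allI impI)
  note u = multiplierD[OF assms(1)]
  have [measurable]: "u \<in> borel_measurable borel" by (rule u(1))
  show "(\<lambda>t. cnj (u t)) \<in> borel_measurable borel" by simp
  show "cmod (cnj (u t)) \<le> r" for t using u(2) by simp
  fix v :: "'a \<Rightarrow> complex" assume v: "integrable lborel v"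
  have [measurable]: "v \<in> borel_measurable borel" using v by simp
  have "fnorm (\<lambda>t. cnj (u t) * v t) = fnorm (\<lambda>t. u t * cnj (v t))"
    using fnorm_cnj[of "\<lambda>t. u t * cnj (v t)"] by simp
  also have "\<dots> \<le> ennreal r * fnorm (\<lambda>t. cnj (v t))" using v by (intro u(3)) simp
  also have "\<dots> = ennreal r * fnorm v" by (simp add: fnorm_cnj)
  finally show "fnorm (\<lambda>t. cnj (u t) * v t) \<le> ennreal r * fnorm v" .
qed

lemma multiplier_cmult: "multiplier u r \<Longrightarrow> multiplier (\<lambda>t. c * u t) (cmod c * r)"
  by (rule multiplier_mult[OF multiplier_const])

lemma multiplier_power: "multiplier u r \<Longrightarrow> multiplier (\<lambda>t. u t ^ k) (r ^ k)"
proof (induction k)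
  case 0 then show ?case using multiplier_const[of 1] by simp
next
  case (Suc k) then show ?case using multiplier_mult[of u r "\<lambda>t. u t ^ k" "r ^ k"] by simp
qed

text \<open>Conjugation only reflects the transform, so averaging with the conjugate costs nothing.
  This opens the way to power series in the real and imaginary parts separately.\<close>

lemma multiplier_Re:
  assumes "multiplier u r" shows "multiplier (\<lambda>t. of_real (Re (u t))) r"
proof -
  have "multiplier (\<lambda>t. (1/2) * (u t + cnj (u t))) (cmod (1/2) * (r + r))"
    by (intro multiplier_cmult multiplier_add multiplier_cnj assms)
  then show ?thesis by (simp add: complex_add_cnj mult.commute)
qed

lemma multiplier_Im:
  assumes "multiplier u r" shows "multiplier (\<lambda>t. of_real (Im (u t))) r"
proof -
  have "multiplier (\<lambda>t. of_real (Re (- \<i> * u t))) (cmod (- \<i>) * r)"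
    by (intro multiplier_Re multiplier_cmult assms)
  then show ?thesis by simp
qed

text \<open>Summability of the \<open>L1\<close> norms permits taking the transform term by term;
  what remains is the triangle inequality for series under the integral.\<close>

lemma fnorm_suminf_le:
  fixes v :: "nat \<Rightarrow> 'a::euclidean_space \<Rightarrow> complex"
  assumes v: "\<And>j. integrable lborel (v j)"
    and sv: "\<And>t. summable (\<lambda>j. cmod (v j t))" "summable (\<lambda>j. \<integral>t. cmod (v j t) \<partial>lborel)"
  shows "fnorm (\<lambda>t. \<Sum>j. v j t) \<le> (\<Sum>j. fnorm (v j))"
proof -
  have [measurable]: "v j \<in> borel_measurable borel" for j using v[of j] by simp
  have "ennreal (cmod (fourier (\<lambda>t. \<Sum>j. v j t) w)) \<le> (\<Sum>j. ennreal (cmod (fourier (v j) w)))" for w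
  proof -
    let ?c = "\<lambda>t. cis (- (2 * pi * (w \<bullet> t)))"
    have s: "(\<lambda>j. \<integral>t. v j t * ?c t \<partial>lborel) sums (\<integral>t. (\<Sum>j. v j t * ?c t) \<partial>lborel)"
      by (rule sums_integral) (use sv in \<open>auto simp: norm_mult intro!: integrable_mult_cis v\<close>)
    have eq: "(\<Sum>j. v j t * ?c t) = (\<Sum>j. v j t) * ?c t" for t
      by (rule suminf_mult2[symmetric, OF summable_norm_cancel[OF sv(1)]])
    have s: "(\<lambda>j. fourier (v j) w) sums fourier (\<lambda>t. \<Sum>j. v j t) w"
      using s unfolding fourier_def by (simp only: eq)
    have sn: "summable (\<lambda>j. cmod (fourier (v j) w))"
      by (rule summable_comparison_test'[OF sv(2)]) (simp add: norm_fourier_le)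
    have "cmod (fourier (\<lambda>t. \<Sum>j. v j t) w) \<le> (\<Sum>j. cmod (fourier (v j) w))"
      using summable_norm[OF sn] sums_unique[OF s] by simp
    then show ?thesis
      by (subst suminf_ennreal2) (auto intro!: sn ennreal_leI)
  qed
  then have "fnorm (\<lambda>t. \<Sum>j. v j t) \<le> (\<integral>\<^sup>+w. (\<Sum>j. ennreal (cmod (fourier (v j) w))) \<partial>lborel)"
    by (intro nn_integral_mono)
  also have "\<dots> = (\<Sum>j. fnorm (v j))" by (rule nn_integral_suminf) simp
  finally show ?thesis .
qed

lemma multiplier_suminf:
  assumes u: "\<And>j. multiplier (u j) (r j)" and r: "summable r"
  shows "multiplier (\<lambda>t. \<Sum>j. u j t) (\<Sum>j. r j)"
  unfolding multiplier_def
proof (intro conjI allI impI)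
  note uD = multiplierD[OF u]
  have [measurable]: "u j \<in> borel_measurable borel" for j by (rule uD(1))
  show "(\<lambda>t. \<Sum>j. u j t) \<in> borel_measurable borel" by simp
  have su: "summable (\<lambda>j. cmod (u j t))" for t
    by (rule summable_comparison_test'[OF r]) (simp add: uD(2))
  show "cmod (\<Sum>j. u j t) \<le> (\<Sum>j. r j)" for t
    by (rule order_trans[OF summable_norm[OF su]]) (intro suminf_le uD(2) su r)
  fix v :: "'a \<Rightarrow> complex" assume v: "integrable lborel v"
  have "(\<Sum>j. u j t) * v t = (\<Sum>j. u j t * v t)" for t
    by (rule suminf_mult2[OF summable_norm_cancel[OF su]])
  then have "fnorm (\<lambda>t. (\<Sum>j. u j t) * v t) = fnorm (\<lambda>t. \<Sum>j. u j t * v t)" by simp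
  also have "\<dots> \<le> (\<Sum>j. fnorm (\<lambda>t. u j t * v t))"
  proof (rule fnorm_suminf_le)
    show "integrable lborel (\<lambda>t. u j t * v t)" for j by (rule uD(4)[OF v])
    show "summable (\<lambda>j. cmod (u j t * v t))" for t
      using su by (simp add: norm_mult summable_mult2)
    show "summable (\<lambda>j. \<integral>t. cmod (u j t * v t) \<partial>lborel)"
    proof (rule summable_comparison_test')
      show "summable (\<lambda>j. r j * (\<integral>t. cmod (v t) \<partial>lborel))" using r by (rule summable_mult2)
      fix j
      have "(\<integral>t. cmod (u j t * v t) \<partial>lborel) \<le> (\<integral>t. r j * cmod (v t) \<partial>lborel)"
        using v uD(2) by (intro integral_mono integrable_norm uD(4)) (auto simp: norm_mult intro!: mult_right_mono)
      then show "norm (\<integral>t. cmod (u j t * v t) \<partial>lborel) \<le> r j * (\<integral>t. cmod (v t) \<partial>lborel)" by simp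
    qed
  qed
  also have "\<dots> \<le> (\<Sum>j. ennreal (r j) * fnorm v)"
    by (intro suminf_le uD(3) v) auto
  also have "\<dots> = ennreal (\<Sum>j. r j) * fnorm v"
    by (simp add: suminf_ennreal2[OF _ r] uD(5))
  finally show "fnorm (\<lambda>t. (\<Sum>j. u j t) * v t) \<le> ennreal (\<Sum>j. r j) * fnorm v" .
qed

text \<open>By Fubini the transform of \<open>u * v\<close> is the convolution of \<open>H\<close>
  with that of \<open>v\<close>; integrating the modulus gives the product of the two
  \<open>L1\<close> norms.\<close>

lemma multiplier_inverse_fourier:
  fixes H :: "'a::euclidean_space \<Rightarrow> complex"
  assumes H: "integrable lborel H" and u: "\<And>t. u t = (\<integral>w. H w * cis (2 * pi * (w \<bullet> t)) \<partial>lborel)"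
    and r: "(\<integral>\<^sup>+w. ennreal (cmod (H w)) \<partial>lborel) \<le> ennreal r" "0 \<le> r"
  shows "multiplier u r"
  unfolding multiplier_def
proof (intro conjI allI impI)
  have [measurable]: "H \<in> borel_measurable borel" using H by simp
  show "u \<in> borel_measurable borel" unfolding u by measurable
  have "(\<integral>w. cmod (H w) \<partial>lborel) \<le> r"
    using r H by (subst (asm) nn_integral_eq_integral) auto
  then show "cmod (u t) \<le> r" for t
    unfolding u by (rule order_trans[rotated]) (rule order_trans[OF integral_norm_bound], simp add: norm_mult)
  fix v :: "'a \<Rightarrow> complex" assume v: "integrable lborel v"
  have [measurable]: "v \<in> borel_measurable borel" using v by simp
  have Hv: "(\<integral>\<^sup>+t. \<integral>\<^sup>+w. ennreal (cmod (H w * v t * c t w)) \<partial>lborel \<partial>lborel) < \<infinity>"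
    if "\<And>t w. cmod (c t w) = 1" for c
  proof -
    have "(\<integral>\<^sup>+t. \<integral>\<^sup>+w. ennreal (cmod (H w * v t * c t w)) \<partial>lborel \<partial>lborel)
        = (\<integral>\<^sup>+t. (\<integral>\<^sup>+w. ennreal (cmod (H w)) \<partial>lborel) * ennreal (cmod (v t)) \<partial>lborel)"
      by (simp add: norm_mult that ennreal_mult nn_integral_multc)
    also have "\<dots> = (\<integral>\<^sup>+w. ennreal (cmod (H w)) \<partial>lborel) * (\<integral>\<^sup>+t. ennreal (cmod (v t)) \<partial>lborel)"
      by (intro nn_integral_cmult) simp
    also have "\<dots> < \<infinity>"
      using v H unfolding integrable_iff_bounded by (simp add: ennreal_mult_less_top)
    finally show ?thesis .
  qed
  have F: "fourier (\<lambda>t. u t * v t) x = (\<integral>w. H w * fourier v (x - w) \<partial>lborel)" for x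
  proof -
    let ?c = "\<lambda>t w. cis (- (2 * pi * ((x - w) \<bullet> t)))"
    have c: "cis (2 * pi * (w \<bullet> t)) * cis (- (2 * pi * (x \<bullet> t))) = ?c t w" for t w
      unfolding cis_mult by (simp add: algebra_simps)
    have "u t * v t * cis (- (2 * pi * (x \<bullet> t))) = (\<integral>w. H w * v t * ?c t w \<partial>lborel)" for t
    proof -
      have "u t * v t * cis (- (2 * pi * (x \<bullet> t))) =
         (\<integral>w. H w * cis (2 * pi * (w \<bullet> t)) * (v t * cis (- (2 * pi * (x \<bullet> t)))) \<partial>lborel)"
        unfolding u integral_mult_left_zero by (simp only: mult.assoc)
      also have "\<dots> = (\<integral>w. H w * v t * ?c t w \<partial>lborel)"
        by (intro Bochner_Integration.integral_cong refl) (simp flip: c)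
      finally show ?thesis .
    qed
    then have "fourier (\<lambda>t. u t * v t) x = (\<integral>t. \<integral>w. H w * v t * ?c t w \<partial>lborel \<partial>lborel)"
      by (simp add: fourier_def)
    also have "\<dots> = (\<integral>w. \<integral>t. H w * v t * ?c t w \<partial>lborel \<partial>lborel)"
      by (rule fubini_swap) (measurable, rule Hv, simp)
    also have "\<dots> = (\<integral>w. H w * fourier v (x - w) \<partial>lborel)"
      by (simp add: fourier_def mult.assoc)
    finally show ?thesis .
  qed
  have "fnorm (\<lambda>t. u t * v t) \<le> (\<integral>\<^sup>+x. \<integral>\<^sup>+w. ennreal (cmod (H w)) * ennreal (cmod (fourier v (x - w))) \<partial>lborel \<partial>lborel)"
  proof (intro nn_integral_mono)
    fix x
    show "ennreal (cmod (fourier (\<lambda>t. u t * v t) x)) \<le> (\<integral>\<^sup>+w. ennreal (cmod (H w)) * ennreal (cmod (fourier v (x - w))) \<partial>lborel)"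
      unfolding F by (rule order_trans[OF integral_norm_bound_ennreal])
        (auto simp: norm_mult ennreal_mult intro!: integrable_mult_bounded[where B="\<integral>t. cmod (v t) \<partial>lborel", of H "\<lambda>w. fourier v (x - w)", unfolded mult.commute[of _ "H _"]] H norm_fourier_le)
  qed
  also have "\<dots> = (\<integral>\<^sup>+w. \<integral>\<^sup>+x. ennreal (cmod (H w)) * ennreal (cmod (fourier v (x - w))) \<partial>lborel \<partial>lborel)"
    by (rule nn_fubini_swap) measurable
  also have "\<dots> = (\<integral>\<^sup>+w. ennreal (cmod (H w)) * fnorm v \<partial>lborel)"
    by (intro nn_integral_cong)
       (simp add: nn_integral_cmult nn_integral_shift[of "\<lambda>x. ennreal (cmod (fourier v x))"])
  also have "\<dots> = (\<integral>\<^sup>+w. ennreal (cmod (H w)) \<partial>lborel) * fnorm v"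
    by (rule nn_integral_multc) simp
  also have "\<dots> \<le> ennreal r * fnorm v" using r by (intro mult_right_mono) auto
  finally show "fnorm (\<lambda>t. u t * v t) \<le> ennreal r * fnorm v" .
qed

text \<open>By inversion \<open>u\<close> is the inverse transform of \<open>fourier u\<close>. Thus
  the Fourier algebra norm of a function is also a bound for it as a multiplier.\<close>

lemma multiplier_fnorm:
  fixes u :: "'a::euclidean_space \<Rightarrow> complex"
  assumes "continuous_on UNIV u" "\<And>t. cmod (u t) \<le> B" and u: "integrable lborel u"
    and r: "fnorm u \<le> ennreal r" "0 \<le> r"
  shows "multiplier u r"
proof (rule multiplier_inverse_fourier[OF _ _ r])
  have [measurable]: "u \<in> borel_measurable borel" using u by simp
  show int: "integrable lborel (fourier u)"
    by (rule integrableI_bounded) (use r in \<open>auto simp: le_less_trans\<close>)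
  show "u t = (\<integral>w. fourier u w * cis (2 * pi * (w \<bullet> t)) \<partial>lborel)" for t
    by (rule fourier_inversion[OF assms(1,2) u int])
qed

section \<open>Schwartz functions\<close>

lemma partial_deriv_eq: "(f has_derivative f') (at x) \<Longrightarrow> partial_deriv b f x = f' b"
  unfolding partial_deriv_def by (metis frechet_derivative_at)

lemma has_derivative_partial:
  "f differentiable at x \<Longrightarrow> (f has_derivative (\<lambda>h. frechet_derivative f (at x) h)) (at x)"
  by (simp add: frechet_derivative_works[symmetric])

lemma partial_deriv_add:
  assumes "f differentiable at x" "g differentiable at x"
  shows "partial_deriv b (\<lambda>t. f t + g t) x = partial_deriv b f x + partial_deriv b g x"
  by (rule trans[OF partial_deriv_eq[OF has_derivative_add[OF assms[THEN has_derivative_partial]]]])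
     (simp add: partial_deriv_def)

lemma partial_deriv_mult:
  assumes "f differentiable at x" "g differentiable at x"
  shows "partial_deriv b (\<lambda>t. f t * g t) x = f x * partial_deriv b g x + partial_deriv b f x * g x"
  by (rule trans[OF partial_deriv_eq[OF has_derivative_mult[OF assms[THEN has_derivative_partial]]]])
     (simp add: partial_deriv_def)

lemma partial_deriv_cmult:
  assumes "f differentiable at x"
  shows "partial_deriv b (\<lambda>t. c * f t) x = c * partial_deriv b f x"
  by (rule trans[OF partial_deriv_eq[OF has_derivative_mult_right[OF assms[THEN has_derivative_partial]]]])
     (simp add: partial_deriv_def)

lemma partial_deriv_cnj:
  assumes "f differentiable at x"
  shows "partial_deriv b (\<lambda>t. cnj (f t)) x = cnj (partial_deriv b f x)"
  by (rule trans[OF partial_deriv_eq[OF bounded_linear.has_derivative[OF bounded_linear_cnj assms[THEN has_derivative_partial]]]])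
     (simp add: partial_deriv_def)

lemma has_derivative_translate:
  assumes "f differentiable at (x - z)"
  shows "((\<lambda>t. f (t - z)) has_derivative frechet_derivative f (at (x - z))) (at x)"
proof -
  have "((\<lambda>t. t - z) has_derivative (\<lambda>h. h)) (at x)"
    by (auto intro!: derivative_eq_intros)
  from has_derivative_compose[OF this has_derivative_partial[OF assms]] show ?thesis by simp
qed

lemma partial_deriv_translate:
  assumes "f differentiable at (x - z)"
  shows "partial_deriv b (\<lambda>t. f (t - z)) x = partial_deriv b f (x - z)"
  using partial_deriv_eq[OF has_derivative_translate[OF assms]] by (simp add: partial_deriv_def)

lemma differentiable_translate:
  "f differentiable at (x - z) \<Longrightarrow> (\<lambda>t. f (t - z)) differentiable at x"
  using has_derivative_translate by (blast intro: differentiableI)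

lemma differentiable_cnj: "f differentiable at x \<Longrightarrow> (\<lambda>t. cnj (f t)) differentiable at x"
  by (blast intro: differentiableI bounded_linear.has_derivative[OF bounded_linear_cnj] has_derivative_partial)

lemma has_derivative_cis_inner:
  "((\<lambda>t. cis (a * (w \<bullet> t))) has_derivative (\<lambda>h. of_real (a * (w \<bullet> h)) * (\<i> * cis (a * (w \<bullet> x))))) (at x)"
proof -
  have "((\<lambda>t. \<i> * complex_of_real (a * (w \<bullet> t))) has_derivative (\<lambda>h. \<i> * of_real (a * (w \<bullet> h)))) (at x)"
    by (auto intro!: derivative_eq_intros)
  from has_derivative_compose[OF this DERIV_exp[unfolded has_field_derivative_def]]
  have "((\<lambda>t. exp (\<i> * of_real (a * (w \<bullet> t)))) has_derivative
     (\<lambda>h. exp (\<i> * of_real (a * (w \<bullet> x))) * (\<i> * of_real (a * (w \<bullet> h))))) (at x)" .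
  then show ?thesis by (simp add: cis_conv_exp mult_ac)
qed

lemma partial_derivs_Nil [simp]: "partial_derivs [] f = f"
  by (simp add: partial_derivs_def)

lemma partial_derivs_snoc [simp]: "partial_derivs (bs @ [b]) f = partial_derivs bs (partial_deriv b f)"
  by (simp add: partial_derivs_def)

lemma partial_derivs_Cons [simp]: "partial_derivs (b # bs) f = partial_deriv b (partial_derivs bs f)"
  by (simp add: partial_derivs_def)

definition rapid :: "('i \<Rightarrow> real) \<Rightarrow> ('i \<Rightarrow> 'a::euclidean_space \<Rightarrow> complex) \<Rightarrow> bool" where
  "rapid W \<Phi> \<longleftrightarrow> (\<forall>k. \<exists>C. \<forall>i x. W i * (1 + norm x) ^ k * cmod (\<Phi> i x) \<le> C)"

text \<open>A family of functions with rapidly decreasing derivatives up to order \<open>m\<close>, uniformly in the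
  index after multiplication with the weight \<open>W\<close>.\<close>

primrec sch :: "nat \<Rightarrow> ('i \<Rightarrow> real) \<Rightarrow> ('i \<Rightarrow> 'a::euclidean_space \<Rightarrow> complex) \<Rightarrow> bool" where
  "sch 0 W \<Phi> \<longleftrightarrow> rapid W \<Phi>"
| "sch (Suc m) W \<Phi> \<longleftrightarrow> rapid W \<Phi> \<and> (\<forall>i x. \<Phi> i differentiable at x) \<and>
     (\<forall>b\<in>Basis. sch m W (\<lambda>i. partial_deriv b (\<Phi> i)))"

lemma sch_rapid: "sch m W \<Phi> \<Longrightarrow> rapid W \<Phi>"
  by (cases m) auto

lemma sch_Suc: "sch (Suc m) W \<Phi> \<Longrightarrow> sch m W \<Phi>"
  by (induction m arbitrary: \<Phi>) auto

text \<open>The recursion of \<open>sch\<close> differentiates the given function first, and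
  \<open>partial_derivs\<close> applies the last list entry first; therefore lists are split at
  their end.\<close>

lemma sch_iff:
  "sch m W \<Phi> \<longleftrightarrow> (\<forall>bs\<in>lists Basis.
     (length bs \<le> m \<longrightarrow> rapid W (\<lambda>i. partial_derivs bs (\<Phi> i))) \<and>
     (length bs < m \<longrightarrow> (\<forall>i x. partial_derivs bs (\<Phi> i) differentiable at x)))"
proof (induction m arbitrary: \<Phi>)
  case 0
  show ?case by (auto intro: bexI[of _ "[]"])
next
  case (Suc m)
  have split: "(\<forall>bs\<in>lists (Basis :: 'b set). P bs) \<longleftrightarrow> P [] \<and> (\<forall>b\<in>Basis. \<forall>bs\<in>lists Basis. P (bs @ [b]))" for P
  proof (intro iffI conjI ballI)
    fix bs :: "'b list" assume *: "P [] \<and> (\<forall>b\<in>Basis. \<forall>bs\<in>lists Basis. P (bs @ [b]))" "bs \<in> lists Basis"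
    then show "P bs" by (cases bs rule: rev_cases) auto
  qed auto
  show ?case by (subst split) (auto simp: Suc.IH)
qed

lemma schwartz_iff: "f \<in> schwartz \<longleftrightarrow> (\<forall>m. sch m (\<lambda>_::unit. 1) (\<lambda>_. f))"
proof -
  have "bounded (range (\<lambda>x. (1 + norm x) ^ k * cmod (h x))) \<longleftrightarrow> (\<exists>C. \<forall>x. (1 + norm x) ^ k * cmod (h x) \<le> C)"
    for k and h :: "'a \<Rightarrow> complex"
    by (auto simp: bounded_iff)
  then have r: "(\<forall>k. bounded (range (\<lambda>x. (1 + norm x) ^ k * cmod (h x)))) \<longleftrightarrow> rapid (\<lambda>_::unit. 1) (\<lambda>_. h)"
    for h :: "'a \<Rightarrow> complex" by (simp add: rapid_def)
  have "f \<in> schwartz \<longleftrightarrow> (\<forall>bs\<in>lists Basis. (\<forall>x. partial_derivs bs f differentiable at x) \<and>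
     rapid (\<lambda>_::unit. 1) (\<lambda>_. partial_derivs bs f))"
    by (auto simp: schwartz_def smooth_def r[symmetric])
  also have "\<dots> \<longleftrightarrow> (\<forall>m. sch m (\<lambda>_::unit. 1) (\<lambda>_. f))"
    unfolding sch_iff by (meson lessI less_imp_le)
  finally show ?thesis .
qed

lemma rapid_add: "rapid W \<Phi> \<Longrightarrow> rapid W \<Psi> \<Longrightarrow> (\<And>i. 0 \<le> W i) \<Longrightarrow> rapid W (\<lambda>i x. \<Phi> i x + \<Psi> i x)"
  unfolding rapid_def
proof (intro allI)
  fix k
  assume "\<forall>k. \<exists>C. \<forall>i x. W i * (1 + norm x) ^ k * cmod (\<Phi> i x) \<le> C" "\<forall>k. \<exists>C. \<forall>i x. W i * (1 + norm x) ^ k * cmod (\<Psi> i x) \<le> C"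
    and W: "\<And>i. 0 \<le> W i"
  then obtain C D where CD: "\<And>i x. W i * (1 + norm x) ^ k * cmod (\<Phi> i x) \<le> C" "\<And>i x. W i * (1 + norm x) ^ k * cmod (\<Psi> i x) \<le> D"
    by meson
  have "W i * (1 + norm x) ^ k * cmod (\<Phi> i x + \<Psi> i x) \<le> C + D" for i x
  proof -
    have "W i * (1 + norm x) ^ k * cmod (\<Phi> i x + \<Psi> i x) \<le> W i * (1 + norm x) ^ k * (cmod (\<Phi> i x) + cmod (\<Psi> i x))"
      using W by (intro mult_left_mono norm_triangle_ineq mult_nonneg_nonneg) auto
    also have "\<dots> \<le> C + D" using CD[of i x] unfolding distrib_left by linarith
    finally show ?thesis .
  qed
  then show "\<exists>C. \<forall>i x. W i * (1 + norm x) ^ k * cmod (\<Phi> i x + \<Psi> i x) \<le> C" by blast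
qed

lemma rapid_cmult: "rapid W \<Phi> \<Longrightarrow> rapid W (\<lambda>i x. c * \<Phi> i x)"
  unfolding rapid_def
proof (intro allI)
  fix k assume "\<forall>k. \<exists>C. \<forall>i x. W i * (1 + norm x) ^ k * cmod (\<Phi> i x) \<le> C"
  then obtain C where C: "\<And>i x. W i * (1 + norm x) ^ k * cmod (\<Phi> i x) \<le> C" by meson
  have "W i * (1 + norm x) ^ k * cmod (c * \<Phi> i x) \<le> cmod c * C" for i x
    using mult_left_mono[OF C[of i x], of "cmod c"] by (simp add: norm_mult mult_ac)
  then show "\<exists>C. \<forall>i x. W i * (1 + norm x) ^ k * cmod (c * \<Phi> i x) \<le> C" by blast
qed

lemma sch_add:
  "sch m W \<Phi> \<Longrightarrow> sch m W \<Psi> \<Longrightarrow> (\<And>i. 0 \<le> W i) \<Longrightarrow> sch m W (\<lambda>i x. \<Phi> i x + \<Psi> i x)"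
proof (induction m arbitrary: \<Phi> \<Psi>)
  case 0 then show ?case by (simp add: rapid_add)
next
  case (Suc m)
  have "partial_deriv b (\<lambda>x. \<Phi> i x + \<Psi> i x) = (\<lambda>x. partial_deriv b (\<Phi> i) x + partial_deriv b (\<Psi> i) x)" for b i
    using Suc.prems by (auto simp: partial_deriv_add)
  then show ?case using Suc by (auto simp: rapid_add)
qed

lemma sch_cmult: "sch m W \<Phi> \<Longrightarrow> sch m W (\<lambda>i x. c * \<Phi> i x)"
proof (induction m arbitrary: \<Phi>)
  case 0 then show ?case by (simp add: rapid_cmult)
next
  case (Suc m)
  have "partial_deriv b (\<lambda>x. c * \<Phi> i x) = (\<lambda>x. c * partial_deriv b (\<Phi> i) x)" for b i
    using Suc.prems by (auto simp: partial_deriv_cmult)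
  then show ?case using Suc by (auto simp: rapid_cmult)
qed

lemma sch_cnj: "sch m W \<Phi> \<Longrightarrow> sch m W (\<lambda>i x. cnj (\<Phi> i x))"
proof (induction m arbitrary: \<Phi>)
  case 0 then show ?case by (simp add: rapid_def)
next
  case (Suc m)
  have "partial_deriv b (\<lambda>x. cnj (\<Phi> i x)) = (\<lambda>x. cnj (partial_deriv b (\<Phi> i) x))" for b i
    using Suc.prems by (auto simp: partial_deriv_cnj)
  then show ?case using Suc by (auto simp: rapid_def differentiable_cnj)
qed

lemma sch_cis:
  assumes "sch m W \<Phi>" and W: "\<And>i. 0 \<le> W i"
  shows "sch m W (\<lambda>i x. cis (a * (w \<bullet> x)) * \<Phi> i x)"
  using assms(1)
proof (induction m arbitrary: \<Phi>)
  case 0 then show ?case by (simp add: rapid_def norm_mult)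
next
  case (Suc m)
  have dc: "(\<lambda>x. cis (a * (w \<bullet> x))) differentiable at x" for x
    using has_derivative_cis_inner by (blast intro: differentiableI)
  \<comment> \<open>The derivative is regrouped as the same exponential times a new family, so that
    the induction hypothesis applies again.\<close>
  have "partial_deriv b (\<lambda>x. cis (a * (w \<bullet> x)) * \<Phi> i x) x =
     cis (a * (w \<bullet> x)) * (partial_deriv b (\<Phi> i) x + (of_real (a * (w \<bullet> b)) * \<i>) * \<Phi> i x)" for b i x
    using Suc.prems by (subst partial_deriv_mult[OF dc])
      (auto simp: partial_deriv_eq[OF has_derivative_cis_inner] algebra_simps)
  then have "partial_deriv b (\<lambda>x. cis (a * (w \<bullet> x)) * \<Phi> i x) = (\<lambda>x.
     cis (a * (w \<bullet> x)) * (partial_deriv b (\<Phi> i) x + (of_real (a * (w \<bullet> b)) * \<i>) * \<Phi> i x))" for b i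
    by auto
  moreover have "sch m W \<Phi>" using Suc.prems by (rule sch_Suc)
  ultimately show ?case using Suc.prems dc
    by (auto simp: rapid_def norm_mult intro!: Suc.IH sch_add sch_cmult W differentiable_mult)
qed

lemma one_plus_norm_le: "1 + norm (x::'a::real_normed_vector) \<le> (1 + norm (x - z)) * (1 + norm z)"
proof -
  have "1 + norm x \<le> 1 + (norm (x - z) + norm z)" using norm_triangle_ineq[of "x - z" z] by simp
  also have "\<dots> \<le> (1 + norm (x - z)) * (1 + norm z)" by (simp add: algebra_simps)
  finally show ?thesis .
qed

lemma sch_translate:
  assumes "sch m W \<Phi>" and W: "\<And>i. 0 \<le> W i"
  shows "sch m W (\<lambda>i x. \<Phi> i (x - z))"
proof -
  have r: "rapid W (\<lambda>i x. \<Phi> i (x - z))" if "rapid W \<Phi>" for \<Phi> :: "'a \<Rightarrow> 'b \<Rightarrow> complex"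
    unfolding rapid_def
  proof
    fix k
    obtain C where C: "\<And>i x. W i * (1 + norm x) ^ k * cmod (\<Phi> i x) \<le> C"
      using \<open>rapid W \<Phi>\<close> unfolding rapid_def by meson
    have "W i * (1 + norm x) ^ k * cmod (\<Phi> i (x - z)) \<le> (1 + norm z) ^ k * C" for i x
    proof -
      have "(1 + norm x) ^ k \<le> ((1 + norm (x - z)) * (1 + norm z)) ^ k"
        by (intro power_mono one_plus_norm_le) auto
      then have "W i * (1 + norm x) ^ k * cmod (\<Phi> i (x - z)) \<le> W i * ((1 + norm (x - z)) * (1 + norm z)) ^ k * cmod (\<Phi> i (x - z))"
        using W by (intro mult_right_mono mult_left_mono) auto
      also have "\<dots> = (1 + norm z) ^ k * (W i * (1 + norm (x - z)) ^ k * cmod (\<Phi> i (x - z)))"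
        by (simp add: power_mult_distrib mult_ac)
      also have "\<dots> \<le> (1 + norm z) ^ k * C" by (intro mult_left_mono C) auto
      finally show ?thesis .
    qed
    then show "\<exists>C. \<forall>i x. W i * (1 + norm x) ^ k * cmod (\<Phi> i (x - z)) \<le> C" by blast
  qed
  show ?thesis using assms(1)
  proof (induction m arbitrary: \<Phi>)
    case 0 then show ?case by (simp add: r)
  next
    case (Suc m)
    have "partial_deriv b (\<lambda>x. \<Phi> i (x - z)) = (\<lambda>x. partial_deriv b (\<Phi> i) (x - z))" for b i
      using Suc.prems by (auto simp: partial_deriv_translate)
    then show ?case using Suc.prems Suc.IH[of "\<lambda>i. partial_deriv b (\<Phi> i)" for b]
      by (auto simp: r differentiable_translate)
  qed
qed

text \<open>Since \<open>1 + norm z\<close> is at most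
  \<open>(1 + norm (x - z)) * (1 + norm x)\<close>, any power of it is absorbed by the rapid
  decrease of the two factors. So products of distant windows are small together with their
  derivatives.\<close>

lemma sch_mult_translate:
  assumes "sch m (\<lambda>_::unit. 1) (\<lambda>_. \<psi>)" "sch m (\<lambda>_::unit. 1) (\<lambda>_. g)"
  shows "sch m (\<lambda>z. (1 + norm z) ^ K) (\<lambda>z x. \<psi> x * g (x - z))"
proof -
  have r: "rapid (\<lambda>z. (1 + norm z) ^ K) (\<lambda>z x. \<psi> x * g (x - z))"
    if r1: "rapid (\<lambda>_::unit. 1) (\<lambda>_. \<psi>)" and r2: "rapid (\<lambda>_::unit. 1) (\<lambda>_. g)" for \<psi> g :: "'a \<Rightarrow> complex"
    unfolding rapid_def
  proof
    fix k
    obtain C where C: "\<And>x. (1 + norm x) ^ (k + K) * cmod (\<psi> x) \<le> C"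
      using r1[unfolded rapid_def, THEN spec, of "k + K"] by auto
    obtain D where D: "\<And>x. (1 + norm x) ^ K * cmod (g x) \<le> D"
      using r2[unfolded rapid_def, THEN spec, of K] by auto
    have "0 \<le> (1 + norm (0::'a)) ^ (k + K) * cmod (\<psi> 0)" by simp
    then have "0 \<le> C" using C[of 0] by linarith
    have "(1 + norm z) ^ K * (1 + norm x) ^ k * cmod (\<psi> x * g (x - z)) \<le> C * D" for x z
    proof -
      have "1 + norm z \<le> (1 + norm (x - z)) * (1 + norm x)"
        using one_plus_norm_le[of z x] by (simp add: norm_minus_commute)
      then have "(1 + norm z) ^ K \<le> ((1 + norm (x - z)) * (1 + norm x)) ^ K"
        by (intro power_mono) auto
      then have "(1 + norm z) ^ K * (1 + norm x) ^ k * cmod (\<psi> x * g (x - z))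
         \<le> ((1 + norm (x - z)) * (1 + norm x)) ^ K * (1 + norm x) ^ k * cmod (\<psi> x * g (x - z))"
        by (intro mult_right_mono) auto
      also have "\<dots> = ((1 + norm x) ^ (k + K) * cmod (\<psi> x)) * ((1 + norm (x - z)) ^ K * cmod (g (x - z)))"
        by (simp add: power_mult_distrib norm_mult power_add mult_ac)
      also have "\<dots> \<le> C * D" using \<open>0 \<le> C\<close> by (intro mult_mono C D) auto
      finally show ?thesis .
    qed
    then show "\<exists>C. \<forall>i x. (1 + norm i) ^ K * (1 + norm x) ^ k * cmod (\<psi> x * g (x - i)) \<le> C" by blast
  qed
  show ?thesis using assms
  proof (induction m arbitrary: \<psi> g)
    case 0 then show ?case by (simp add: r)
  next
    case (Suc m)
    have "partial_deriv b (\<lambda>x. \<psi> x * g (x - z)) =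
        (\<lambda>x. \<psi> x * partial_deriv b g (x - z) + partial_deriv b \<psi> x * g (x - z))" for b z
      using Suc.prems by (auto simp: partial_deriv_mult partial_deriv_translate differentiable_translate)
    moreover have "sch m (\<lambda>_::unit. 1) (\<lambda>_. \<psi>)" "sch m (\<lambda>_::unit. 1) (\<lambda>_. g)"
      using Suc.prems by (auto intro: sch_Suc)
    ultimately show ?case using Suc.prems
      by (auto intro!: r sch_add Suc.IH differentiable_mult differentiable_translate)
  qed
qed

lemma schwartz_add: "f \<in> schwartz \<Longrightarrow> g \<in> schwartz \<Longrightarrow> (\<lambda>x. f x + g x) \<in> schwartz"
  by (auto simp: schwartz_iff intro: sch_add)

lemma schwartz_cmult: "f \<in> schwartz \<Longrightarrow> (\<lambda>x. c * f x) \<in> schwartz"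
  by (auto simp: schwartz_iff intro: sch_cmult)

lemma schwartz_cnj: "f \<in> schwartz \<Longrightarrow> (\<lambda>x. cnj (f x)) \<in> schwartz"
  by (auto simp: schwartz_iff intro: sch_cnj)

lemma schwartz_cis: "f \<in> schwartz \<Longrightarrow> (\<lambda>x. cis (a * (w \<bullet> x)) * f x) \<in> schwartz"
  by (auto simp: schwartz_iff intro: sch_cis)

lemma schwartz_translate: "f \<in> schwartz \<Longrightarrow> (\<lambda>x. f (x - z)) \<in> schwartz"
  by (auto simp: schwartz_iff intro: sch_translate)

lemma schwartz_differentiable: "f \<in> schwartz \<Longrightarrow> f differentiable at x"
  unfolding schwartz_iff by (metis sch.simps(2))

lemma schwartz_continuous: "f \<in> schwartz \<Longrightarrow> continuous_on A f"
  by (meson continuous_at_imp_continuous_on differentiable_imp_continuous_within schwartz_differentiable)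

lemma schwartz_measurable: "f \<in> schwartz \<Longrightarrow> f \<in> borel_measurable borel"
  by (intro borel_measurable_continuous_onI schwartz_continuous)

section \<open>Integrability and Fourier decay of Schwartz functions\<close>

lemma rapid_decay:
  fixes \<Phi> :: "'i \<Rightarrow> 'a::euclidean_space \<Rightarrow> complex"
  assumes "rapid W \<Phi>"
  obtains C where "0 \<le> C" "\<And>i x. W i * cmod (\<Phi> i x) \<le> C * decay x"
proof -
  let ?N = "2 * DIM('a)"
  obtain C where C: "\<And>i x. W i * (1 + norm x) ^ ?N * cmod (\<Phi> i x) \<le> C"
    using assms unfolding rapid_def by meson
  have "W i * cmod (\<Phi> i x) \<le> max C 0 * decay x" for i x
  proof -
    have "W i * cmod (\<Phi> i x) = (W i * (1 + norm x) ^ ?N * cmod (\<Phi> i x)) * inverse ((1 + norm x) ^ ?N)"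
      by (simp add: field_simps) (metis add_nonneg_eq_0_iff norm_ge_zero zero_le_one zero_neq_one)
    also have "\<dots> \<le> max C 0 * inverse ((1 + norm x) ^ ?N)"
      using C[of i x] by (intro mult_right_mono) auto
    also have "\<dots> \<le> max C 0 * decay x"
      by (intro mult_left_mono decay_lower_bound) auto
    finally show ?thesis .
  qed
  then show ?thesis by (intro that[of "max C 0"]) auto
qed

lemma integrable_decay_bound:
  fixes f :: "'a::euclidean_space \<Rightarrow> complex"
  assumes "\<And>x. cmod (f x) \<le> C * decay x" and [measurable]: "f \<in> borel_measurable borel"
  shows "integrable lborel f"
  by (rule Bochner_Integration.integrable_bound[of _ "\<lambda>x. C * decay x"])
     (use assms in \<open>auto intro!: integrable_decay simp: order_trans[OF _ abs_ge_self]\<close>)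

lemma schwartz_decay:
  assumes "f \<in> schwartz"
  obtains C where "0 \<le> C" "\<And>x. cmod (f x) \<le> C * decay x"
proof -
  have "rapid (\<lambda>_::unit. 1) (\<lambda>_. f)" using assms by (auto simp: schwartz_iff intro: sch_rapid)
  from rapid_decay[OF this] show ?thesis using that by auto
qed

lemma schwartz_integrable: "f \<in> schwartz \<Longrightarrow> integrable lborel f"
  by (metis schwartz_decay integrable_decay_bound schwartz_measurable)

lemma schwartz_bounded:
  assumes "f \<in> schwartz"
  obtains B where "0 \<le> B" "\<And>x. cmod (f x) \<le> B"
proof -
  obtain C where C: "0 \<le> C" "\<And>x. cmod (f x) \<le> C * decay x" using schwartz_decay[OF assms] by blast
  then have "cmod (f x) \<le> C" for x
    using mult_left_mono[OF decay_le_1, of C x] by (metis mult.right_neutral order_trans)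
  with C(1) show ?thesis using that by blast
qed

text \<open>The integral of a derivative vanishes because, by Fubini and translation invariance, it equals
  the integral of \<open>f (t + b) - f t\<close>.\<close>

lemma integral_partial_deriv_eq_0:
  fixes f :: "'a::euclidean_space \<Rightarrow> complex"
  assumes d: "\<And>x. f differentiable at x" and c: "continuous_on UNIV (partial_deriv b f)"
    and f: "integrable lborel f" and pf: "integrable lborel (partial_deriv b f)"
  shows "(\<integral>t. partial_deriv b f t \<partial>lborel) = 0"
proof -
  let ?g = "partial_deriv b f"
  have [measurable]: "?g \<in> borel_measurable borel" "f \<in> borel_measurable borel" using f pf by auto
  have line: "((\<lambda>u. f (t + u *\<^sub>R b)) has_vector_derivative ?g (t + u *\<^sub>R b)) (at u within S)" for t u S
  proof -
    have "((\<lambda>u. t + u *\<^sub>R b) has_derivative (\<lambda>h. h *\<^sub>R b)) (at u within S)"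
      by (auto intro!: derivative_eq_intros)
    from has_derivative_compose[OF this has_derivative_partial[OF d]]
    have D: "((\<lambda>u. f (t + u *\<^sub>R b)) has_derivative (\<lambda>h. frechet_derivative f (at (t + u *\<^sub>R b)) (h *\<^sub>R b))) (at u within S)" .
    have "bounded_linear (frechet_derivative f (at (t + u *\<^sub>R b)))"
      using has_derivative_partial[OF d] by (rule has_derivative_bounded_linear)
    then have "(\<lambda>h. frechet_derivative f (at (t + u *\<^sub>R b)) (h *\<^sub>R b)) = (\<lambda>h. h *\<^sub>R ?g (t + u *\<^sub>R b))"
      by (auto simp: partial_deriv_def linear_simps)
    then show ?thesis using D unfolding has_vector_derivative_def by simp
  qed
  have "f (t + b) - f t = (\<integral>u. indicator {0..1::real} u *\<^sub>R ?g (t + u *\<^sub>R b) \<partial>lborel)" for t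
    by (subst integral_FTC_Icc[where F="\<lambda>u. f (t + u *\<^sub>R b)"])
       (auto intro!: line continuous_intros continuous_on_compose2[OF c])
  then have "(\<integral>t. f (t + b) - f t \<partial>lborel) = (\<integral>t. \<integral>u. indicator {0..1::real} u *\<^sub>R ?g (t + u *\<^sub>R b) \<partial>lborel \<partial>lborel)"
    by simp
  also have "\<dots> = (\<integral>u. \<integral>t. indicator {0..1::real} u *\<^sub>R ?g (t + u *\<^sub>R b) \<partial>lborel \<partial>lborel)"
  proof (rule fubini_swap)
    have "(\<integral>\<^sup>+t. \<integral>\<^sup>+u. ennreal (cmod (indicator {0..1::real} u *\<^sub>R ?g (t + u *\<^sub>R b))) \<partial>lborel \<partial>lborel)
       = (\<integral>\<^sup>+u. \<integral>\<^sup>+t. ennreal (cmod (indicator {0..1::real} u *\<^sub>R ?g (t + u *\<^sub>R b))) \<partial>lborel \<partial>lborel)"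
      by (rule nn_fubini_swap) measurable
    also have "\<dots> = (\<integral>\<^sup>+u. indicator {0..1::real} u * (\<integral>\<^sup>+t. ennreal (cmod (?g t)) \<partial>lborel) \<partial>lborel)"
    proof (intro nn_integral_cong)
      fix u :: real
      have "(\<integral>\<^sup>+t. ennreal (cmod (?g (t + u *\<^sub>R b))) \<partial>lborel) = (\<integral>\<^sup>+t. ennreal (cmod (?g t)) \<partial>lborel)"
        using nn_integral_shift[of "\<lambda>t. ennreal (cmod (?g t))" "- (u *\<^sub>R b)"] by simp
      then show "(\<integral>\<^sup>+t. ennreal (cmod (indicator {0..1::real} u *\<^sub>R ?g (t + u *\<^sub>R b))) \<partial>lborel)
         = indicator {0..1::real} u * (\<integral>\<^sup>+t. ennreal (cmod (?g t)) \<partial>lborel)"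
        by (simp add: indicator_def)
    qed
    also have "\<dots> = (\<integral>\<^sup>+t. ennreal (cmod (?g t)) \<partial>lborel)" by (simp add: nn_integral_multc)
    also have "\<dots> < \<infinity>" using pf by (simp add: integrable_iff_bounded)
    finally show "(\<integral>\<^sup>+t. \<integral>\<^sup>+u. ennreal (cmod (indicator {0..1::real} u *\<^sub>R ?g (t + u *\<^sub>R b))) \<partial>lborel \<partial>lborel) < \<infinity>" .
  qed measurable
  also have "\<dots> = (\<integral>u. indicator {0..1::real} u *\<^sub>R (\<integral>t. ?g t \<partial>lborel) \<partial>lborel)"
    using integral_shift[of ?g "- (u *\<^sub>R b)" for u] by (intro Bochner_Integration.integral_cong refl) simp
  also have "\<dots> = (\<integral>t. ?g t \<partial>lborel)" by simp
  also have "(\<integral>t. f (t + b) - f t \<partial>lborel) = 0"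
    using integral_shift[of f "- b"] integrable_shift[OF f, of "- b"] f by simp
  finally show ?thesis by simp
qed

text \<open>Integration by parts: the integral of the derivative of \<open>f\<close> times the
  exponential vanishes, and the product rule splits it into the two transforms.\<close>

lemma fourier_partial_deriv:
  fixes f :: "'a::euclidean_space \<Rightarrow> complex"
  assumes d: "\<And>x. f differentiable at x" and c: "continuous_on UNIV (partial_deriv b f)"
    and f: "integrable lborel f" and pf: "integrable lborel (partial_deriv b f)"
  shows "fourier (partial_deriv b f) w = 2 * pi * \<i> * (w \<bullet> b) * fourier f w"
proof -
  let ?e = "\<lambda>t. cis (- (2 * pi) * (w \<bullet> t))"
  have [measurable]: "partial_deriv b f \<in> borel_measurable borel" "f \<in> borel_measurable borel" using f pf by auto
  have de: "?e differentiable at x" for x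
    using has_derivative_cis_inner by (blast intro: differentiableI)
  have pe: "partial_deriv b ?e x = of_real (- (2 * pi) * (w \<bullet> b)) * (\<i> * ?e x)" for x
    by (rule partial_deriv_eq[OF has_derivative_cis_inner])
  have eq: "partial_deriv b (\<lambda>t. f t * ?e t) = (\<lambda>x. (- (2 * pi * \<i> * (w \<bullet> b))) * (f x * ?e x) + partial_deriv b f x * ?e x)"
    by (rule ext, subst partial_deriv_mult[OF d de], subst pe) (simp add: algebra_simps)
  have i1: "integrable lborel (\<lambda>t. f t * ?e t)" "integrable lborel (\<lambda>t. partial_deriv b f t * ?e t)"
    using f pf by (auto intro!: integrable_mult_cis)
  have "continuous_on UNIV f"
    using d by (meson continuous_at_imp_continuous_on differentiable_imp_continuous_within)
  then have "(\<integral>t. partial_deriv b (\<lambda>t. f t * ?e t) t \<partial>lborel) = 0"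
  proof (intro integral_partial_deriv_eq_0 differentiable_mult d de i1)
    show "continuous_on UNIV (partial_deriv b (\<lambda>t. f t * ?e t))"
      unfolding eq by (intro continuous_intros c \<open>continuous_on UNIV f\<close>)
    show "integrable lborel (partial_deriv b (\<lambda>t. f t * ?e t))"
      unfolding eq by (intro Bochner_Integration.integrable_add integrable_mult_right i1)
  qed
  then have "- (2 * pi * \<i> * (w \<bullet> b)) * (\<integral>t. f t * ?e t \<partial>lborel) + (\<integral>t. partial_deriv b f t * ?e t \<partial>lborel) = 0"
    unfolding eq using i1 by (subst (asm) Bochner_Integration.integral_add) (auto simp del: mult_minus_left)
  then show ?thesis by (simp add: fourier_def)
qed

lemma sch_SucD:
  fixes \<Phi> :: "'i \<Rightarrow> 'a::euclidean_space \<Rightarrow> complex"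
  assumes "sch (Suc m) W \<Phi>" and W: "0 < W i"
  shows "\<Phi> i differentiable at x" "continuous_on A (\<Phi> i)" "integrable lborel (\<Phi> i)"
proof -
  show d: "\<Phi> i differentiable at x" for x using assms(1) by simp
  show c: "continuous_on A (\<Phi> i)" for A
    by (intro continuous_at_imp_continuous_on ballI differentiable_imp_continuous_within d)
  obtain C where "0 \<le> C" and C: "\<And>i x. W i * cmod (\<Phi> i x) \<le> C * decay x"
    by (rule rapid_decay[OF sch_rapid[OF assms(1)]]) (rule that)
  have "cmod (\<Phi> i x) \<le> C / W i * decay x" for x
    using C[of i x] W by (simp add: field_simps)
  then show "integrable lborel (\<Phi> i)"
    by (rule integrable_decay_bound) (intro borel_measurable_continuous_onI c)
qed

text \<open>Identity minus the second derivative along \<open>b\<close> divided by 4 pi squared: the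
  differential operator whose symbol is \<open>1 + (w \<bullet> b)\<^sup>2\<close>, one factor of
  the reciprocal of \<open>decay\<close>.\<close>

definition helm :: "'a \<Rightarrow> ('a::euclidean_space \<Rightarrow> complex) \<Rightarrow> 'a \<Rightarrow> complex" where
  "helm b f = (\<lambda>x. f x + (- (1 / (4 * pi\<^sup>2))) * partial_deriv b (partial_deriv b f) x)"

lemma sch_helm:
  assumes "sch (Suc (Suc m)) W \<Phi>" "\<And>i. 0 \<le> W i" "b \<in> Basis"
  shows "sch m W (\<lambda>i. helm b (\<Phi> i))"
proof -
  have "sch m W \<Phi>" using assms(1) by (meson sch_Suc)
  moreover have "sch m W (\<lambda>i. partial_deriv b (partial_deriv b (\<Phi> i)))" using assms by simp
  ultimately show ?thesis unfolding helm_def by (intro sch_add sch_cmult assms(2))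
qed

lemma fourier_helm:
  assumes "sch (Suc (Suc (Suc m))) W \<Phi>" "0 < W i" "b \<in> Basis"
  shows "fourier (helm b (\<Phi> i)) w = of_real (1 + (w \<bullet> b)\<^sup>2) * fourier (\<Phi> i) w"
proof -
  have 1: "sch (Suc (Suc m)) W (\<lambda>i. partial_deriv b (\<Phi> i))" using assms by simp
  have 2: "sch (Suc m) W (\<lambda>i. partial_deriv b (partial_deriv b (\<Phi> i)))" using assms by simp
  note D0 = sch_SucD[OF assms(1), of i, OF assms(2)]
  note D1 = sch_SucD[OF 1, of i, OF assms(2)]
  note D2 = sch_SucD[OF 2, of i, OF assms(2)]
  have "fourier (helm b (\<Phi> i)) w = fourier (\<Phi> i) w + (- (1 / (4 * pi\<^sup>2))) * fourier (partial_deriv b (partial_deriv b (\<Phi> i))) w"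
    unfolding helm_def
    by (subst fourier_add[OF D0(3) integrable_mult_right[OF D2(3)]]) (simp only: fourier_cmult)
  also have "fourier (partial_deriv b (partial_deriv b (\<Phi> i))) w = (2 * pi * \<i> * (w \<bullet> b)) * ((2 * pi * \<i> * (w \<bullet> b)) * fourier (\<Phi> i) w)"
    by (subst fourier_partial_deriv, (rule D1 D2)+, subst fourier_partial_deriv) (rule D0 D1 refl)+
  also have "fourier (\<Phi> i) w + (- (1 / (4 * pi\<^sup>2))) * ((2 * pi * \<i> * (w \<bullet> b)) * ((2 * pi * \<i> * (w \<bullet> b)) * fourier (\<Phi> i) w))
     = of_real (1 + (w \<bullet> b)\<^sup>2) * fourier (\<Phi> i) w"
  proof -
    have "(2 * pi * \<i> * (w \<bullet> b)) * (2 * pi * \<i> * (w \<bullet> b)) = of_real (- (4 * pi\<^sup>2) * (w \<bullet> b)\<^sup>2)"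
      by (simp add: power2_eq_square)
    then have "(- (1 / (4 * pi\<^sup>2))) * ((2 * pi * \<i> * (w \<bullet> b)) * ((2 * pi * \<i> * (w \<bullet> b)) * fourier (\<Phi> i) w))
      = of_real (- (1 / (4 * pi\<^sup>2)) * (- (4 * pi\<^sup>2) * (w \<bullet> b)\<^sup>2)) * fourier (\<Phi> i) w"
      by (simp only: mult.assoc[symmetric]) simp
    also have "- (1 / (4 * pi\<^sup>2)) * (- (4 * pi\<^sup>2) * (w \<bullet> b)\<^sup>2) = (w \<bullet> b)\<^sup>2" by simp
    finally show ?thesis by (simp add: distrib_right)
  qed
  finally show ?thesis .
qed

text \<open>Each use of \<open>helm\<close> spends two derivatives and gains one factor of the
  product. The additional order 1 is what supplies continuity and integrability at the end of the
  recursion.\<close>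

lemma sch_fourier_prod:
  fixes \<Phi> :: "'i \<Rightarrow> 'a::euclidean_space \<Rightarrow> complex"
  assumes "distinct bs" "set bs \<subseteq> Basis" "sch (2 * length bs + 1) W \<Phi>" and W: "\<And>i. 0 < W i"
  shows "\<exists>C. \<forall>i w. W i * (cmod (fourier (\<Phi> i) w) * (\<Prod>b\<in>set bs. 1 + (w \<bullet> b)\<^sup>2)) \<le> C"
  using assms(1-3)
proof (induction bs arbitrary: \<Phi>)
  case Nil
  then have s: "sch (Suc 0) W \<Phi>" by simp
  obtain C where "0 \<le> C" and C: "\<And>i x. W i * cmod (\<Phi> i x) \<le> C * decay x"
    by (rule rapid_decay[OF sch_rapid[OF s]]) (rule that)
  have "W i * cmod (fourier (\<Phi> i) w) \<le> (\<integral>x. C * decay (x::'a) \<partial>lborel)" for i w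
  proof -
    have "W i * cmod (fourier (\<Phi> i) w) \<le> W i * (\<integral>x. cmod (\<Phi> i x) \<partial>lborel)"
      using W by (intro mult_left_mono norm_fourier_le less_imp_le)
    also have "\<dots> = (\<integral>x. W i * cmod (\<Phi> i x) \<partial>lborel)" by simp
    also have "\<dots> \<le> (\<integral>x. C * decay (x::'a) \<partial>lborel)"
      using sch_SucD(3)[OF s, of i] W by (intro integral_mono C) (auto intro: integrable_decay)
    finally show ?thesis .
  qed
  then show ?case by auto
next
  case (Cons b bs)
  have b: "b \<in> Basis" "b \<notin> set bs" using Cons.prems by auto
  have s: "sch (Suc (Suc (2 * length bs + 1))) W \<Phi>" "sch (Suc (Suc (Suc (2 * length bs)))) W \<Phi>"
    using Cons.prems(3) by simp_all
  obtain C where C: "\<And>i w. W i * (cmod (fourier (helm b (\<Phi> i)) w) * (\<Prod>b\<in>set bs. 1 + (w \<bullet> b)\<^sup>2)) \<le> C"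
    using Cons.IH[OF _ _ sch_helm[OF s(1) less_imp_le[OF W] b(1)]] Cons.prems by auto
  have "W i * (cmod (fourier (\<Phi> i) w) * (\<Prod>b\<in>set (b # bs). 1 + (w \<bullet> b)\<^sup>2)) \<le> C" for i w
  proof -
    have "cmod (fourier (helm b (\<Phi> i)) w) = (1 + (w \<bullet> b)\<^sup>2) * cmod (fourier (\<Phi> i) w)"
      unfolding fourier_helm[OF s(2) W b(1)] norm_mult norm_of_real by (simp add: abs_of_nonneg)
    then show ?thesis using C[of i w] b(2) by (simp add: mult_ac)
  qed
  then show ?case by blast
qed

lemma sch_fourier_decay:
  fixes \<Phi> :: "'i \<Rightarrow> 'a::euclidean_space \<Rightarrow> complex"
  assumes "sch (2 * DIM('a) + 1) W \<Phi>" and W: "\<And>i. 0 < W i"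
  obtains C where "0 \<le> C" "\<And>i w. W i * cmod (fourier (\<Phi> i) w) \<le> C * decay w"
proof -
  obtain bs where bs: "set bs = (Basis :: 'a set)" "distinct bs"
    using finite_distinct_list[OF finite_Basis] by blast
  have l: "length bs = DIM('a)" using bs distinct_card by fastforce
  obtain C where C: "\<And>i w. W i * (cmod (fourier (\<Phi> i) w) * (\<Prod>b\<in>Basis. 1 + (w \<bullet> b)\<^sup>2)) \<le> C"
    using sch_fourier_prod[of bs W \<Phi>] assms bs l by auto
  have d: "(\<Prod>b\<in>Basis. 1 + (w \<bullet> b)\<^sup>2) = inverse (decay w)" for w :: 'a
    unfolding decay_def prod_inversef[symmetric] by (simp add: field_simps)
  have "W i * cmod (fourier (\<Phi> i) w) \<le> max C 0 * decay w" for i w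
  proof -
    have "W i * cmod (fourier (\<Phi> i) w) \<le> C * decay w"
      using C[of i w] decay_pos[of w] unfolding d by (simp add: field_simps)
    also have "\<dots> \<le> max C 0 * decay w" by (intro mult_right_mono) auto
    finally show ?thesis .
  qed
  then show ?thesis using that[of "max C 0"] by simp
qed

lemma schwartz_fourier_decay:
  assumes "f \<in> schwartz"
  obtains C where "0 \<le> C" "\<And>w. cmod (fourier f w) \<le> C * decay w"
  using sch_fourier_decay[of "\<lambda>_::unit. 1" "\<lambda>_. f"] assms unfolding schwartz_iff by auto

text \<open>The weight \<open>(1 + norm z) ^ (2 * DIM('a))\<close> is carried through the uniform
  estimate as an index weight and then traded for \<open>decay z\<close>.\<close>

lemma schwartz_mult_fourier_decay:
  fixes \<psi> g :: "'a::euclidean_space \<Rightarrow> complex"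
  assumes "\<psi> \<in> schwartz" "g \<in> schwartz"
  obtains C where "0 \<le> C" "\<And>z w. cmod (fourier (\<lambda>t. \<psi> t * g (t - z)) w) \<le> C * decay z * decay w"
proof -
  let ?K = "2 * DIM('a)"
  have "sch (2 * DIM('a) + 1) (\<lambda>z. (1 + norm z) ^ ?K) (\<lambda>z x. \<psi> x * g (x - z))"
    using assms by (intro sch_mult_translate) (auto simp: schwartz_iff)
  moreover have W: "0 < (1 + norm z) ^ ?K" for z :: 'a
    by (intro zero_less_power add_pos_nonneg) auto
  ultimately obtain C where C: "0 \<le> C" "\<And>z w. (1 + norm z) ^ ?K * cmod (fourier (\<lambda>x. \<psi> x * g (x - z)) w) \<le> C * decay w"
    using sch_fourier_decay[of "\<lambda>z. (1 + norm z) ^ ?K" "\<lambda>z x. \<psi> x * g (x - z)"] by blast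
  have "cmod (fourier (\<lambda>t. \<psi> t * g (t - z)) w) \<le> C * decay z * decay w" for z w
  proof -
    have "cmod (fourier (\<lambda>t. \<psi> t * g (t - z)) w) \<le> inverse ((1 + norm z) ^ ?K) * (C * decay w)"
      using C(2)[of z w] W[of z] by (simp add: field_simps)
    also have "\<dots> \<le> decay z * (C * decay w)"
      using C(1) by (intro mult_right_mono decay_lower_bound) auto
    finally show ?thesis by (simp add: mult_ac)
  qed
  with C(1) show ?thesis using that by blast
qed

lemma schwartz_norm_bound:
  fixes \<phi> :: "'a::euclidean_space \<Rightarrow> complex"
  assumes "\<phi> \<in> schwartz"
  shows "cmod (\<phi> x) \<le> schwartz_norm (2 * DIM('a)) \<phi> * decay x"
proof -
  let ?N = "2 * DIM('a)" and ?L = "{bs \<in> lists (Basis::'a set). length bs \<le> 2 * DIM('a)}"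
  let ?f = "\<lambda>(bs, x). (1 + norm x) ^ ?N * cmod (partial_derivs bs \<phi> x)"
  \<comment> \<open>Only finitely many multi-indices of bounded order exist, so the set under the
    real supremum is bounded above and the supremum dominates its members.\<close>
  have fin: "finite ?L"
    using finite_lists_length_le[of "Basis::'a set" ?N] by (simp add: lists_eq_set Int_def conj_commute)
  have "\<exists>C. \<forall>x. ?f (bs, x) \<le> C" if "bs \<in> ?L" for bs
  proof -
    have "bounded (range (\<lambda>x. ?f (bs, x)))" using assms that by (simp add: schwartz_def)
    then obtain B where B: "\<And>y. y \<in> range (\<lambda>x. ?f (bs, x)) \<Longrightarrow> norm y \<le> B"
      unfolding bounded_iff by blast
    have "?f (bs, x) \<le> B" for x
      using B[of "?f (bs, x)"] by (simp add: abs_le_D1)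
    then show ?thesis by blast
  qed
  then have "\<forall>bs\<in>?L. \<exists>C. \<forall>x. ?f (bs, x) \<le> C" by (intro ballI)
  from bchoice[OF this] obtain C where "\<forall>bs\<in>?L. \<forall>x. ?f (bs, x) \<le> C bs" ..
  then have C: "?f (bs, x) \<le> C bs" if "bs \<in> ?L" for bs x using that by (elim ballE allE) auto
  have "?f p \<le> (\<Sum>bs\<in>?L. \<bar>C bs\<bar>)" if "p \<in> ?L \<times> UNIV" for p
  proof -
    obtain bs x where p: "p = (bs, x)" "bs \<in> ?L" using \<open>p \<in> ?L \<times> UNIV\<close> by auto
    have "?f p \<le> \<bar>C bs\<bar>" unfolding p(1) by (rule order_trans[OF C[OF p(2)] abs_ge_self])
    also have "\<dots> \<le> (\<Sum>bs\<in>?L. \<bar>C bs\<bar>)" using fin p(2) by (intro member_le_sum) auto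
    finally show ?thesis .
  qed
  then have "bdd_above (?f ` (?L \<times> UNIV))" by (auto intro!: bdd_aboveI2)
  then have le: "?f ([], x) \<le> schwartz_norm ?N \<phi>"
    unfolding schwartz_norm_def by (intro cSUP_upper) auto
  have "cmod (\<phi> x) = ?f ([], x) * inverse ((1 + norm x) ^ ?N)"
  proof -
    have "(1 + norm x) ^ ?N \<noteq> 0" by (metis add_nonneg_eq_0_iff norm_ge_zero power_not_zero zero_le_one zero_neq_one)
    then show ?thesis by simp
  qed
  also have "\<dots> \<le> schwartz_norm ?N \<phi> * inverse ((1 + norm x) ^ ?N)"
    using le by (intro mult_right_mono) auto
  also have "\<dots> \<le> schwartz_norm ?N \<phi> * decay x"
  proof (intro mult_left_mono decay_lower_bound)
    have "0 \<le> ?f ([], x)" by simp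
    then show "0 \<le> schwartz_norm ?N \<phi>" using le by linarith
  qed
  finally show ?thesis .
qed

section \<open>Smooth bump functions\<close>

primrec smo :: "nat \<Rightarrow> ('a::euclidean_space \<Rightarrow> complex) \<Rightarrow> bool" where
  "smo 0 f \<longleftrightarrow> True"
| "smo (Suc m) f \<longleftrightarrow> (\<forall>x. f differentiable at x) \<and> (\<forall>b\<in>Basis. smo m (partial_deriv b f))"

lemma smo_Suc: "smo (Suc m) f \<Longrightarrow> smo m f"
  by (induction m arbitrary: f) auto

lemma smo_derivs: "smo (Suc (length bs)) f \<Longrightarrow> bs \<in> lists Basis \<Longrightarrow> partial_derivs bs f differentiable at x"
  by (induction bs arbitrary: f rule: rev_induct) auto

lemma smooth_iff: "smooth f \<longleftrightarrow> (\<forall>m. smo m f)"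
proof
  assume f: "smooth f"
  have "smo m f" if "\<And>bs x. bs \<in> lists Basis \<Longrightarrow> partial_derivs bs f differentiable at x" for m f
    using that
  proof (induction m arbitrary: f)
    case (Suc m)
    then show ?case using Suc.prems[of "[]"] Suc.prems[of "_ @ [_]"] by auto
  qed simp
  then show "\<forall>m. smo m f" using f unfolding smooth_def by blast
qed (simp add: smooth_def smo_derivs)

lemma smo_add: "smo m f \<Longrightarrow> smo m g \<Longrightarrow> smo m (\<lambda>x. f x + g x)"
proof (induction m arbitrary: f g)
  case (Suc m)
  have "partial_deriv b (\<lambda>x. f x + g x) = (\<lambda>x. partial_deriv b f x + partial_deriv b g x)" for b
    using Suc.prems by (auto simp: partial_deriv_add)
  then show ?case using Suc by auto
qed simp

lemma smo_mult: "smo m f \<Longrightarrow> smo m g \<Longrightarrow> smo m (\<lambda>x. f x * g x)"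
proof (induction m arbitrary: f g)
  case (Suc m)
  have "partial_deriv b (\<lambda>x. f x * g x) = (\<lambda>x. f x * partial_deriv b g x + partial_deriv b f x * g x)" for b
    using Suc.prems by (auto simp: partial_deriv_mult)
  moreover have "smo m f" "smo m g" using Suc.prems smo_Suc by blast+
  ultimately show ?case using Suc.prems by (auto intro!: smo_add Suc.IH)
qed simp

lemma smo_const: "smo m (\<lambda>_::'a::euclidean_space. c)"
proof (induction m arbitrary: c)
  case (Suc m)
  have "partial_deriv b (\<lambda>_::'a. c) = (\<lambda>_. 0)" for b
    using partial_deriv_eq[OF has_derivative_const] by auto
  then show ?case using Suc by auto
qed simp

text \<open>The outer function is given as the whole sequence of its successive derivatives. The
  chain rule raises the index \<open>k\<close> by one, which keeps the induction on the order
  closed.\<close>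

lemma smo_compose:
  assumes \<phi>: "\<And>k x. (\<phi> k has_real_derivative \<phi> (Suc k) x) (at x)"
  shows "smo m (\<lambda>t. complex_of_real (p t)) \<Longrightarrow> smo m (\<lambda>t. complex_of_real (\<phi> k (p t)))"
proof (induction m arbitrary: k)
  case (Suc m)
  have D: "((\<lambda>t. complex_of_real (\<phi> k (p t))) has_derivative
     (\<lambda>h. complex_of_real (\<phi> (Suc k) (p x)) * frechet_derivative (\<lambda>t. complex_of_real (p t)) (at x) h)) (at x)" for x k
  proof -
    let ?D = "frechet_derivative (\<lambda>t. complex_of_real (p t)) (at x)"
    have D1: "((\<lambda>t. complex_of_real (p t)) has_derivative ?D) (at x)"
      using Suc.prems by (intro has_derivative_partial) auto
    have Dp: "(p has_derivative (\<lambda>h. Re (?D h))) (at x)"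
      using bounded_linear.has_derivative[OF bounded_linear_Re D1] by simp
    have "((\<lambda>t. complex_of_real (p t)) has_derivative (\<lambda>h. complex_of_real (Re (?D h)))) (at x)"
      by (rule bounded_linear.has_derivative[OF bounded_linear_of_real Dp])
    then have re: "(\<lambda>h. complex_of_real (Re (?D h))) = ?D"
      using has_derivative_unique[OF _ D1] by blast
    have "((\<lambda>t. \<phi> k (p t)) has_derivative (\<lambda>h. \<phi> (Suc k) (p x) * Re (?D h))) (at x)"
      using has_derivative_compose[OF Dp \<phi>[unfolded has_field_derivative_def]] .
    then have "((\<lambda>t. complex_of_real (\<phi> k (p t))) has_derivative (\<lambda>h. complex_of_real (\<phi> (Suc k) (p x) * Re (?D h)))) (at x)"
      by (rule bounded_linear.has_derivative[OF bounded_linear_of_real])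
    then show ?thesis unfolding of_real_mult using re by metis
  qed
  have "partial_deriv b (\<lambda>t. complex_of_real (\<phi> k (p t))) =
     (\<lambda>x. complex_of_real (\<phi> (Suc k) (p x)) * partial_deriv b (\<lambda>t. complex_of_real (p t)) x)" for b
    using partial_deriv_eq[OF D] by (auto simp: partial_deriv_def)
  moreover have "smo m (\<lambda>t. complex_of_real (p t))" using Suc.prems by (rule smo_Suc)
  ultimately show ?case using D Suc.prems
    by (auto intro!: smo_mult Suc.IH intro: differentiableI)
qed simp

lemma smo_inner: "smo m (\<lambda>t. complex_of_real (a * (t \<bullet> c) + d))"
proof (cases m)
  case (Suc k)
  have D: "((\<lambda>t. complex_of_real (a * (t \<bullet> c) + d)) has_derivative (\<lambda>h. complex_of_real (a * (h \<bullet> c)))) (at x)" for x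
    by (auto intro!: derivative_eq_intros)
  have eq: "partial_deriv b (\<lambda>t. complex_of_real (a * (t \<bullet> c) + d)) = (\<lambda>_. complex_of_real (a * (b \<bullet> c)))" for b
    using partial_deriv_eq[OF D] by blast
  show ?thesis unfolding Suc smo.simps eq using D smo_const by (blast intro: differentiableI)
qed simp

lemma smo_dist_square: "smo m (\<lambda>t. complex_of_real (((t - q) \<bullet> (t - q)) / r - 1))"
proof (cases m)
  case (Suc k)
  have D: "((\<lambda>t. complex_of_real (((t - q) \<bullet> (t - q)) / r - 1)) has_derivative
     (\<lambda>h. complex_of_real (2 / r * (x \<bullet> h) + (- 2 / r * (q \<bullet> h))))) (at x)" for x
    unfolding divide_inverse
    by (auto intro!: derivative_eq_intros simp: inner_commute algebra_simps fun_eq_iff)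
  have eq: "partial_deriv b (\<lambda>t. complex_of_real (((t - q) \<bullet> (t - q)) / r - 1)) =
     (\<lambda>x. complex_of_real (2 / r * (x \<bullet> b) + (- 2 / r * (q \<bullet> b))))" for b
    using partial_deriv_eq[OF D] by blast
  have "smo k (\<lambda>x. complex_of_real (2 / r * (x \<bullet> b) + (- 2 / r * (q \<bullet> b))))" for b by (rule smo_inner)
  then show ?thesis unfolding Suc smo.simps eq using D by (blast intro: differentiableI)
qed simp

text \<open>Shifts by quarter periods list all derivatives of the cosine in the form that
  \<open>smo_compose\<close> expects.\<close>

lemma smooth_cos: "smooth (\<lambda>t. complex_of_real (cos (a * (t \<bullet> c))))"
proof -
  have "smo m (\<lambda>t. complex_of_real ((\<lambda>k x. cos (x + real k * (pi / 2))) 0 (a * (t \<bullet> c) + 0)))" for m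
  proof (rule smo_compose[OF _ smo_inner])
    fix k x
    have "cos (x + real (Suc k) * (pi / 2)) = - sin (x + real k * (pi / 2))"
      by (simp add: algebra_simps cos_add sin_add add_divide_distrib) 
    then show "((\<lambda>x. cos (x + real k * (pi / 2))) has_real_derivative cos (x + real (Suc k) * (pi / 2))) (at x)"
      by (auto intro!: derivative_eq_intros)
  qed
  then show ?thesis by (simp add: smooth_iff)
qed

lemma partial_derivs_eq_0:
  assumes "\<And>x. norm x > R \<Longrightarrow> f x = 0"
  shows "norm x > R \<Longrightarrow> partial_derivs bs f x = 0"
proof (induction bs arbitrary: x)
  case (Cons b bs)
  let ?S = "{x. norm x > R}"
  have o: "open ?S" by (intro open_Collect_less continuous_intros)
  have "(partial_derivs bs f has_derivative (\<lambda>_. 0)) (at x)"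
    by (rule has_derivative_transform_within_open[OF has_derivative_const o]) (use Cons in auto)
  then show ?case using partial_deriv_eq by fastforce
qed (use assms in simp)

lemma schwartz_compact_support:
  fixes f :: "'a::euclidean_space \<Rightarrow> complex"
  assumes f: "smooth f" and z: "\<And>x. norm x > R \<Longrightarrow> f x = 0"
  shows "f \<in> schwartz"
proof -
  have "bounded (range (\<lambda>x. (1 + norm x) ^ k * cmod (partial_derivs bs f x)))" if bs: "bs \<in> lists Basis" for k bs
  proof -
    let ?h = "\<lambda>x. (1 + norm x) ^ k * cmod (partial_derivs bs f x)"
    have "continuous_on UNIV (partial_derivs bs f)"
      using f bs unfolding smooth_def
      by (intro continuous_at_imp_continuous_on ballI differentiable_imp_continuous_within) auto
    then have "continuous_on (cball 0 R) ?h"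
      by (intro continuous_intros) (auto intro: continuous_on_subset)
    then have "compact (?h ` cball 0 R)" by (intro compact_continuous_image compact_cball)
    then have "bounded (insert 0 (?h ` cball 0 R))" by (simp add: compact_imp_bounded)
    moreover have "range ?h \<subseteq> insert 0 (?h ` cball 0 R)"
    proof
      fix y assume "y \<in> range ?h"
      then obtain x where "y = ?h x" by blast
      then show "y \<in> insert 0 (?h ` cball 0 R)"
        using partial_derivs_eq_0[OF z, where x=x and bs=bs] by (cases "norm x \<le> R") auto
    qed
    ultimately show ?thesis by (rule bounded_subset)
  qed
  then show ?thesis using f by (auto simp: schwartz_def)
qed

section \<open>A function flat at the origin and bumps built from it\<close>

text \<open>With \<open>y = 1 / x\<close>, differentiating \<open>p(y) exp (- y)\<close> in
  \<open>x\<close> gives \<open>y\<^sup>2 * (p(y) - p'(y)) * exp (- y)\<close>; this is the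
  recursion.\<close>

fun flat_poly :: "nat \<Rightarrow> real poly" where
  "flat_poly 0 = 1"
| "flat_poly (Suc k) = [:0, 0, 1:] * (flat_poly k - pderiv (flat_poly k))"

definition flat :: "nat \<Rightarrow> real \<Rightarrow> real" where
  "flat k x = (if x > 0 then poly (flat_poly k) (1 / x) * exp (- (1 / x)) else 0)"

lemma poly_exp_tendsto_0: "((\<lambda>y::real. poly p y * exp (- y)) \<longlongrightarrow> 0) at_top"
proof -
  have "((\<lambda>y::real. \<Sum>i\<le>degree p. coeff p i * (y ^ i / exp y)) \<longlongrightarrow> (\<Sum>i\<le>degree p. coeff p i * 0)) at_top"
    by (intro tendsto_intros tendsto_power_div_exp_0)
  then show ?thesis
    by (simp add: poly_altdef sum_distrib_left exp_minus divide_inverse mult_ac)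
qed

lemma flat_has_derivative: "(flat k has_real_derivative flat (Suc k) x) (at x)"
proof (cases x "0::real" rule: linorder_cases)
  case less
  have "((\<lambda>_. 0) has_real_derivative 0) (at x)" by simp
  then have "(flat k has_real_derivative 0) (at x)"
    by (rule has_field_derivative_transform_within_open[of _ _ _ "{..<0}"]) (use less in \<open>auto simp: flat_def\<close>)
  then show ?thesis using less by (simp add: flat_def)
next
  case greater
  have "((\<lambda>x. poly (flat_poly k) (1 / x) * exp (- (1 / x))) has_real_derivative flat (Suc k) x) (at x)"
    using greater
    by (auto intro!: derivative_eq_intros DERIV_chain2[OF poly_DERIV] simp: flat_def field_simps power2_eq_square)
  then show ?thesis
    by (rule has_field_derivative_transform_within_open[of _ _ _ "{0<..}"]) (use greater in \<open>auto simp: flat_def\<close>)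
next
  case equal
  \<comment> \<open>With \<open>y = inverse h\<close> the quotient is \<open>y\<close> times a
    polynomial in \<open>y\<close> times \<open>exp (- y)\<close>; \<open>pCons 0\<close> supplies
    the extra factor \<open>y\<close>.\<close>
  have r: "((\<lambda>h. flat k h / h) \<longlongrightarrow> 0) (at_right 0)"
  proof -
    have "((\<lambda>h. poly (pCons 0 (flat_poly k)) (inverse h) * exp (- inverse h)) \<longlongrightarrow> 0) (at_right (0::real))"
      by (rule filterlim_compose[OF poly_exp_tendsto_0 filterlim_inverse_at_top_right])
    then show ?thesis
      by (rule Lim_transform_eventually)
         (auto simp: eventually_at_right_field flat_def field_simps intro!: exI[of _ 1])
  qed
  have l: "((\<lambda>h. flat k h / h) \<longlongrightarrow> 0) (at_left 0)"
    by (rule Lim_transform_eventually[OF tendsto_const])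
       (auto simp: eventually_at_left_field flat_def intro!: exI[of _ "-1"])
  have "((\<lambda>h. flat k h / h) \<longlongrightarrow> 0) (at 0)"
    using l r by (simp add: filterlim_split_at_real)
  then have "(flat k has_real_derivative 0) (at 0)"
    by (simp add: DERIV_def flat_def)
  then show ?thesis using equal by (simp add: flat_def)
qed

lemma flat_0: "flat 0 x = (if x > 0 then exp (- (1 / x)) else 0)"
  by (simp add: flat_def)

text \<open>The inner function vanishes for \<open>norm (t - q) \<le> r\<close> and is at least \<open>exp (-1)\<close> for
  \<open>norm (t - q) \<ge> 2 * r\<close>.\<close>

definition bump :: "'a::euclidean_space \<Rightarrow> real \<Rightarrow> 'a \<Rightarrow> real" where
  "bump q r t = flat 0 (exp (- 1) - flat 0 (((t - q) \<bullet> (t - q)) / r\<^sup>2 - 1)) / flat 0 (exp (- 1))"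

lemma flat_0_mono: "x \<le> y \<Longrightarrow> flat 0 x \<le> flat 0 y"
  by (auto simp: flat_0 divide_simps)

lemma flat_0_nonneg: "0 \<le> flat 0 x"
  by (simp add: flat_0)

lemma bump_nonneg: "0 \<le> bump q r t"
  unfolding bump_def by (intro divide_nonneg_nonneg flat_0_nonneg)

lemma bump_le_1: "bump q r t \<le> 1"
proof -
  have "flat 0 (exp (- 1) - flat 0 (((t - q) \<bullet> (t - q)) / r\<^sup>2 - 1)) \<le> flat 0 (exp (- 1))"
    by (intro flat_0_mono) (simp add: flat_0_nonneg)
  moreover have "0 < flat 0 (exp (- 1))" by (simp add: flat_0)
  ultimately show ?thesis unfolding bump_def by simp
qed

lemma bump_eq_1:
  assumes "norm (t - q) \<le> r" "0 < r" shows "bump q r t = 1"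
proof -
  have "(norm (t - q))\<^sup>2 \<le> r\<^sup>2" using assms by (intro power_mono) auto
  then have "flat 0 (((t - q) \<bullet> (t - q)) / r\<^sup>2 - 1) = 0"
    using assms(2) by (simp add: flat_0 power2_norm_eq_inner)
  then show ?thesis by (simp add: bump_def flat_0)
qed

lemma bump_eq_0:
  assumes "norm (t - q) \<ge> 2 * r" "0 < r" shows "bump q r t = 0"
proof -
  have "(2 * r)\<^sup>2 \<le> (norm (t - q))\<^sup>2" using assms by (intro power_mono) auto
  \<comment> \<open>The quotient is in fact at least 4. The bound 2 already lifts the inner function
    to \<open>flat 0 1 = exp (- 1)\<close>, which switches the outer one off.\<close>
  then have "2 \<le> ((t - q) \<bullet> (t - q)) / r\<^sup>2"
    using assms(2) by (simp add: power2_norm_eq_inner field_simps)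
       (smt (verit) zero_le_power2)
  then have "flat 0 1 \<le> flat 0 (((t - q) \<bullet> (t - q)) / r\<^sup>2 - 1)"
    by (intro flat_0_mono) linarith
  then have "exp (- 1) \<le> flat 0 (((t - q) \<bullet> (t - q)) / r\<^sup>2 - 1)"
    by (simp add: flat_0[of 1])
  then have "flat 0 (exp (- 1) - flat 0 (((t - q) \<bullet> (t - q)) / r\<^sup>2 - 1)) = 0"
    unfolding flat_0[of "exp (- 1) - _"] by simp
  then show ?thesis by (simp add: bump_def)
qed

lemma smooth_bump: "smooth (\<lambda>t. complex_of_real (bump q r t))"
proof -
  have "smo m (\<lambda>t. complex_of_real (bump q r t))" for m
  proof -
    let ?p = "\<lambda>t. flat 0 (((t - q) \<bullet> (t - q)) / r\<^sup>2 - 1)"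
    have "smo m (\<lambda>t. complex_of_real (?p t))"
      by (rule smo_compose[where \<phi>=flat and k=0, OF flat_has_derivative smo_dist_square])
    then have "smo m (\<lambda>t. complex_of_real (exp (- 1)) + complex_of_real (- 1) * complex_of_real (?p t))"
      by (intro smo_add smo_mult smo_const)
    then have "smo m (\<lambda>t. complex_of_real (exp (- 1) - ?p t))" by simp
    then have "smo m (\<lambda>t. complex_of_real (1 / flat 0 (exp (- 1))) * complex_of_real (flat 0 (exp (- 1) - ?p t)))"
      by (intro smo_mult smo_const smo_compose[where \<phi>=flat and k=0, OF flat_has_derivative])
    then show ?thesis by (simp add: bump_def)
  qed
  then show ?thesis by (simp add: smooth_iff)
qed

lemma schwartz_smooth_mult_bump:
  assumes "smooth f" "0 < r"
  shows "(\<lambda>t. f t * complex_of_real (bump q r t)) \<in> schwartz"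
proof (rule schwartz_compact_support)
  show "smooth (\<lambda>t. f t * complex_of_real (bump q r t))"
    using assms(1) smooth_bump[of q r] by (auto simp: smooth_iff intro: smo_mult)
  fix x :: 'a assume "norm x > norm q + 2 * r"
  then have "norm (x - q) \<ge> 2 * r" using norm_triangle_ineq2[of x q] by linarith
  then show "f x * complex_of_real (bump q r x) = 0" using assms(2) by (simp add: bump_eq_0)
qed

lemma schwartz_bump: "0 < r \<Longrightarrow> (\<lambda>t. complex_of_real (bump q r t)) \<in> schwartz"
  using schwartz_smooth_mult_bump[of "\<lambda>_. 1"] by (simp add: smooth_iff smo_const)

lemma continuous_on_bump: "0 < r \<Longrightarrow> continuous_on A (bump q r)"
  using continuous_on_Re[OF schwartz_continuous[OF schwartz_bump]] by simp

lemma bump_rescale: "bump q (c * r) t = bump 0 r ((t - q) /\<^sub>R c)"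
proof -
  have "((t - q) \<bullet> (t - q)) / (c * r)\<^sup>2 = (((t - q) /\<^sub>R c - 0) \<bullet> ((t - q) /\<^sub>R c - 0)) / r\<^sup>2"
    by (simp only: diff_zero inner_scaleR_left inner_scaleR_right power2_eq_square divide_inverse inverse_mult_distrib mult_ac)
  then show ?thesis by (simp only: bump_def)
qed

section \<open>Change of window\<close>

text \<open>A Schwartz function that vanishes almost everywhere has zero transform and, by inversion
  and continuity, vanishes everywhere. The positive integral is the normalization of the window in
  the reproducing formula.\<close>

lemma integral_norm_square_pos:
  fixes g :: "'a::euclidean_space \<Rightarrow> complex"
  assumes g: "g \<in> schwartz" and nz: "g \<noteq> (\<lambda>_. 0)"
  shows "integrable lborel (\<lambda>t. cnj (g t) * g t)"
    and "0 < (\<integral>t. (cmod (g t))\<^sup>2 \<partial>lborel)"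
    and "integrable lborel (\<lambda>t. (cmod (g t))\<^sup>2)"
proof -
  have [measurable]: "g \<in> borel_measurable borel" by (rule schwartz_measurable[OF g])
  obtain B where B: "\<And>x. cmod (g x) \<le> B" using schwartz_bounded[OF g] by metis
  show "integrable lborel (\<lambda>t. cnj (g t) * g t)"
    by (rule integrable_mult_bounded[OF schwartz_integrable[OF g], where B=B]) (use B in auto)
  from integrable_norm[OF this] show i: "integrable lborel (\<lambda>t. (cmod (g t))\<^sup>2)"
    by (simp add: norm_mult power2_eq_square)
  have "(\<integral>t. (cmod (g t))\<^sup>2 \<partial>lborel) \<noteq> 0"
  proof
    assume "(\<integral>t. (cmod (g t))\<^sup>2 \<partial>lborel) = 0"
    then have ae: "AE t in lborel. g t = 0"
      using integral_nonneg_eq_0_iff_AE[OF i] by simp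
    have "fourier g w = 0" for w
    proof -
      have "fourier g w = (\<integral>t. 0 \<partial>(lborel::'a measure))"
        unfolding fourier_def
      proof (rule integral_cong_AE)
        show "AE t in lborel. g t * cis (- (2 * pi * (w \<bullet> t))) = 0" using ae by eventually_elim simp
      qed auto
      then show ?thesis by simp
    qed
    then have "fnorm g = 0" by simp
    then have "g x = 0" for x
      by (rule fourier_unique_zero[OF schwartz_continuous[OF g] B schwartz_integrable[OF g]])
    then show False using nz by auto
  qed
  moreover have "0 \<le> (\<integral>t. (cmod (g t))\<^sup>2 \<partial>lborel)" by simp
  ultimately show "0 < (\<integral>t. (cmod (g t))\<^sup>2 \<partial>lborel)" by linarith
qed

text \<open>The setting in which \<open>h\<close> can be paired with Schwartz functions. Boundedness
  is not part of it, because for an element of the space boundedness is first derived from its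
  norm.\<close>

definition pairable :: "('a::euclidean_space \<Rightarrow> complex) \<Rightarrow> bool" where
  "pairable h \<longleftrightarrow> h \<in> borel_measurable borel \<and> (\<forall>\<phi>\<in>schwartz. integrable lborel (\<lambda>t. h t * \<phi> t))"

text \<open>The profile of local norms convolved with \<open>decay\<close>. It controls the local
  norm at \<open>x\<close> for every Schwartz window, yet remains integrable in
  \<open>x\<close>.\<close>

definition ambient :: "('a::euclidean_space \<Rightarrow> complex) \<Rightarrow> ('a \<Rightarrow> complex) \<Rightarrow> 'a \<Rightarrow> ennreal" where
  "ambient g h x = (\<integral>\<^sup>+y. fnorm (\<lambda>t. h t * cnj (g (t - y))) * ennreal (decay (x - y)) \<partial>lborel)"

text \<open>For a function that induces a distribution this is the modulation norm with the inner
  integral read as a Fourier algebra norm.\<close>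

definition xnorm :: "('a::euclidean_space \<Rightarrow> complex) \<Rightarrow> ('a \<Rightarrow> complex) \<Rightarrow> ennreal" where
  "xnorm g h = (\<integral>\<^sup>+y. fnorm (\<lambda>t. h t * cnj (g (t - y))) \<partial>lborel)"

lemma fnorm_decay_bound:
  fixes f :: "'a::euclidean_space \<Rightarrow> complex"
  assumes "\<And>w. cmod (fourier f w) \<le> C * decay w" "0 \<le> C"
  shows "fnorm f \<le> ennreal (C * pi ^ DIM('a))"
proof -
  have "fnorm f \<le> (\<integral>\<^sup>+w. ennreal C * ennreal (decay (w::'a)) \<partial>lborel)"
    using assms by (intro nn_integral_mono) (simp add: ennreal_mult[symmetric] ennreal_leI)
  also have "\<dots> = ennreal (C * pi ^ DIM('a))"
    using assms(2) by (simp add: nn_integral_cmult nn_integral_decay ennreal_mult)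
  finally show ?thesis .
qed

text \<open>A translation reduces to \<open>x = 0\<close>, where the transform of the product of the
  windows is bounded by \<open>decay\<close> in both the displacement and the frequency.\<close>

lemma multiplier_schwartz_window:
  fixes \<psi> g :: "'a::euclidean_space \<Rightarrow> complex"
  assumes \<psi>: "\<psi> \<in> schwartz" and g: "g \<in> schwartz"
  obtains C where "0 \<le> C" "\<And>x y. multiplier (\<lambda>t. \<psi> (t - x) * g (t - y)) (C * decay (y - x))"
proof -
  obtain C where C: "0 \<le> C" "\<And>z w. cmod (fourier (\<lambda>t. \<psi> t * g (t - z)) w) \<le> C * decay z * decay w"
    using schwartz_mult_fourier_decay[OF \<psi> g] by metis
  obtain A where A: "0 \<le> A" "\<And>x. cmod (\<psi> x) \<le> A" using schwartz_bounded[OF \<psi>] by metis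
  obtain B where B: "0 \<le> B" "\<And>x. cmod (g x) \<le> B" using schwartz_bounded[OF g] by metis
  have [measurable]: "\<psi> \<in> borel_measurable borel" "g \<in> borel_measurable borel"
    by (rule schwartz_measurable[OF \<psi>] schwartz_measurable[OF g])+
  have "multiplier (\<lambda>t. \<psi> (t - x) * g (t - y)) (C * pi ^ DIM('a) * decay (y - x))" for x y
  proof (rule multiplier_fnorm)
    show "continuous_on UNIV (\<lambda>t. \<psi> (t - x) * g (t - y))"
      by (intro continuous_intros continuous_on_compose2[OF schwartz_continuous[OF \<psi>, of UNIV]]
          continuous_on_compose2[OF schwartz_continuous[OF g, of UNIV]]) auto
    show "cmod (\<psi> (t - x) * g (t - y)) \<le> A * B" for t
      unfolding norm_mult using A B by (intro mult_mono) auto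
    show "integrable lborel (\<lambda>t. \<psi> (t - x) * g (t - y))"
      using integrable_mult_bounded[OF integrable_shift[OF schwartz_integrable[OF \<psi>], of x], of "\<lambda>t. g (t - y)" B] B
      by (simp add: mult.commute)
    have "fnorm (\<lambda>t. \<psi> (t - x) * g (t - y)) = fnorm (\<lambda>t. \<psi> t * g (t - (y - x)))"
      using fnorm_translate[of "\<lambda>t. \<psi> t * g (t - (y - x))" x] by (simp add: algebra_simps)
    also have "\<dots> \<le> ennreal (C * decay (y - x) * pi ^ DIM('a))"
      using C by (intro fnorm_decay_bound) auto
    finally show "fnorm (\<lambda>t. \<psi> (t - x) * g (t - y)) \<le> ennreal (C * pi ^ DIM('a) * decay (y - x))"
      by (simp add: mult_ac)
    show "0 \<le> C * pi ^ DIM('a) * decay (y - x)" using C(1) by simp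
  qed
  then show ?thesis using that[of "C * pi ^ DIM('a)"] C(1) by simp
qed

text \<open>The squared modulus of \<open>g (t - y)\<close> has the constant
  \<open>y\<close>-integral \<open>G\<close>, so \<open>h\<close> times the new window is
  \<open>1 / G\<close> times the integral over \<open>y\<close> of the pieces \<open>h\<close> times
  the conjugate window \<open>g\<close>, each multiplied by
  \<open>\<psi> (t - x) * g (t - y)\<close>. That factor has multiplier bound
  \<open>C * decay (y - x)\<close>.\<close>

lemma window_change:
  fixes \<psi> g :: "'a::euclidean_space \<Rightarrow> complex"
  assumes \<psi>: "\<psi> \<in> schwartz" and g: "g \<in> schwartz" and nz: "g \<noteq> (\<lambda>_. 0)"
  obtains C where "0 \<le> C"
    "\<And>h x. pairable h \<Longrightarrow> fnorm (\<lambda>t. h t * \<psi> (t - x)) \<le> ennreal C * ambient g h x"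
proof -
  have [measurable]: "\<psi> \<in> borel_measurable borel" "g \<in> borel_measurable borel"
    by (rule schwartz_measurable[OF \<psi>] schwartz_measurable[OF g])+
  define G where "G = (\<integral>t. (cmod (g t))\<^sup>2 \<partial>lborel)"
  have G: "0 < G" using integral_norm_square_pos(2)[OF g nz] by (simp add: G_def)
  have Gc: "(\<integral>y. cnj (g (t - y)) * g (t - y) \<partial>lborel) = of_real G" for t
  proof -
    have "(\<integral>y. cnj (g (t - y)) * g (t - y) \<partial>lborel) = (\<integral>y. cnj (g y) * g y \<partial>lborel)"
      by (rule integral_reflect[of "\<lambda>y. cnj (g y) * g y"]) measurable
    also have "\<dots> = (\<integral>y. complex_of_real ((cmod (g y))\<^sup>2) \<partial>lborel)"
      by (simp add: complex_norm_square mult.commute del: of_real_power)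
    also have "\<dots> = of_real G" by (simp only: G_def integral_complex_of_real)
    finally show ?thesis .
  qed
  have Gn: "(\<integral>\<^sup>+y. ennreal ((cmod (g (t - y)))\<^sup>2) \<partial>lborel) = ennreal G" for t
  proof -
    have "(\<integral>\<^sup>+y. ennreal ((cmod (g (t - y)))\<^sup>2) \<partial>lborel) = (\<integral>\<^sup>+y. ennreal ((cmod (g y))\<^sup>2) \<partial>lborel)"
      by (rule nn_integral_reflect[of "\<lambda>y. ennreal ((cmod (g y))\<^sup>2)"]) measurable
    also have "\<dots> = ennreal G"
      unfolding G_def using integral_norm_square_pos(3)[OF g nz] by (intro nn_integral_eq_integral) auto
    finally show ?thesis .
  qed
  obtain C where C: "0 \<le> C" "\<And>x y. multiplier (\<lambda>t. \<psi> (t - x) * g (t - y)) (C * decay (y - x))"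
    using multiplier_schwartz_window[OF \<psi> g] by metis
  have main: "fnorm (\<lambda>t. h t * \<psi> (t - x)) \<le> ennreal (C / G) * ambient g h x" if h: "pairable h" for h x
  proof -
    have [measurable]: "h \<in> borel_measurable borel" using h by (simp add: pairable_def)
    have i\<psi>: "integrable lborel (\<lambda>t. h t * \<psi> (t - x))"
      using h schwartz_translate[OF \<psi>] by (simp add: pairable_def)
    have ig: "integrable lborel (\<lambda>t. h t * cnj (g (t - y)))" for y
      using h schwartz_cnj[OF schwartz_translate[OF g]] by (simp add: pairable_def)
    define q where "q y t = (\<psi> (t - x) * g (t - y)) * (h t * cnj (g (t - y)))" for y t
    have [measurable]: "case_prod q \<in> borel_measurable (borel \<Otimes>\<^sub>M borel)"
      unfolding q_def by measurable
    have [measurable]: "(\<lambda>t. q y t) \<in> borel_measurable borel" for y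
      unfolding q_def by measurable
    have e: "fourier (\<lambda>t. h t * \<psi> (t - x)) w * of_real G = (\<integral>y. fourier (q y) w \<partial>lborel)" for w
    proof -
      let ?c = "\<lambda>t. cis (- (2 * pi * (w \<bullet> t)))"
      have q: "h t * \<psi> (t - x) * ?c t * of_real G = (\<integral>y. q y t * ?c t \<partial>lborel)" for t
      proof -
        have "(\<integral>y. q y t * ?c t \<partial>lborel) = (\<integral>y. (h t * \<psi> (t - x) * ?c t) * (cnj (g (t - y)) * g (t - y)) \<partial>lborel)"
          by (simp add: q_def mult_ac)
        then show ?thesis by (simp only: integral_mult_right_zero Gc)
      qed
      have "fourier (\<lambda>t. h t * \<psi> (t - x)) w * of_real G = (\<integral>t. \<integral>y. q y t * ?c t \<partial>lborel \<partial>lborel)"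
        unfolding fourier_def q[symmetric] by simp
      also have "\<dots> = (\<integral>y. \<integral>t. q y t * ?c t \<partial>lborel \<partial>lborel)"
      proof (rule fubini_swap)
        have "(\<integral>\<^sup>+t. \<integral>\<^sup>+y. ennreal (cmod (q y t * ?c t)) \<partial>lborel \<partial>lborel)
          = (\<integral>\<^sup>+t. ennreal (cmod (h t * \<psi> (t - x))) * (\<integral>\<^sup>+y. ennreal ((cmod (g (t - y)))\<^sup>2) \<partial>lborel) \<partial>lborel)"
        proof (intro nn_integral_cong)
          fix t
          have "(\<integral>\<^sup>+y. ennreal (cmod (q y t * ?c t)) \<partial>lborel)
            = (\<integral>\<^sup>+y. ennreal (cmod (h t * \<psi> (t - x))) * ennreal ((cmod (g (t - y)))\<^sup>2) \<partial>lborel)"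
            by (intro nn_integral_cong) (simp add: q_def norm_mult ennreal_mult[symmetric] power2_eq_square mult_ac)
          then show "(\<integral>\<^sup>+y. ennreal (cmod (q y t * ?c t)) \<partial>lborel)
            = ennreal (cmod (h t * \<psi> (t - x))) * (\<integral>\<^sup>+y. ennreal ((cmod (g (t - y)))\<^sup>2) \<partial>lborel)"
            by (simp add: nn_integral_cmult)
        qed
        also have "\<dots> = (\<integral>\<^sup>+t. ennreal (cmod (h t * \<psi> (t - x))) \<partial>lborel) * ennreal G"
          unfolding Gn by (simp add: nn_integral_multc)
        also have "\<dots> < \<infinity>"
          using i\<psi> unfolding integrable_iff_bounded by (simp add: ennreal_mult_less_top)
        finally show "(\<integral>\<^sup>+t. \<integral>\<^sup>+y. ennreal (cmod (q y t * ?c t)) \<partial>lborel \<partial>lborel) < \<infinity>" .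
      qed (unfold q_def, measurable)
      finally show ?thesis by (simp add: fourier_def)
    qed
    have "fnorm (\<lambda>t. h t * \<psi> (t - x)) * ennreal G = (\<integral>\<^sup>+w. ennreal (cmod (\<integral>y. fourier (q y) w \<partial>lborel)) \<partial>lborel)"
      unfolding e[symmetric] using G by (simp add: norm_mult ennreal_mult nn_integral_multc)
    also have "\<dots> \<le> (\<integral>\<^sup>+w. \<integral>\<^sup>+y. ennreal (cmod (fourier (q y) w)) \<partial>lborel \<partial>lborel)"
    proof (intro nn_integral_mono)
      fix w
      have [measurable]: "(\<lambda>y. fourier (q y) w) \<in> borel_measurable borel" by measurable
      show "ennreal (cmod (\<integral>y. fourier (q y) w \<partial>lborel)) \<le> (\<integral>\<^sup>+y. ennreal (cmod (fourier (q y) w)) \<partial>lborel)"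
      \<comment> \<open>A function that is not integrable has Bochner integral 0, so the inequality
        holds in either case.\<close>
      proof (cases "integrable lborel (\<lambda>y. fourier (q y) w)")
        case True then show ?thesis by (rule integral_norm_bound_ennreal)
      next
        case False then show ?thesis by (simp add: not_integrable_integral_eq)
      qed
    qed
    also have "\<dots> = (\<integral>\<^sup>+y. \<integral>\<^sup>+w. ennreal (cmod (fourier (q y) w)) \<partial>lborel \<partial>lborel)"
      by (rule nn_fubini_swap) measurable
    also have "\<dots> \<le> (\<integral>\<^sup>+y. ennreal (C * decay (y - x)) * fnorm (\<lambda>t. h t * cnj (g (t - y))) \<partial>lborel)"
      unfolding q_def by (intro nn_integral_mono multiplierD(3)[OF C(2)] ig)
    also have "\<dots> = (\<integral>\<^sup>+y. ennreal C * (fnorm (\<lambda>t. h t * cnj (g (t - y))) * ennreal (decay (x - y))) \<partial>lborel)"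
    proof (intro nn_integral_cong)
      fix y
      have "decay (y - x) = decay (x - y)" using decay_uminus[of "x - y"] by simp
      then show "ennreal (C * decay (y - x)) * fnorm (\<lambda>t. h t * cnj (g (t - y)))
         = ennreal C * (fnorm (\<lambda>t. h t * cnj (g (t - y))) * ennreal (decay (x - y)))"
        using C(1) by (simp add: ennreal_mult mult_ac)
    qed
    also have "\<dots> = ennreal C * ambient g h x"
      unfolding ambient_def by (rule nn_integral_cmult) measurable
    finally have *: "fnorm (\<lambda>t. h t * \<psi> (t - x)) * ennreal G \<le> ennreal C * ambient g h x" .
    have "fnorm (\<lambda>t. h t * \<psi> (t - x)) = fnorm (\<lambda>t. h t * \<psi> (t - x)) * ennreal G * ennreal (1 / G)"
      using G by (simp add: mult.assoc ennreal_mult[symmetric])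
    also have "\<dots> \<le> ennreal C * ambient g h x * ennreal (1 / G)"
      by (rule mult_right_mono[OF *]) simp
    also have "\<dots> = ennreal (C / G) * ambient g h x"
    proof -
      have "ennreal (C / G) = ennreal C * ennreal (1 / G)"
        using C(1) G by (simp add: ennreal_mult[symmetric])
      then show ?thesis by (simp add: mult_ac)
    qed
    finally show ?thesis .
  qed
  show ?thesis using that[of "C / G"] C(1) G main by simp
qed

section \<open>Vanishing at infinity and change of the window\<close>

lemma one_plus_sum_le_prod:
  fixes f :: "'b \<Rightarrow> real"
  assumes "finite A" "\<And>a. a \<in> A \<Longrightarrow> 0 \<le> f a"
  shows "1 + sum f A \<le> (\<Prod>a\<in>A. 1 + f a)"
  using assms
proof (induction A rule: finite_induct)
  case (insert a A)
  have "1 + sum f (insert a A) \<le> (1 + f a) * (1 + sum f A)"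
    using insert.hyps insert.prems sum_nonneg[of A f] by (simp add: algebra_simps)
  also have "\<dots> \<le> (1 + f a) * (\<Prod>a\<in>A. 1 + f a)"
    using insert by (intro mult_left_mono) auto
  finally show ?case using insert.hyps by simp
qed simp

lemma decay_le: "decay x \<le> 1 / (1 + (norm x)\<^sup>2)"
proof -
  have "(norm x)\<^sup>2 = (\<Sum>b\<in>Basis. (x \<bullet> b)\<^sup>2)"
    unfolding power2_norm_eq_inner using euclidean_inner[of x x] by (simp add: power2_eq_square)
  then have "1 + (norm x)\<^sup>2 \<le> (\<Prod>b\<in>Basis. 1 + (x \<bullet> b)\<^sup>2)"
    using one_plus_sum_le_prod[of Basis "\<lambda>b. (x \<bullet> b)\<^sup>2"] by simp
  moreover have "decay x = 1 / (\<Prod>b\<in>Basis. 1 + (x \<bullet> b)\<^sup>2)"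
    by (simp add: decay_def prod_dividef)
  ultimately show ?thesis
    by (simp add: divide_left_mono prod_pos add_pos_nonneg)
qed

lemma decay_tendsto_0: "(decay \<longlongrightarrow> 0) at_infinity"
proof (rule tendsto_sandwich[of "\<lambda>_. 0"])
  show "((\<lambda>x::'a. 1 / (1 + (norm x)\<^sup>2)) \<longlongrightarrow> 0) at_infinity"
  proof (rule filterlim_compose[of "\<lambda>r::real. 1 / (1 + r\<^sup>2)"])
    show "((\<lambda>r::real. 1 / (1 + r\<^sup>2)) \<longlongrightarrow> 0) at_top" by real_asymp
    show "filterlim norm at_top (at_infinity :: 'a filter)" by (rule filterlim_norm_at_top)
  qed
qed (auto intro!: always_eventually decay_le)

lemma ambient_le_xnorm: "ambient g h x \<le> xnorm g h"
  unfolding ambient_def xnorm_def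
proof (intro nn_integral_mono)
  fix y
  show "fnorm (\<lambda>t. h t * cnj (g (t - y))) * ennreal (decay (x - y)) \<le> fnorm (\<lambda>t. h t * cnj (g (t - y)))"
    using mult_left_mono[of "ennreal (decay (x - y))" 1 "fnorm (\<lambda>t. h t * cnj (g (t - y)))"] by simp
qed

lemma borel_measurable_ambient [measurable]:
  assumes [measurable]: "h \<in> borel_measurable borel" "g \<in> borel_measurable borel"
  shows "ambient g h \<in> borel_measurable borel"
  unfolding ambient_def by measurable

lemma nn_integral_ambient:
  fixes g h :: "'a::euclidean_space \<Rightarrow> complex"
  assumes [measurable]: "h \<in> borel_measurable borel" "g \<in> borel_measurable borel"
  shows "(\<integral>\<^sup>+x. ambient g h x \<partial>lborel) = ennreal (pi ^ DIM('a)) * xnorm g h"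
proof -
  have "(\<integral>\<^sup>+x. ambient g h x \<partial>lborel) = (\<integral>\<^sup>+y. \<integral>\<^sup>+x. fnorm (\<lambda>t. h t * cnj (g (t - y))) * ennreal (decay (x - y)) \<partial>lborel \<partial>lborel)"
    unfolding ambient_def by (rule nn_fubini_swap) measurable
  also have "\<dots> = (\<integral>\<^sup>+y. fnorm (\<lambda>t. h t * cnj (g (t - y))) * ennreal (pi ^ DIM('a)) \<partial>lborel)"
    by (intro nn_integral_cong)
       (simp add: nn_integral_cmult nn_integral_shift[of "\<lambda>x. ennreal (decay x)"] nn_integral_decay)
  also have "\<dots> = xnorm g h * ennreal (pi ^ DIM('a))"
    unfolding xnorm_def by (rule nn_integral_multc) measurable
  finally show ?thesis by (simp add: mult.commute)
qed

text \<open>Otherwise there is a sequence of centres going to infinity with values at least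
  \<open>e\<close>. Along it \<open>decay (x k - y)\<close> tends to 0 for each \<open>y\<close>,
  and the integrable profile of local norms dominates.\<close>

lemma ambient_tendsto_0:
  assumes [measurable]: "h \<in> borel_measurable borel" "g \<in> borel_measurable borel"
    and fin: "xnorm g h < \<infinity>" and e: "0 < e"
  obtains R where "\<And>x. norm x > R \<Longrightarrow> ambient g h x < e"
proof (rule ccontr)
  assume "\<not> thesis"
  then have "\<forall>k::nat. \<exists>x. norm x > real k \<and> \<not> ambient g h x < e" using that by blast
  from choice[OF this] obtain x where "\<forall>k::nat. norm (x k) > real k \<and> \<not> ambient g h (x k) < e" ..
  then have x: "\<And>k::nat. norm (x k) > real k" "\<And>k. \<not> ambient g h (x k) < e" by auto
  let ?F = "\<lambda>y. fnorm (\<lambda>t. h t * cnj (g (t - y)))"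
  have xinf: "filterlim x at_infinity sequentially"
    unfolding filterlim_at_infinity[OF order_refl]
  proof (intro allI impI)
    fix r :: real
    show "\<forall>\<^sub>F k in sequentially. r \<le> norm (x k)"
      using eventually_ge_at_top[of "nat \<lceil>r\<rceil>"]
    proof eventually_elim
      case (elim k)
      then have "r \<le> real k" by linarith
      then show ?case using x(1)[of k] by linarith
    qed
  qed
  have lim: "(\<lambda>k. decay (x k - y)) \<longlonglongrightarrow> 0" for y
  proof (rule filterlim_compose[OF decay_tendsto_0])
    show "filterlim (\<lambda>k. x k - y) at_infinity sequentially"
      using tendsto_add_filterlim_at_infinity'[OF xinf tendsto_const[of "- y"]] by simp
  qed
  \<comment> \<open>Where the local norm is infinite, its product with a positive weight stays
    infinite; this null set has to be excluded.\<close>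
  have aefin: "AE y in lborel. ?F y \<noteq> \<infinity>"
    using fin unfolding xnorm_def by (intro nn_integral_PInf_AE) auto
  have "(\<lambda>k. \<integral>\<^sup>+y. ?F y * ennreal (decay (x k - y)) \<partial>lborel) \<longlonglongrightarrow> (\<integral>\<^sup>+y. 0 \<partial>(lborel::'a measure))"
  proof (rule nn_integral_dominated_convergence[where w="?F"])
    show "AE y in lborel. ?F y * ennreal (decay (x k - y)) \<le> ?F y" for k
    proof (rule AE_I2)
      fix y show "?F y * ennreal (decay (x k - y)) \<le> ?F y"
        using mult_left_mono[of "ennreal (decay (x k - y))" 1 "?F y"] by simp
    qed
    show "(\<integral>\<^sup>+y. ?F y \<partial>lborel) < \<infinity>" using fin by (simp add: xnorm_def)
    show "AE y in lborel. (\<lambda>k. ?F y * ennreal (decay (x k - y))) \<longlonglongrightarrow> 0"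
      using aefin
    proof eventually_elim
      case (elim y)
      have "(\<lambda>k. ?F y * ennreal (decay (x k - y))) \<longlonglongrightarrow> ?F y * ennreal 0"
        using elim by (intro tendsto_mult_ennreal tendsto_const tendsto_ennrealI lim) auto
      then show ?case by simp
    qed
  qed measurable
  then have "(\<lambda>k. ambient g h (x k)) \<longlonglongrightarrow> 0" by (simp add: ambient_def)
  from order_tendstoD(2)[OF this e] have "\<forall>\<^sub>F k in sequentially. False"
    using x(2) by simp
  then show False by simp
qed

lemma pairable_bounded:
  assumes [measurable]: "h \<in> borel_measurable borel" and B: "\<And>t. cmod (h t) \<le> B"
  shows "pairable h"
  unfolding pairable_def using assms integrable_mult_bounded[OF schwartz_integrable] by blast

lemma bump_translate: "bump q r t = bump 0 r (t - q)"
  by (simp add: bump_def)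

lemma continuous_compact_support_bounded:
  fixes f :: "'a::euclidean_space \<Rightarrow> complex"
  assumes "continuous_on UNIV f" "\<And>t. R < norm (t - q) \<Longrightarrow> f t = 0"
  obtains B where "0 \<le> B" "\<And>t. cmod (f t) \<le> B"
proof -
  have "compact (f ` cball q R)"
    by (intro compact_continuous_image compact_cball continuous_on_subset[OF assms(1)]) auto
  then obtain B where B: "0 < B" "\<And>y. y \<in> f ` cball q R \<Longrightarrow> norm y \<le> B"
    using bounded_pos compact_imp_bounded by metis
  have "cmod (f t) \<le> B" for t
    using B assms(2)[of t] by (cases "R < norm (t - q)") (auto simp: dist_norm norm_minus_commute)
  then show ?thesis using that[of B] B(1) by auto
qed

lemma continuous_mult_bump:
  assumes "continuous_on UNIV h" "0 < \<rho>"
  shows "continuous_on UNIV (\<lambda>s. h s * complex_of_real (bump q \<rho> s))"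
  by (intro continuous_intros assms(1) continuous_on_bump assms(2))

lemma bounded_mult_bump:
  assumes "continuous_on UNIV h" "0 < \<rho>"
  obtains B where "0 \<le> B" "\<And>s. cmod (h s * complex_of_real (bump q \<rho> s)) \<le> B"
proof -
  have z: "h t * complex_of_real (bump q \<rho> t) = 0" if "2 * \<rho> < norm (t - q)" for t
    using that assms(2) by (simp add: bump_eq_0)
  show ?thesis
    using continuous_compact_support_bounded[OF continuous_mult_bump[OF assms] z] that by blast
qed

lemma pairable_bump_integrable:
  "pairable h \<Longrightarrow> 0 < \<rho> \<Longrightarrow> integrable lborel (\<lambda>s. h s * complex_of_real (bump q \<rho> s))"
  unfolding pairable_def by (rule bspec[OF conjunct2 schwartz_bump])

lemma multiplier_local:
  fixes h :: "'a::euclidean_space \<Rightarrow> complex"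
  assumes h: "continuous_on UNIV h" "pairable h" and \<rho>: "0 < \<rho>"
    and r: "fnorm (\<lambda>s. h s * complex_of_real (bump q \<rho> s)) \<le> ennreal r" "0 \<le> r"
  shows "multiplier (\<lambda>s. h s * complex_of_real (bump q \<rho> s)) r"
proof -
  obtain B where B: "\<And>s. cmod (h s * complex_of_real (bump q \<rho> s)) \<le> B"
    using bounded_mult_bump[OF h(1) \<rho>] by metis
  show ?thesis
    by (rule multiplier_fnorm[OF continuous_mult_bump[OF h(1) \<rho>] B pairable_bump_integrable[OF h(2) \<rho>] r])
qed

lemma bump_nonzero: "0 < r \<Longrightarrow> (\<lambda>t. complex_of_real (bump q r t)) \<noteq> (\<lambda>_. 0)"
  using bump_eq_1[of q q r] by (auto simp: fun_eq_iff intro!: exI[of _ q])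

text \<open>Cut off by a bump equal to 1 at \<open>t\<close>, the function has a multiplier bound
  given by its local norm, and a multiplier bound controls values.\<close>

lemma sup_le_ambient:
  fixes g :: "'a::euclidean_space \<Rightarrow> complex"
  assumes g: "g \<in> schwartz" and nz: "g \<noteq> (\<lambda>_. 0)"
  obtains C where "0 < C" "\<And>h t. continuous_on UNIV h \<Longrightarrow> pairable h \<Longrightarrow> ennreal (cmod (h t)) \<le> ennreal C * ambient g h t"
proof -
  obtain C where C: "0 \<le> C" "\<And>h x. pairable h \<Longrightarrow> fnorm (\<lambda>t. h t * complex_of_real (bump 0 1 (t - x))) \<le> ennreal C * ambient g h x"
    using window_change[OF schwartz_bump[of 1 0] g nz] by (metis zero_less_one)
  \<comment> \<open>If \<open>C = 0\<close> and \<open>ambient\<close> is infinite, their product in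
    \<open>ennreal\<close> is 0. With \<open>C + 1\<close> the infinite case is trivial, and the
    constant is positive.\<close>
  have "ennreal (cmod (h t)) \<le> ennreal (C + 1) * ambient g h t" if h: "continuous_on UNIV h" "pairable h" for h t
  proof (cases "ambient g h t = \<infinity>")
    case True
    then show ?thesis using C(1) by (simp add: ennreal_mult_top)
  next
    case False
    let ?r = "enn2real (ennreal C * ambient g h t)"
    have fin: "ennreal C * ambient g h t < \<infinity>" using False by (auto simp: ennreal_mult_less_top top.not_eq_extremum)
    have "fnorm (\<lambda>s. h s * complex_of_real (bump t 1 s)) \<le> ennreal ?r"
      using C(2)[OF h(2), of t] fin by (simp add: bump_translate[of t])
    then have "multiplier (\<lambda>s. h s * complex_of_real (bump t 1 s)) ?r"
      by (intro multiplier_local h) auto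
    from multiplierD(2)[OF this, of t] have "cmod (h t) \<le> ?r" by (simp add: bump_eq_1)
    then have "ennreal (cmod (h t)) \<le> ennreal C * ambient g h t"
      using fin by (metis ennreal_enn2real ennreal_leI infinity_ennreal_def)
    also have "\<dots> \<le> ennreal (C + 1) * ambient g h t" by (intro mult_right_mono ennreal_leI) auto
    finally show ?thesis .
  qed
  then show ?thesis using that[of "C + 1"] C(1) by simp
qed

text \<open>Integrate \<open>window_change\<close> over the position; the convolution with
  \<open>decay\<close> costs its total mass \<open>pi ^ DIM('a)\<close>. This is the independence of
  the space from the window.\<close>

lemma xnorm_window:
  fixes g1 g2 :: "'a::euclidean_space \<Rightarrow> complex"
  assumes g1: "g1 \<in> schwartz" and g2: "g2 \<in> schwartz" "g2 \<noteq> (\<lambda>_. 0)"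
  obtains C where "0 \<le> C" "\<And>h. pairable h \<Longrightarrow> xnorm g1 h \<le> ennreal C * xnorm g2 h"
proof -
  obtain C where C: "0 \<le> C" "\<And>h x. pairable h \<Longrightarrow> fnorm (\<lambda>t. h t * cnj (g1 (t - x))) \<le> ennreal C * ambient g2 h x"
    using window_change[OF schwartz_cnj[OF g1] g2] by metis
  have "xnorm g1 h \<le> ennreal (C * pi ^ DIM('a)) * xnorm g2 h" if h: "pairable h" for h
  proof -
    have [measurable]: "h \<in> borel_measurable borel" "g2 \<in> borel_measurable borel"
      using h schwartz_measurable[OF g2(1)] by (auto simp: pairable_def)
    have "xnorm g1 h \<le> (\<integral>\<^sup>+x. ennreal C * ambient g2 h x \<partial>lborel)"
      unfolding xnorm_def by (intro nn_integral_mono C h)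
    also have "\<dots> = ennreal C * (ennreal (pi ^ DIM('a)) * xnorm g2 h)"
      by (simp add: nn_integral_cmult nn_integral_ambient)
    finally show ?thesis using C(1) by (simp add: ennreal_mult mult.assoc)
  qed
  then show ?thesis using that[of "C * pi ^ DIM('a)"] C(1) by simp
qed

lemma xnorm_schwartz:
  fixes f g :: "'a::euclidean_space \<Rightarrow> complex"
  assumes "f \<in> schwartz" "g \<in> schwartz"
  shows "xnorm g f < \<infinity>"
proof -
  obtain C where C: "0 \<le> C" "\<And>z w. cmod (fourier (\<lambda>t. f t * cnj (g (t - z))) w) \<le> C * decay z * decay w"
    using schwartz_mult_fourier_decay[OF assms(1) schwartz_cnj[OF assms(2)]] by metis
  have "xnorm g f \<le> (\<integral>\<^sup>+z. ennreal (C * pi ^ DIM('a)) * ennreal (decay (z::'a)) \<partial>lborel)"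
    unfolding xnorm_def
  proof (intro nn_integral_mono)
    fix z
    have "fnorm (\<lambda>t. f t * cnj (g (t - z))) \<le> ennreal (C * decay z * pi ^ DIM('a))"
      using C by (intro fnorm_decay_bound) auto
    then show "fnorm (\<lambda>t. f t * cnj (g (t - z))) \<le> ennreal (C * pi ^ DIM('a)) * ennreal (decay z)"
      using C(1) by (simp add: ennreal_mult[symmetric] mult_ac)
  qed
  also have "\<dots> < \<infinity>"
    by (simp add: nn_integral_cmult nn_integral_decay ennreal_mult_less_top)
  finally show ?thesis .
qed

lemma xnorm_multiplier:
  assumes g: "g \<in> schwartz" and u: "multiplier u r" and h: "pairable h"
  shows "xnorm g (\<lambda>t. u t * h t) \<le> ennreal r * xnorm g h"
proof -
  have [measurable]: "h \<in> borel_measurable borel" "g \<in> borel_measurable borel"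
    using h schwartz_measurable[OF g] by (auto simp: pairable_def)
  have "xnorm g (\<lambda>t. u t * h t) \<le> (\<integral>\<^sup>+y. ennreal r * fnorm (\<lambda>t. h t * cnj (g (t - y))) \<partial>lborel)"
    unfolding xnorm_def
  proof (intro nn_integral_mono)
    fix y
    have "integrable lborel (\<lambda>t. h t * cnj (g (t - y)))"
      using h schwartz_cnj[OF schwartz_translate[OF g]] by (simp add: pairable_def)
    from multiplierD(3)[OF u this]
    show "fnorm (\<lambda>t. u t * h t * cnj (g (t - y))) \<le> ennreal r * fnorm (\<lambda>t. h t * cnj (g (t - y)))"
      by (simp add: mult.assoc)
  qed
  also have "\<dots> = ennreal r * xnorm g h" unfolding xnorm_def by (rule nn_integral_cmult) measurable
  finally show ?thesis .
qed

lemma xnorm_add_le: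
  assumes g: "g \<in> schwartz" and h: "pairable h" and k: "pairable k"
  shows "xnorm g (\<lambda>t. h t + k t) \<le> xnorm g h + xnorm g k"
proof -
  have [measurable]: "h \<in> borel_measurable borel" "k \<in> borel_measurable borel" "g \<in> borel_measurable borel"
    using h k schwartz_measurable[OF g] by (auto simp: pairable_def)
  have "xnorm g (\<lambda>t. h t + k t) \<le> (\<integral>\<^sup>+y. fnorm (\<lambda>t. h t * cnj (g (t - y))) + fnorm (\<lambda>t. k t * cnj (g (t - y))) \<partial>lborel)"
    unfolding xnorm_def
  proof (intro nn_integral_mono)
    fix y
    have "integrable lborel (\<lambda>t. h t * cnj (g (t - y)))" "integrable lborel (\<lambda>t. k t * cnj (g (t - y)))"
      using h k schwartz_cnj[OF schwartz_translate[OF g]] by (auto simp: pairable_def)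
    from fnorm_add_le[OF this]
    show "fnorm (\<lambda>t. (h t + k t) * cnj (g (t - y))) \<le> fnorm (\<lambda>t. h t * cnj (g (t - y))) + fnorm (\<lambda>t. k t * cnj (g (t - y)))"
      by (simp add: distrib_right)
  qed
  also have "\<dots> = xnorm g h + xnorm g k" unfolding xnorm_def by (rule nn_integral_add) measurable
  finally show ?thesis .
qed

lemma xnorm_suminf_le:
  fixes h :: "nat \<Rightarrow> 'a::euclidean_space \<Rightarrow> complex"
  assumes g: "g \<in> schwartz" and [measurable]: "\<And>j. h j \<in> borel_measurable borel"
    and b: "\<And>j t. cmod (h j t) \<le> b j" "summable b"
  shows "xnorm g (\<lambda>t. \<Sum>j. h j t) \<le> (\<Sum>j. xnorm g (h j))"
proof -
  have [measurable]: "g \<in> borel_measurable borel" by (rule schwartz_measurable[OF g])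
  have su: "summable (\<lambda>j. cmod (h j t))" for t
    by (rule summable_comparison_test'[OF b(2)]) (simp add: b)
  have "xnorm g (\<lambda>t. \<Sum>j. h j t) \<le> (\<integral>\<^sup>+y. (\<Sum>j. fnorm (\<lambda>t. h j t * cnj (g (t - y)))) \<partial>lborel)"
    unfolding xnorm_def
  proof (intro nn_integral_mono)
    fix y
    let ?v = "\<lambda>j t. h j t * cnj (g (t - y))"
    have ig: "integrable lborel (\<lambda>t. cnj (g (t - y)))"
      by (intro schwartz_integrable schwartz_cnj schwartz_translate g)
    have iv: "integrable lborel (?v j)" for j
      by (rule integrable_mult_bounded[OF ig _ b(1)]) simp
    have eq: "(\<Sum>j. h j t) * cnj (g (t - y)) = (\<Sum>j. ?v j t)" for t
      by (rule suminf_mult2[OF summable_norm_cancel[OF su]])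
    show "fnorm (\<lambda>t. (\<Sum>j. h j t) * cnj (g (t - y))) \<le> (\<Sum>j. fnorm (?v j))"
      unfolding eq
    proof (rule fnorm_suminf_le[OF iv])
      show "summable (\<lambda>j. cmod (?v j t))" for t
        unfolding norm_mult by (rule summable_mult2[OF su])
      show "summable (\<lambda>j. \<integral>t. cmod (?v j t) \<partial>lborel)"
      proof (rule summable_comparison_test')
        show "summable (\<lambda>j. b j * (\<integral>t. cmod (cnj (g (t - y))) \<partial>lborel))" by (rule summable_mult2[OF b(2)])
        fix j
        have "(\<integral>t. cmod (?v j t) \<partial>lborel) \<le> (\<integral>t. b j * cmod (cnj (g (t - y))) \<partial>lborel)"
          using ig by (intro integral_mono integrable_norm iv integrable_mult_right)
            (auto simp: norm_mult intro!: mult_right_mono b)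
        then show "norm (\<integral>t. cmod (?v j t) \<partial>lborel) \<le> b j * (\<integral>t. cmod (cnj (g (t - y))) \<partial>lborel)"
          by simp
      qed
    qed
  qed
  also have "\<dots> = (\<Sum>j. xnorm g (h j))" unfolding xnorm_def by (rule nn_integral_suminf) measurable
  finally show ?thesis .
qed

section \<open>The modulation space in terms of functions\<close>

lemma stft_integrand:
  "cnj (modulate w (translate x g) t) = cis (- (2 * pi) * (w \<bullet> t)) * cnj (g (t - x))"
proof -
  have "exp (2 * of_real pi * \<i> * of_real (w \<bullet> t)) = cis (2 * pi * (w \<bullet> t))"
    by (simp add: cis_conv_exp mult_ac)
  then show ?thesis by (simp add: modulate_def translate_def cis_cnj)
qed

lemma stft_eq_fourier:
  assumes g: "g \<in> schwartz" and u: "induces h u"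
  shows "stft g u x w = fourier (\<lambda>t. h t * cnj (g (t - x))) w"
proof -
  have "(\<lambda>t. cnj (modulate w (translate x g) t)) \<in> schwartz"
    unfolding stft_integrand by (intro schwartz_cis schwartz_cnj schwartz_translate g)
  then have "stft g u x w = (\<integral>t. h t * cnj (modulate w (translate x g) t) \<partial>lborel)"
    using u by (simp add: stft_def sesqui_pairing_def induces_def)
  then show ?thesis unfolding stft_integrand fourier_def by (simp add: mult_ac)
qed

text \<open>Distributions are eliminated here. In one direction boundedness follows from
  \<open>sup_le_ambient\<close>; in the other a bounded function induces a functional controlled by
  a Schwartz norm of order \<open>2 * DIM('a)\<close>, enough to integrate against
  \<open>decay\<close>.\<close>

theorem M11_fun_iff:
  fixes g :: "'a::euclidean_space \<Rightarrow> complex"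
  assumes g: "g \<in> schwartz" and nz: "g \<noteq> (\<lambda>_. 0)"
  shows "h \<in> M11_fun g \<longleftrightarrow> continuous_on UNIV h \<and> (\<exists>B. \<forall>t. cmod (h t) \<le> B) \<and> xnorm g h < \<infinity>"
proof
  assume "h \<in> M11_fun g"
  then obtain u where c: "continuous_on UNIV h" and u: "u \<in> M11 g" "induces h u"
    by (auto simp: M11_fun_def)
  have x: "xnorm g h < \<infinity>"
    using u(1) unfolding M11_def mem_Collect_eq xnorm_def stft_eq_fourier[OF g u(2)] by simp
  have p: "pairable h"
    using u(2) borel_measurable_continuous_onI[OF c] by (auto simp: pairable_def induces_def)
  obtain C where C: "\<And>h t. continuous_on UNIV h \<Longrightarrow> pairable h \<Longrightarrow> ennreal (cmod (h t)) \<le> ennreal C * ambient g h t"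
    using sup_le_ambient[OF g nz] by metis
  have fin: "ennreal C * xnorm g h < \<infinity>" using x by (simp add: ennreal_mult_less_top)
  have "cmod (h t) \<le> enn2real (ennreal C * xnorm g h)" for t
  proof -
    have "ennreal (cmod (h t)) \<le> ennreal C * xnorm g h"
      by (rule order_trans[OF C[OF c p]]) (intro mult_left_mono ambient_le_xnorm, simp)
    then show ?thesis using enn2real_mono[OF _ fin[unfolded infinity_ennreal_def], of "ennreal (cmod (h t))"] by simp
  qed
  then show "continuous_on UNIV h \<and> (\<exists>B. \<forall>t. cmod (h t) \<le> B) \<and> xnorm g h < \<infinity>"
    using c x by blast
next
  assume *: "continuous_on UNIV h \<and> (\<exists>B. \<forall>t. cmod (h t) \<le> B) \<and> xnorm g h < \<infinity>"
  then obtain B where c: "continuous_on UNIV h" and B: "\<And>t. cmod (h t) \<le> B" and x: "xnorm g h < \<infinity>" by blast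
  have [measurable]: "h \<in> borel_measurable borel" using c by (rule borel_measurable_continuous_onI)
  have p: "pairable h" by (rule pairable_bounded[OF _ B]) simp
  have i: "integrable lborel (\<lambda>t. h t * \<phi> t)" if "\<phi> \<in> schwartz" for \<phi>
    using p that by (simp add: pairable_def)
  \<comment> \<open>The restriction gives the value \<open>undefined\<close> off the Schwartz space,
    as membership in \<open>extensional\<close> demands.\<close>
  define u where "u = restrict (\<lambda>\<phi>. \<integral>t. h t * \<phi> t \<partial>lborel) schwartz"
  have ind: "induces h u" using i by (auto simp: induces_def u_def)
  have "tempered_distribution u"
    unfolding tempered_distribution_def
  proof (intro conjI ballI allI)
    show "u \<in> extensional schwartz" by (simp add: u_def)
    show "u (\<lambda>x. \<phi> x + \<psi> x) = u \<phi> + u \<psi>" if "\<phi> \<in> schwartz" "\<psi> \<in> schwartz" for \<phi> \<psi>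
      using that by (simp add: u_def schwartz_add distrib_left i)
    show "u (\<lambda>x. c * \<phi> x) = c * u \<phi>" if "\<phi> \<in> schwartz" for c \<phi>
      using that by (simp add: u_def schwartz_cmult mult.left_commute)
    have "cmod (u \<phi>) \<le> B * pi ^ DIM('a) * schwartz_norm (2 * DIM('a)) \<phi>" if \<phi>: "\<phi> \<in> schwartz" for \<phi>
    proof -
      let ?S = "schwartz_norm (2 * DIM('a)) \<phi>"
      have "0 \<le> B" using B[of 0] norm_ge_zero[of "h 0"] by linarith
      have "cmod (u \<phi>) \<le> (\<integral>t. cmod (h t * \<phi> t) \<partial>lborel)"
        using \<phi> by (simp add: u_def integral_norm_bound)
      also have "\<dots> \<le> (\<integral>t. B * (?S * decay (t::'a)) \<partial>lborel)"
      proof (rule integral_mono)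
        show "integrable lborel (\<lambda>t. cmod (h t * \<phi> t))" by (intro integrable_norm i \<phi>)
        show "integrable lborel (\<lambda>t::'a. B * (?S * decay t))" by (intro integrable_mult_right integrable_decay)
        show "cmod (h t * \<phi> t) \<le> B * (?S * decay t)" for t
          unfolding norm_mult using \<open>0 \<le> B\<close> by (intro mult_mono B schwartz_norm_bound[OF \<phi>]) auto
      qed
      also have "\<dots> = B * pi ^ DIM('a) * ?S" by (simp add: integral_decay)
      finally show ?thesis .
    qed
    then show "\<exists>C N. \<forall>\<phi>\<in>schwartz. cmod (u \<phi>) \<le> C * schwartz_norm N \<phi>" by blast
  qed
  then have "u \<in> M11 g"
    using x unfolding M11_def mem_Collect_eq xnorm_def stft_eq_fourier[OF g ind] by simp
  then show "h \<in> M11_fun g" using c ind by (auto simp: M11_fun_def)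
qed

section \<open>Real analytic functions operate\<close>

text \<open>The double series is enumerated by \<open>prod_decode\<close>, which puts the constant
  term at index 0. A single index suits both the series of multipliers and the removal of the
  constant term.\<close>

lemma real_analytic_expansion:
  assumes F: "real_analytic F"
  obtains r c p q where "0 < r" "p 0 = 0" "q 0 = 0" "\<And>i::nat. 0 < i \<Longrightarrow> 0 < p i + q i"
    "summable (\<lambda>i. cmod (c i) * r ^ (p i + q i))"
    "\<And>s t. \<bar>s\<bar> \<le> r \<Longrightarrow> \<bar>t\<bar> \<le> r \<Longrightarrow>
       (\<lambda>i. c i * of_real s ^ p i * of_real t ^ q i) sums F (s0 + s, t0 + t)"
proof -
  let ?S = "\<lambda>a s t. (\<lambda>(j, k). cmod (a j k * of_real (s - s0) ^ j * of_real (t - t0) ^ k)) summable_on (UNIV :: (nat \<times> nat) set)"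
  let ?H = "\<lambda>a s t. ((\<lambda>(j, k). a j k * of_real (s - s0) ^ j * of_real (t - t0) ^ k) has_sum F (s, t)) (UNIV :: (nat \<times> nat) set)"
  have "\<exists>a U. open U \<and> (s0, t0) \<in> U \<and> (\<forall>(s, t)\<in>U. ?S a s t \<and> ?H a s t)"
    using F unfolding real_analytic_def by (elim allE)
  then obtain a U where U: "open U" "(s0, t0) \<in> U" and *: "\<forall>(s, t)\<in>U. ?S a s t \<and> ?H a s t"
    by (elim exE conjE) (rule that)
  have sm: "?S a s t" and hs: "?H a s t" if "(s, t) \<in> U" for s t
    using bspec[OF * that] by simp_all
  obtain e where e: "0 < e" "ball (s0, t0) e \<subseteq> U" using U openE by blast
  \<comment> \<open>The distance from the centre to a point of the box is at most
    \<open>\<bar>s\<bar> + \<bar>t\<bar>\<close>, hence at most two thirds of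
    \<open>e\<close>.\<close>
  define r where "r = e / 3"
  have r: "0 < r" using e by (simp add: r_def)
  have box: "(s0 + s, t0 + t) \<in> U" if "\<bar>s\<bar> \<le> r" "\<bar>t\<bar> \<le> r" for s t
  proof -
    have "dist (s0, t0) (s0 + s, t0 + t) \<le> \<bar>s\<bar> + \<bar>t\<bar>"
      using sqrt_sum_squares_le_sum_abs[of s t] by (simp add: dist_Pair_Pair dist_real_def)
    also have "\<dots> < e" using that e(1) by (simp add: r_def)
    finally show ?thesis using e(2) by auto
  qed
  define P where "P i = fst (prod_decode i)" for i
  define Q where "Q i = snd (prod_decode i)" for i
  define c where "c i = a (P i) (Q i)" for i
  have bij: "bij_betw prod_decode UNIV UNIV" by (rule bij_prod_decode)
  show ?thesis
  proof (rule that[of r P Q c])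
    show "0 < r" by (rule r)
    have "prod_decode 0 = (0, 0)" by (metis prod_encode_inverse prod_encode_prod_decode_aux prod_decode_aux.simps prod_decode_def diff_zero le0)
    then show "P 0 = 0" "Q 0 = 0" by (simp_all add: P_def Q_def)
    show "0 < P i + Q i" if "0 < i" for i
    proof (rule ccontr)
      assume "\<not> ?thesis"
      then have "prod_decode i = (0, 0)" by (simp add: P_def Q_def prod_eq_iff)
      then have "prod_decode i = prod_decode 0" using \<open>prod_decode 0 = (0, 0)\<close> by simp
      then show False using that by (metis inj_prod_decode inj_eq less_irrefl)
    qed
    \<comment> \<open>Absolute convergence at the single corner \<open>(r, r)\<close> majorizes the
      series on the whole box.\<close>
    have "(\<lambda>(j, k). cmod (a j k * of_real r ^ j * of_real r ^ k)) summable_on UNIV"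
      using sm[OF box[of r r]] r by simp
    then have "(\<lambda>i. (\<lambda>(j, k). cmod (a j k * of_real r ^ j * of_real r ^ k)) (prod_decode i)) summable_on UNIV"
      by (subst summable_on_reindex_bij_betw[OF bij])
    then have "(\<lambda>i. cmod (c i) * r ^ (P i + Q i)) summable_on UNIV"
      using r by (simp add: c_def P_def Q_def case_prod_unfold norm_mult norm_power power_add mult.assoc)
    then show "summable (\<lambda>i. cmod (c i) * r ^ (P i + Q i))"
      using r by (subst (asm) summable_on_UNIV_nonneg_real_iff) auto
    show "(\<lambda>i. c i * of_real s ^ P i * of_real t ^ Q i) sums F (s0 + s, t0 + t)" if "\<bar>s\<bar> \<le> r" "\<bar>t\<bar> \<le> r" for s t
    proof -
      have "((\<lambda>(j, k). a j k * of_real s ^ j * of_real t ^ k) has_sum F (s0 + s, t0 + t)) UNIV"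
        using hs[OF box[OF that]] by simp
      then have "((\<lambda>i. (\<lambda>(j, k). a j k * of_real s ^ j * of_real t ^ k) (prod_decode i)) has_sum F (s0 + s, t0 + t)) UNIV"
        by (subst has_sum_reindex_bij_betw[OF bij])
      then show ?thesis
        by (intro has_sum_imp_sums) (simp add: c_def P_def Q_def case_prod_unfold)
    qed
  qed
qed

lemma real_analytic_continuous:
  assumes "real_analytic F"
  shows "continuous_on UNIV F"
  unfolding continuous_on_eq_continuous_at[OF open_UNIV]
proof (intro ballI)
  fix z :: "real \<times> real"
  obtain s0 t0 where z: "z = (s0, t0)" by (cases z)
  obtain r c p q where r: "0 < r" and sm: "summable (\<lambda>i::nat. cmod (c i) * r ^ (p i + q i))"
    and F: "\<And>s t. \<bar>s\<bar> \<le> r \<Longrightarrow> \<bar>t\<bar> \<le> r \<Longrightarrow> (\<lambda>i. c i * of_real s ^ p i * of_real t ^ q i) sums F (s0 + s, t0 + t)"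
    by (rule real_analytic_expansion[OF assms, of s0 t0]) (rule that)
  let ?B = "{s0 - r..s0 + r} \<times> {t0 - r..t0 + r}"
  let ?f = "\<lambda>i x. c i * of_real (fst x - s0) ^ p i * of_real (snd x - t0) ^ q i"
  have le: "norm (?f i x) \<le> cmod (c i) * r ^ (p i + q i)" if "x \<in> ?B" for i x
  proof -
    have "\<bar>fst x - s0\<bar> ^ p i * \<bar>snd x - t0\<bar> ^ q i \<le> r ^ p i * r ^ q i"
      using that r by (intro mult_mono power_mono) (auto simp: mem_Times_iff abs_le_iff)
    then have "cmod (c i) * (\<bar>fst x - s0\<bar> ^ p i * \<bar>snd x - t0\<bar> ^ q i) \<le> cmod (c i) * (r ^ p i * r ^ q i)"
      by (rule mult_left_mono) simp
    moreover have "norm (?f i x) = cmod (c i) * (\<bar>fst x - s0\<bar> ^ p i * \<bar>snd x - t0\<bar> ^ q i)"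
      unfolding norm_mult norm_power norm_of_real by (simp add: mult.assoc)
    ultimately show ?thesis by (simp add: power_add)
  qed
  have "uniform_limit ?B (\<lambda>n x. \<Sum>i<n. ?f i x) (\<lambda>x. \<Sum>i. ?f i x) sequentially"
    by (rule Weierstrass_m_test[OF le sm])
  then have "continuous_on ?B (\<lambda>x. \<Sum>i. ?f i x)"
    by (rule uniform_limit_theorem[rotated]) (auto intro!: always_eventually continuous_intros)
  moreover have "(\<Sum>i. ?f i x) = F x" if "x \<in> ?B" for x
    using F[of "fst x - s0" "snd x - t0"] that
    by (auto simp: mem_Times_iff abs_le_iff intro!: sums_unique[symmetric])
  ultimately have "continuous_on ?B F" by (simp cong: continuous_on_cong)
  moreover have "z \<in> interior ?B"
    unfolding z interior_Times using r by simp
  ultimately show "isCont F z" by (rule continuous_on_interior)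
qed

text \<open>Real and imaginary parts inherit the bound \<open>r\<close> and bounds are
  submultiplicative, so the majorant is the series of moduli with \<open>r\<close> in place of both
  variables.\<close>

lemma multiplier_power_series:
  assumes u: "multiplier u r" and sm: "summable (\<lambda>i::nat. cmod (c i) * r ^ (p i + q i))"
  shows "multiplier (\<lambda>t. \<Sum>i. c i * of_real (Re (u t)) ^ p i * of_real (Im (u t)) ^ q i) (\<Sum>i. cmod (c i) * r ^ (p i + q i))"
proof (rule multiplier_suminf[OF _ sm])
  fix i
  have "multiplier (\<lambda>t. c i * (of_real (Re (u t)) ^ p i * of_real (Im (u t)) ^ q i)) (cmod (c i) * (r ^ p i * r ^ q i))"
    by (intro multiplier_cmult multiplier_mult multiplier_power multiplier_Re multiplier_Im u)
  then show "multiplier (\<lambda>t. c i * of_real (Re (u t)) ^ p i * of_real (Im (u t)) ^ q i) (cmod (c i) * r ^ (p i + q i))"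
    by (simp add: power_add mult.assoc)
qed

section \<open>Small oscillation gives a small multiplier\<close>

text \<open>Modulation translates the transform, so this is continuity of translation in
  \<open>L1\<close>. Finitely many terms are dropped in order that \<open>decay_shift\<close>
  provide the majorant.\<close>

lemma fnorm_modulation_difference:
  fixes \<beta> :: "'a::euclidean_space \<Rightarrow> complex"
  assumes \<beta>: "\<beta> \<in> schwartz" and v: "v \<longlonglongrightarrow> 0"
  shows "(\<lambda>k::nat. fnorm (\<lambda>s. (cis (2 * pi * (v k \<bullet> s)) - 1) * \<beta> s)) \<longlonglongrightarrow> 0"
proof -
  have [measurable]: "\<beta> \<in> borel_measurable borel" by (rule schwartz_measurable[OF \<beta>])
  have i: "integrable lborel \<beta>" by (rule schwartz_integrable[OF \<beta>])
  have F: "fourier (\<lambda>s. (cis (2 * pi * (x \<bullet> s)) - 1) * \<beta> s) w = fourier \<beta> (w - x) - fourier \<beta> w" for x w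
  proof -
    have "integrable lborel (\<lambda>s. cis (2 * pi * (x \<bullet> s)) * \<beta> s)"
      by (rule integrable_mult_bounded[OF i, where B=1]) auto
    then have "fourier (\<lambda>s. cis (2 * pi * (x \<bullet> s)) * \<beta> s + (-1) * \<beta> s) w = fourier \<beta> (w - x) + (-1) * fourier \<beta> w"
      using i by (subst fourier_add) (auto simp only: fourier_cis fourier_cmult intro!: integrable_mult_right)
    then show ?thesis by (simp add: left_diff_distrib)
  qed
  obtain C where C: "0 \<le> C" "\<And>w. cmod (fourier \<beta> w) \<le> C * decay w" using schwartz_fourier_decay[OF \<beta>] by metis
  obtain N where N: "\<And>k. k \<ge> N \<Longrightarrow> norm (v k) \<le> 1"
    using LIMSEQ_D[OF v, of 1] by (auto intro: less_imp_le)
  have cF: "isCont (fourier \<beta>) w" for w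
  proof -
    have "continuous_on UNIV (fourier \<beta>)"
      unfolding fourier_def
    proof (rule continuous_on_subset[OF _ subset_UNIV], unfold continuous_on_sequentially, intro allI ballI impI, elim conjE)
      fix x :: "nat \<Rightarrow> 'a" and a
      assume x: "x \<longlonglongrightarrow> a"
      show "((\<lambda>w. \<integral>t. \<beta> t * cis (- (2 * pi * (w \<bullet> t))) \<partial>lborel) \<circ> x) \<longlonglongrightarrow> (\<integral>t. \<beta> t * cis (- (2 * pi * (a \<bullet> t))) \<partial>lborel)"
        unfolding o_def
      proof (rule integral_dominated_convergence[where w="\<lambda>t. cmod (\<beta> t)"])
        show "AE t in lborel. (\<lambda>k. \<beta> t * cis (- (2 * pi * (x k \<bullet> t)))) \<longlonglongrightarrow> \<beta> t * cis (- (2 * pi * (a \<bullet> t)))"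
          unfolding cis_conv_exp by (intro AE_I2 tendsto_intros x)
      qed (use i in \<open>auto simp: norm_mult\<close>)
    qed
    then show ?thesis by (simp add: continuous_on_eq_continuous_at)
  qed
  have "(\<lambda>k. fnorm (\<lambda>s. (cis (2 * pi * (v (k + N) \<bullet> s)) - 1) * \<beta> s)) \<longlonglongrightarrow> (\<integral>\<^sup>+w. 0 \<partial>(lborel::'a measure))"
    unfolding F
  proof (rule nn_integral_dominated_convergence[where w="\<lambda>w. ennreal (C * (3 ^ DIM('a) + 1) * decay w)"])
    show "AE w in lborel. ennreal (cmod (fourier \<beta> (w - v (k + N)) - fourier \<beta> w)) \<le> ennreal (C * (3 ^ DIM('a) + 1) * decay w)" for k
    proof (intro AE_I2 ennreal_leI)
      fix w
      have "cmod (fourier \<beta> (w - v (k + N)) - fourier \<beta> w) \<le> C * decay (w - v (k + N)) + C * decay w"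
        using C(2)[of "w - v (k + N)"] C(2)[of w] norm_triangle_ineq4[of "fourier \<beta> (w - v (k + N))" "fourier \<beta> w"] by linarith
      also have "\<dots> \<le> C * (3 ^ DIM('a) * decay w) + C * decay w"
        using C(1) by (intro add_right_mono mult_left_mono decay_shift N) auto
      finally show "cmod (fourier \<beta> (w - v (k + N)) - fourier \<beta> w) \<le> C * (3 ^ DIM('a) + 1) * decay w"
        by (simp add: algebra_simps)
    qed
    show "(\<integral>\<^sup>+w. ennreal (C * (3 ^ DIM('a) + 1) * decay (w::'a)) \<partial>lborel) < \<infinity>"
      using C(1) by (simp add: ennreal_mult nn_integral_cmult nn_integral_decay ennreal_mult_less_top)
    show "AE w in lborel. (\<lambda>k. ennreal (cmod (fourier \<beta> (w - v (k + N)) - fourier \<beta> w))) \<longlonglongrightarrow> 0"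
    proof (rule AE_I2)
      fix w
      have "(\<lambda>k. w - v (k + N)) \<longlonglongrightarrow> w - 0"
        by (intro tendsto_intros LIMSEQ_ignore_initial_segment v)
      then have "(\<lambda>k. fourier \<beta> (w - v (k + N))) \<longlonglongrightarrow> fourier \<beta> w"
        by (intro isCont_tendsto_compose[OF cF]) simp
      then have "(\<lambda>k. cmod (fourier \<beta> (w - v (k + N)) - fourier \<beta> w)) \<longlonglongrightarrow> 0"
        by (simp add: LIM_zero tendsto_norm_zero)
      then show "(\<lambda>k. ennreal (cmod (fourier \<beta> (w - v (k + N)) - fourier \<beta> w))) \<longlonglongrightarrow> 0"
        using tendsto_ennrealI by fastforce
    qed
  qed measurable
  then show ?thesis by (simp add: LIMSEQ_offset[of _ N])
qed

text \<open>By invariance under translation and dilation, frequency \<open>w\<close> seen at scale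
  \<open>\<rho>\<close> is frequency \<open>\<rho> *\<^sub>R w\<close> seen at scale 1; the value of
  the character at \<open>t0\<close> comes out as a unimodular constant.\<close>

lemma fnorm_local_modulation:
  fixes w t0 :: "'a::euclidean_space"
  assumes \<rho>: "0 < \<rho>"
  shows "fnorm (\<lambda>t. (cis (2 * pi * (w \<bullet> t)) - cis (2 * pi * (w \<bullet> t0))) * complex_of_real (bump t0 \<rho> t))
     = fnorm (\<lambda>s. (cis (2 * pi * ((\<rho> *\<^sub>R w) \<bullet> s)) - 1) * complex_of_real (bump 0 1 s))"
proof -
  let ?k = "\<lambda>s. (cis (2 * pi * ((\<rho> *\<^sub>R w) \<bullet> s)) - 1) * complex_of_real (bump (0::'a) 1 s)"
  have [measurable]: "bump (0::'a) 1 \<in> borel_measurable borel"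
    by (intro borel_measurable_continuous_onI continuous_on_bump) simp
  have eq: "(cis (2 * pi * (w \<bullet> t)) - cis (2 * pi * (w \<bullet> t0))) * complex_of_real (bump t0 \<rho> t)
     = cis (2 * pi * (w \<bullet> t0)) * ?k ((t - t0) /\<^sub>R \<rho>)" for t
  proof -
    have 1: "(\<rho> *\<^sub>R w) \<bullet> ((t - t0) /\<^sub>R \<rho>) = w \<bullet> (t - t0)" using \<rho> by simp
    have 2: "cis (2 * pi * (w \<bullet> t0)) * cis (2 * pi * (w \<bullet> (t - t0))) = cis (2 * pi * (w \<bullet> t))"
      unfolding cis_mult by (simp add: algebra_simps)
    have 3: "bump t0 \<rho> t = bump 0 1 ((t - t0) /\<^sub>R \<rho>)"
      using bump_rescale[of t0 \<rho> 1 t] by simp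
    have "(A * B - A) * D = A * ((B - 1) * D)" for A B D :: complex by (simp add: algebra_simps)
    then show ?thesis unfolding 1 3 2[symmetric] .
  qed
  have "fnorm (\<lambda>t. cis (2 * pi * (w \<bullet> t0)) * ?k ((t - t0) /\<^sub>R \<rho>)) = fnorm (\<lambda>t. ?k ((t - t0) /\<^sub>R \<rho>))"
    by (subst fnorm_cmult) auto
  also have "\<dots> = fnorm (\<lambda>t. ?k (t /\<^sub>R \<rho>))"
    by (rule fnorm_translate[of "\<lambda>t. ?k (t /\<^sub>R \<rho>)"]) measurable
  also have "\<dots> = fnorm ?k" by (rule fnorm_scale) (measurable, rule \<rho>)
  finally show ?thesis unfolding eq .
qed

text \<open>Near \<open>t0\<close> the function is a superposition of characters with integrable
  density \<open>H\<close>. For each character the norm \<open>K\<close> of its cut-off oscillation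
  tends to 0 with the radius and is bounded by \<open>2 * fnorm\<close> of the unit bump; dominated
  convergence in \<open>w\<close> finishes.\<close>

lemma local_oscillation_multiplier:
  fixes f :: "'a::euclidean_space \<Rightarrow> complex"
  assumes f: "continuous_on UNIV f" "pairable f"
    and fin: "fnorm (\<lambda>s. f s * complex_of_real (bump t0 1 s)) < \<infinity>" and e: "0 < e"
  obtains \<rho> where "0 < \<rho>" "multiplier (\<lambda>t. (f t - f t0) * complex_of_real (bump t0 \<rho> t)) e"
proof -
  define u where "u = (\<lambda>s. f s * complex_of_real (bump t0 1 s))"
  define H where "H = fourier u"
  have uc: "continuous_on UNIV u" unfolding u_def by (rule continuous_mult_bump[OF f(1)]) simp
  obtain B where B: "\<And>s. cmod (u s) \<le> B" using bounded_mult_bump[OF f(1), of 1 t0] unfolding u_def by (metis zero_less_one)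
  have ui: "integrable lborel u" unfolding u_def by (rule pairable_bump_integrable[OF f(2)]) simp
  have [measurable]: "u \<in> borel_measurable borel" using ui by simp
  have [measurable]: "H \<in> borel_measurable borel" unfolding H_def by measurable
  have Hfin: "(\<integral>\<^sup>+w. ennreal (cmod (H w)) \<partial>lborel) < \<infinity>" using fin by (simp add: H_def u_def)
  have Hi: "integrable lborel H" by (rule integrableI_bounded) (use Hfin in auto)
  have uH: "u t = (\<integral>w. H w * cis (2 * pi * (w \<bullet> t)) \<partial>lborel)" for t
    unfolding H_def by (rule fourier_inversion[OF uc B ui Hi[unfolded H_def]])
  \<comment> \<open>Radii of at most 1/2 keep the support of the narrow bump inside the unit ball,
    where the auxiliary cut-off is 1 and \<open>u\<close> equals \<open>f\<close>.\<close>
  define \<rho> where "\<rho> k = 1 / (real k + 2)" for k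
  have \<rho>: "0 < \<rho> k" "\<rho> k \<le> 1 / 2" for k by (auto simp: \<rho>_def field_simps)
  have \<rho>0: "\<rho> \<longlonglongrightarrow> 0" unfolding \<rho>_def by real_asymp
  let ?b = "\<lambda>k t. complex_of_real (bump t0 (\<rho> k) t)"
  let ?d = "\<lambda>w t. cis (2 * pi * (w \<bullet> t)) - cis (2 * pi * (w \<bullet> t0))"
  have [measurable]: "bump t0 (\<rho> k) \<in> borel_measurable borel" for k
    by (intro borel_measurable_continuous_onI continuous_on_bump \<rho>)
  define K where "K k w = fnorm (\<lambda>t. ?d w t * ?b k t)" for k w
  have [measurable]: "K k \<in> borel_measurable borel" for k unfolding K_def by measurable
  define v where "v k t = (u t - u t0) * ?b k t" for k t
  have bi: "integrable lborel (?b k)" for k by (intro schwartz_integrable schwartz_bump \<rho>)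
  have vF: "fourier (v k) \<xi> = (\<integral>w. H w * fourier (\<lambda>t. ?d w t * ?b k t) \<xi> \<partial>lborel)" for k \<xi>
  proof -
    let ?c = "\<lambda>t. cis (- (2 * pi * (\<xi> \<bullet> t)))"
    have "v k t * ?c t = (\<integral>w. H w * (?d w t * ?b k t * ?c t) \<partial>lborel)" for t
    proof -
      have "u t - u t0 = (\<integral>w. H w * ?d w t \<partial>lborel)"
        unfolding uH right_diff_distrib
        by (intro Bochner_Integration.integral_diff[symmetric] integrable_mult_cis Hi) measurable
      then have "v k t * ?c t = (\<integral>w. H w * ?d w t \<partial>lborel) * (?b k t * ?c t)"
        by (simp add: v_def mult.assoc)
      also have "\<dots> = (\<integral>w. H w * ?d w t * (?b k t * ?c t) \<partial>lborel)" by simp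
      finally show ?thesis by (simp only: mult.assoc)
    qed
    then have "fourier (v k) \<xi> = (\<integral>t. \<integral>w. H w * (?d w t * ?b k t * ?c t) \<partial>lborel \<partial>lborel)"
      by (simp add: fourier_def)
    also have "\<dots> = (\<integral>w. \<integral>t. H w * (?d w t * ?b k t * ?c t) \<partial>lborel \<partial>lborel)"
    proof (rule fubini_swap)
      have "(\<integral>\<^sup>+t. \<integral>\<^sup>+w. ennreal (cmod (H w * (?d w t * ?b k t * ?c t))) \<partial>lborel \<partial>lborel)
         \<le> (\<integral>\<^sup>+t. \<integral>\<^sup>+w. ennreal (cmod (H w)) * ennreal (2 * cmod (?b k t)) \<partial>lborel \<partial>lborel)"
      proof (intro nn_integral_mono)
        fix t w
        have "cmod (?d w t) \<le> 2" using norm_triangle_ineq4[of "cis (2 * pi * (w \<bullet> t))" "cis (2 * pi * (w \<bullet> t0))"] by simp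
        then have "cmod (H w) * (cmod (?d w t) * cmod (?b k t)) \<le> cmod (H w) * (2 * cmod (?b k t))"
          by (intro mult_left_mono mult_right_mono) auto
        then show "ennreal (cmod (H w * (?d w t * ?b k t * ?c t))) \<le> ennreal (cmod (H w)) * ennreal (2 * cmod (?b k t))"
          by (subst ennreal_mult[symmetric]) (auto simp: norm_mult intro!: ennreal_leI)
      qed
      also have "\<dots> = (\<integral>\<^sup>+w. ennreal (cmod (H w)) \<partial>lborel) * (\<integral>\<^sup>+t. ennreal (2 * cmod (?b k t)) \<partial>lborel)"
        by (simp add: nn_integral_multc nn_integral_cmult)
      also have "\<dots> < \<infinity>"
        using Hfin bi[of k] unfolding integrable_iff_bounded
        by (simp add: ennreal_mult_less_top ennreal_mult nn_integral_cmult del: norm_of_real)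
      finally show "(\<integral>\<^sup>+t. \<integral>\<^sup>+w. ennreal (cmod (H w * (?d w t * ?b k t * ?c t))) \<partial>lborel \<partial>lborel) < \<infinity>" .
    qed measurable
    also have "\<dots> = (\<integral>w. H w * fourier (\<lambda>t. ?d w t * ?b k t) \<xi> \<partial>lborel)"
      by (simp add: fourier_def)
    finally show ?thesis .
  qed
  have le: "fnorm (v k) \<le> (\<integral>\<^sup>+w. ennreal (cmod (H w)) * K k w \<partial>lborel)" for k
  proof -
    have "fnorm (v k) \<le> (\<integral>\<^sup>+\<xi>. \<integral>\<^sup>+w. ennreal (cmod (H w)) * ennreal (cmod (fourier (\<lambda>t. ?d w t * ?b k t) \<xi>)) \<partial>lborel \<partial>lborel)"
    proof (intro nn_integral_mono)
      fix \<xi>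
      show "ennreal (cmod (fourier (v k) \<xi>)) \<le> (\<integral>\<^sup>+w. ennreal (cmod (H w)) * ennreal (cmod (fourier (\<lambda>t. ?d w t * ?b k t) \<xi>)) \<partial>lborel)"
      proof (cases "integrable lborel (\<lambda>w. H w * fourier (\<lambda>t. ?d w t * ?b k t) \<xi>)")
        case True
        show ?thesis unfolding vF using integral_norm_bound_ennreal[OF True] by (simp add: norm_mult ennreal_mult)
      next
        case False then show ?thesis unfolding vF by (simp add: not_integrable_integral_eq)
      qed
    qed
    also have "\<dots> = (\<integral>\<^sup>+w. \<integral>\<^sup>+\<xi>. ennreal (cmod (H w)) * ennreal (cmod (fourier (\<lambda>t. ?d w t * ?b k t) \<xi>)) \<partial>lborel \<partial>lborel)"
      by (rule nn_fubini_swap) measurable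
    also have "\<dots> = (\<integral>\<^sup>+w. ennreal (cmod (H w)) * K k w \<partial>lborel)"
      unfolding K_def by (intro nn_integral_cong nn_integral_cmult) measurable
    finally show ?thesis .
  qed
  let ?\<beta> = "\<lambda>s::'a. complex_of_real (bump 0 1 s)"
  have \<beta>: "?\<beta> \<in> schwartz" by (rule schwartz_bump) simp
  have KL: "K k w = fnorm (\<lambda>s. (cis (2 * pi * ((\<rho> k *\<^sub>R w) \<bullet> s)) - 1) * ?\<beta> s)" for k w
    unfolding K_def by (rule fnorm_local_modulation[OF \<rho>(1)])
  have \<beta>fin: "fnorm ?\<beta> < \<infinity>"
    using schwartz_fourier_decay[OF \<beta>] fnorm_decay_bound by (metis ennreal_less_top infinity_ennreal_def le_less_trans)
  have Kb: "K k w \<le> 2 * fnorm ?\<beta>" for k w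
  proof -
    have "multiplier (\<lambda>s. cis (2 * pi * ((\<rho> k *\<^sub>R w) \<bullet> s)) + (- 1)) (1 + cmod (- 1))"
      by (intro multiplier_add multiplier_cis multiplier_const)
    from multiplierD(3)[OF this schwartz_integrable[OF \<beta>]] show ?thesis by (simp add: KL)
  qed
  have "(\<lambda>k. \<integral>\<^sup>+w. ennreal (cmod (H w)) * K k w \<partial>lborel) \<longlonglongrightarrow> (\<integral>\<^sup>+w. 0 \<partial>(lborel::'a measure))"
  proof (rule nn_integral_dominated_convergence[where w="\<lambda>w. ennreal (cmod (H w)) * (2 * fnorm ?\<beta>)"])
    show "AE w in lborel. ennreal (cmod (H w)) * K k w \<le> ennreal (cmod (H w)) * (2 * fnorm ?\<beta>)" for k
      by (intro AE_I2 mult_left_mono Kb) simp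
    show "(\<integral>\<^sup>+w. ennreal (cmod (H w)) * (2 * fnorm ?\<beta>) \<partial>lborel) < \<infinity>"
      using Hfin \<beta>fin by (simp add: nn_integral_multc ennreal_mult_less_top)
    show "AE w in lborel. (\<lambda>k. ennreal (cmod (H w)) * K k w) \<longlonglongrightarrow> 0"
    proof (rule AE_I2)
      fix w :: 'a
      have "(\<lambda>k. \<rho> k *\<^sub>R w) \<longlonglongrightarrow> 0 *\<^sub>R w" by (rule tendsto_scaleR[OF \<rho>0 tendsto_const])
      then have "(\<lambda>k. K k w) \<longlonglongrightarrow> 0" unfolding KL by (intro fnorm_modulation_difference \<beta>) simp
      then have "(\<lambda>k. ennreal (cmod (H w)) * K k w) \<longlonglongrightarrow> ennreal (cmod (H w)) * 0"
        by (intro tendsto_mult_ennreal tendsto_const) auto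
      then show "(\<lambda>k. ennreal (cmod (H w)) * K k w) \<longlonglongrightarrow> 0" by simp
    qed
  qed measurable
  then have "(\<lambda>k. \<integral>\<^sup>+w. ennreal (cmod (H w)) * K k w \<partial>lborel) \<longlonglongrightarrow> 0" by simp
  from order_tendstoD(2)[OF this, of "ennreal e"] e
  obtain k where "(\<integral>\<^sup>+w. ennreal (cmod (H w)) * K k w \<partial>lborel) < ennreal e"
    by (auto simp: eventually_sequentially)
  with le[of k] have small: "fnorm (v k) \<le> ennreal e" by simp
  have uf: "u t0 = f t0" by (simp add: u_def bump_eq_1)
  have veq: "v k = (\<lambda>t. (f t - f t0) * ?b k t)"
  proof
    fix t
    show "v k t = (f t - f t0) * ?b k t"
    proof (cases "norm (t - t0) \<le> 1")
      case True then show ?thesis by (simp add: v_def uf u_def bump_eq_1)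
    next
      case False
      then have "bump t0 (\<rho> k) t = 0" using \<rho>[of k] by (intro bump_eq_0) linarith+
      then show ?thesis by (simp add: v_def)
    qed
  qed
  have cv: "continuous_on UNIV (\<lambda>t. u t - u t0)" by (intro continuous_intros uc)
  obtain A where A: "\<And>s. cmod (v k s) \<le> A" using bounded_mult_bump[OF cv \<rho>(1)[of k], of t0] unfolding v_def by metis
  have vi: "integrable lborel (v k)"
    unfolding v_def left_diff_distrib
    by (intro Bochner_Integration.integrable_diff integrable_mult_right bi integrable_mult_bounded[OF bi, where B=B]) (use B in auto)
  have "multiplier (v k) e"
  proof (rule multiplier_fnorm[OF _ A vi small])
    show "continuous_on UNIV (v k)"
      using continuous_mult_bump[OF cv \<rho>(1)[of k], of t0] by (simp add: v_def[abs_def])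
  qed (use e in auto)
  then show ?thesis using that[OF \<rho>(1)[of k]] veq by simp
qed

lemma multiplier_fnorm_mono:
  "multiplier m S \<Longrightarrow> integrable lborel \<gamma> \<Longrightarrow> (\<And>t. h t * \<gamma> t = m t * \<gamma> t) \<Longrightarrow>
     fnorm (\<lambda>t. h t * \<gamma> t) \<le> ennreal S * fnorm \<gamma>"
  using multiplierD(3)[of m S \<gamma>] by (simp only:)

section \<open>Composition with a convergent power series\<close>

text \<open>Where \<open>\<gamma>\<close> lives the bump is 1, so the series centred at
  \<open>f t0\<close> has argument exactly \<open>f t - f t0\<close>; elsewhere both sides are 0.
  The oscillation is first made small enough to enter the domain of convergence.\<close>

lemma local_composition_bound:
  fixes f :: "'a::euclidean_space \<Rightarrow> complex"
  assumes F: "real_analytic F" and f: "continuous_on UNIV f" "pairable f"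
    and fin: "fnorm (\<lambda>s. f s * complex_of_real (bump t0 1 s)) < \<infinity>"
  obtains \<rho> C where "0 < \<rho>" "0 \<le> C"
    "\<And>\<gamma>. integrable lborel \<gamma> \<Longrightarrow> (\<And>t. \<rho> < norm (t - t0) \<Longrightarrow> \<gamma> t = 0) \<Longrightarrow>
       fnorm (\<lambda>t. F (Re (f t), Im (f t)) * \<gamma> t) \<le> ennreal C * fnorm \<gamma>"
proof -
  obtain r c p q where r: "0 < r" and sm: "summable (\<lambda>i::nat. cmod (c i) * r ^ (p i + q i))"
    and E: "\<And>s t. \<bar>s\<bar> \<le> r \<Longrightarrow> \<bar>t\<bar> \<le> r \<Longrightarrow>
      (\<lambda>i. c i * of_real s ^ p i * of_real t ^ q i) sums F (Re (f t0) + s, Im (f t0) + t)"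
    by (rule real_analytic_expansion[OF F, of "Re (f t0)" "Im (f t0)"]) (rule that)
  obtain \<rho> where \<rho>: "0 < \<rho>" and m: "multiplier (\<lambda>t. (f t - f t0) * complex_of_real (bump t0 \<rho> t)) r"
    by (rule local_oscillation_multiplier[OF f fin r]) (rule that)
  let ?u = "\<lambda>t. (f t - f t0) * complex_of_real (bump t0 \<rho> t)"
  let ?m = "\<lambda>t. \<Sum>i. c i * of_real (Re (?u t)) ^ p i * of_real (Im (?u t)) ^ q i"
  let ?S = "\<Sum>i. cmod (c i) * r ^ (p i + q i)"
  have mm: "multiplier ?m ?S" by (rule multiplier_power_series[OF m sm])
  show ?thesis
  proof (rule that[OF \<rho> multiplierD(5)[OF mm]])
    fix \<gamma> :: "'a \<Rightarrow> complex" assume \<gamma>: "integrable lborel \<gamma>" "\<And>t. \<rho> < norm (t - t0) \<Longrightarrow> \<gamma> t = 0"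
    show "fnorm (\<lambda>t. F (Re (f t), Im (f t)) * \<gamma> t) \<le> ennreal ?S * fnorm \<gamma>"
    proof (rule multiplier_fnorm_mono[OF mm \<gamma>(1)])
      fix t
      show "F (Re (f t), Im (f t)) * \<gamma> t = ?m t * \<gamma> t"
      proof (cases "\<rho> < norm (t - t0)")
        case False
        then have b: "bump t0 \<rho> t = 1" using \<rho> by (intro bump_eq_1) auto
        have "\<bar>Re (?u t)\<bar> \<le> r" "\<bar>Im (?u t)\<bar> \<le> r"
          using multiplierD(2)[OF m, of t] abs_Re_le_cmod[of "?u t"] abs_Im_le_cmod[of "?u t"] by linarith+
        from E[OF this] have "?m t = F (Re (f t0) + Re (?u t), Im (f t0) + Im (?u t))" by (rule sums_unique[symmetric])
        then show ?thesis by (simp add: b)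
      qed (simp add: \<gamma>(2))
    qed
  qed
qed

text \<open>Without a constant term, \<open>s ^ (p i + q i)\<close> is at most
  \<open>r ^ (p i + q i) * (s / r)\<close>, so the multiplier bound is linear in the local norm
  \<open>s\<close>. A bound that is merely constant would not be integrable over all window
  positions.\<close>

lemma composition_bound_at_infinity:
  fixes f :: "'a::euclidean_space \<Rightarrow> complex"
  assumes F: "real_analytic F" "F (0, 0) = 0" and f: "continuous_on UNIV f" "pairable f"
  obtains r C where "0 < r" "0 \<le> C"
    "\<And>\<gamma> y s. integrable lborel \<gamma> \<Longrightarrow> (\<forall>t. 1 < norm (t - y) \<longrightarrow> \<gamma> t = 0) \<Longrightarrow> 0 \<le> s \<Longrightarrow> s \<le> r \<Longrightarrow>
       fnorm (\<lambda>t. f t * complex_of_real (bump y 1 t)) \<le> ennreal s \<Longrightarrow>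
       fnorm (\<lambda>t. F (Re (f t), Im (f t)) * \<gamma> t) \<le> ennreal (C * s) * fnorm \<gamma>"
proof -
  obtain r c p q where r: "0 < r" and pq0: "p 0 = 0" "q 0 = 0" "\<And>i::nat. 0 < i \<Longrightarrow> 0 < p i + q i"
    and sm: "summable (\<lambda>i::nat. cmod (c i) * r ^ (p i + q i))"
    and E: "\<And>s t. \<bar>s\<bar> \<le> r \<Longrightarrow> \<bar>t\<bar> \<le> r \<Longrightarrow> (\<lambda>i. c i * of_real s ^ p i * of_real t ^ q i) sums F (0 + s, 0 + t)"
    by (rule real_analytic_expansion[OF F(1), of 0 0]) (rule that)
  have c0: "c 0 = 0"
  proof -
    have "(\<lambda>i. c i * of_real 0 ^ p i * of_real 0 ^ q i) sums 0" using E[of 0 0] r F(2) by simp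
    \<comment> \<open>At the origin only index 0 survives, through \<open>0 ^ 0 = 1\<close>; all
      others have a positive exponent.\<close>
    moreover have "(\<lambda>i. c i * of_real 0 ^ p i * of_real 0 ^ q i) = (\<lambda>i. if i = 0 then c 0 else 0)"
    proof
      fix i show "c i * of_real 0 ^ p i * of_real 0 ^ q i = (if i = 0 then c 0 else 0)"
        using pq0(1,2) pq0(3)[of i] by (cases "p i = 0"; cases "q i = 0"; cases "i = 0") auto
    qed
    ultimately show ?thesis using sums_single[of 0 "\<lambda>_. c 0"] sums_unique2 by fastforce
  qed
  let ?S = "\<Sum>i. cmod (c i) * r ^ (p i + q i)"
  have S: "0 \<le> ?S / r" using r by (intro divide_nonneg_nonneg suminf_nonneg sm) auto
  show ?thesis
  proof (rule that[OF r S])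
    fix \<gamma> :: "'a \<Rightarrow> complex" and y s
    assume \<gamma>: "integrable lborel \<gamma>" "\<forall>t. 1 < norm (t - y) \<longrightarrow> \<gamma> t = 0" and s: "0 \<le> s" "s \<le> r"
      and fn: "fnorm (\<lambda>t. f t * complex_of_real (bump y 1 t)) \<le> ennreal s"
    let ?u = "\<lambda>t. f t * complex_of_real (bump y 1 t)"
    let ?m = "\<lambda>t. \<Sum>i. c i * of_real (Re (?u t)) ^ p i * of_real (Im (?u t)) ^ q i"
    let ?T = "\<Sum>i. cmod (c i) * s ^ (p i + q i)"
    have m: "multiplier ?u s" by (rule multiplier_local[OF f _ fn s(1)]) simp
    have le: "cmod (c i) * s ^ (p i + q i) \<le> cmod (c i) * r ^ (p i + q i) * (s / r)" for i
    proof (cases "i = 0")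
      case False
      then obtain k where k: "p i + q i = Suc k" using pq0(3)[of i] by (cases "p i + q i") auto
      have "s ^ Suc k \<le> r ^ Suc k * (s / r)"
        using s r power_mono[of s r k] by (simp add: mult_left_mono mult.commute)
      then have "cmod (c i) * s ^ Suc k \<le> cmod (c i) * (r ^ Suc k * (s / r))" by (intro mult_left_mono) auto
      then show ?thesis unfolding k mult.assoc .
    qed (simp add: c0)
    have sms: "summable (\<lambda>i. cmod (c i) * s ^ (p i + q i))"
      by (rule summable_comparison_test'[OF summable_mult2[OF sm, of "s / r"]]) (use le s in auto)
    have "?T \<le> (\<Sum>i. cmod (c i) * r ^ (p i + q i) * (s / r))"
      by (intro suminf_le le sms summable_mult2 sm)
    also have "\<dots> = ?S / r * s" using suminf_mult2[OF sm, of "s / r"] by simp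
    finally have "multiplier ?m (?S / r * s)"
      by (rule multiplier_mono[OF multiplier_power_series[OF m sms]])
    then show "fnorm (\<lambda>t. F (Re (f t), Im (f t)) * \<gamma> t) \<le> ennreal (?S / r * s) * fnorm \<gamma>"
    proof (rule multiplier_fnorm_mono[OF _ \<gamma>(1)])
      fix t
      show "F (Re (f t), Im (f t)) * \<gamma> t = ?m t * \<gamma> t"
      proof (cases "1 < norm (t - y)")
        case False
        then have b: "bump y 1 t = 1" by (intro bump_eq_1) auto
        have "\<bar>Re (?u t)\<bar> \<le> r" "\<bar>Im (?u t)\<bar> \<le> r"
          using multiplierD(2)[OF m, of t] abs_Re_le_cmod[of "?u t"] abs_Im_le_cmod[of "?u t"] s by linarith+
        from E[OF this] have "?m t = F (Re (?u t), Im (?u t))" unfolding add_0 by (rule sums_unique[symmetric])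
        then show ?thesis by (simp add: b)
      qed (simp add: \<gamma>(2))
    qed
  qed
qed

theorem real_analytic_operates:
  fixes g :: "'a::euclidean_space \<Rightarrow> complex"
  assumes g: "g \<in> schwartz" and nz: "g \<noteq> (\<lambda>_. 0)" and F: "real_analytic F" "F (0, 0) = 0"
  shows "operates_in_M11 g F"
  unfolding operates_in_M11_def
proof
  fix f assume "f \<in> M11_fun g"
  then obtain B where f: "continuous_on UNIV f" and B: "\<And>t. cmod (f t) \<le> B" and x: "xnorm g f < \<infinity>"
    by (auto simp: M11_fun_iff[OF g nz])
  have [measurable]: "f \<in> borel_measurable borel" "g \<in> borel_measurable borel"
    using borel_measurable_continuous_onI[OF f] schwartz_measurable[OF g] by auto
  have p: "pairable f" by (rule pairable_bounded[OF _ B]) simp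
  let ?h = "\<lambda>x. F (Re (f x), Im (f x))"
  have ch: "continuous_on UNIV ?h"
    by (rule continuous_on_compose2[OF real_analytic_continuous[OF F(1)]]) (auto intro!: continuous_intros f)
  have [measurable]: "?h \<in> borel_measurable borel" by (rule borel_measurable_continuous_onI[OF ch])
  obtain A where A: "\<And>t. cmod (?h t) \<le> A"
  proof -
    have "compact (F ` ({- B..B} \<times> {- B..B}))"
      by (intro compact_continuous_image compact_Times compact_Icc continuous_on_subset[OF real_analytic_continuous[OF F(1)]]) auto
    then obtain A where A: "\<And>y. y \<in> F ` ({- B..B} \<times> {- B..B}) \<Longrightarrow> norm y \<le> A"
      using compact_imp_bounded bounded_iff by metis
    have "cmod (?h t) \<le> A" for t
    proof (rule A, rule imageI)
      show "(Re (f t), Im (f t)) \<in> {- B..B} \<times> {- B..B}"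
        using abs_Re_le_cmod[of "f t"] abs_Im_le_cmod[of "f t"] B[of t] by auto
    qed
    then show ?thesis using that by blast
  qed
  have ph: "pairable ?h" by (rule pairable_bounded[OF _ A]) simp
  obtain C0 where C0p: "0 \<le> C0" "\<And>h x. pairable h \<Longrightarrow> fnorm (\<lambda>t. h t * complex_of_real (bump (0::'a) 1 (t - x))) \<le> ennreal C0 * ambient g h x"
    by (rule window_change[OF schwartz_bump[of 1 0] g nz]) (simp, rule that)
  have C0: "0 \<le> C0" "\<And>y. fnorm (\<lambda>t. f t * complex_of_real (bump y 1 t)) \<le> ennreal C0 * ambient g f y"
  proof -
    show "0 \<le> C0" by (rule C0p(1))
    fix y :: 'a
    show "fnorm (\<lambda>t. f t * complex_of_real (bump y 1 t)) \<le> ennreal C0 * ambient g f y"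
      using C0p(2)[OF p, of y] unfolding bump_translate[of y 1] .
  qed
  have afin: "ambient g f y < \<infinity>" for y using ambient_le_xnorm x by (rule le_less_trans)
  have lfin: "fnorm (\<lambda>t. f t * complex_of_real (bump y 1 t)) < \<infinity>" for y
    by (rule le_less_trans[OF C0(2)]) (use afin[of y] in \<open>simp add: ennreal_mult_less_top\<close>)
  obtain r C where r: "0 < r" and C: "0 \<le> C"
    and inf: "\<And>\<gamma> y s. integrable lborel \<gamma> \<Longrightarrow> (\<forall>t. 1 < norm (t - y) \<longrightarrow> \<gamma> t = 0) \<Longrightarrow> 0 \<le> s \<Longrightarrow> s \<le> r \<Longrightarrow>
       fnorm (\<lambda>t. f t * complex_of_real (bump y 1 t)) \<le> ennreal s \<Longrightarrow> fnorm (\<lambda>t. ?h t * \<gamma> t) \<le> ennreal (C * s) * fnorm \<gamma>"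
    by (rule composition_bound_at_infinity[OF F f p]) (rule that)
  \<comment> \<open>Below this threshold \<open>C0 * ambient\<close> is at most \<open>r\<close>, so
    beyond \<open>R\<close> the estimate at infinity applies.\<close>
  have "0 < ennreal (r / (C0 + 1))" using r C0(1) by (simp add: ennreal_less_zero_iff)
  from ambient_tendsto_0[OF _ _ x this]
  obtain R where R: "\<And>y. norm y > R \<Longrightarrow> ambient g f y < ennreal (r / (C0 + 1))" by auto
  have "\<forall>t0. \<exists>\<rho> C. 0 < \<rho> \<and> 0 \<le> C \<and> (\<forall>\<gamma>. integrable lborel \<gamma> \<longrightarrow> (\<forall>t. \<rho> < norm (t - t0) \<longrightarrow> \<gamma> t = 0) \<longrightarrow>
       fnorm (\<lambda>t. ?h t * \<gamma> t) \<le> ennreal C * fnorm \<gamma>)"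
    by (rule allI, rule local_composition_bound[OF F(1) f p lfin]) blast
  from choice[OF this] obtain \<rho> where "\<forall>t0. \<exists>C. 0 < \<rho> t0 \<and> 0 \<le> C \<and> (\<forall>\<gamma>. integrable lborel \<gamma> \<longrightarrow>
      (\<forall>t. \<rho> t0 < norm (t - t0) \<longrightarrow> \<gamma> t = 0) \<longrightarrow> fnorm (\<lambda>t. ?h t * \<gamma> t) \<le> ennreal C * fnorm \<gamma>)" ..
  from choice[OF this] obtain D where D0: "\<forall>t0. 0 < \<rho> t0 \<and> 0 \<le> D t0 \<and> (\<forall>\<gamma>. integrable lborel \<gamma> \<longrightarrow>
      (\<forall>t. \<rho> t0 < norm (t - t0) \<longrightarrow> \<gamma> t = 0) \<longrightarrow> fnorm (\<lambda>t. ?h t * \<gamma> t) \<le> ennreal (D t0) * fnorm \<gamma>)" ..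
  have \<rho>: "\<And>t0. 0 < \<rho> t0" and D: "\<And>t0. 0 \<le> D t0"
    and loc: "\<And>t0 \<gamma>. integrable lborel \<gamma> \<Longrightarrow> (\<And>t. \<rho> t0 < norm (t - t0) \<Longrightarrow> \<gamma> t = 0) \<Longrightarrow>
       fnorm (\<lambda>t. ?h t * \<gamma> t) \<le> ennreal (D t0) * fnorm \<gamma>"
    using D0 by blast+
  have cov: "cball 0 R \<subseteq> (\<Union>t0\<in>cball 0 R. ball t0 (\<rho> t0))" using \<rho> by force
  obtain T where T: "T \<subseteq> cball 0 R" "finite T" "cball 0 R \<subseteq> (\<Union>t0\<in>T. ball t0 (\<rho> t0))"
    by (rule compactE_image[OF compact_cball _ cov]) (rule open_ball, rule that)
  \<comment> \<open>A Lebesgue number: one radius serves for all centres in the compact ball, so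
    that a single window fits into some member of the finite cover.\<close>
  obtain e where e: "0 < e" "\<And>y. y \<in> cball 0 R \<Longrightarrow> \<exists>G\<in>(\<lambda>t0. ball t0 (\<rho> t0)) ` T. ball y e \<subseteq> G"
    using Heine_Borel_lemma[OF compact_cball T(3)] by auto
  \<comment> \<open>The window vanishes from distance \<open>2 * \<delta>\<close> on. It therefore
    fits both into a Lebesgue ball and into the unit ball used near infinity.\<close>
  define \<delta> where "\<delta> = min (e / 3) (1 / 2)"
  have \<delta>: "0 < \<delta>" "2 * \<delta> < e" "2 * \<delta> \<le> 1" using e(1) by (auto simp: \<delta>_def min_def)
  let ?\<gamma> = "\<lambda>y t. complex_of_real (bump y \<delta> t)"
  let ?\<beta> = "\<lambda>t::'a. complex_of_real (bump 0 \<delta> t)"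
  have \<gamma>s: "?\<gamma> y \<in> schwartz" for y :: 'a by (rule schwartz_bump[OF \<delta>(1)])
  have \<gamma>i: "integrable lborel (?\<gamma> y)" for y :: 'a by (rule schwartz_integrable[OF \<gamma>s])
  have \<gamma>n: "fnorm (?\<gamma> y) = fnorm ?\<beta>" for y :: 'a
    using fnorm_translate[OF schwartz_measurable[OF \<gamma>s[of 0]], of y] by (simp add: bump_translate[of y])
  have \<beta>fin: "fnorm ?\<beta> < \<infinity>"
    using schwartz_fourier_decay[OF \<gamma>s[of 0]] fnorm_decay_bound by (metis ennreal_less_top infinity_ennreal_def le_less_trans)
  define M where "M = (\<Sum>t0\<in>T. D t0)"
  have near: "fnorm (\<lambda>t. ?h t * ?\<gamma> y t) \<le> ennreal M * fnorm ?\<beta>" if y: "norm y \<le> R" for y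
  proof -
    obtain t0 where t0: "t0 \<in> T" "ball y e \<subseteq> ball t0 (\<rho> t0)" using e(2)[of y] y by auto
    have "fnorm (\<lambda>t. ?h t * ?\<gamma> y t) \<le> ennreal (D t0) * fnorm (?\<gamma> y)"
    proof (rule loc[OF \<gamma>i])
      fix t assume t: "\<rho> t0 < norm (t - t0)"
      have "t \<notin> ball y e"
      proof
        assume "t \<in> ball y e"
        then have "t \<in> ball t0 (\<rho> t0)" using t0(2) by blast
        then show False using t by (simp add: dist_norm norm_minus_commute)
      qed
      then have "2 * \<delta> \<le> norm (t - y)" using \<delta>(2) by (simp add: dist_norm norm_minus_commute)
      then show "?\<gamma> y t = 0" using \<delta>(1) by (simp add: bump_eq_0)
    qed
    also have "\<dots> \<le> ennreal M * fnorm ?\<beta>"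
      unfolding \<gamma>n[of y] M_def using T(2) t0(1) D by (intro mult_right_mono ennreal_leI member_le_sum) auto
    finally show ?thesis .
  qed
  have far: "fnorm (\<lambda>t. ?h t * ?\<gamma> y t) \<le> ennreal (C * C0) * fnorm ?\<beta> * ambient g f y" if y: "norm y > R" for y
  proof -
    define s where "s = enn2real (ennreal C0 * ambient g f y)"
    have fin: "ennreal C0 * ambient g f y < top" using afin[of y] by (simp add: ennreal_mult_less_top)
    have s: "ennreal s = ennreal C0 * ambient g f y" using fin by (simp add: s_def)
    have "ennreal s \<le> ennreal C0 * ennreal (r / (C0 + 1))"
      using mult_left_mono[OF less_imp_le[OF R[OF y]], of "ennreal C0"] s by simp
    also have "\<dots> = ennreal (C0 * (r / (C0 + 1)))" using C0(1) r by (intro ennreal_mult[symmetric]) auto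
    also have "\<dots> \<le> ennreal r" using C0(1) r by (intro ennreal_leI) (simp add: field_simps)
    finally have sr: "s \<le> r" using r by (simp add: ennreal_le_iff)
    have "fnorm (\<lambda>t. ?h t * ?\<gamma> y t) \<le> ennreal (C * s) * fnorm (?\<gamma> y)"
    proof (rule inf[OF \<gamma>i _ _ sr])
      show "\<forall>t. 1 < norm (t - y) \<longrightarrow> ?\<gamma> y t = 0" using \<delta> by (simp add: bump_eq_0)
      show "0 \<le> s" by (simp add: s_def)
      show "fnorm (\<lambda>t. f t * complex_of_real (bump y 1 t)) \<le> ennreal s" using C0(2)[of y] s by simp
    qed
    also have "\<dots> = ennreal (C * C0) * fnorm ?\<beta> * ambient g f y"
    proof -
      have "ennreal (C * s) = ennreal C * ennreal s" using C by (intro ennreal_mult) (auto simp: s_def)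
      also have "\<dots> = ennreal (C * C0) * ambient g f y" using C C0(1) s by (simp add: ennreal_mult mult_ac)
      finally show ?thesis by (simp only: \<gamma>n[of y] mult_ac)
    qed
    finally show ?thesis .
  qed
  \<comment> \<open>The constant bound is integrated only over a ball of finite measure; the other
    term is integrable because \<open>ambient\<close> is.\<close>
  have "xnorm ?\<beta> ?h \<le> (\<integral>\<^sup>+y. ennreal M * fnorm ?\<beta> * indicator (cball 0 R) y + ennreal (C * C0) * fnorm ?\<beta> * ambient g f y \<partial>lborel)"
    unfolding xnorm_def
  proof (intro nn_integral_mono)
    fix y
    have "(\<lambda>t. ?h t * cnj (?\<beta> (t - y))) = (\<lambda>t. ?h t * ?\<gamma> y t)" by (simp add: bump_translate[of y])
    then show "fnorm (\<lambda>t. ?h t * cnj (?\<beta> (t - y))) \<le> ennreal M * fnorm ?\<beta> * indicator (cball 0 R) y + ennreal (C * C0) * fnorm ?\<beta> * ambient g f y"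
      using near[of y] far[of y] by (cases "norm y \<le> R") (auto simp: add_increasing2)
  qed
  also have "\<dots> = ennreal M * fnorm ?\<beta> * emeasure lborel (cball (0::'a) R) + ennreal (C * C0) * fnorm ?\<beta> * (ennreal (pi ^ DIM('a)) * xnorm g f)"
  proof -
    have "(\<integral>\<^sup>+y. a * indicator (cball 0 R) y + b * ambient g f y \<partial>lborel)
       = a * emeasure lborel (cball (0::'a) R) + b * (ennreal (pi ^ DIM('a)) * xnorm g f)" for a b
    proof (subst nn_integral_add)
      show "(\<lambda>y::'a. a * indicator (cball 0 R) y) \<in> borel_measurable lborel"
        by (intro borel_measurable_times_ennreal borel_measurable_const borel_measurable_indicator) simp
      have "(\<integral>\<^sup>+y. a * indicator (cball (0::'a) R) y \<partial>lborel) = a * emeasure lborel (cball (0::'a) R)"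
        by (rule nn_integral_cmult_indicator) simp
      then show "(\<integral>\<^sup>+y. a * indicator (cball (0::'a) R) y \<partial>lborel) + (\<integral>\<^sup>+y. b * ambient g f y \<partial>lborel)
          = a * emeasure lborel (cball (0::'a) R) + b * (ennreal (pi ^ DIM('a)) * xnorm g f)"
        by (simp add: nn_integral_cmult nn_integral_ambient)
    qed simp
    then show ?thesis .
  qed
  also have "\<dots> < \<infinity>"
    using \<beta>fin x emeasure_lborel_cball_finite[of "0::'a" R] by (simp add: ennreal_mult_eq_top_iff less_top[symmetric])
  finally have "xnorm ?\<beta> ?h < \<infinity>" .
  \<comment> \<open>The estimate was made with the narrow window \<open>?\<beta>\<close>; here it
    returns to the window \<open>g\<close>.\<close>
  obtain K where K: "0 \<le> K" "\<And>h. pairable h \<Longrightarrow> xnorm g h \<le> ennreal K * xnorm ?\<beta> h"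
    by (rule xnorm_window[OF g \<gamma>s bump_nonzero[OF \<delta>(1)]]) (rule that)
  have "xnorm g ?h < \<infinity>"
    by (rule le_less_trans[OF K(2)[OF ph]]) (use \<open>xnorm ?\<beta> ?h < \<infinity>\<close> in \<open>simp add: ennreal_mult_less_top\<close>)
  then show "?h \<in> M11_fun g" using ch A by (auto simp: M11_fun_iff[OF g nz])
qed

section \<open>Operating functions are continuous and locally bounded\<close>

lemma sup_le_xnorm:
  fixes g :: "'a::euclidean_space \<Rightarrow> complex"
  assumes g: "g \<in> schwartz" and nz: "g \<noteq> (\<lambda>_. 0)"
  obtains C where "0 < C" "\<And>h t X. continuous_on UNIV h \<Longrightarrow> pairable h \<Longrightarrow> 0 \<le> X \<Longrightarrow> xnorm g h \<le> ennreal X \<Longrightarrow> cmod (h t) \<le> C * X"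
proof -
  obtain C where C: "0 < C" "\<And>h t. continuous_on UNIV h \<Longrightarrow> pairable h \<Longrightarrow> ennreal (cmod (h t)) \<le> ennreal C * ambient g h t"
    by (rule sup_le_ambient[OF g nz]) (rule that)
  show ?thesis
  proof (rule that[OF C(1)])
    fix h :: "'a \<Rightarrow> complex" and t X assume h: "continuous_on UNIV h" "pairable h" and X: "0 \<le> X" "xnorm g h \<le> ennreal X"
    have "ennreal (cmod (h t)) \<le> ennreal C * ambient g h t" by (rule C(2)[OF h])
    also have "\<dots> \<le> ennreal C * ennreal X"
      by (intro mult_left_mono order_trans[OF ambient_le_xnorm X(2)]) simp
    also have "\<dots> = ennreal (C * X)" using C(1) X(1) by (simp add: ennreal_mult)
    finally show "cmod (h t) \<le> C * X" using C(1) X(1) by (simp add: ennreal_le_iff)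
  qed
qed

lemma M11_fun_schwartz:
  assumes g: "g \<in> schwartz" and nz: "g \<noteq> (\<lambda>_. 0)" and f: "f \<in> schwartz"
  shows "f \<in> M11_fun g"
  using schwartz_continuous[OF f] schwartz_bounded[OF f] xnorm_schwartz[OF f g]
  unfolding M11_fun_iff[OF g nz] by metis

lemma pairable_continuous_bounded:
  "continuous_on UNIV h \<Longrightarrow> (\<And>t. cmod (h t) \<le> B) \<Longrightarrow> pairable h"
  by (rule pairable_bounded[OF borel_measurable_continuous_onI])

text \<open>The zero function is mapped to a constant, which would have finite norm. Its
  \<open>ambient\<close> would tend to 0 at infinity and yet dominate a fixed positive value
  everywhere.\<close>

lemma operates_at_0:
  fixes g :: "'a::euclidean_space \<Rightarrow> complex"
  assumes g: "g \<in> schwartz" and nz: "g \<noteq> (\<lambda>_. 0)" and op: "operates_in_M11 g F"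
  shows "F (0, 0) = 0"
proof (rule ccontr)
  assume c: "F (0, 0) \<noteq> 0"
  let ?c = "F (0, 0)"
  have "(\<lambda>_::'a. 0) \<in> schwartz"
    using schwartz_cmult[OF g, of 0] by simp
  then have "(\<lambda>_::'a. 0) \<in> M11_fun g" by (rule M11_fun_schwartz[OF g nz])
  then have "(\<lambda>_. ?c) \<in> M11_fun g" using op unfolding operates_in_M11_def by fastforce
  then have x: "xnorm g (\<lambda>_. ?c) < \<infinity>" by (simp add: M11_fun_iff[OF g nz])
  obtain C where C: "0 < C" "\<And>h t. continuous_on UNIV h \<Longrightarrow> pairable h \<Longrightarrow> ennreal (cmod (h t)) \<le> ennreal C * ambient g h t"
    by (rule sup_le_ambient[OF g nz]) (rule that)
  have "0 < ennreal (cmod ?c / C)" using c C(1) by (simp add: ennreal_less_zero_iff)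
  obtain R where R: "\<And>y. norm y > R \<Longrightarrow> ambient g (\<lambda>_. ?c) y < ennreal (cmod ?c / C)"
    by (rule ambient_tendsto_0[OF _ schwartz_measurable[OF g] x \<open>0 < ennreal (cmod ?c / C)\<close>]) (simp, rule that)
  obtain b :: 'a where b: "b \<in> Basis" using nonempty_Basis by blast
  define y where "y = (\<bar>R\<bar> + 1) *\<^sub>R b"
  have "norm y > R" using b by (simp add: y_def)
  from R[OF this] have "ennreal C * ambient g (\<lambda>_. ?c) y < ennreal C * ennreal (cmod ?c / C)"
    using C(1) by (intro ennreal_mult_strict_left_mono) auto
  also have "\<dots> = ennreal (cmod ?c)" using C(1) by (simp add: ennreal_mult[symmetric])
  also have "\<dots> \<le> ennreal C * ambient g (\<lambda>_. ?c) y"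
    by (rule C(2)) (auto intro: pairable_continuous_bounded[where B="cmod ?c"])
  finally show False by simp
qed

section \<open>Disjoint humps accumulating at the origin\<close>

text \<open>One coordinate axis is enough for necessity: the humps are placed along it, and all
  cosines oscillate along it.\<close>

definition base_dir :: "'a::euclidean_space" where
  "base_dir = (SOME b. b \<in> Basis)"

lemma base_dir: "base_dir \<in> Basis"
  unfolding base_dir_def by (rule someI_ex) (use nonempty_Basis in blast)

lemma norm_base_dir [simp]: "norm base_dir = 1"
  by (rule norm_Basis[OF base_dir])

definition hump_center :: "nat \<Rightarrow> 'a::euclidean_space" where
  "hump_center j = (1 / 2) ^ j *\<^sub>R base_dir"

text \<open>Distinct centres are at least half the larger of their norms apart. The doubled radius
  is one eighth of the norm of the centre, so the doubled balls, outside which the bumps vanish, are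
  disjoint and avoid 0.\<close>

definition hump_radius :: "nat \<Rightarrow> real" where
  "hump_radius j = (1 / 2) ^ j / 16"

lemma hump_radius_pos: "0 < hump_radius j"
  by (simp add: hump_radius_def)

lemma norm_hump_center: "norm (hump_center j) = (1 / 2) ^ j"
  by (simp add: hump_center_def)

lemma hump_disjoint_aux:
  fixes t :: "'a::euclidean_space"
  assumes "i < j" "norm (t - hump_center i) \<le> 2 * hump_radius i"
  shows "2 * hump_radius j < norm (t - hump_center j)"
proof -
  have "(1 / 2) ^ j \<le> (1 / 2 :: real) ^ Suc i" using assms(1) by (intro power_decreasing) auto
  then have p: "(1 / 2) ^ j \<le> (1 / 2) ^ i / (2::real)" by simp
  have pos: "(0::real) < (1 / 2) ^ i" by simp
  have "hump_center i - hump_center j = (((1 / 2) ^ i - (1 / 2) ^ j) *\<^sub>R base_dir :: 'a)"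
    by (simp add: hump_center_def scaleR_diff_left)
  then have "norm (hump_center i - hump_center j :: 'a) = \<bar>(1 / 2) ^ i - (1 / 2) ^ j\<bar>"
    by simp
  then have "norm (hump_center i - hump_center j :: 'a) \<ge> (1 / 2) ^ i / 2" using p by linarith
  moreover have "norm (hump_center i - hump_center j :: 'a) \<le> norm (t - hump_center i) + norm (t - hump_center j)"
    using norm_triangle_ineq4[of "t - hump_center j" "t - hump_center i"] by (simp add: add.commute)
  ultimately show ?thesis using assms(2) p pos unfolding hump_radius_def by linarith
qed

lemma hump_disjoint:
  assumes "i \<noteq> j" "norm (t - hump_center i) \<le> 2 * hump_radius i"
  shows "2 * hump_radius j < norm (t - hump_center j)"
proof (cases "i < j")
  case False
  then have "j < i" using assms(1) by simp
  from hump_disjoint_aux[OF this, of t] show ?thesis using assms(2) by linarith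
qed (use hump_disjoint_aux assms in blast)

lemma hump_norm: "norm (t - hump_center j) \<le> 2 * hump_radius j \<Longrightarrow> norm t \<le> 2"
proof -
  assume *: "norm (t - hump_center j) \<le> 2 * hump_radius j"
  have "norm t \<le> norm (t - hump_center j) + norm (hump_center j :: 'a)"
    using norm_triangle_ineq[of "t - hump_center j" "hump_center j"] by simp
  moreover have "(1 / 2 :: real) ^ j \<le> 1" by (rule power_le_one) auto
  ultimately show ?thesis using * unfolding norm_hump_center hump_radius_def by linarith
qed

lemma hump_not_0: "2 * hump_radius j < norm (0 - hump_center j)"
  unfolding norm_minus_commute[of 0] diff_zero norm_hump_center hump_radius_def by simp

text \<open>The gliding hump: if \<open>F\<close> were discontinuous or not locally bounded at \<open>p0\<close>, bad pieces placed on
  the disjoint humps would add up to a single element on which \<open>F\<close> fails to operate.\<close>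

lemma hump_sum:
  fixes g :: "'a::euclidean_space \<Rightarrow> complex"
  assumes g: "g \<in> schwartz" and nz: "g \<noteq> (\<lambda>_. 0)"
    and f: "\<And>j. continuous_on UNIV (f j)"
    and supp: "\<And>j t. 2 * hump_radius j < norm (t - hump_center j) \<Longrightarrow> f j t = 0"
    and x: "\<And>j. xnorm g (f j) \<le> ennreal ((1 / 2) ^ j)"
  obtains h where "h \<in> M11_fun g" "h 0 = p0"
    "\<And>j t. norm (t - hump_center j) \<le> 2 * hump_radius j \<Longrightarrow> h t = p0 + f j t"
proof -
  have p: "pairable (f j)" for j
  proof -
    obtain B where "\<And>t. cmod (f j t) \<le> B"
      using continuous_compact_support_bounded[OF f supp] by metis
    then show ?thesis by (rule pairable_continuous_bounded[OF f])
  qed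
  obtain C where C: "0 < C" "\<And>h t X. continuous_on UNIV h \<Longrightarrow> pairable h \<Longrightarrow> 0 \<le> X \<Longrightarrow> xnorm g h \<le> ennreal X \<Longrightarrow> cmod (h t) \<le> C * X"
    by (rule sup_le_xnorm[OF g nz]) (rule that)
  have b: "cmod (f j t) \<le> C * (1 / 2) ^ j" for j t by (rule C(2)[OF f p _ x]) simp
  have sb: "summable (\<lambda>j. C * (1 / 2) ^ j)" by (intro summable_mult summable_geometric) simp
  let ?s = "\<lambda>t. \<Sum>j. f j t"
  have "uniform_limit UNIV (\<lambda>n t. \<Sum>i<n. f i t) ?s sequentially"
    by (rule Weierstrass_m_test[OF b sb])
  then have cs: "continuous_on UNIV ?s"
    by (rule uniform_limit_theorem[rotated]) (auto intro!: always_eventually continuous_intros f)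
  have bs: "cmod (?s t) \<le> (\<Sum>j. C * (1 / 2) ^ j)" for t
  proof -
    have su: "summable (\<lambda>j. cmod (f j t))" by (rule summable_comparison_test'[OF sb]) (simp add: b)
    show ?thesis by (rule order_trans[OF summable_norm[OF su]]) (intro suminf_le b su sb)
  qed
  have "xnorm g ?s \<le> (\<Sum>j. xnorm g (f j))"
    by (rule xnorm_suminf_le[OF g borel_measurable_continuous_onI[OF f] b sb])
  also have "\<dots> \<le> (\<Sum>j. ennreal ((1 / 2) ^ j))" by (intro suminf_le x) auto
  also have "\<dots> < \<infinity>"
    by (subst suminf_ennreal2) (auto intro!: summable_geometric)
  finally have xs: "xnorm g ?s < \<infinity>" .
  \<comment> \<open>This Schwartz function equals \<open>p0\<close> on the ball of radius 2, which
    contains 0 and all humps.\<close>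
  let ?w = "\<lambda>t::'a. p0 * complex_of_real (bump 0 2 t)"
  have w: "?w \<in> schwartz" by (intro schwartz_cmult schwartz_bump) simp
  obtain W where W: "\<And>t. cmod (?w t) \<le> W" using schwartz_bounded[OF w] by metis
  have cw: "continuous_on UNIV ?w" by (rule schwartz_continuous[OF w])
  let ?h = "\<lambda>t. ?w t + ?s t"
  have "xnorm g ?h \<le> xnorm g ?w + xnorm g ?s"
    by (intro xnorm_add_le[OF g] pairable_continuous_bounded[OF cw W] pairable_continuous_bounded[OF cs bs])
  also have "\<dots> < \<infinity>" using xnorm_schwartz[OF w g] xs by simp
  finally have "xnorm g ?h < \<infinity>" .
  moreover have "continuous_on UNIV ?h" by (intro continuous_intros cw cs)
  moreover have "cmod (?h t) \<le> W + (\<Sum>j. C * (1 / 2) ^ j)" for t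
    using norm_triangle_ineq[of "?w t" "?s t"] W[of t] bs[of t] by linarith
  ultimately have hM: "?h \<in> M11_fun g" unfolding M11_fun_iff[OF g nz] by blast
  have "f j 0 = 0" for j by (rule supp[OF hump_not_0])
  then have h0: "?h 0 = p0" by (simp add: bump_eq_1)
  have "?h t = p0 + f j t" if t: "norm (t - hump_center j) \<le> 2 * hump_radius j" for j t
  proof -
    have "f i t = 0" if "i \<noteq> j" for i by (rule supp[OF hump_disjoint[OF not_sym[OF that] t]])
    then have "(\<Sum>i. f i t) = (\<Sum>i\<in>{j}. f i t)" by (intro suminf_finite) auto
    then show ?thesis using hump_norm[OF t] by (simp add: bump_eq_1)
  qed
  then show ?thesis using that[OF hM h0] by blast
qed

lemma xnorm_cmult_le:
  "g \<in> schwartz \<Longrightarrow> pairable h \<Longrightarrow> xnorm g (\<lambda>t. c * h t) \<le> ennreal (cmod c) * xnorm g h"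
  using xnorm_multiplier[OF _ multiplier_const[of c]] by blast

text \<open>At a discontinuity \<open>p0\<close> choose \<open>p j\<close> near \<open>p0\<close>
  with values of \<open>F\<close> far from that at \<open>p0\<close>. The glued \<open>h\<close>
  equals \<open>p j\<close> at the \<open>j\<close>-th centre and \<open>p0\<close> at 0, so the
  image of \<open>h\<close> is discontinuous at 0 although it lies in the space.\<close>

theorem operates_continuous:
  fixes g :: "'a::euclidean_space \<Rightarrow> complex"
  assumes g: "g \<in> schwartz" and nz: "g \<noteq> (\<lambda>_. 0)" and op: "operates_in_M11 g F"
  shows "continuous_on UNIV (\<lambda>z. F (Re z, Im z))"
  unfolding continuous_on_eq_continuous_at[OF open_UNIV]
proof (intro ballI, rule ccontr)
  fix p0 :: complex
  let ?F = "\<lambda>z. F (Re z, Im z)"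
  assume "\<not> isCont ?F p0"
  then obtain e where e: "0 < e" "\<And>d. 0 < d \<Longrightarrow> \<exists>z. dist z p0 < d \<and> \<not> dist (?F z) (?F p0) < e"
    unfolding continuous_at_eps_delta by blast
  let ?\<psi> = "\<lambda>j (t::'a). complex_of_real (bump (hump_center j) (hump_radius j) t)"
  have \<psi>: "?\<psi> j \<in> schwartz" for j by (rule schwartz_bump[OF hump_radius_pos])
  have p\<psi>: "pairable (?\<psi> j)" for j
    by (intro pairable_bounded[where B=1] schwartz_measurable[OF \<psi>])
       (simp add: abs_of_nonneg[OF bump_nonneg] bump_le_1)
  define X where "X j = enn2real (xnorm g (?\<psi> j))" for j
  have X: "xnorm g (?\<psi> j) = ennreal (X j)" "0 \<le> X j" for j
    using xnorm_schwartz[OF \<psi> g] by (simp_all add: X_def)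
  \<comment> \<open>Dividing by \<open>1 + X j\<close> makes the \<open>j\<close>-th hump of norm at
    most \<open>(1 / 2) ^ j\<close>, whatever the norm of its bump.\<close>
  have "\<forall>j. \<exists>z. dist z p0 < (1 / 2) ^ j / (1 + X j) \<and> \<not> dist (?F z) (?F p0) < e"
    by (intro allI e(2) divide_pos_pos) (use X(2) in \<open>auto simp: add_pos_nonneg\<close>)
  from choice[OF this] obtain p where p: "\<forall>j. dist (p j) p0 < (1 / 2) ^ j / (1 + X j) \<and> \<not> dist (?F (p j)) (?F p0) < e" ..
  have xle: "xnorm g (\<lambda>t. (p j - p0) * ?\<psi> j t) \<le> ennreal ((1 / 2) ^ j)" for j
  proof -
    have "xnorm g (\<lambda>t. (p j - p0) * ?\<psi> j t) \<le> ennreal (cmod (p j - p0)) * ennreal (X j)"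
      using xnorm_cmult_le[OF g p\<psi>, of "p j - p0" j] X(1)[of j] by simp
    also have "\<dots> = ennreal (cmod (p j - p0) * X j)" using X(2) by (simp add: ennreal_mult)
    also have "\<dots> \<le> ennreal ((1 / 2) ^ j)"
    proof (rule ennreal_leI)
      have "cmod (p j - p0) * X j \<le> (1 / 2) ^ j / (1 + X j) * (1 + X j)"
        using p[rule_format, of j] X(2)[of j] by (intro mult_mono) (auto simp: dist_norm intro: less_imp_le)
      then show "cmod (p j - p0) * X j \<le> (1 / 2) ^ j" using X(2)[of j] by simp
    qed
    finally show ?thesis .
  qed
  obtain h where h: "h \<in> M11_fun g" "h 0 = p0"
    "\<And>j t. norm (t - hump_center j) \<le> 2 * hump_radius j \<Longrightarrow> h t = p0 + (p j - p0) * ?\<psi> j t"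
  proof (rule hump_sum[OF g nz, of "\<lambda>j t. (p j - p0) * ?\<psi> j t" p0])
    show "continuous_on UNIV (\<lambda>t. (p j - p0) * ?\<psi> j t)" for j
      by (intro continuous_intros continuous_on_bump hump_radius_pos)
    show "(p j - p0) * ?\<psi> j t = 0" if "2 * hump_radius j < norm (t - hump_center j)" for j t
      using that bump_eq_0[OF less_imp_le[OF that] hump_radius_pos] by simp
  qed (use xle that in blast)+
  have "(\<lambda>x. ?F (h x)) \<in> M11_fun g" using op h(1) unfolding operates_in_M11_def by blast
  then have "isCont (\<lambda>x. ?F (h x)) 0"
    by (simp add: M11_fun_iff[OF g nz] continuous_on_eq_continuous_at)
  moreover have "(hump_center :: nat \<Rightarrow> 'a) \<longlonglongrightarrow> 0"
  proof -
    have "(\<lambda>j. (1 / 2 :: real) ^ j) \<longlonglongrightarrow> 0" by (rule LIMSEQ_realpow_zero) auto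
    from tendsto_scaleR[OF this tendsto_const[of "base_dir :: 'a"]]
    show ?thesis by (simp add: hump_center_def[abs_def])
  qed
  ultimately have "(\<lambda>j. ?F (h (hump_center j))) \<longlonglongrightarrow> ?F (h 0)" by (rule isCont_tendsto_compose)
  moreover have "h (hump_center j) = p j" for j
    using h(3)[of "hump_center j" j] hump_radius_pos[of j] by (simp add: bump_eq_1)
  ultimately have "(\<lambda>j. ?F (p j)) \<longlonglongrightarrow> ?F p0" using h(2) by simp
  from LIMSEQ_D[OF this e(1)] obtain N where "\<And>j. j \<ge> N \<Longrightarrow> norm (?F (p j) - ?F p0) < e" by blast
  then show False using p by (metis dist_norm order_refl)
qed

text \<open>The localized \<open>h\<close> has an integrable transform, so by inversion and Fubini
  the pairing with \<open>\<phi>\<close> becomes an integral of one transform against the other: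
  \<open>L1\<close> norm times supremum.\<close>

lemma M11_dual_bound:
  fixes g \<psi> :: "'a::euclidean_space \<Rightarrow> complex"
  assumes g: "g \<in> schwartz" and nz: "g \<noteq> (\<lambda>_. 0)" and \<psi>: "\<psi> \<in> schwartz"
  obtains L where "0 \<le> L" "\<And>h \<phi> S. h \<in> M11_fun g \<Longrightarrow> integrable lborel \<phi> \<Longrightarrow> \<forall>w. cmod (fourier \<phi> w) \<le> S \<Longrightarrow>
     cmod (\<integral>t. \<psi> t * h t * \<phi> t \<partial>lborel) \<le> L * enn2real (xnorm g h) * S"
proof -
  obtain L where L: "0 \<le> L" "\<And>h x. pairable h \<Longrightarrow> fnorm (\<lambda>t. h t * \<psi> (t - x)) \<le> ennreal L * ambient g h x"
    by (rule window_change[OF \<psi> g nz]) (rule that)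
  show ?thesis
  proof (rule that[OF L(1)])
    fix h \<phi> :: "'a \<Rightarrow> complex" and S
    assume h: "h \<in> M11_fun g" and \<phi>: "integrable lborel \<phi>" and S: "\<forall>w. cmod (fourier \<phi> w) \<le> S"
    obtain B where hc: "continuous_on UNIV h" and B: "\<And>t. cmod (h t) \<le> B" and x: "xnorm g h < \<infinity>"
      using h by (auto simp: M11_fun_iff[OF g nz])
    have hp: "pairable h" by (rule pairable_continuous_bounded[OF hc B])
    let ?v = "\<lambda>t. h t * \<psi> t"
    obtain A where A: "0 \<le> A" "\<And>t. cmod (\<psi> t) \<le> A" using schwartz_bounded[OF \<psi>] by metis
    have vc: "continuous_on UNIV ?v" by (intro continuous_intros hc schwartz_continuous[OF \<psi>])
    have B0: "0 \<le> B" using B[of 0] norm_ge_zero[of "h 0"] by linarith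
    have vb: "cmod (?v t) \<le> B * A" for t
      unfolding norm_mult by (intro mult_mono A B B0 norm_ge_zero)
    have vi: "integrable lborel ?v" using hp \<psi> by (simp add: pairable_def)
    have [measurable]: "?v \<in> borel_measurable borel" "\<phi> \<in> borel_measurable borel" using vi \<phi> by auto
    let ?V = "fourier ?v"
    have fin: "ennreal L * xnorm g h < \<infinity>" using x by (simp add: ennreal_mult_less_top)
    have fv: "fnorm ?v \<le> ennreal L * xnorm g h"
      using L(2)[OF hp, of 0] mult_left_mono[OF ambient_le_xnorm[of g h 0], of "ennreal L"] by (auto intro: order_trans)
    have Vi: "integrable lborel ?V"
      by (rule integrableI_bounded) (use le_less_trans[OF fv fin] in auto)
    have "(\<integral>t. \<psi> t * h t * \<phi> t \<partial>lborel) = (\<integral>t. \<integral>w. ?V w * (cis (2 * pi * (w \<bullet> t)) * \<phi> t) \<partial>lborel \<partial>lborel)"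
    proof (intro Bochner_Integration.integral_cong refl)
      fix t
      have "\<psi> t * h t * \<phi> t = ?v t * \<phi> t" by simp
      also have "\<dots> = (\<integral>w. ?V w * cis (2 * pi * (w \<bullet> t)) \<partial>lborel) * \<phi> t"
        by (subst fourier_inversion[OF vc vb vi Vi, of t]) (rule refl)
      also have "\<dots> = (\<integral>w. ?V w * (cis (2 * pi * (w \<bullet> t)) * \<phi> t) \<partial>lborel)"
        unfolding integral_mult_left_zero[symmetric] by (simp only: mult.assoc)
      finally show "\<psi> t * h t * \<phi> t = (\<integral>w. ?V w * (cis (2 * pi * (w \<bullet> t)) * \<phi> t) \<partial>lborel)" .
    qed
    also have "\<dots> = (\<integral>w. \<integral>t. ?V w * (cis (2 * pi * (w \<bullet> t)) * \<phi> t) \<partial>lborel \<partial>lborel)"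
    proof (rule fubini_swap)
      have "(\<integral>\<^sup>+t. \<integral>\<^sup>+w. ennreal (cmod (?V w * (cis (2 * pi * (w \<bullet> t)) * \<phi> t))) \<partial>lborel \<partial>lborel)
         = (\<integral>\<^sup>+w. ennreal (cmod (?V w)) \<partial>lborel) * (\<integral>\<^sup>+t. ennreal (cmod (\<phi> t)) \<partial>lborel)"
        by (simp add: norm_mult ennreal_mult nn_integral_multc nn_integral_cmult)
      also have "\<dots> < \<infinity>"
        using Vi \<phi> unfolding integrable_iff_bounded by (simp add: ennreal_mult_less_top)
      finally show "(\<integral>\<^sup>+t. \<integral>\<^sup>+w. ennreal (cmod (?V w * (cis (2 * pi * (w \<bullet> t)) * \<phi> t))) \<partial>lborel \<partial>lborel) < \<infinity>" .
    qed measurable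
    also have "\<dots> = (\<integral>w. ?V w * fourier \<phi> (- w) \<partial>lborel)"
      by (simp add: fourier_def mult.commute)
    finally have eq: "(\<integral>t. \<psi> t * h t * \<phi> t \<partial>lborel) = (\<integral>w. ?V w * fourier \<phi> (- w) \<partial>lborel)" .
    have "cmod (\<integral>w. ?V w * fourier \<phi> (- w) \<partial>lborel) \<le> (\<integral>w. cmod (?V w) * S \<partial>lborel)"
    proof (rule order_trans[OF integral_norm_bound], rule integral_mono)
      show "integrable lborel (\<lambda>w. cmod (?V w * fourier \<phi> (- w)))"
        using integrable_mult_bounded[OF Vi, of "\<lambda>w. fourier \<phi> (- w)" S] S by (simp add: mult.commute)
      show "cmod (?V w * fourier \<phi> (- w)) \<le> cmod (?V w) * S" for w
        unfolding norm_mult using S by (intro mult_left_mono) auto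
    qed (use Vi in auto)
    also have "\<dots> = (\<integral>w. cmod (?V w) \<partial>lborel) * S" by simp
    also have "\<dots> \<le> (L * enn2real (xnorm g h)) * S"
    proof (rule mult_right_mono)
      have "ennreal (\<integral>w. cmod (?V w) \<partial>lborel) \<le> ennreal L * xnorm g h"
        using fv nn_integral_eq_integral[OF integrable_norm[OF Vi]] by simp
      then have "enn2real (ennreal (\<integral>w. cmod (?V w) \<partial>lborel)) \<le> enn2real (ennreal L * xnorm g h)"
        using fin by (intro enn2real_mono) auto
      then show "(\<integral>w. cmod (?V w) \<partial>lborel) \<le> L * enn2real (xnorm g h)"
        using L(1) by (simp add: enn2real_mult)
      show "0 \<le> S" using S[rule_format, of 0] norm_ge_zero order_trans by blast
    qed
    finally show "cmod (\<integral>t. \<psi> t * h t * \<phi> t \<partial>lborel) \<le> L * enn2real (xnorm g h) * S" unfolding eq .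
  qed
qed

text \<open>If the estimate fails on every hump with constant \<open>real j * L j\<close> and size
  \<open>(1 / 2) ^ j\<close>, the violating functions are glued into one \<open>h\<close>. The dual
  bound on the \<open>j\<close>-th hump then gives \<open>real j < X\<close> for the fixed norm
  \<open>X\<close> of the image.\<close>

theorem operates_locally_bounded:
  fixes g :: "'a::euclidean_space \<Rightarrow> complex"
  assumes g: "g \<in> schwartz" and nz: "g \<noteq> (\<lambda>_. 0)" and op: "operates_in_M11 g F"
  obtains q :: 'a and \<rho> \<delta> K where "0 < \<rho>" "0 < \<delta>" "0 \<le> K"
    "\<And>f \<phi> S. continuous_on UNIV f \<Longrightarrow> (\<forall>t. 2 * \<rho> < norm (t - q) \<longrightarrow> f t = 0) \<Longrightarrow> xnorm g f \<le> ennreal \<delta> \<Longrightarrow>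
       integrable lborel \<phi> \<Longrightarrow> \<forall>w. cmod (fourier \<phi> w) \<le> S \<Longrightarrow>
       cmod (\<integral>t. complex_of_real (bump q \<rho> t) * F (Re (p0 + f t), Im (p0 + f t)) * \<phi> t \<partial>lborel) \<le> K * S"
proof (rule ccontr)
  assume contr: "\<not> thesis"
  let ?F = "\<lambda>z. F (Re z, Im z)"
  let ?\<psi> = "\<lambda>j (t::'a). complex_of_real (bump (hump_center j) (hump_radius j) t)"
  have \<psi>: "?\<psi> j \<in> schwartz" for j by (rule schwartz_bump[OF hump_radius_pos])
  have "\<forall>j. \<exists>L. 0 \<le> L \<and> (\<forall>h \<phi> S. h \<in> M11_fun g \<longrightarrow> integrable lborel \<phi> \<longrightarrow> (\<forall>w. cmod (fourier \<phi> w) \<le> S) \<longrightarrow>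
     cmod (\<integral>t. ?\<psi> j t * h t * \<phi> t \<partial>lborel) \<le> L * enn2real (xnorm g h) * S)"
    by (rule allI, rule M11_dual_bound[OF g nz \<psi>]) blast
  from choice[OF this] obtain L where L: "\<forall>j. 0 \<le> L j \<and> (\<forall>h \<phi> S. h \<in> M11_fun g \<longrightarrow> integrable lborel \<phi> \<longrightarrow> (\<forall>w. cmod (fourier \<phi> w) \<le> S) \<longrightarrow>
     cmod (\<integral>t. ?\<psi> j t * h t * \<phi> t \<partial>lborel) \<le> L j * enn2real (xnorm g h) * S)" ..
  let ?P = "\<lambda>j f \<phi> S. continuous_on UNIV f \<and> (\<forall>t. 2 * hump_radius j < norm (t - hump_center j) \<longrightarrow> f t = 0) \<and>
     xnorm g f \<le> ennreal ((1 / 2) ^ j) \<and> integrable lborel \<phi> \<and> (\<forall>w. cmod (fourier \<phi> w) \<le> S) \<and>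
     \<not> cmod (\<integral>t. ?\<psi> j t * ?F (p0 + f t) * \<phi> t \<partial>lborel) \<le> (real j * L j) * S"
  have "\<exists>f \<phi> S. ?P j f \<phi> S" for j
  proof (rule ccontr)
    assume no: "\<nexists>f \<phi> S. ?P j f \<phi> S"
    have d: "(0::real) < (1 / 2) ^ j" by simp
    have K: "0 \<le> real j * L j" using L by simp
    have thesis
      by (rule that[OF hump_radius_pos d K, where q="hump_center j"]) (use no in blast)
    with contr show False ..
  qed
  then have "\<forall>j. \<exists>y. ?P j (fst y) (fst (snd y)) (snd (snd y))" by fastforce
  from choice[OF this] obtain y where y: "\<forall>j. ?P j (fst (y j)) (fst (snd (y j))) (snd (snd (y j)))" ..
  define f where "f j = fst (y j)" for j
  define \<phi> where "\<phi> j = fst (snd (y j))" for j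
  define S where "S j = snd (snd (y j))" for j
  have P: "?P j (f j) (\<phi> j) (S j)" for j using y unfolding f_def \<phi>_def S_def by blast
  obtain h where h: "h \<in> M11_fun g"
    "\<And>j t. norm (t - hump_center j) \<le> 2 * hump_radius j \<Longrightarrow> h t = p0 + f j t"
    by (rule hump_sum[OF g nz, of f p0]) (use P that in blast)+
  have Fh: "(\<lambda>x. ?F (h x)) \<in> M11_fun g" using op h(1) unfolding operates_in_M11_def by blast
  define X where "X = enn2real (xnorm g (\<lambda>x. ?F (h x)))"
  have "real j < X" for j
  proof -
    have eq: "?\<psi> j t * ?F (p0 + f j t) * \<phi> j t = ?\<psi> j t * ?F (h t) * \<phi> j t" for t
    proof (cases "norm (t - hump_center j) \<le> 2 * hump_radius j")
      case False
      then have "bump (hump_center j) (hump_radius j) t = 0" by (intro bump_eq_0 hump_radius_pos) simp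
      then show ?thesis by simp
    qed (simp add: h(2))
    have "cmod (\<integral>t. ?\<psi> j t * ?F (h t) * \<phi> j t \<partial>lborel) \<le> L j * X * S j"
      unfolding X_def using L[THEN spec, THEN conjunct2, rule_format, OF Fh] P[of j] by blast
    then have "cmod (\<integral>t. ?\<psi> j t * ?F (p0 + f j t) * \<phi> j t \<partial>lborel) \<le> L j * X * S j"
      unfolding eq .
    then have "real j * L j * S j < L j * X * S j" using P[of j] by linarith
    \<comment> \<open>The strict inequality rules out \<open>L j * S j = 0\<close>, so this
      nonnegative factor can be cancelled.\<close>
    then have "0 < (X - real j) * (L j * S j)" by (simp add: algebra_simps)
    moreover have "0 \<le> S j" using P[of j] norm_ge_zero order_trans by blast
    moreover have "0 \<le> L j" using L by blast
    ultimately show ?thesis by (simp add: zero_less_mult_iff) (smt (verit) mult_nonneg_nonneg)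
  qed
  then show False using reals_Archimedean2 less_asym by blast
qed

section \<open>Exponentials with small Fourier transform\<close>

definition wave :: "real \<Rightarrow> 'a::euclidean_space \<Rightarrow> real" where
  "wave l t = cos (2 * pi * l * (t \<bullet> base_dir))"

lemma continuous_on_wave [continuous_intros]: "continuous_on A (wave l)"
  unfolding wave_def by (intro continuous_intros)

lemma borel_measurable_wave [measurable]: "wave l \<in> borel_measurable borel"
  by (intro borel_measurable_continuous_onI continuous_intros)

lemma abs_wave_le_1: "\<bar>wave l t\<bar> \<le> 1"
  by (simp add: wave_def)

lemma complex_cos_eq: "complex_of_real (cos x) = 1 / 2 * (cis x + cis (- x))"
  by (simp add: complex_eq_iff)

lemma wave_eq: "complex_of_real (wave l t) =
    1 / 2 * (cis (2 * pi * ((l *\<^sub>R base_dir) \<bullet> t)) + cis (2 * pi * ((- l *\<^sub>R base_dir) \<bullet> t)))"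
  unfolding wave_def complex_cos_eq by (simp add: inner_commute mult.assoc)

lemma multiplier_wave: "multiplier (\<lambda>t::'a::euclidean_space. complex_of_real (wave l t)) 1"
proof -
  have "multiplier (\<lambda>t::'a. 1 / 2 * (cis (2 * pi * ((l *\<^sub>R base_dir) \<bullet> t)) + cis (2 * pi * ((- l *\<^sub>R base_dir) \<bullet> t)))) (cmod (1 / 2) * (1 + 1))"
    by (intro multiplier_cmult multiplier_add multiplier_cis)
  then show ?thesis by (simp add: wave_eq)
qed

lemma integrable_wave_mult:
  "integrable lborel h \<Longrightarrow> integrable lborel (\<lambda>t. complex_of_real (wave l t) * h t)"
  by (rule multiplierD(4)[OF multiplier_wave])

lemma fourier_wave:
  assumes h: "integrable lborel h"
  shows "fourier (\<lambda>t. complex_of_real (wave l t) * h t) w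
     = 1 / 2 * (fourier h (w - l *\<^sub>R base_dir) + fourier h (w + l *\<^sub>R base_dir))"
proof -
  have i: "integrable lborel (\<lambda>t. cis (2 * pi * (v \<bullet> t)) * h t)" for v
    by (rule multiplierD(4)[OF multiplier_cis h])
  have "(\<lambda>t. complex_of_real (wave l t) * h t) =
     (\<lambda>t. 1 / 2 * (cis (2 * pi * ((l *\<^sub>R base_dir) \<bullet> t)) * h t + cis (2 * pi * ((- l *\<^sub>R base_dir) \<bullet> t)) * h t))"
    unfolding wave_eq by (simp add: algebra_simps)
  then show ?thesis by (simp only: fourier_cmult fourier_add[OF i i] fourier_cis) simp
qed

text \<open>Multiplication by a wave averages two translates of the transform, and averaging does
  not increase the supremum.\<close>

lemma fourier_wave_power:
  assumes h: "integrable lborel h" and S: "\<And>w. cmod (fourier h w) \<le> S"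
  shows "integrable lborel (\<lambda>t. complex_of_real (wave l t) ^ m * h t) \<and>
    (\<forall>w. cmod (fourier (\<lambda>t. complex_of_real (wave l t) ^ m * h t) w) \<le> S)"
proof (induction m)
  case 0 then show ?case using h S by simp
next
  case (Suc m)
  let ?k = "\<lambda>t. complex_of_real (wave l t) ^ m * h t"
  have eq: "(\<lambda>t. complex_of_real (wave l t) ^ Suc m * h t) = (\<lambda>t. complex_of_real (wave l t) * ?k t)"
    by (simp add: mult.assoc)
  have i: "integrable lborel ?k" using Suc by blast
  have "cmod (1 / 2 * (fourier ?k (w - l *\<^sub>R base_dir) + fourier ?k (w + l *\<^sub>R base_dir))) \<le> S" for w
  proof -
    have "cmod (fourier ?k (w - l *\<^sub>R base_dir)) \<le> S" "cmod (fourier ?k (w + l *\<^sub>R base_dir)) \<le> S"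
      using Suc by blast+
    then have "cmod (fourier ?k (w - l *\<^sub>R base_dir) + fourier ?k (w + l *\<^sub>R base_dir)) \<le> S + S"
      using norm_triangle_mono by blast
    then show ?thesis unfolding norm_mult by simp
  qed
  then show ?case unfolding eq fourier_wave[OF i] using integrable_wave_mult[OF i] by blast
qed

text \<open>The exponential series, transformed term by term. It separates the few low powers, whose
  frequencies are explicit, from a small tail.\<close>

lemma fourier_cis_wave_sums:
  assumes h: "integrable lborel h"
  shows "(\<lambda>m. (\<i> * of_real r) ^ m /\<^sub>R fact m * fourier (\<lambda>t. complex_of_real (wave l t) ^ m * h t) w)
     sums fourier (\<lambda>t. cis (r * wave l t) * h t) w"
proof -
  let ?c = "\<lambda>t. cis (- (2 * pi * (w \<bullet> t)))"
  let ?f = "\<lambda>m t. (\<i> * complex_of_real (r * wave l t)) ^ m /\<^sub>R fact m * (h t * ?c t)"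
  have [measurable]: "h \<in> borel_measurable borel" using h by simp
  have nf: "norm (?f m t) \<le> \<bar>r\<bar> ^ m /\<^sub>R fact m * cmod (h t)" for m t
  proof -
    have "\<bar>r * wave l t\<bar> \<le> \<bar>r\<bar>" using abs_wave_le_1[of l t] by (simp add: abs_mult mult_left_le)
    then have "\<bar>r * wave l t\<bar> ^ m \<le> \<bar>r\<bar> ^ m" by (intro power_mono) auto
    have "norm (?f m t) = inverse (fact m) * \<bar>r * wave l t\<bar> ^ m * cmod (h t)"
      unfolding norm_mult norm_scaleR norm_power norm_of_real by simp
    also have "\<dots> \<le> inverse (fact m) * \<bar>r\<bar> ^ m * cmod (h t)"
      using \<open>\<bar>r * wave l t\<bar> ^ m \<le> \<bar>r\<bar> ^ m\<close> by (intro mult_right_mono mult_left_mono) auto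
    finally show ?thesis by simp
  qed
  have se: "summable (\<lambda>m. \<bar>r\<bar> ^ m /\<^sub>R fact m)" using exp_converges[of "\<bar>r\<bar>"] by (rule sums_summable)
  have fi: "integrable lborel (?f m)" for m
  proof (rule Bochner_Integration.integrable_bound)
    show "integrable lborel (\<lambda>t. \<bar>r\<bar> ^ m /\<^sub>R fact m * cmod (h t))" using h by simp
    show "AE t in lborel. norm (?f m t) \<le> norm (\<bar>r\<bar> ^ m /\<^sub>R fact m * cmod (h t))"
      using nf by (intro AE_I2) (auto intro: order_trans[OF _ abs_ge_self])
  qed measurable
  have "(\<lambda>m. \<integral>t. ?f m t \<partial>lborel) sums (\<integral>t. (\<Sum>m. ?f m t) \<partial>lborel)"
  proof (rule sums_integral[OF fi])
    show "AE t in lborel. summable (\<lambda>m. norm (?f m t))"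
      by (intro AE_I2 summable_comparison_test'[OF summable_mult2[OF se]]) (use nf in simp)
    show "summable (\<lambda>m. \<integral>t. norm (?f m t) \<partial>lborel)"
    proof (rule summable_comparison_test'[OF summable_mult2[OF se, of "\<integral>t. cmod (h t) \<partial>lborel"]])
      fix m
      have "(\<integral>t. norm (?f m t) \<partial>lborel) \<le> (\<integral>t. \<bar>r\<bar> ^ m /\<^sub>R fact m * cmod (h t) \<partial>lborel)"
        using h by (intro integral_mono integrable_norm fi nf) auto
      then show "norm (\<integral>t. norm (?f m t) \<partial>lborel) \<le> \<bar>r\<bar> ^ m /\<^sub>R fact m * (\<integral>t. cmod (h t) \<partial>lborel)" by simp
    qed
  qed
  moreover have "(\<Sum>m. ?f m t) = cis (r * wave l t) * h t * ?c t" for t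
  proof -
    have "(\<lambda>m. ?f m t) sums (exp (\<i> * complex_of_real (r * wave l t)) * (h t * ?c t))"
      by (intro sums_mult2 exp_converges)
    from sums_unique[OF this] show ?thesis by (simp add: cis_conv_exp mult.assoc)
  qed
  moreover have "(\<integral>t. ?f m t \<partial>lborel) = (\<i> * of_real r) ^ m /\<^sub>R fact m * fourier (\<lambda>t. complex_of_real (wave l t) ^ m * h t) w" for m
  proof -
    have eq: "?f m t = (\<i> * of_real r) ^ m /\<^sub>R fact m * (complex_of_real (wave l t) ^ m * h t * ?c t)" for t
      by (simp add: power_mult_distrib mult_ac scaleR_conv_of_real)
    show ?thesis unfolding eq fourier_def by (rule integral_mult_right_zero)
  qed
  ultimately show ?thesis by (simp add: fourier_def)
qed

text \<open>The second order Taylor polynomial of \<open>cis (cos \<theta> / 4)\<close> has the five frequencies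
  \<open>0\<close>, \<open>\<plusminus>1\<close>, \<open>\<plusminus>2\<close> with coefficients of modulus at most \<open>63 / 64\<close>. For a large frequency \<open>l\<close> the
  corresponding translates of the Fourier transform of \<open>h\<close> are essentially disjoint.\<close>

lemma fourier_cis_wave_small:
  fixes h :: "'a::euclidean_space \<Rightarrow> complex"
  assumes h: "h \<in> schwartz" and S: "\<And>w. cmod (fourier h w) \<le> S" and S0: "0 < S"
  obtains l where "\<And>w. cmod (fourier (\<lambda>t. cis (1 / 4 * wave l t) * h t) w) \<le> 127 / 128 * S"
proof -
  have hi: "integrable lborel h" by (rule schwartz_integrable[OF h])
  obtain D where D: "0 \<le> D" "\<And>w. cmod (fourier h w) \<le> D * decay w" using schwartz_fourier_decay[OF h] by metis
  have "\<forall>\<^sub>F w in at_infinity. decay (w::'a) < S / 128 / (D + 1)"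
    using decay_tendsto_0 S0 D(1) by (intro order_tendstoD(2)) auto
  then obtain R0 where R0: "\<And>w::'a. R0 \<le> norm w \<Longrightarrow> decay w < S / 128 / (D + 1)"
    by (auto simp: eventually_at_infinity)
  define R where "R = max R0 0"
  have R: "cmod (fourier h w) \<le> S / 128" if "R \<le> norm w" for w
  proof -
    have "D * decay w \<le> (D + 1) * (S / 128 / (D + 1))"
      using D(1) R0[of w] that by (intro mult_mono) (auto simp: R_def intro: less_imp_le)
    moreover have "(D + 1) * (S / 128 / (D + 1)) = S / 128"
    proof -
      have "D + 1 \<noteq> 0" using D(1) by simp
      moreover have "x * (y / x) = y" if "x \<noteq> 0" for x y :: real using that by simp
      ultimately show ?thesis by blast
    qed
    ultimately show ?thesis using D(2)[of w] by linarith
  qed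
  \<comment> \<open>Translates by distinct multiples of \<open>l\<close> cannot both lie in the ball
    of radius \<open>R\<close>, outside which the transform is at most
    \<open>S / 128\<close>.\<close>
  define l where "l = 2 * R + 1"
  have l: "R + R \<le> l" "0 \<le> R" "0 < l" by (auto simp: l_def R_def)
  have main: "cmod (fourier (\<lambda>t. cis (1 / 4 * wave l t) * h t) w) \<le> 127 / 128 * S" for w
  proof -
    let ?a = "\<lambda>m. fourier (\<lambda>t. complex_of_real (wave l t) ^ m * h t) w"
    let ?x = "\<lambda>m. (\<i> * of_real (1 / 4)) ^ m /\<^sub>R fact m * ?a m"
    let ?F = "\<lambda>k::real. fourier h (w + (k * l) *\<^sub>R base_dir)"
    have s: "?x sums fourier (\<lambda>t. cis (1 / 4 * wave l t) * h t) w"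
      by (rule fourier_cis_wave_sums[OF hi])
    have aS: "cmod (?a m) \<le> S" for m using fourier_wave_power[OF hi S] by blast
    \<comment> \<open>The amplitude cubed over 3! is 1/384, and the geometric ratio 1/4 sums the
      tail to 1/288.\<close>
    have tn: "norm (?x (m + 3)) \<le> S / 384 * (1 / 4) ^ m" for m
    proof -
      have "fact 3 \<le> (fact (m + 3) :: real)" by (rule fact_mono) simp
      then have f: "6 \<le> (fact (m + 3) :: real)" by (simp add: fact_numeral)
      have "inverse (fact (m + 3)) \<le> inverse (6 :: real)" using f by (intro le_imp_inverse_le) auto
      moreover have "(1 / 4 :: real) ^ (m + 3) = (1 / 4) ^ m * (1 / 64)" by (subst power_add) (simp add: power3_eq_cube)
      moreover have "norm (?x (m + 3)) = inverse (fact (m + 3)) * (1 / 4) ^ (m + 3) * cmod (?a (m + 3))"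
        by (simp only: norm_mult norm_scaleR norm_power norm_ii norm_of_real abs_inverse abs_of_nonneg[OF fact_ge_zero] mult_1_left abs_divide abs_numeral abs_one)
      ultimately have "norm (?x (m + 3)) \<le> inverse 6 * ((1 / 4) ^ m * (1 / 64)) * S"
        by (simp only:) (intro mult_mono aS, auto)
      also have "\<dots> = S / 384 * (1 / 4) ^ m" by simp
      finally show ?thesis .
    qed
    have st: "summable (\<lambda>m. S / 384 * (1 / 4) ^ m)" by (intro summable_mult summable_geometric) simp
    have tail: "norm (\<Sum>m. ?x (m + 3)) \<le> S / 288"
    proof -
      have "norm (\<Sum>m. ?x (m + 3)) \<le> (\<Sum>m. S / 384 * (1 / 4) ^ m)"
        using tn st by (rule norm_suminf_le)
      also have "\<dots> = S / 288" by (subst suminf_mult) (auto simp: suminf_geometric)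
      finally show ?thesis .
    qed
    have split: "fourier (\<lambda>t. cis (1 / 4 * wave l t) * h t) w = (\<Sum>m. ?x (m + 3)) + (\<Sum>m<3. ?x m)"
      using suminf_split_initial_segment[OF sums_summable[OF s], of 3] sums_unique[OF s] by simp
    have w1: "integrable lborel (\<lambda>t. complex_of_real (wave l t) * h t)" by (rule integrable_wave_mult[OF hi])
    have a0: "?a 0 = ?F 0" by simp
    have a1: "?a 1 = 1 / 2 * (?F (- 1) + ?F 1)" by (simp add: fourier_wave[OF hi])
    have a2: "?a 2 = 1 / 4 * (?F (- 2) + 2 * ?F 0 + ?F 2)"
    proof -
      have e: "(\<lambda>t. complex_of_real (wave l t) ^ 2 * h t) = (\<lambda>t. complex_of_real (wave l t) * (complex_of_real (wave l t) * h t))"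
        by (simp add: power2_eq_square mult.assoc)
      have v: "w - l *\<^sub>R base_dir - l *\<^sub>R base_dir = w + (- 2 * l) *\<^sub>R base_dir"
        "w + l *\<^sub>R base_dir + l *\<^sub>R base_dir = w + (2 * l) *\<^sub>R base_dir"
      proof -
        have d: "(2 * l) *\<^sub>R base_dir = l *\<^sub>R base_dir + (l *\<^sub>R base_dir :: 'a)"
          unfolding scaleR_left_distrib[symmetric] by simp
        have "(- 2 * l) *\<^sub>R base_dir = - ((2 * l) *\<^sub>R base_dir :: 'a)" by simp
        then show "w - l *\<^sub>R base_dir - l *\<^sub>R base_dir = w + (- 2 * l) *\<^sub>R base_dir"
          "w + l *\<^sub>R base_dir + l *\<^sub>R base_dir = w + (2 * l) *\<^sub>R base_dir"
          unfolding d by (simp_all only:) (simp_all add: algebra_simps)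
      qed
      show ?thesis unfolding e fourier_wave[OF w1] fourier_wave[OF hi] v by (simp add: field_simps)
    qed
    have "(\<Sum>m<3. ?x m) = 63 / 64 * ?F 0 + \<i> / 8 * (?F (- 1) + ?F 1) + - 1 / 128 * (?F (- 2) + ?F 2)"
    proof -
      have sum3: "(\<Sum>m<3. f m) = f 0 + f 1 + f 2" for f :: "nat \<Rightarrow> complex"
        by (simp add: numeral_3_eq_3 numeral_2_eq_2)
      have c: "(\<i> * complex_of_real (1 / 4)) ^ 0 /\<^sub>R fact 0 = 1"
        "(\<i> * complex_of_real (1 / 4)) ^ 1 /\<^sub>R fact 1 = \<i> / 4"
        "(\<i> * complex_of_real (1 / 4)) ^ 2 /\<^sub>R fact 2 = - 1 / 32"
        by (simp_all add: power2_eq_square scaleR_conv_of_real)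
      have alg: "1 * X + \<i> / 4 * (1 / 2 * (Y + Z)) + - 1 / 32 * (1 / 4 * (U + 2 * X + V))
         = 63 / 64 * X + \<i> / 8 * (Y + Z) + - 1 / 128 * (U + V)" for X Y Z U V :: complex
        by (simp add: field_simps)
      show ?thesis unfolding sum3 c a0 a1 a2 by (rule alg)
    qed
    then have "cmod (\<Sum>m<3. ?x m) \<le> 63 / 64 * cmod (?F 0) + 1 / 8 * (cmod (?F (- 1)) + cmod (?F 1)) + 1 / 128 * (cmod (?F (- 2)) + cmod (?F 2))"
      by (simp only:) (intro norm_triangle_mono order_refl,
          simp_all add: norm_mult norm_divide norm_triangle_ineq del: scaleR_left.minus)
    moreover have "63 / 64 * cmod (?F 0) + 1 / 8 * (cmod (?F (- 1)) + cmod (?F 1)) + 1 / 128 * (cmod (?F (- 2)) + cmod (?F 2)) \<le> 253 / 256 * S"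
    \<comment> \<open>Far from the origin the centre term is small and the other coefficients add up
      to only 17/64. Near the origin every shifted term is small, while the centre keeps its
      coefficient 63/64.\<close>
    proof (cases "R \<le> norm w")
      case True
      then have "cmod (?F 0) \<le> S / 128" using R by simp
      moreover have "63 / 64 * X + 1 / 8 * (Y + Z) + 1 / 128 * (U + V) \<le> 253 / 256 * S"
        if "X \<le> S / 128" "Y \<le> S" "Z \<le> S" "U \<le> S" "V \<le> S" for X Y Z U V
        using that S0 by argo
      ultimately show ?thesis using S by blast
    next
      case False
      have big: "cmod (?F k) \<le> S / 128" if "1 \<le> \<bar>k\<bar>" for k
      proof (rule R)
        have "l \<le> \<bar>k\<bar> * l" using that l(3) by simp
        moreover have "norm ((k * l) *\<^sub>R base_dir :: 'a) = \<bar>k\<bar> * l" using l(3) by (simp add: abs_mult)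
        moreover have "norm ((k * l) *\<^sub>R base_dir :: 'a) \<le> norm (w + (k * l) *\<^sub>R base_dir) + norm w"
          using norm_triangle_ineq4[of "w + (k * l) *\<^sub>R base_dir" w] by simp
        ultimately show "R \<le> norm (w + (k * l) *\<^sub>R base_dir)" using False l(1) by linarith
      qed
      have "63 / 64 * X + 1 / 8 * (Y + Z) + 1 / 128 * (U + V) \<le> 253 / 256 * S"
        if "X \<le> S" "Y \<le> S / 128" "Z \<le> S / 128" "U \<le> S / 128" "V \<le> S / 128" for X Y Z U V
        using that S0 by argo
      then show ?thesis using big[of "- 1"] big[of 1] big[of "- 2"] big[of 2] S by simp
    qed
    ultimately have "cmod (fourier (\<lambda>t. cis (1 / 4 * wave l t) * h t) w) \<le> 253 / 256 * S + S / 288"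
      unfolding split using tail norm_triangle_ineq[of "\<Sum>m. ?x (m + 3)" "\<Sum>m<3. ?x m"] by linarith
    \<comment> \<open>The sum of 253/256 and 1/288 is about 0.99175, just below 127/128.\<close>
    also have "\<dots> \<le> 127 / 128 * S" using S0 by simp
    finally show ?thesis .
  qed
  show ?thesis by (rule that[OF main])
qed

text \<open>The amplitude 1/4 is that of \<open>fourier_cis_wave_small\<close>. A list is used
  because each frequency is chosen only after the function built from the others is known.\<close>

definition waves :: "real list \<Rightarrow> 'a::euclidean_space \<Rightarrow> real" where
  "waves ls t = 1 / 4 * (\<Sum>l\<leftarrow>ls. wave l t)"

lemma waves_Nil: "waves [] t = 0"
  and waves_Cons: "waves (l # ls) t = 1 / 4 * wave l t + waves ls t"
  by (simp_all add: waves_def distrib_left)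

lemma continuous_on_waves: "continuous_on A (waves ls)"
proof (induction ls)
  case Nil then show ?case by (simp add: waves_Nil[abs_def])
next
  case (Cons l ls) then show ?case unfolding waves_Cons[abs_def] by (intro continuous_intros) auto
qed

lemma smo_waves: "smo m (\<lambda>t::'a::euclidean_space. complex_of_real (waves ls t))"
proof (induction ls)
  case Nil then show ?case by (simp add: waves_Nil smo_const)
next
  case (Cons l ls)
  have "smo m (\<lambda>t::'a. complex_of_real (wave l t))"
    using smooth_cos[of "2 * pi * l" "base_dir :: 'a"] by (simp add: smooth_iff wave_def)
  then have "smo m (\<lambda>t::'a. (1 / 4) * complex_of_real (wave l t) + complex_of_real (waves ls t))"
    by (intro smo_add smo_mult smo_const Cons)
  then show ?case by (simp add: waves_Cons)
qed

text \<open>The sine is a cosine shifted by a quarter period, so the free phase \<open>a\<close>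
  lets one composition serve both parts of \<open>cis\<close>.\<close>

lemma smooth_cis_waves: "smooth (\<lambda>t. cis (waves ls t))"
proof -
  have d: "((\<lambda>x. cos (x + a + real k * (pi / 2))) has_real_derivative cos (x + a + real (Suc k) * (pi / 2))) (at x)" for k a x
  proof -
    have "cos (x + a + real (Suc k) * (pi / 2)) = cos (x + a + real k * (pi / 2) + pi / 2)"
      by (simp add: algebra_simps add_divide_distrib)
    then have "cos (x + a + real (Suc k) * (pi / 2)) = - sin (x + a + real k * (pi / 2))"
      by (simp only: cos_add cos_pi_half sin_pi_half)
    then show ?thesis by (auto intro!: derivative_eq_intros)
  qed
  have c: "smo m (\<lambda>t. complex_of_real (cos (waves ls t + a + real 0 * (pi / 2))))" for m a
    by (rule smo_compose[where \<phi>="\<lambda>k x. cos (x + a + real k * (pi / 2))", OF d smo_waves])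
  have "cis (waves ls t) = complex_of_real (cos (waves ls t + 0 + real 0 * (pi / 2))) +
      \<i> * complex_of_real (cos (waves ls t + (- pi / 2) + real 0 * (pi / 2)))" for t :: 'a
    by (simp add: complex_eq_iff cos_diff)
  then show ?thesis by (simp only: smooth_iff) (intro allI smo_add smo_mult smo_const c)
qed

lemma waves_schwartz:
  "0 < r \<Longrightarrow> (\<lambda>t. cis (waves ls t) * complex_of_real (bump q r t)) \<in> schwartz"
  by (rule schwartz_smooth_mult_bump[OF smooth_cis_waves])

text \<open>Induction on the number of factors: the product built so far is again a Schwartz
  function, and a further frequency, chosen for it, gains the ratio 127/128. The constant
  \<open>S\<close> belongs to the bump alone.\<close>

lemma exponential_small_fourier:
  fixes q :: "'a::euclidean_space"
  assumes r: "0 < r"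
  obtains S where "0 < S" "\<And>M. \<exists>ls. length ls = M \<and>
    (\<forall>w. cmod (fourier (\<lambda>t. cis (waves ls t) * complex_of_real (bump q r t)) w) \<le> S * (127 / 128) ^ M)"
proof -
  let ?b = "\<lambda>t::'a. complex_of_real (bump q r t)"
  \<comment> \<open>Adding 1 makes \<open>S\<close> visibly positive, as the shrinking lemma
    requires.\<close>
  define S where "S = (\<integral>t. cmod (?b t) \<partial>lborel) + 1"
  have S: "0 < S" unfolding S_def by (smt (verit) Bochner_Integration.integral_nonneg norm_ge_zero)
  have "\<exists>ls. length ls = M \<and> (\<forall>w. cmod (fourier (\<lambda>t. cis (waves ls t) * ?b t) w) \<le> S * (127 / 128) ^ M)" for M
  proof (induction M)
    case 0
    have "cmod (fourier (\<lambda>t. cis (waves [] t) * ?b t) w) \<le> S" for w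
      using norm_fourier_le[of ?b w] by (simp add: waves_Nil S_def)
    then show ?case by (intro exI[of _ "[]"]) simp
  next
    case (Suc M)
    then obtain ls where ls: "length ls = M" "\<And>w. cmod (fourier (\<lambda>t. cis (waves ls t) * ?b t) w) \<le> S * (127 / 128) ^ M"
      by blast
    have pos: "0 < S * (127 / 128) ^ M" using S by simp
    obtain l where l: "\<And>w. cmod (fourier (\<lambda>t. cis (1 / 4 * wave l t) * (cis (waves ls t) * ?b t)) w) \<le> 127 / 128 * (S * (127 / 128) ^ M)"
      by (rule fourier_cis_wave_small[OF waves_schwartz[OF r] ls(2) pos]) (rule that)
    have eq: "cis (1 / 4 * wave l t) * (cis (waves ls t) * ?b t) = cis (waves (l # ls) t) * ?b t" for t
      unfolding waves_Cons cis_mult[symmetric] by (simp only: mult.assoc)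
    have "127 / 128 * (S * (127 / 128) ^ M) = S * (127 / 128) ^ Suc M" by simp
    with l[unfolded eq] ls(1) show ?case by (intro exI[of _ "l # ls"]) (simp only: list.size, simp)
  qed
  then show ?thesis using that[OF S] by blast
qed

text \<open>An average of functions of bound 1/4, so the number of frequencies disappears. For the
  empty list the quotient is \<open>0 / 0 = 0\<close>.\<close>

lemma multiplier_waves:
  "multiplier (\<lambda>t::'a::euclidean_space. complex_of_real (waves ls t / real (length ls))) (1 / 4)"
proof -
  have m: "multiplier (\<lambda>t::'a. complex_of_real (waves ls t)) (1 / 4 * real (length ls))"
  proof (induction ls)
    case Nil then show ?case using multiplier_const[of 0] by (simp add: waves_Nil)
  next
    case (Cons l ls)
    have "multiplier (\<lambda>t::'a. (1 / 4) * complex_of_real (wave l t) + complex_of_real (waves ls t)) (cmod (1 / 4) * 1 + 1 / 4 * real (length ls))"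
      by (intro multiplier_add multiplier_cmult multiplier_wave Cons)
    then show ?case by (simp add: waves_Cons algebra_simps add_divide_distrib)
  qed
  have "multiplier (\<lambda>t::'a. complex_of_real (1 / real (length ls)) * complex_of_real (waves ls t)) (cmod (complex_of_real (1 / real (length ls))) * (1 / 4 * real (length ls)))"
    by (rule multiplier_cmult[OF m])
  then show ?thesis
  proof (cases "ls = []")
    case True
    show ?thesis unfolding True using multiplier_mono[OF multiplier_const[of 0], of "1 / 4"] by simp
  next
    case False
    with \<open>multiplier (\<lambda>t::'a. complex_of_real (1 / real (length ls)) * _ t) _\<close> show ?thesis
      by (simp add: norm_divide)
  qed
qed

lemma multiplier_cis_compose:
  assumes "multiplier (\<lambda>t. complex_of_real (v t)) r"
  shows "multiplier (\<lambda>t. cis (v t)) (exp r)"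
proof -
  have sr: "(\<lambda>k. r ^ k /\<^sub>R fact k) sums exp r" by (rule exp_converges)
  have "multiplier (\<lambda>t. \<Sum>k. (\<i> ^ k /\<^sub>R fact k) * complex_of_real (v t) ^ k) (\<Sum>k. r ^ k /\<^sub>R fact k)"
  proof (rule multiplier_suminf[OF _ sums_summable[OF sr]])
    fix k
    have "multiplier (\<lambda>t. (\<i> ^ k /\<^sub>R fact k) * complex_of_real (v t) ^ k) (cmod (\<i> ^ k /\<^sub>R fact k) * r ^ k)"
      by (intro multiplier_cmult multiplier_power assms)
    then show "multiplier (\<lambda>t. (\<i> ^ k /\<^sub>R fact k) * complex_of_real (v t) ^ k) (r ^ k /\<^sub>R fact k)"
      by (simp add: norm_power divide_inverse mult_ac)
  qed
  moreover have "(\<Sum>k. (\<i> ^ k /\<^sub>R fact k) * complex_of_real (v t) ^ k) = cis (v t)" for t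
  proof -
    have "(\<lambda>k. (\<i> * complex_of_real (v t)) ^ k /\<^sub>R fact k) sums exp (\<i> * complex_of_real (v t))" by (rule exp_converges)
    then have "(\<lambda>k. (\<i> ^ k /\<^sub>R fact k) * complex_of_real (v t) ^ k) sums cis (v t)"
      by (simp add: power_mult_distrib cis_conv_exp scaleR_conv_of_real mult.assoc)
    then show ?thesis by (rule sums_unique[symmetric])
  qed
  ultimately show ?thesis using sums_unique[OF sr] by simp
qed

text \<open>As the real part of \<open>cis (v t) * cis a\<close> it has a bound independent of the
  phase, which makes the later estimates uniform in \<open>\<alpha>\<close> and
  \<open>\<beta>\<close>.\<close>

lemma multiplier_cos_shift:
  assumes "multiplier (\<lambda>t. complex_of_real (v t)) r"
  shows "multiplier (\<lambda>t. complex_of_real (cos (v t + a))) (exp r)"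
proof -
  have "multiplier (\<lambda>t. cis (v t) * cis a) (exp r * cmod (cis a))"
    by (intro multiplier_mult multiplier_cis_compose[OF assms] multiplier_const)
  from multiplier_Re[OF this] show ?thesis by (simp add: cis_mult)
qed

section \<open>Chebyshev expansions\<close>

fun cheb :: "nat \<Rightarrow> real poly" where
  "cheb 0 = 1"
| "cheb (Suc 0) = [:0, 1:]"
| "cheb (Suc (Suc n)) = [:0, 2:] * cheb (Suc n) - cheb n"

lemma poly_cheb_cos: "poly (cheb n) (cos x) = cos (real n * x)"
proof (induction n rule: cheb.induct)
  case (3 n)
  have "cos (real (Suc n) * x + x) + cos (real (Suc n) * x - x) = 2 * cos x * cos (real (Suc n) * x)"
    by (simp add: cos_add cos_diff)
  moreover have "real (Suc n) * x + x = real (Suc (Suc n)) * x" "real (Suc n) * x - x = real n * x"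
    by (simp_all add: algebra_simps)
  ultimately show ?case using 3 by simp
qed simp_all

lemma abs_poly_cheb_le_1:
  assumes "x \<in> {-1..1}" shows "\<bar>poly (cheb n) x\<bar> \<le> 1"
proof -
  have "x = cos (arccos x)" using assms by simp
  then show ?thesis using poly_cheb_cos[of n "arccos x"] by (metis abs_cos_le_one)
qed

text \<open>The weighted coefficient sums obey the recurrence with plus signs, and
  \<open>2 * \<rho> * (1 + 2 * \<rho>) + 1\<close> is at most
  \<open>(1 + 2 * \<rho>)\<^sup>2\<close>. The growth rate tends to 1 as \<open>\<rho>\<close> tends
  to 0, so any exponential decay eventually beats it.\<close>

lemma cheb_coeff_bound:
  assumes "0 \<le> \<rho>"
  shows "(\<Sum>i\<le>N. \<bar>coeff (cheb n) i\<bar> * \<rho> ^ i) \<le> (1 + 2 * \<rho>) ^ n"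
proof (induction n rule: cheb.induct)
  case 1
  have "(\<Sum>i\<le>N. \<bar>coeff (1 :: real poly) i\<bar> * \<rho> ^ i) = (\<Sum>i\<in>{0}. \<bar>coeff (1 :: real poly) i\<bar> * \<rho> ^ i)"
    by (intro sum.mono_neutral_right) auto
  then show ?case by simp
next
  case 2
  have "\<bar>coeff [:0, 1 :: real:] i\<bar> * \<rho> ^ i = (if i = 1 then \<rho> else 0)" for i
    by (auto simp: coeff_pCons split: nat.split)
  then show ?case using assms by (simp add: sum.delta)
next
  case (3 n)
  let ?a = "\<lambda>n i. \<bar>coeff (cheb n) i\<bar> * \<rho> ^ i"
  have c: "coeff (cheb (Suc (Suc n))) i = (case i of 0 \<Rightarrow> 0 | Suc k \<Rightarrow> 2 * coeff (cheb (Suc n)) k) - coeff (cheb n) i" for i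
    by (simp add: coeff_pCons split: nat.split)
  have "(\<Sum>i\<le>N. ?a (Suc (Suc n)) i) \<le> (\<Sum>i\<le>N. (case i of 0 \<Rightarrow> 0 | Suc k \<Rightarrow> 2 * \<bar>coeff (cheb (Suc n)) k\<bar>) * \<rho> ^ i + ?a n i)"
  proof (intro sum_mono)
    fix i
    have "\<bar>coeff (cheb (Suc (Suc n))) i\<bar> \<le> (case i of 0 \<Rightarrow> 0 | Suc k \<Rightarrow> 2 * \<bar>coeff (cheb (Suc n)) k\<bar>) + \<bar>coeff (cheb n) i\<bar>"
      unfolding c by (auto split: nat.split)
    from mult_right_mono[OF this, of "\<rho> ^ i"]
    show "?a (Suc (Suc n)) i \<le> (case i of 0 \<Rightarrow> 0 | Suc k \<Rightarrow> 2 * \<bar>coeff (cheb (Suc n)) k\<bar>) * \<rho> ^ i + ?a n i"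
      using assms by (simp add: distrib_right)
  qed
  also have "\<dots> = (\<Sum>i\<le>N. (case i of 0 \<Rightarrow> 0 | Suc k \<Rightarrow> 2 * \<bar>coeff (cheb (Suc n)) k\<bar>) * \<rho> ^ i) + (\<Sum>i\<le>N. ?a n i)"
    by (rule sum.distrib)
  also have "(\<Sum>i\<le>N. (case i of 0 \<Rightarrow> 0 | Suc k \<Rightarrow> 2 * \<bar>coeff (cheb (Suc n)) k\<bar>) * \<rho> ^ i) \<le> 2 * \<rho> * (\<Sum>i\<le>N. ?a (Suc n) i)"
  proof (cases N)
    case 0 then show ?thesis using assms by simp
  next
    case (Suc M)
    have "(\<Sum>i\<le>N. (case i of 0 \<Rightarrow> 0 | Suc k \<Rightarrow> 2 * \<bar>coeff (cheb (Suc n)) k\<bar>) * \<rho> ^ i) = 2 * \<rho> * (\<Sum>i\<le>M. ?a (Suc n) i)"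
      unfolding Suc sum.atMost_Suc_shift by (simp add: sum_distrib_left mult_ac)
    also have "\<dots> \<le> 2 * \<rho> * (\<Sum>i\<le>N. ?a (Suc n) i)"
      using assms Suc by (intro mult_left_mono sum_mono2) auto
    finally show ?thesis .
  qed
  also have "2 * \<rho> * (\<Sum>i\<le>N. ?a (Suc n) i) + (\<Sum>i\<le>N. ?a n i) \<le> 2 * \<rho> * (1 + 2 * \<rho>) ^ Suc n + (1 + 2 * \<rho>) ^ n"
    using 3 assms by (intro add_mono mult_left_mono) auto
  also have "\<dots> = (2 * \<rho> * (1 + 2 * \<rho>) + 1) * (1 + 2 * \<rho>) ^ n" by (simp add: algebra_simps)
  also have "\<dots> \<le> ((1 + 2 * \<rho>) * (1 + 2 * \<rho>)) * (1 + 2 * \<rho>) ^ n"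
    using assms by (intro mult_right_mono) (auto simp: algebra_simps)
  also have "\<dots> = (1 + 2 * \<rho>) ^ Suc (Suc n)" by simp
  finally show ?case by simp
qed

lemma integral_cos_multiple: "integral {0..2 * pi} (\<lambda>x. cos (real_of_int k * x)) = (if k = 0 then 2 * pi else 0)"
proof (cases "k = 0")
  case False
  have "((\<lambda>x. cos (real_of_int k * x)) has_integral (sin (real_of_int k * (2 * pi)) / real_of_int k - sin (real_of_int k * 0) / real_of_int k)) {0..2 * pi}"
    using False
    by (intro fundamental_theorem_of_calculus)
       (auto intro!: derivative_eq_intros simp: has_real_derivative_iff_has_vector_derivative[symmetric])
  moreover have "sin (real_of_int k * (2 * pi)) = 0"
    by (metis mult.commute mult.assoc sin_int_2pin)
  ultimately show ?thesis using False by (simp add: integral_unique)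
qed simp

lemma integral_cos_cos:
  "integral {0..2 * pi} (\<lambda>x. cos (real m * x) * cos (real n * x)) = (if m = n then if n = 0 then 2 * pi else pi else 0)"
proof -
  have i: "(\<lambda>x. cos (real_of_int k * x)) integrable_on {0..2 * pi}" for k
    by (intro integrable_continuous_interval continuous_intros)
  have e: "cos (real m * x) * cos (real n * x) = 1 / 2 * (cos (real_of_int (int m - int n) * x) + cos (real_of_int (int m + int n) * x))" for x
    by (simp add: cos_times_cos algebra_simps)
  have "integral {0..2 * pi} (\<lambda>x. cos (real m * x) * cos (real n * x)) =
     1 / 2 * (integral {0..2 * pi} (\<lambda>x. cos (real_of_int (int m - int n) * x)) + integral {0..2 * pi} (\<lambda>x. cos (real_of_int (int m + int n) * x)))"
    unfolding e Henstock_Kurzweil_Integration.integral_mult_right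
    by (subst Henstock_Kurzweil_Integration.integral_add[OF i i]) (rule refl)
  then show ?thesis unfolding integral_cos_multiple by auto
qed

text \<open>Up to the normalization in \<open>cweight\<close>, the Chebyshev coefficient of
  \<open>\<phi>\<close>, expressed as a Fourier coefficient of the even function
  \<open>\<phi> (cos x)\<close>.\<close>

definition ccoeff :: "(real \<Rightarrow> complex) \<Rightarrow> nat \<Rightarrow> complex" where
  "ccoeff \<phi> m = integral {0..2 * pi} (\<lambda>x. \<phi> (cos x) * of_real (cos (real m * x)))"

lemma continuous_on_cos_compose:
  assumes "continuous_on {-1..1} \<phi>"
  shows "continuous_on A (\<lambda>x. \<phi> (cos x :: real))"
  by (rule continuous_on_compose2[OF assms]) (auto intro!: continuous_intros)

lemma ccoeff_diff:
  assumes "continuous_on {-1..1} \<phi>" "continuous_on {-1..1} \<psi>"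
  shows "ccoeff (\<lambda>x. \<phi> x - \<psi> x) m = ccoeff \<phi> m - ccoeff \<psi> m"
  unfolding ccoeff_def left_diff_distrib
  by (intro Henstock_Kurzweil_Integration.integral_diff integrable_continuous_interval continuous_intros
      continuous_on_cos_compose assms)

lemma ccoeff_norm_le:
  assumes "continuous_on {-1..1} \<phi>" "\<And>x. x \<in> {-1..1} \<Longrightarrow> cmod (\<phi> x) \<le> B"
  shows "cmod (ccoeff \<phi> m) \<le> B * (2 * pi)"
proof -
  have "cmod (\<phi> 0) \<le> B" using assms(2)[of 0] by simp
  then have B: "0 \<le> B" using norm_ge_zero[of "\<phi> 0"] by linarith
  have "norm (ccoeff \<phi> m) \<le> B * (2 * pi - 0)"
    unfolding ccoeff_def
  proof (rule integral_bound)
    show "continuous_on {0..2 * pi} (\<lambda>x. \<phi> (cos x) * of_real (cos (real m * x)))"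
      by (intro continuous_intros continuous_on_cos_compose assms)
    fix x
    have "cmod (\<phi> (cos x)) * \<bar>cos (real m * x)\<bar> \<le> B * 1"
      using assms(2)[of "cos x"] B by (intro mult_mono) auto
    then show "norm (\<phi> (cos x) * of_real (cos (real m * x))) \<le> B" by (simp add: norm_mult)
  qed simp
  then show ?thesis by simp
qed

text \<open>Products of cosines are sums of cosines, so all integrals against powers of
  \<open>cos x\<close> vanish. Approximating the conjugate of \<open>D\<close> by polynomials shows
  that the squared modulus has integral 0.\<close>

lemma ccoeff_zero_imp_zero:
  assumes D: "continuous_on {-1..1} D" and z: "\<And>m. ccoeff D m = 0" and x: "x \<in> {-1..1}"
  shows "D x = 0"
proof -
  let ?I = "\<lambda>f :: real \<Rightarrow> complex. integral {0..2 * pi} f"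
  note cD = continuous_on_cos_compose[OF D]
  have cc: "continuous_on A (\<lambda>x. D (cos x) * of_real (cos x) ^ j * of_real (cos (real m * x)))" for A j m
    by (intro continuous_intros cD)
  have z1: "?I (\<lambda>x. D (cos x) * of_real (cos x) ^ j * of_real (cos (real m * x))) = 0" for j m
  proof (induction j arbitrary: m)
    case 0 then show ?case using z[of m] by (simp add: ccoeff_def)
  next
    case (Suc j)
    \<comment> \<open>For \<open>m = 0\<close> the lower neighbour -1 is reflected to 1, because the
      cosine is even.\<close>
    define m' where "m' = (if m = 0 then 1 else m - 1)"
    have e0: "cos x * cos (real m * x) = 1 / 2 * (cos (real (Suc m) * x) + cos (real m' * x))" for x
    proof (cases m)
      case 0 then show ?thesis by (simp add: m'_def)
    next
      case (Suc k)
      have "cos (real m * x + x) + cos (real m * x - x) = 2 * cos x * cos (real m * x)"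
        by (simp add: cos_add cos_diff)
      moreover have "real m * x + x = real (Suc m) * x" "real m * x - x = real m' * x"
        by (simp_all add: algebra_simps Suc m'_def)
      ultimately show ?thesis by simp
    qed
    have e1: "complex_of_real (cos x) * of_real (cos (real m * x)) = 1 / 2 * (of_real (cos (real (Suc m) * x)) + of_real (cos (real m' * x)))" for x
      unfolding of_real_mult[symmetric] e0 by simp
    have e: "D (cos x) * of_real (cos x) ^ Suc j * of_real (cos (real m * x)) =
      1 / 2 * (D (cos x) * of_real (cos x) ^ j * of_real (cos (real (Suc m) * x)) + D (cos x) * of_real (cos x) ^ j * of_real (cos (real m' * x)))" for x
    proof -
      have "D (cos x) * of_real (cos x) ^ Suc j * of_real (cos (real m * x)) =
         D (cos x) * of_real (cos x) ^ j * (of_real (cos x) * of_real (cos (real m * x)))" by (simp only: power_Suc mult_ac)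
      then show ?thesis unfolding e1 by (simp only: distrib_left mult_ac)
    qed
    show ?case unfolding e
      using Henstock_Kurzweil_Integration.integral_add[OF integrable_continuous_interval[OF cc[where j=j and m="Suc m"]] integrable_continuous_interval[OF cc[where j=j and m=m']], of 0 "2 * pi"]
        Suc.IH[of "Suc m"] Suc.IH[of m'] by simp
  qed
  have z2: "?I (\<lambda>x. D (cos x) * of_real (p (cos x))) = 0" if p: "real_polynomial_function p" for p
  proof -
    obtain a n where pa: "p = (\<lambda>x. \<Sum>i\<le>n. a i * x ^ i)"
      using p real_polynomial_function_iff_sum by blast
    have "?I (\<lambda>x. D (cos x) * of_real (p (cos x))) = ?I (\<lambda>x. \<Sum>i\<le>n. of_real (a i) * (D (cos x) * of_real (cos x) ^ i * of_real (cos (real 0 * x))))"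
      by (simp add: pa sum_distrib_left mult_ac)
    also have "\<dots> = (\<Sum>i\<le>n. ?I (\<lambda>x. of_real (a i) * (D (cos x) * of_real (cos x) ^ i * of_real (cos (real 0 * x)))))"
      by (intro Henstock_Kurzweil_Integration.integral_sum finite_atMost integrable_continuous_interval continuous_intros cD)
    also have "\<dots> = 0" by (intro sum.neutral ballI) (simp only: integral_mult_right z1 mult_zero_right)
    finally show ?thesis .
  qed
  obtain B where B: "\<And>x. x \<in> {-1..1} \<Longrightarrow> cmod (D x) \<le> B" "0 \<le> B"
  proof -
    have "compact (D ` {-1..1})" by (intro compact_continuous_image D compact_Icc)
    then obtain B where "0 < B" "\<And>y. y \<in> D ` {-1..1} \<Longrightarrow> norm y \<le> B" using compact_imp_bounded bounded_pos by metis
    then show ?thesis using that[of B] by auto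
  qed
  have "cmod (?I (\<lambda>x. D (cos x) * cnj (D (cos x)))) \<le> e" if e: "0 < e" for e
  proof -
    \<comment> \<open>Chosen to make \<open>(B + 1) * (2 * d) * (2 * pi)\<close> equal to
      \<open>e\<close>; the 2 collects the errors of the real and imaginary parts.\<close>
    define d where "d = e / (4 * pi * (B + 1))"
    have d: "0 < d" using e B(2) by (simp add: d_def)
    obtain p where p: "real_polynomial_function p" "\<And>x. x \<in> {-1..1} \<Longrightarrow> \<bar>Re (D x) - p x\<bar> < d"
      using Stone_Weierstrass_real_polynomial_function[OF compact_Icc continuous_on_Re[OF D] d] by metis
    obtain q where q: "real_polynomial_function q" "\<And>x. x \<in> {-1..1} \<Longrightarrow> \<bar>Im (D x) - q x\<bar> < d"
      using Stone_Weierstrass_real_polynomial_function[OF compact_Icc continuous_on_Im[OF D] d] by metis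
    let ?P = "\<lambda>x. of_real (p (cos x)) - \<i> * of_real (q (cos x))"
    have cpq: "continuous_on A (\<lambda>x. p (cos x))" "continuous_on A (\<lambda>x. q (cos x))" for A
      by (rule continuous_at_imp_continuous_on, intro ballI isCont_o2[OF isCont_cos],
          rule continuous_real_polymonial_function, rule p(1) q(1))+
    have "?I (\<lambda>x. D (cos x) * of_real (p (cos x)) - \<i> * (D (cos x) * of_real (q (cos x)))) = 0 - \<i> * 0"
      by (subst Henstock_Kurzweil_Integration.integral_diff)
         (auto simp only: integral_mult_right z2[OF p(1)] z2[OF q(1)] intro!: integrable_continuous_interval continuous_intros cD cpq)
    then have zP: "?I (\<lambda>x. D (cos x) * ?P x) = 0" by (simp add: algebra_simps)
    have "?I (\<lambda>x. D (cos x) * cnj (D (cos x))) = ?I (\<lambda>x. D (cos x) * (cnj (D (cos x)) - ?P x)) + ?I (\<lambda>x. D (cos x) * ?P x)"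
      by (subst Henstock_Kurzweil_Integration.integral_add[symmetric])
         (auto intro!: integrable_continuous_interval continuous_intros cD cpq simp: algebra_simps)
    also have "cmod \<dots> \<le> (B * (2 * d)) * (2 * pi - 0)"
      unfolding zP add_0_right
    proof (rule integral_bound)
      show "continuous_on {0..2 * pi} (\<lambda>x. D (cos x) * (cnj (D (cos x)) - ?P x))"
        by (intro continuous_intros cD cpq)
      fix x :: real
      have cx: "cos x \<in> {-1..1}" by simp
      have "cmod (cnj (D (cos x)) - ?P x) \<le> \<bar>Re (D (cos x)) - p (cos x)\<bar> + \<bar>Im (D (cos x)) - q (cos x)\<bar>"
        using cmod_le[of "cnj (D (cos x)) - ?P x"] by (simp add: abs_minus_commute)
      also have "\<dots> \<le> 2 * d" using p(2)[OF cx] q(2)[OF cx] by linarith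
      finally show "norm (D (cos x) * (cnj (D (cos x)) - ?P x)) \<le> B * (2 * d)"
        unfolding norm_mult using B(1)[OF cx] B(2) by (intro mult_mono) auto
    qed simp
    also have "\<dots> \<le> e"
    proof -
      have c: "x * (2 * (e / (4 * pi * x))) * (2 * pi) = e" if "x \<noteq> 0" for x
        using that by simp
      have "B * (2 * d) * (2 * pi) \<le> (B + 1) * (2 * d) * (2 * pi)" using d by (intro mult_right_mono) auto
      also have "\<dots> = e" unfolding d_def using B(2) by (intro c) simp
      finally show ?thesis by simp
    qed
    finally show ?thesis .
  qed
  then have "?I (\<lambda>x. D (cos x) * cnj (D (cos x))) = 0"
    using field_le_epsilon[of "cmod (?I (\<lambda>x. D (cos x) * cnj (D (cos x))))" 0] by simp
  then have "?I (\<lambda>x. of_real ((cmod (D (cos x)))\<^sup>2)) = 0" by (simp add: complex_norm_square del: of_real_power)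
  moreover have "?I (\<lambda>x. of_real ((cmod (D (cos x)))\<^sup>2)) = of_real (integral {0..2 * pi} (\<lambda>x. (cmod (D (cos x)))\<^sup>2))"
    by (rule integral_linear[OF _ bounded_linear_of_real, unfolded o_def])
       (intro integrable_continuous_interval continuous_intros cD)
  ultimately have "integral {0..2 * pi} (\<lambda>x. (cmod (D (cos x)))\<^sup>2) = 0" by simp
  then have "\<forall>y\<in>{0..2 * pi}. (cmod (D (cos y)))\<^sup>2 = 0"
    by (subst (asm) integral_eq_0_iff) (auto intro!: continuous_intros cD)
  then have "(cmod (D (cos (arccos x))))\<^sup>2 = 0"
    using x arccos_lbound[of x] arccos_ubound[of x] pi_gt_zero by (auto simp del: cos_arccos)
  then show ?thesis using x by simp
qed

text \<open>Reciprocals of the integrals of the squared cosines over one period.\<close>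

definition cweight :: "nat \<Rightarrow> real" where
  "cweight m = (if m = 0 then 1 / (2 * pi) else 1 / pi)"

text \<open>The series converges uniformly to a continuous function whose coefficients, by
  orthogonality, are those of \<open>\<phi>\<close>; coefficients determine a continuous
  function.\<close>

lemma chebyshev_expansion:
  assumes \<phi>: "continuous_on {-1..1} \<phi>" and sm: "summable (\<lambda>m. cmod (ccoeff \<phi> m))" and x: "x \<in> {-1..1}"
  shows "(\<lambda>m. of_real (cweight m) * ccoeff \<phi> m * of_real (poly (cheb m) x)) sums \<phi> x"
proof -
  let ?c = "\<lambda>m. of_real (cweight m) * ccoeff \<phi> m"
  let ?f = "\<lambda>m x. ?c m * of_real (poly (cheb m) x)"
  have w: "\<bar>cweight m\<bar> \<le> 1" for m
    using pi_gt3 by (auto simp: cweight_def divide_simps)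
  have le: "norm (?f m x) \<le> cmod (ccoeff \<phi> m)" if "x \<in> {-1..1}" for m x
  proof -
    have "\<bar>cweight m\<bar> * cmod (ccoeff \<phi> m) * \<bar>poly (cheb m) x\<bar> \<le> 1 * cmod (ccoeff \<phi> m) * 1"
      using w[of m] abs_poly_cheb_le_1[OF that, of m] by (intro mult_mono) auto
    then show ?thesis by (simp add: norm_mult)
  qed
  let ?s = "\<lambda>x. \<Sum>m. ?f m x"
  have ul: "uniform_limit {-1..1} (\<lambda>n x. \<Sum>m<n. ?f m x) ?s sequentially"
    by (rule Weierstrass_m_test[OF le sm])
  have cf: "continuous_on A (?f m)" for A m by (intro continuous_intros)
  have cs: "continuous_on {-1..1} ?s"
    by (rule uniform_limit_theorem[OF _ ul]) (auto intro!: always_eventually continuous_intros)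
  have "ccoeff ?s k = ccoeff \<phi> k" for k
  proof -
    let ?C = "\<lambda>x. complex_of_real (cos (real k * x))"
    have ul2: "uniform_limit (cbox 0 (2 * pi)) (\<lambda>n x. \<Sum>m<n. ?f m (cos x) * ?C x) (\<lambda>x. \<Sum>m. ?f m (cos x) * ?C x) sequentially"
    proof (rule Weierstrass_m_test[OF _ sm])
      fix m x
      have "norm (?f m (cos x)) * \<bar>cos (real k * x)\<bar> \<le> cmod (ccoeff \<phi> m) * 1"
        by (intro mult_mono le) auto
      then show "norm (?f m (cos x) * ?C x) \<le> cmod (ccoeff \<phi> m)" by (simp add: norm_mult)
    qed
    obtain I J where IJ: "\<And>n. ((\<lambda>x. \<Sum>m<n. ?f m (cos x) * ?C x) has_integral I n) (cbox 0 (2 * pi))"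
      "((\<lambda>x. \<Sum>m. ?f m (cos x) * ?C x) has_integral J) (cbox 0 (2 * pi))" "I \<longlonglongrightarrow> J"
      by (rule uniform_limit_integral_cbox[OF ul2]) (auto intro!: continuous_intros that)
    have fi: "((\<lambda>x. ?f m (cos x) * ?C x) has_integral (if m = k then ccoeff \<phi> k else 0)) {0..2 * pi}" for m
    proof -
      have "((\<lambda>x. complex_of_real (cos (real m * x) * cos (real k * x))) has_integral
          of_real (if m = k then if k = 0 then 2 * pi else pi else 0)) {0..2 * pi}"
      proof (rule has_integral_of_real)
        show "((\<lambda>x. cos (real m * x) * cos (real k * x)) has_integral (if m = k then if k = 0 then 2 * pi else pi else 0)) {0..2 * pi}"
          unfolding integral_cos_cos[symmetric]
          by (intro integrable_integral integrable_continuous_interval continuous_intros)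
      qed
      from has_integral_mult_right[OF this, of "?c m"]
      show ?thesis by (auto simp: poly_cheb_cos cweight_def mult.assoc split: if_splits)
    qed
    have "I n = (if k < n then ccoeff \<phi> k else 0)" for n
    proof -
      have "((\<lambda>x. \<Sum>m<n. ?f m (cos x) * ?C x) has_integral (\<Sum>m<n. if m = k then ccoeff \<phi> k else 0)) {0..2 * pi}"
        by (intro has_integral_sum fi) auto
      then show ?thesis using has_integral_unique[OF IJ(1)[of n]] by simp
    qed
    then have "I \<longlonglongrightarrow> ccoeff \<phi> k"
      by (intro tendsto_eventually eventually_sequentiallyI[of "Suc k"]) auto
    then have J: "J = ccoeff \<phi> k" using IJ(3) LIMSEQ_unique by blast
    have "(\<Sum>m. ?f m (cos x) * ?C x) = ?s (cos x) * ?C x" for x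
    proof (rule suminf_mult2[symmetric])
      show "summable (\<lambda>m. ?f m (cos x))"
        by (rule summable_norm_cancel[OF summable_comparison_test'[OF sm]]) (use le in auto)
    qed
    then have "((\<lambda>x. ?s (cos x) * ?C x) has_integral J) {0..2 * pi}" using IJ(2) by simp
    then show ?thesis unfolding ccoeff_def[of ?s] using J by (simp add: integral_unique)
  qed
  then have "ccoeff (\<lambda>x. \<phi> x - ?s x) m = 0" for m
    using ccoeff_diff[OF \<phi> cs] by simp
  then have "\<phi> x - ?s x = 0" by (rule ccoeff_zero_imp_zero[OF continuous_on_diff[OF \<phi> cs] _ x])
  moreover have "summable (\<lambda>m. ?f m x)"
    by (rule summable_norm_cancel[OF summable_comparison_test'[OF sm]]) (use le[OF x] in auto)
  ultimately show ?thesis by (simp add: summable_sums)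
qed

section \<open>From Chebyshev series to power series\<close>

lemma coeff_cheb_eq_0: "m < j \<Longrightarrow> coeff (cheb m) j = 0"
proof (induction m arbitrary: j rule: cheb.induct)
  case (3 n)
  then show ?case by (cases j) (auto simp: coeff_pCons)
qed (auto simp: coeff_pCons split: nat.splits)

lemma poly_cheb_sum: "poly (cheb m) x = (\<Sum>j\<le>m. coeff (cheb m) j * x ^ j)"
proof -
  have d: "degree (cheb m) \<le> m" by (rule degree_le) (auto intro: coeff_cheb_eq_0)
  show ?thesis unfolding poly_altdef
    by (rule sum.mono_neutral_left) (use d in \<open>auto simp: coeff_eq_0\<close>)
qed

lemma geometric_product_summable:
  fixes l :: real
  assumes "0 \<le> l" "l < 1"
  shows "(\<lambda>p :: nat \<times> nat. C * l ^ fst p * l ^ snd p) summable_on UNIV"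
proof -
  have "(\<lambda>n :: nat. l ^ n) summable_on UNIV"
    using assms by (intro norm_summable_imp_summable_on) (simp add: summable_geometric)
  then have a: "(\<lambda>n :: nat. norm (l ^ n)) summable_on UNIV" using assms by simp
  have "(\<lambda>p. norm (case p of (m :: nat, n :: nat) \<Rightarrow> l ^ m * l ^ n)) summable_on UNIV \<times> UNIV"
    unfolding Infinite_Sum.abs_summable_on_Sigma_iff
  proof (intro conjI ballI)
    fix m
    show "(\<lambda>n. norm (case (m, n) of (m, n) \<Rightarrow> l ^ m * l ^ n)) summable_on UNIV"
      using a assms by (simp add: norm_mult summable_on_cmult_right)
    have "(\<Sum>\<^sub>\<infinity>n. norm (case (m, n) of (m, n) \<Rightarrow> l ^ m * l ^ n)) = l ^ m * (\<Sum>\<^sub>\<infinity>n. l ^ n)" for m :: nat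
      using assms by (simp add: norm_mult infsum_cmult_right')
    then show "(\<lambda>m. norm (\<Sum>\<^sub>\<infinity>n. norm (case (m, n) of (m, n) \<Rightarrow> l ^ m * l ^ n))) summable_on UNIV"
      using a assms by (simp add: norm_mult abs_mult summable_on_cmult_left)
  qed
  then have "(\<lambda>(m :: nat, n :: nat). l ^ m * l ^ n) summable_on UNIV"
    using Infinite_Sum.abs_summable_summable by fastforce
  then have "(\<lambda>p. C * (case p of (m :: nat, n :: nat) \<Rightarrow> l ^ m * l ^ n)) summable_on UNIV"
    by (rule summable_on_cmult_right)
  then show ?thesis by (simp add: case_prod_unfold mult.assoc)
qed

text \<open>Expanding the polynomials multiplies the term of index \<open>p\<close> by at most the
  power \<open>(1 + 2 * \<rho>) ^ (fst p + snd p)\<close>. As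
  \<open>(1 + 2 * \<rho>) * \<kappa> < 1\<close>, the fourfold series converges absolutely and may
  be regrouped by powers of the variables.\<close>

lemma chebyshev_series_rearrange:
  fixes D :: "nat \<times> nat \<Rightarrow> complex"
  assumes D: "\<And>p. cmod (D p) \<le> C * \<kappa> ^ fst p * \<kappa> ^ snd p" and \<kappa>: "0 \<le> \<kappa>" and \<rho>: "0 \<le> \<rho>" "(1 + 2 * \<rho>) * \<kappa> < 1"
    and st: "\<bar>\<sigma>\<bar> \<le> \<rho>" "\<bar>\<tau>\<bar> \<le> \<rho>"
  defines "a \<equiv> \<lambda>r :: nat \<times> nat. \<Sum>\<^sub>\<infinity>p. D p * of_real (coeff (cheb (fst p)) (fst r) * coeff (cheb (snd p)) (snd r))"
  shows "(\<lambda>r. norm (a r * of_real (\<sigma> ^ fst r * \<tau> ^ snd r))) summable_on UNIV"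
    and "((\<lambda>r. a r * of_real (\<sigma> ^ fst r * \<tau> ^ snd r)) has_sum
      (\<Sum>\<^sub>\<infinity>p. D p * of_real (poly (cheb (fst p)) \<sigma> * poly (cheb (snd p)) \<tau>))) UNIV"
proof -
  define G where "G p r = D p * of_real (coeff (cheb (fst p)) (fst r) * coeff (cheb (snd p)) (snd r)) * of_real (\<sigma> ^ fst r * \<tau> ^ snd r)"
    for p r :: "nat \<times> nat"
  let ?B = "\<lambda>p :: nat \<times> nat. {..fst p} \<times> {..snd p}"
  have G0: "G p r = 0" if "r \<in> UNIV - ?B p" for p r
    using that unfolding G_def by (cases r) (auto simp: coeff_cheb_eq_0 not_le)
  have Gn: "((\<lambda>r. norm (G p r)) has_sum (\<Sum>r\<in>?B p. norm (G p r))) UNIV" for p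
    by (rule has_sum_finite_neutralI[of "?B p"]) (use G0 in auto)
  have Gs: "((\<lambda>r. G p r) has_sum (D p * of_real (poly (cheb (fst p)) \<sigma> * poly (cheb (snd p)) \<tau>))) UNIV" for p
  proof (rule has_sum_finite_neutralI[of "?B p"])
    show "D p * of_real (poly (cheb (fst p)) \<sigma> * poly (cheb (snd p)) \<tau>) = (\<Sum>r\<in>?B p. G p r)"
    proof -
      have "poly (cheb (fst p)) \<sigma> * poly (cheb (snd p)) \<tau> =
         (\<Sum>r\<in>?B p. (coeff (cheb (fst p)) (fst r) * \<sigma> ^ fst r) * (coeff (cheb (snd p)) (snd r) * \<tau> ^ snd r))"
        unfolding poly_cheb_sum sum_product sum.cartesian_product by (simp add: case_prod_unfold)
      then show ?thesis unfolding G_def by (simp add: sum_distrib_left mult_ac)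
    qed
  qed (use G0 in auto)
  have "cmod (D (0, 0)) \<le> C" using D[of "(0, 0)"] by simp
  then have C0: "0 \<le> C" using norm_ge_zero[of "D (0, 0)"] by linarith
  let ?l = "(1 + 2 * \<rho>) * \<kappa>"
  have bound: "(\<Sum>r\<in>?B p. norm (G p r)) \<le> C * ?l ^ fst p * ?l ^ snd p" for p
  proof -
    let ?s = "\<lambda>m x. \<Sum>j\<le>m. \<bar>coeff (cheb m) j\<bar> * \<bar>x\<bar> ^ j"
    have sle: "?s m x \<le> (1 + 2 * \<rho>) ^ m" "0 \<le> ?s m x" if "\<bar>x\<bar> \<le> \<rho>" for m x
    proof -
      have "?s m x \<le> (\<Sum>j\<le>m. \<bar>coeff (cheb m) j\<bar> * \<rho> ^ j)"
        using that by (intro sum_mono mult_left_mono power_mono) auto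
      also have "\<dots> \<le> (1 + 2 * \<rho>) ^ m" by (rule cheb_coeff_bound[OF \<rho>(1)])
      finally show "?s m x \<le> (1 + 2 * \<rho>) ^ m" .
      show "0 \<le> ?s m x" by (intro sum_nonneg) auto
    qed
    have "(\<Sum>r\<in>?B p. norm (G p r)) = cmod (D p) * (?s (fst p) \<sigma> * ?s (snd p) \<tau>)"
    proof -
      have "?s (fst p) \<sigma> * ?s (snd p) \<tau> =
         (\<Sum>r\<in>?B p. (\<bar>coeff (cheb (fst p)) (fst r)\<bar> * \<bar>\<sigma>\<bar> ^ fst r) * (\<bar>coeff (cheb (snd p)) (snd r)\<bar> * \<bar>\<tau>\<bar> ^ snd r))"
        unfolding sum_product sum.cartesian_product by (simp add: case_prod_unfold)
      then show ?thesis unfolding G_def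
        by (simp add: sum_distrib_left norm_mult norm_power abs_mult power_abs mult_ac)
    qed
    also have "\<dots> \<le> (C * \<kappa> ^ fst p * \<kappa> ^ snd p) * ((1 + 2 * \<rho>) ^ fst p * (1 + 2 * \<rho>) ^ snd p)"
      using \<rho>(1) C0 \<kappa>
      by (intro mult_mono D sle st mult_nonneg_nonneg) auto
    also have "\<dots> = C * ?l ^ fst p * ?l ^ snd p" by (simp add: power_mult_distrib mult_ac)
    finally show ?thesis .
  qed
  have geo: "(\<lambda>p :: nat \<times> nat. C * ?l ^ fst p * ?l ^ snd p) summable_on UNIV"
    by (rule geometric_product_summable) (use \<kappa> \<rho> in auto)
  have abs: "(\<lambda>x. norm (case x of (p, r) \<Rightarrow> G p r)) summable_on UNIV \<times> UNIV"
    unfolding Infinite_Sum.abs_summable_on_Sigma_iff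
  proof (intro conjI ballI)
    show "(\<lambda>r. norm (case (p, r) of (p, r) \<Rightarrow> G p r)) summable_on UNIV" for p
      using Gn[of p] by (auto simp: summable_on_def)
    have i: "(\<Sum>\<^sub>\<infinity>r. norm (case (p, r) of (p, r) \<Rightarrow> G p r)) = (\<Sum>r\<in>?B p. norm (G p r))" for p
      using infsumI[OF Gn[of p]] by simp
    show "(\<lambda>p. norm (\<Sum>\<^sub>\<infinity>r. norm (case (p, r) of (p, r) \<Rightarrow> G p r))) summable_on UNIV"
      unfolding i
    proof (rule Infinite_Sum.abs_summable_on_comparison_test')
      show "norm (\<Sum>r\<in>?B p. norm (G p r)) \<le> C * ?l ^ fst p * ?l ^ snd p" for p
        using bound[of p] by (simp add: sum_nonneg)
    qed (rule geo)
  qed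
  then have sw: "(\<lambda>x. norm (case x of (r, p) \<Rightarrow> G p r)) summable_on UNIV \<times> UNIV"
    using summable_on_swap[of "\<lambda>(p, r). norm (G p r)" UNIV UNIV] by (simp add: case_prod_unfold)
  have ar: "(\<Sum>\<^sub>\<infinity>p. G p r) = a r * of_real (\<sigma> ^ fst r * \<tau> ^ snd r)" for r
    unfolding G_def a_def by (rule infsum_cmult_left')
  have s1: "(\<lambda>p. norm (G p r)) summable_on UNIV" for r
    using sw unfolding Infinite_Sum.abs_summable_on_Sigma_iff by (cases r) simp
  have s2: "(\<lambda>r. norm (\<Sum>\<^sub>\<infinity>p. norm (G p r))) summable_on UNIV"
    using sw unfolding Infinite_Sum.abs_summable_on_Sigma_iff by simp
  show as: "(\<lambda>r. norm (a r * of_real (\<sigma> ^ fst r * \<tau> ^ snd r))) summable_on UNIV"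
    unfolding ar[symmetric]
  proof (rule Infinite_Sum.abs_summable_on_comparison_test[OF s2])
    fix r :: "nat \<times> nat"
    have "norm (\<Sum>\<^sub>\<infinity>p. G p r) \<le> (\<Sum>\<^sub>\<infinity>p. norm (G p r))" by (rule norm_infsum_bound[OF s1])
    then show "norm (\<Sum>\<^sub>\<infinity>p. G p r) \<le> norm (\<Sum>\<^sub>\<infinity>p. norm (G p r))" by simp
  qed
  have "(\<Sum>\<^sub>\<infinity>r. a r * of_real (\<sigma> ^ fst r * \<tau> ^ snd r)) = (\<Sum>\<^sub>\<infinity>p. \<Sum>\<^sub>\<infinity>r. G p r)"
    unfolding ar[symmetric]
    by (rule infsum_swap_banach[of "\<lambda>r p. G p r"]) (rule Infinite_Sum.abs_summable_summable[OF sw])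
  also have "\<dots> = (\<Sum>\<^sub>\<infinity>p. D p * of_real (poly (cheb (fst p)) \<sigma> * poly (cheb (snd p)) \<tau>))"
    by (intro infsum_cong infsumI Gs)
  finally show "((\<lambda>r. a r * of_real (\<sigma> ^ fst r * \<tau> ^ snd r)) has_sum
      (\<Sum>\<^sub>\<infinity>p. D p * of_real (poly (cheb (fst p)) \<sigma> * poly (cheb (snd p)) \<tau>))) UNIV"
    using has_sum_infsum[OF Infinite_Sum.abs_summable_summable[OF as]] by simp
qed

definition ccoeff2 :: "(real \<Rightarrow> real \<Rightarrow> complex) \<Rightarrow> nat \<Rightarrow> nat \<Rightarrow> complex" where
  "ccoeff2 \<Gamma> m n = ccoeff (\<lambda>t. ccoeff (\<lambda>s. \<Gamma> s t) m) n"

lemma continuous_on_ccoeff_param: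
  fixes \<Gamma> :: "real \<Rightarrow> real \<Rightarrow> complex"
  assumes "continuous_on UNIV (\<lambda>(s, t). \<Gamma> s t)"
  shows "continuous_on A (\<lambda>t. ccoeff (\<lambda>s. \<Gamma> s t) m)"
proof -
  have "continuous_on (A \<times> cbox 0 (2 * pi)) (\<lambda>(t, x). \<Gamma> (cos x) t * of_real (cos (real m * x)))"
  proof -
    have sn: "continuous_on B (\<lambda>x. c * snd x)" for B :: "(real \<times> real) set" and c :: real
      by (intro continuous_on_mult_left continuous_on_snd continuous_on_id)
    have c1: "continuous_on B (\<lambda>x. (cos (snd x), fst x))" for B :: "(real \<times> real) set"
      using sn[of _ 1] by (intro continuous_on_Pair continuous_on_fst continuous_on_cos continuous_on_id) simp
    have c2: "continuous_on B (\<lambda>x. \<Gamma> (cos (snd x)) (fst x))" for B :: "(real \<times> real) set"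
      using continuous_on_compose2[OF assms c1] by simp
    show ?thesis unfolding case_prod_unfold
      by (intro continuous_on_mult c2 continuous_on_of_real continuous_on_cos sn)
  qed
  then show ?thesis unfolding ccoeff_def interval_cbox
    by (rule integral_continuous_on_param)
qed

lemma abs_cweight_le_1: "\<bar>cweight m\<bar> \<le> 1"
  using pi_gt3 by (auto simp: cweight_def divide_simps)

text \<open>The one-variable expansion is applied in \<open>\<tau>\<close> to each coefficient
  function and then in \<open>\<sigma>\<close>. Geometric decay in both indices merges the iterated
  sums into one sum over pairs.\<close>

lemma double_chebyshev_expansion:
  assumes \<Gamma>: "continuous_on UNIV (\<lambda>(s, t). \<Gamma> s t)" and b: "\<And>m n. cmod (ccoeff2 \<Gamma> m n) \<le> C * \<kappa> ^ (m + n)"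
    and \<kappa>: "0 \<le> \<kappa>" "\<kappa> < 1" and st: "\<sigma> \<in> {-1..1}" "\<tau> \<in> {-1..1}"
  shows "\<Gamma> \<sigma> \<tau> = (\<Sum>\<^sub>\<infinity>p. of_real (cweight (fst p) * cweight (snd p)) * ccoeff2 \<Gamma> (fst p) (snd p) *
      of_real (poly (cheb (fst p)) \<sigma> * poly (cheb (snd p)) \<tau>))"
proof -
  let ?c = "\<lambda>m t. ccoeff (\<lambda>s. \<Gamma> s t) m"
  let ?f = "\<lambda>p. of_real (cweight (fst p) * cweight (snd p)) * ccoeff2 \<Gamma> (fst p) (snd p) *
      of_real (poly (cheb (fst p)) \<sigma> * poly (cheb (snd p)) \<tau>)"
  have "cmod (ccoeff2 \<Gamma> 0 0) \<le> C" using b[of 0 0] by simp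
  then have C0: "0 \<le> C" using norm_ge_zero[of "ccoeff2 \<Gamma> 0 0"] by linarith
  have fb: "cmod (?f (m, n)) \<le> C * \<kappa> ^ m * \<kappa> ^ n" for m n
  proof -
    have w: "\<bar>cweight m * cweight n\<bar> \<le> 1" "\<bar>poly (cheb m) \<sigma> * poly (cheb n) \<tau>\<bar> \<le> 1"
      unfolding abs_mult by (intro mult_le_one abs_cweight_le_1 abs_poly_cheb_le_1 st abs_ge_zero)+
    have "\<bar>cweight m * cweight n\<bar> * cmod (ccoeff2 \<Gamma> m n) * \<bar>poly (cheb m) \<sigma> * poly (cheb n) \<tau>\<bar> \<le> 1 * (C * \<kappa> ^ (m + n)) * 1"
      using w b[of m n] C0 \<kappa> by (intro mult_mono) auto
    then show ?thesis unfolding norm_mult norm_of_real by (simp add: power_add mult.assoc)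
  qed
  have geo: "summable (\<lambda>n. K * \<kappa> ^ n)" for K using \<kappa> by (intro summable_mult summable_geometric) simp
  have e1: "(\<lambda>n. of_real (cweight n) * ccoeff2 \<Gamma> m n * of_real (poly (cheb n) \<tau>)) sums ?c m \<tau>" for m
    unfolding ccoeff2_def
  proof (rule chebyshev_expansion[OF continuous_on_ccoeff_param[OF \<Gamma>] _ st(2)])
    show "summable (\<lambda>n. cmod (ccoeff (\<lambda>t. ?c m t) n))"
    proof (rule summable_comparison_test'[OF geo[of "C * \<kappa> ^ m"]])
      show "norm (cmod (ccoeff (\<lambda>t. ?c m t) n)) \<le> C * \<kappa> ^ m * \<kappa> ^ n" for n
        using b[of m n] by (simp add: ccoeff2_def power_add mult.assoc)
    qed
  qed
  \<comment> \<open>The hypothesis controls only double coefficients; decay of the single ones in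
    \<open>m\<close> is recovered by summing their expansion in \<open>\<tau>\<close>.\<close>
  have cb: "cmod (?c m \<tau>) \<le> C * (\<Sum>n. \<kappa> ^ n) * \<kappa> ^ m" for m
  proof -
    let ?g = "\<lambda>n. of_real (cweight n) * ccoeff2 \<Gamma> m n * of_real (poly (cheb n) \<tau>)"
    have g: "norm (?g n) \<le> C * \<kappa> ^ m * \<kappa> ^ n" for n
    proof -
      have "\<bar>cweight n\<bar> * cmod (ccoeff2 \<Gamma> m n) * \<bar>poly (cheb n) \<tau>\<bar> \<le> 1 * (C * \<kappa> ^ (m + n)) * 1"
        using abs_cweight_le_1[of n] abs_poly_cheb_le_1[OF st(2), of n] b[of m n] C0 \<kappa> by (intro mult_mono) auto
      then show ?thesis unfolding norm_mult norm_of_real by (simp add: power_add mult.assoc)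
    qed
    have "cmod (?c m \<tau>) = norm (\<Sum>n. ?g n)" using sums_unique[OF e1] by simp
    also have "\<dots> \<le> (\<Sum>n. C * \<kappa> ^ m * \<kappa> ^ n)" by (rule norm_suminf_le[OF g geo])
    also have "\<dots> = C * \<kappa> ^ m * (\<Sum>n. \<kappa> ^ n)" using \<kappa> by (intro suminf_mult summable_geometric) simp
    finally show ?thesis by (simp add: mult_ac)
  qed
  have c\<sigma>: "continuous_on {-1..1} (\<lambda>s. \<Gamma> s \<tau>)"
    by (rule continuous_on_compose2[OF \<Gamma>, of _ "\<lambda>s. (s, \<tau>)", simplified]) (intro continuous_intros)
  have e2: "(\<lambda>m. of_real (cweight m) * ?c m \<tau> * of_real (poly (cheb m) \<sigma>)) sums \<Gamma> \<sigma> \<tau>"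
  proof (rule chebyshev_expansion[OF c\<sigma> _ st(1)])
    show "summable (\<lambda>m. cmod (?c m \<tau>))"
      by (rule summable_comparison_test'[OF geo[of "C * (\<Sum>n. \<kappa> ^ n)"]]) (use cb in simp)
  qed
  have inner: "(\<Sum>\<^sub>\<infinity>n. ?f (m, n)) = of_real (cweight m) * ?c m \<tau> * of_real (poly (cheb m) \<sigma>)" for m
  proof (rule infsumI, rule norm_summable_imp_has_sum)
    show "summable (\<lambda>n. norm (?f (m, n)))"
      by (rule summable_comparison_test'[OF geo[of "C * \<kappa> ^ m"]]) (use fb in simp)
    have "(\<lambda>n. (of_real (cweight m) * of_real (poly (cheb m) \<sigma>)) * (of_real (cweight n) * ccoeff2 \<Gamma> m n * of_real (poly (cheb n) \<tau>)))
        sums ((of_real (cweight m) * of_real (poly (cheb m) \<sigma>)) * ?c m \<tau>)"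
      by (rule sums_mult[OF e1])
    then show "(\<lambda>n. ?f (m, n)) sums (of_real (cweight m) * ?c m \<tau> * of_real (poly (cheb m) \<sigma>))"
      by (simp add: mult_ac)
  qed
  have abs: "(\<lambda>p. norm (?f p)) summable_on UNIV"
    by (rule Infinite_Sum.abs_summable_on_comparison_test'[OF geometric_product_summable[OF \<kappa>, of C]])
       (use fb in \<open>metis prod.collapse\<close>)
  then have "(\<lambda>p. norm (?f p)) summable_on UNIV \<times> UNIV" by simp
  then have "(\<Sum>\<^sub>\<infinity>m. \<Sum>\<^sub>\<infinity>n. ?f (m, n)) = infsum ?f (UNIV \<times> UNIV)"
    by (rule infsum_Sigma_banach[OF Infinite_Sum.abs_summable_summable])
  then have "infsum ?f UNIV = (\<Sum>\<^sub>\<infinity>m. of_real (cweight m) * ?c m \<tau> * of_real (poly (cheb m) \<sigma>))"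
    unfolding inner by simp
  also have "\<dots> = \<Gamma> \<sigma> \<tau>"
  proof (rule infsumI, rule norm_summable_imp_has_sum[OF _ e2])
    show "summable (\<lambda>m. norm (of_real (cweight m) * ?c m \<tau> * of_real (poly (cheb m) \<sigma>)))"
    proof (rule summable_comparison_test'[OF geo[of "C * (\<Sum>n. \<kappa> ^ n)"]])
      fix m
      have "\<bar>cweight m\<bar> * cmod (?c m \<tau>) * \<bar>poly (cheb m) \<sigma>\<bar> \<le> 1 * cmod (?c m \<tau>) * 1"
        using abs_cweight_le_1[of m] abs_poly_cheb_le_1[OF st(1), of m] by (intro mult_mono) auto
      then show "norm (norm (of_real (cweight m) * ?c m \<tau> * of_real (poly (cheb m) \<sigma>))) \<le> C * (\<Sum>n. \<kappa> ^ n) * \<kappa> ^ m"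
        using cb[of m] by (simp add: norm_mult)
    qed
  qed
  finally show ?thesis by simp
qed

lemma real_analytic_if_chebyshev_decay:
  fixes F :: "real \<times> real \<Rightarrow> complex"
  assumes F: "continuous_on UNIV F"
    and dec: "\<And>s0 t0. \<exists>e C \<kappa>. 0 < e \<and> 0 < \<kappa> \<and> \<kappa> < 1 \<and>
      (\<forall>m n. cmod (ccoeff2 (\<lambda>s t. F (s0 + e * s, t0 + e * t)) m n) \<le> C * \<kappa> ^ (m + n))"
  shows "real_analytic F"
  unfolding real_analytic_def
proof (intro allI)
  fix s0 t0
  obtain e C \<kappa> where e: "0 < e" and \<kappa>: "0 < \<kappa>" "\<kappa> < 1"
    and b: "\<And>m n. cmod (ccoeff2 (\<lambda>s t. F (s0 + e * s, t0 + e * t)) m n) \<le> C * \<kappa> ^ (m + n)"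
    using dec[of s0 t0] by blast
  let ?\<Gamma> = "\<lambda>s t. F (s0 + e * s, t0 + e * t)"
  have c\<Gamma>: "continuous_on UNIV (\<lambda>(s, t). ?\<Gamma> s t)"
    unfolding case_prod_unfold by (rule continuous_on_compose2[OF F]) (auto intro!: continuous_intros)
  \<comment> \<open>The second entry halves the room in
    \<open>1 + 2 * \<rho> < 1 / \<kappa>\<close>; the first keeps the variables in the interval on
    which the Chebyshev expansion holds.\<close>
  define \<rho> where "\<rho> = min 1 ((1 / \<kappa> - 1) / 4)"
  have \<rho>: "0 < \<rho>" "\<rho> \<le> 1" using \<kappa> by (auto simp: \<rho>_def)
  have \<rho>\<kappa>: "(1 + 2 * \<rho>) * \<kappa> < 1"
  proof -
    have "(1 + 2 * \<rho>) \<le> 1 + (1 / \<kappa> - 1) / 2" by (simp add: \<rho>_def min_def field_simps)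
    also have "\<dots> < 1 / \<kappa>" using \<kappa> by (simp add: field_simps)
    finally show ?thesis using \<kappa> by (simp add: field_simps)
  qed
  define D where "D p = of_real (cweight (fst p) * cweight (snd p)) * ccoeff2 ?\<Gamma> (fst p) (snd p)" for p
  have D: "cmod (D p) \<le> C * \<kappa> ^ fst p * \<kappa> ^ snd p" for p
  proof -
    have "\<bar>cweight (fst p) * cweight (snd p)\<bar> \<le> 1"
      unfolding abs_mult by (intro mult_le_one abs_cweight_le_1 abs_ge_zero)
    then have "\<bar>cweight (fst p) * cweight (snd p)\<bar> * cmod (ccoeff2 ?\<Gamma> (fst p) (snd p)) \<le> 1 * (C * \<kappa> ^ (fst p + snd p))"
      using b by (intro mult_mono) auto
    then show ?thesis unfolding D_def norm_mult norm_of_real by (simp add: power_add mult.assoc)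
  qed
  define a where "a r = (\<Sum>\<^sub>\<infinity>p. D p * of_real (coeff (cheb (fst p)) (fst r) * coeff (cheb (snd p)) (snd r)))" for r :: "nat \<times> nat"
  \<comment> \<open>Undoes the rescaling of both variables by \<open>e\<close>.\<close>
  define A where "A j k = a (j, k) / of_real (e ^ j * e ^ k)" for j k
  let ?U = "{s0 - e * \<rho><..<s0 + e * \<rho>} \<times> {t0 - e * \<rho><..<t0 + e * \<rho>}"
  have *: "(\<lambda>(j, k). cmod (A j k * of_real (s - s0) ^ j * of_real (t - t0) ^ k)) summable_on UNIV \<and>
           ((\<lambda>(j, k). A j k * of_real (s - s0) ^ j * of_real (t - t0) ^ k) has_sum F (s, t)) UNIV"
    if "(s, t) \<in> ?U" for s t
  proof -
    define \<sigma> where "\<sigma> = (s - s0) / e"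
    define \<tau> where "\<tau> = (t - t0) / e"
    have s: "s - s0 = e * \<sigma>" "s = s0 + e * \<sigma>" and t: "t - t0 = e * \<tau>" "t = t0 + e * \<tau>"
      using e by (simp_all add: \<sigma>_def \<tau>_def)
    have "\<bar>e * \<sigma>\<bar> \<le> e * \<rho>" "\<bar>e * \<tau>\<bar> \<le> e * \<rho>" using that unfolding s(1)[symmetric] t(1)[symmetric] by auto
    then have st: "\<bar>\<sigma>\<bar> \<le> \<rho>" "\<bar>\<tau>\<bar> \<le> \<rho>" using e by (simp_all add: abs_mult)
    have eq: "A j k * of_real (s - s0) ^ j * of_real (t - t0) ^ k = a (j, k) * of_real (\<sigma> ^ j * \<tau> ^ k)" for j k
      unfolding A_def s(1) t(1) using e by (simp add: power_mult_distrib field_simps)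
    have s1: "\<sigma> \<in> {-1..1}" "\<tau> \<in> {-1..1}" using st \<rho>(2) by auto
    have "F (s, t) = (\<Sum>\<^sub>\<infinity>p. D p * of_real (poly (cheb (fst p)) \<sigma> * poly (cheb (snd p)) \<tau>))"
      using double_chebyshev_expansion[OF c\<Gamma> b less_imp_le[OF \<kappa>(1)] \<kappa>(2) s1] unfolding D_def s(2) t(2) .
    moreover note chebyshev_series_rearrange[OF D less_imp_le[OF \<kappa>(1)] less_imp_le[OF \<rho>(1)] \<rho>\<kappa> st]
    ultimately show ?thesis unfolding eq a_def[symmetric] by (simp add: case_prod_unfold)
  qed
  show "\<exists>a U. open U \<and> (s0, t0) \<in> U \<and>
        (\<forall>(s, t)\<in>U. (\<lambda>(j, k). cmod (a j k * of_real (s - s0) ^ j * of_real (t - t0) ^ k)) summable_on UNIV \<and>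
           ((\<lambda>(j, k). a j k * of_real (s - s0) ^ j * of_real (t - t0) ^ k) has_sum F (s, t)) UNIV)"
  proof (intro exI conjI)
    show "open ?U" by (intro open_Times open_greaterThanLessThan)
    show "(s0, t0) \<in> ?U" using e \<rho> by simp
    show "\<forall>(s, t)\<in>?U. (\<lambda>(j, k). cmod (A j k * of_real (s - s0) ^ j * of_real (t - t0) ^ k)) summable_on UNIV \<and>
           ((\<lambda>(j, k). A j k * of_real (s - s0) ^ j * of_real (t - t0) ^ k) has_sum F (s, t)) UNIV"
      using * by blast
  qed
qed

section \<open>Operating functions are real analytic\<close>

text \<open>Connects the gauge integrals that define the coefficients with the Lebesgue integrals to
  which Fubini applies.\<close>

lemma lborel_integral_Icc:
  fixes h :: "real \<Rightarrow> complex"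
  assumes "continuous_on {a..b} h"
  shows "(\<integral>x. indicator {a..b} x *\<^sub>R h x \<partial>lborel) = integral {a..b} h"
  using set_borel_integral_eq_integral(2)[OF borel_integrable_atLeastAtMost'[OF assms]]
  by (simp add: set_lebesgue_integral_def)

lemma integral_periodic_shift:
  fixes h :: "real \<Rightarrow> complex"
  assumes h: "continuous_on UNIV h" and per: "\<And>x. h (x + 2 * pi) = h x" and v: "\<bar>v\<bar> \<le> 2 * pi"
  shows "integral {0..2 * pi} (\<lambda>x. h (x + v)) = integral {0..2 * pi} h"
proof -
  have i: "h integrable_on {a..b}" for a b
    by (intro integrable_continuous_interval continuous_on_subset[OF h]) simp
  have pos: "integral {0..2 * pi} (\<lambda>x. h (x + v)) = integral {0..2 * pi} h" if v: "0 \<le> v" "v \<le> 2 * pi" for v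
  proof -
    have "integral {0..2 * pi} (\<lambda>x. h (x + v)) = integral {v..2 * pi + v} h"
      using integral_shift_real_ivl[of v v "2 * pi + v" h] by simp
    also have "\<dots> = integral {v..2 * pi} h + integral {2 * pi..2 * pi + v} h"
      using v by (intro Henstock_Kurzweil_Integration.integral_combine[symmetric] i) auto
    also have "integral {2 * pi..2 * pi + v} h = integral {0..v} h"
      using integral_shift_real_ivl[of "2 * pi" "2 * pi" "2 * pi + v" h] by (simp add: per)
    also have "integral {v..2 * pi} h + integral {0..v} h = integral {0..2 * pi} h"
      using Henstock_Kurzweil_Integration.integral_combine[of 0 v "2 * pi" h] v i by (simp add: add.commute)
    finally show ?thesis .
  qed
  show ?thesis
  proof (cases "0 \<le> v")
    case False
    have "h (x + v) = h (x + (v + 2 * pi))" for x using per[of "x + v"] by (simp add: add.assoc)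
    then show ?thesis using pos[of "v + 2 * pi"] False v by simp
  qed (use pos v in simp)
qed

lemma integral_odd_periodic:
  fixes k :: "real \<Rightarrow> complex"
  assumes "\<And>x. k (2 * pi - x) = - k x"
  shows "integral {0..2 * pi} k = 0"
proof -
  have "integral {0..2 * pi} (\<lambda>x. k (2 * pi - x)) = integral {- (2 * pi)..- 0} (\<lambda>x. k (- x))"
    using integral_shift_real_ivl[of "- (2 * pi)" "- (2 * pi)" 0 "\<lambda>x. k (- x)"] by simp
  also have "\<dots> = integral {0..2 * pi} k" by (rule Henstock_Kurzweil_Integration.integral_reflect_real)
  finally have "- integral {0..2 * pi} k = integral {0..2 * pi} k" by (simp add: assms)
  then show ?thesis by simp
qed

text \<open>A translation of the phase multiplies the \<open>m\<close>-th Fourier coefficient by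
  \<open>cis (real m * v)\<close>. The sine part of the coefficient vanishes because
  \<open>\<phi> (cos x)\<close> is even.\<close>

lemma ccoeff_shift:
  assumes \<phi>: "continuous_on {-1..1} \<phi>" and v: "\<bar>v\<bar> \<le> 2 * pi"
  shows "(\<integral>x. indicator {0..2 * pi} x *\<^sub>R (cis (- (real m * x)) * \<phi> (cos (v + x))) \<partial>lborel) = cis (real m * v) * ccoeff \<phi> m"
proof -
  note c\<phi> = continuous_on_cos_compose[OF \<phi>]
  define h where "h x = cis (- (real m * x)) * \<phi> (cos x)" for x
  have ch: "continuous_on A h" for A unfolding h_def by (intro continuous_intros c\<phi>)
  have per: "h (x + 2 * pi) = h x" for x
  proof -
    have "cis (- (real m * (x + 2 * pi))) = cis (- (real m * x)) * cis (2 * pi * - real m)"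
      unfolding cis_mult by (simp add: algebra_simps)
    also have "cis (2 * pi * - real m) = 1" by (rule cis_multiple_2pi) simp
    finally show ?thesis by (simp add: h_def)
  qed
  have eq: "cis (- (real m * x)) * \<phi> (cos (v + x)) = cis (real m * v) * h (x + v)" for x
  proof -
    have "cis (- (real m * x)) = cis (real m * v) * cis (- (real m * (x + v)))"
      unfolding cis_mult by (simp add: algebra_simps)
    then show ?thesis by (simp add: h_def add.commute)
  qed
  have cs: "continuous_on A (\<lambda>x. h (x + v))" for A
    by (rule continuous_on_compose2[OF ch[of UNIV]]) (auto intro!: continuous_intros)
  have "(\<integral>x. indicator {0..2 * pi} x *\<^sub>R (cis (- (real m * x)) * \<phi> (cos (v + x))) \<partial>lborel) = integral {0..2 * pi} (\<lambda>x. cis (real m * v) * h (x + v))"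
    unfolding eq by (intro lborel_integral_Icc continuous_intros cs)
  also have "\<dots> = cis (real m * v) * integral {0..2 * pi} h"
    by (simp only: Henstock_Kurzweil_Integration.integral_mult_right integral_periodic_shift[OF ch per v])
  also have "integral {0..2 * pi} h = ccoeff \<phi> m"
  proof -
    let ?k = "\<lambda>x. \<phi> (cos x) * of_real (sin (real m * x))"
    have ce: "cis (- (real m * x)) = of_real (cos (real m * x)) - \<i> * of_real (sin (real m * x))" for x
      by (simp add: complex_eq_iff)
    have "h = (\<lambda>x. \<phi> (cos x) * of_real (cos (real m * x)) - \<i> * ?k x)"
      unfolding h_def ce by (rule ext) (simp only: right_diff_distrib left_diff_distrib mult_ac)
    then have "integral {0..2 * pi} h = ccoeff \<phi> m - integral {0..2 * pi} (\<lambda>x. \<i> * ?k x)"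
      unfolding ccoeff_def
      by (simp only:) (intro Henstock_Kurzweil_Integration.integral_diff integrable_continuous_interval continuous_intros c\<phi>)
    moreover have "integral {0..2 * pi} ?k = 0"
    proof (rule integral_odd_periodic)
      fix x
      have "sin (real m * (2 * pi - x)) = sin (real m * (2 * pi)) * cos (real m * x) - cos (real m * (2 * pi)) * sin (real m * x)"
        unfolding sin_diff[symmetric] by (simp add: algebra_simps)
      also have "real m * (2 * pi) = 2 * pi * real m" by simp
      finally have "sin (real m * (2 * pi - x)) = - sin (real m * x)"
        by (simp only: sin_2npi cos_2npi[of m] sin_integer_2pi[OF Ints_of_nat] cos_integer_2pi[OF Ints_of_nat])
      then show "?k (2 * pi - x) = - ?k x" by (simp add: cos_diff)
    qed
    ultimately show ?thesis by (simp only: Henstock_Kurzweil_Integration.integral_mult_right) simp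
  qed
  finally show ?thesis .
qed

lemma norm_integral_Icc_le:
  fixes I :: "real \<Rightarrow> complex"
  assumes "\<And>x. cmod (I x) \<le> B"
  shows "cmod (\<integral>x. indicator {0..2 * pi} x *\<^sub>R I x \<partial>lborel) \<le> B * (2 * pi)"
proof (cases "integrable lborel (\<lambda>x. indicator {0..2 * pi} x *\<^sub>R I x)")
  case True
  have "cmod (\<integral>x. indicator {0..2 * pi} x *\<^sub>R I x \<partial>lborel) \<le> (\<integral>x. indicator {0..2 * pi} x * B \<partial>lborel)"
  proof (rule order_trans[OF integral_norm_bound], rule integral_mono)
    show "integrable lborel (\<lambda>x. indicator {0..2 * pi} x * B :: real)" by simp
    show "norm (indicator {0..2 * pi} x *\<^sub>R I x) \<le> indicator {0..2 * pi} x * B" for x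
      using assms by (simp add: indicator_def)
  qed (rule integrable_norm[OF True])
  then show ?thesis by (simp add: mult.commute)
next
  case False
  have "0 \<le> B" using assms[of 0] norm_ge_zero order_trans by blast
  then show ?thesis using False by (simp add: not_integrable_integral_eq)
qed

text \<open>The coefficients are read off by integrating against \<open>cis (- (m * \<alpha>))\<close> and \<open>cis (- (n * \<beta>))\<close> the
  bounded quantities \<open>I \<alpha> \<beta>\<close>, in which \<open>v\<close> translates the phases at every point.\<close>

lemma ccoeff2_average:
  fixes \<Gamma> :: "real \<Rightarrow> real \<Rightarrow> complex" and v :: "'a::euclidean_space \<Rightarrow> real"
  assumes \<Gamma>: "continuous_on UNIV (\<lambda>(s, t). \<Gamma> s t)" and v: "continuous_on UNIV v" "\<And>t. \<bar>v t\<bar> \<le> 2 * pi"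
    and \<phi>: "integrable lborel \<phi>"
    and B: "\<And>\<alpha> \<beta>. cmod (\<integral>t. \<Gamma> (cos (v t + \<alpha>)) (cos (v t + \<beta>)) * \<phi> t \<partial>lborel) \<le> B"
  shows "cmod (ccoeff2 \<Gamma> m n * (\<integral>t. cis (real (m + n) * v t) * \<phi> t \<partial>lborel)) \<le> B * (2 * pi) * (2 * pi)"
proof -
  have [measurable]: "v \<in> borel_measurable borel" "\<phi> \<in> borel_measurable borel"
    using borel_measurable_continuous_onI[OF v(1)] \<phi> by auto
  have G [measurable]: "(\<lambda>x. \<Gamma> (cos (f x)) (cos (g x))) \<in> borel_measurable M"
    if [measurable]: "f \<in> borel_measurable M" "g \<in> borel_measurable M" for f g and M :: "'z measure"
  proof -
    have [measurable]: "(\<lambda>p. \<Gamma> (fst p) (snd p)) \<in> borel_measurable borel"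
      using borel_measurable_continuous_onI[OF \<Gamma>] by (simp add: case_prod_unfold)
    have "(\<lambda>x. (\<lambda>p. \<Gamma> (fst p) (snd p)) (cos (f x), cos (g x))) \<in> borel_measurable M" by measurable
    then show ?thesis by simp
  qed
  obtain A where A: "0 \<le> A" "\<And>x y. cmod (\<Gamma> (cos x) (cos y)) \<le> A"
  proof -
    have "compact ((\<lambda>(s, t). \<Gamma> s t) ` ({-1..1} \<times> {-1..1}))"
      by (intro compact_continuous_image compact_Times compact_Icc continuous_on_subset[OF \<Gamma>]) auto
    then obtain A where A: "0 < A" "\<And>y. y \<in> (\<lambda>(s, t). \<Gamma> s t) ` ({-1..1} \<times> {-1..1}) \<Longrightarrow> norm y \<le> A"
      using compact_imp_bounded bounded_pos by metis
    have "cmod (\<Gamma> (cos x) (cos y)) \<le> A" for x y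
      by (rule A(2)) (auto intro!: image_eqI[of _ _ "(cos x, cos y)"])
    then show ?thesis using that[of A] A(1) by simp
  qed
  let ?ind = "\<lambda>x. indicator {0..2 * pi} x :: real"
  let ?k = "\<lambda>\<alpha> \<beta> t. \<Gamma> (cos (v t + \<alpha>)) (cos (v t + \<beta>)) * \<phi> t"
  let ?c = "\<lambda>t. ccoeff (\<lambda>s. \<Gamma> s t) m"
  have ci: "continuous_on {-1..1} (\<lambda>s. \<Gamma> s y)" for y
    by (rule continuous_on_compose2[OF \<Gamma>, of _ "\<lambda>s. (s, y)", simplified]) (intro continuous_intros)
  have cc: "continuous_on C ?c" for C by (rule continuous_on_ccoeff_param[OF \<Gamma>])
  have ind1: "(\<integral>\<^sup>+x. ennreal (?ind x) \<partial>lborel) = ennreal (2 * pi)"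
    by (simp add: ennreal_indicator)
  have step1: "(\<integral>\<alpha>. ?ind \<alpha> *\<^sub>R (cis (- (real m * \<alpha>)) * (\<integral>t. ?k \<alpha> \<beta> t \<partial>lborel)) \<partial>lborel)
      = (\<integral>t. cis (real m * v t) * ?c (cos (v t + \<beta>)) * \<phi> t \<partial>lborel)" for \<beta>
  proof -
    have "(\<integral>\<alpha>. ?ind \<alpha> *\<^sub>R (cis (- (real m * \<alpha>)) * (\<integral>t. ?k \<alpha> \<beta> t \<partial>lborel)) \<partial>lborel)
      = (\<integral>\<alpha>. \<integral>t. ?ind \<alpha> *\<^sub>R (cis (- (real m * \<alpha>)) * ?k \<alpha> \<beta> t) \<partial>lborel \<partial>lborel)" by simp
    also have "\<dots> = (\<integral>t. \<integral>\<alpha>. ?ind \<alpha> *\<^sub>R (cis (- (real m * \<alpha>)) * ?k \<alpha> \<beta> t) \<partial>lborel \<partial>lborel)"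
    proof (rule fubini_swap)
      have "(\<integral>\<^sup>+\<alpha>. \<integral>\<^sup>+t. ennreal (cmod (?ind \<alpha> *\<^sub>R (cis (- (real m * \<alpha>)) * ?k \<alpha> \<beta> t))) \<partial>lborel \<partial>lborel)
        \<le> (\<integral>\<^sup>+\<alpha>. \<integral>\<^sup>+t. ennreal (?ind \<alpha>) * ennreal (A * cmod (\<phi> t)) \<partial>lborel \<partial>lborel)"
      proof (intro nn_integral_mono)
        fix \<alpha> t
        have "?ind \<alpha> * (cmod (\<Gamma> (cos (v t + \<alpha>)) (cos (v t + \<beta>))) * cmod (\<phi> t)) \<le> ?ind \<alpha> * (A * cmod (\<phi> t))"
          by (intro mult_left_mono mult_right_mono A) auto
        then show "ennreal (cmod (?ind \<alpha> *\<^sub>R (cis (- (real m * \<alpha>)) * ?k \<alpha> \<beta> t))) \<le> ennreal (?ind \<alpha>) * ennreal (A * cmod (\<phi> t))"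
          using A(1) by (subst ennreal_mult[symmetric]) (auto simp: norm_mult intro!: ennreal_leI)
      qed
      also have "\<dots> = ennreal (2 * pi) * (\<integral>\<^sup>+t. ennreal (A * cmod (\<phi> t)) \<partial>lborel)"
        by (simp add: nn_integral_cmult nn_integral_multc ind1)
      also have "\<dots> < \<infinity>"
        using \<phi> A(1) unfolding integrable_iff_bounded
        by (simp add: ennreal_mult nn_integral_cmult ennreal_mult_less_top)
      finally show "(\<integral>\<^sup>+\<alpha>. \<integral>\<^sup>+t. ennreal (cmod (?ind \<alpha> *\<^sub>R (cis (- (real m * \<alpha>)) * ?k \<alpha> \<beta> t))) \<partial>lborel \<partial>lborel) < \<infinity>" .
    qed measurable
    also have "\<dots> = (\<integral>t. cis (real m * v t) * ?c (cos (v t + \<beta>)) * \<phi> t \<partial>lborel)"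
    proof (intro Bochner_Integration.integral_cong refl)
      fix t
      have "(\<integral>\<alpha>. ?ind \<alpha> *\<^sub>R (cis (- (real m * \<alpha>)) * ?k \<alpha> \<beta> t) \<partial>lborel)
         = (\<integral>\<alpha>. (?ind \<alpha> *\<^sub>R (cis (- (real m * \<alpha>)) * \<Gamma> (cos (v t + \<alpha>)) (cos (v t + \<beta>)))) * \<phi> t \<partial>lborel)"
        by (simp add: mult.assoc)
      then show "(\<integral>\<alpha>. ?ind \<alpha> *\<^sub>R (cis (- (real m * \<alpha>)) * ?k \<alpha> \<beta> t) \<partial>lborel) = cis (real m * v t) * ?c (cos (v t + \<beta>)) * \<phi> t"
        by (simp only: integral_mult_left_zero ccoeff_shift[OF ci v(2)])
    qed
    finally show ?thesis .
  qed
  have Ac: "cmod (?c y) \<le> A * (2 * pi)" if "y \<in> {-1..1}" for y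
  proof (rule ccoeff_norm_le[OF ci])
    fix x :: real assume "x \<in> {-1..1}"
    then show "cmod (\<Gamma> x y) \<le> A" using A(2)[of "arccos x" "arccos y"] that by simp
  qed
  have [measurable]: "?c \<in> borel_measurable borel" by (rule borel_measurable_continuous_onI[OF cc])
  \<comment> \<open>The averages over \<open>\<alpha>\<close> and \<open>\<beta>\<close> yield
    \<open>cis (real m * v t)\<close> and \<open>cis (real n * v t)\<close>. Both phases ride on the
    same \<open>v\<close>, so the exponents add up to \<open>m + n\<close>.\<close>
  have step2: "(\<integral>\<beta>. ?ind \<beta> *\<^sub>R (cis (- (real n * \<beta>)) * (\<integral>t. cis (real m * v t) * ?c (cos (v t + \<beta>)) * \<phi> t \<partial>lborel)) \<partial>lborel)
      = ccoeff2 \<Gamma> m n * (\<integral>t. cis (real (m + n) * v t) * \<phi> t \<partial>lborel)"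
  proof -
    let ?j = "\<lambda>\<beta> t. cis (real m * v t) * ?c (cos (v t + \<beta>)) * \<phi> t"
    have "(\<integral>\<beta>. ?ind \<beta> *\<^sub>R (cis (- (real n * \<beta>)) * (\<integral>t. ?j \<beta> t \<partial>lborel)) \<partial>lborel)
      = (\<integral>\<beta>. \<integral>t. ?ind \<beta> *\<^sub>R (cis (- (real n * \<beta>)) * ?j \<beta> t) \<partial>lborel \<partial>lborel)" by simp
    also have "\<dots> = (\<integral>t. \<integral>\<beta>. ?ind \<beta> *\<^sub>R (cis (- (real n * \<beta>)) * ?j \<beta> t) \<partial>lborel \<partial>lborel)"
    proof (rule fubini_swap)
      have "(\<integral>\<^sup>+\<beta>. \<integral>\<^sup>+t. ennreal (cmod (?ind \<beta> *\<^sub>R (cis (- (real n * \<beta>)) * ?j \<beta> t))) \<partial>lborel \<partial>lborel)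
        \<le> (\<integral>\<^sup>+\<beta>. \<integral>\<^sup>+t. ennreal (?ind \<beta>) * ennreal (A * (2 * pi) * cmod (\<phi> t)) \<partial>lborel \<partial>lborel)"
      proof (intro nn_integral_mono)
        fix \<beta> t
        have "?ind \<beta> * (cmod (?c (cos (v t + \<beta>))) * cmod (\<phi> t)) \<le> ?ind \<beta> * (A * (2 * pi) * cmod (\<phi> t))"
          by (intro mult_left_mono mult_right_mono Ac) auto
        then show "ennreal (cmod (?ind \<beta> *\<^sub>R (cis (- (real n * \<beta>)) * ?j \<beta> t))) \<le> ennreal (?ind \<beta>) * ennreal (A * (2 * pi) * cmod (\<phi> t))"
          using A(1) by (subst ennreal_mult[symmetric]) (auto simp: norm_mult intro!: ennreal_leI)
      qed
      also have "\<dots> = ennreal (2 * pi) * (\<integral>\<^sup>+t. ennreal (A * (2 * pi) * cmod (\<phi> t)) \<partial>lborel)"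
        by (simp add: nn_integral_cmult nn_integral_multc ind1)
      also have "\<dots> < \<infinity>"
        using \<phi> A(1) unfolding integrable_iff_bounded
        by (simp add: ennreal_mult nn_integral_cmult ennreal_mult_less_top)
      finally show "(\<integral>\<^sup>+\<beta>. \<integral>\<^sup>+t. ennreal (cmod (?ind \<beta> *\<^sub>R (cis (- (real n * \<beta>)) * ?j \<beta> t))) \<partial>lborel \<partial>lborel) < \<infinity>" .
    qed measurable
    also have "\<dots> = (\<integral>t. ccoeff2 \<Gamma> m n * (cis (real (m + n) * v t) * \<phi> t) \<partial>lborel)"
    proof (intro Bochner_Integration.integral_cong refl)
      fix t
      have "(\<integral>\<beta>. ?ind \<beta> *\<^sub>R (cis (- (real n * \<beta>)) * ?j \<beta> t) \<partial>lborel)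
         = (\<integral>\<beta>. (?ind \<beta> *\<^sub>R (cis (- (real n * \<beta>)) * ?c (cos (v t + \<beta>)))) * (cis (real m * v t) * \<phi> t) \<partial>lborel)"
        by (simp add: mult_ac)
      also have "\<dots> = cis (real n * v t) * ccoeff2 \<Gamma> m n * (cis (real m * v t) * \<phi> t)"
        unfolding ccoeff2_def by (simp only: integral_mult_left_zero ccoeff_shift[OF cc v(2)])
      also have "\<dots> = ccoeff2 \<Gamma> m n * (cis (real n * v t) * cis (real m * v t) * \<phi> t)" by (simp add: mult_ac)
      also have "cis (real n * v t) * cis (real m * v t) = cis (real (m + n) * v t)"
        unfolding cis_mult by (simp add: algebra_simps)
      finally show "(\<integral>\<beta>. ?ind \<beta> *\<^sub>R (cis (- (real n * \<beta>)) * ?j \<beta> t) \<partial>lborel) = ccoeff2 \<Gamma> m n * (cis (real (m + n) * v t) * \<phi> t)" .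
    qed
    finally show ?thesis by simp
  qed
  have "cmod (\<integral>\<beta>. ?ind \<beta> *\<^sub>R (cis (- (real n * \<beta>)) * (\<integral>\<alpha>. ?ind \<alpha> *\<^sub>R (cis (- (real m * \<alpha>)) * (\<integral>t. ?k \<alpha> \<beta> t \<partial>lborel)) \<partial>lborel)) \<partial>lborel)
     \<le> B * (2 * pi) * (2 * pi)"
  proof (rule norm_integral_Icc_le)
    fix \<beta>
    have "cmod (\<integral>\<alpha>. ?ind \<alpha> *\<^sub>R (cis (- (real m * \<alpha>)) * (\<integral>t. ?k \<alpha> \<beta> t \<partial>lborel)) \<partial>lborel) \<le> B * (2 * pi)"
      by (rule norm_integral_Icc_le) (simp add: norm_mult B)
    then show "cmod (cis (- (real n * \<beta>)) * (\<integral>\<alpha>. ?ind \<alpha> *\<^sub>R (cis (- (real m * \<alpha>)) * (\<integral>t. ?k \<alpha> \<beta> t \<partial>lborel)) \<partial>lborel)) \<le> B * (2 * pi)"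
      by (simp add: norm_mult)
  qed
  then show ?thesis unfolding step1 step2 .
qed

text \<open>The factor \<open>e\<close> is fixed before \<open>m\<close> and \<open>n\<close>, since
  the perturbations have a norm bound free of the indices and phases. All exponential smallness
  comes from the test function, which is chosen to cancel the character left by the
  averaging.\<close>

theorem operates_coefficient_decay:
  fixes g :: "'a::euclidean_space \<Rightarrow> complex"
  assumes g: "g \<in> schwartz" and nz: "g \<noteq> (\<lambda>_. 0)" and op: "operates_in_M11 g F"
  obtains e C where "0 < e"
    "\<And>m n. cmod (ccoeff2 (\<lambda>s t. F (s0 + e * s, t0 + e * t)) m n) \<le> C * (127 / 128) ^ (m + n)"
proof -
  let ?p0 = "Complex s0 t0"
  obtain q :: 'a and \<rho> \<delta> K where \<rho>: "0 < \<rho>" and \<delta>: "0 < \<delta>" and K: "0 \<le> K"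
    and lb: "\<And>f \<phi> S. continuous_on UNIV f \<Longrightarrow> (\<forall>t. 2 * \<rho> < norm (t - q) \<longrightarrow> f t = 0) \<Longrightarrow> xnorm g f \<le> ennreal \<delta> \<Longrightarrow>
       integrable lborel \<phi> \<Longrightarrow> \<forall>w. cmod (fourier \<phi> w) \<le> S \<Longrightarrow>
       cmod (\<integral>t. complex_of_real (bump q \<rho> t) * F (Re (?p0 + f t), Im (?p0 + f t)) * \<phi> t \<partial>lborel) \<le> K * S"
    by (rule operates_locally_bounded[OF g nz op, of ?p0]) (rule that)
  have Fc: "continuous_on UNIV (\<lambda>z. F (Re z, Im z))" by (rule operates_continuous[OF g nz op])
  \<comment> \<open>Nested cut-offs: the test function carries the bump of radius
    \<open>\<rho> / 4\<close> and so lives in the ball of radius \<open>\<rho> / 2\<close>, where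
    the two wider bumps equal 1.\<close>
  let ?a = "\<lambda>t. complex_of_real (bump q (\<rho> / 2) t)"
  let ?b = "\<lambda>t. complex_of_real (bump q (\<rho> / 4) t)"
  have a: "?a \<in> schwartz" by (rule schwartz_bump) (use \<rho> in simp)
  have b: "?b \<in> schwartz" by (rule schwartz_bump) (use \<rho> in simp)
  have pa: "pairable ?a"
    by (intro pairable_bounded[where B=1] schwartz_measurable[OF a]) (simp add: abs_of_nonneg[OF bump_nonneg] bump_le_1)
  define X where "X = enn2real (xnorm g ?a)"
  have X: "xnorm g ?a = ennreal X" "0 \<le> X" using xnorm_schwartz[OF a g] by (simp_all add: X_def)
  \<comment> \<open>Two cosines of multiplier bound \<open>exp (1 / 4)\<close> each, times the norm
    \<open>X\<close> of the cut-off; this choice brings the perturbation below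
    \<open>\<delta>\<close>.\<close>
  define e where "e = \<delta> / (2 * exp (1 / 4) * (X + 1))"
  have e: "0 < e" using \<delta> X(2) by (simp add: e_def)
  have eX: "e * (2 * exp (1 / 4)) * X \<le> \<delta>"
  proof -
    have c: "\<delta> / (y * z) * y * z = \<delta>" if "y \<noteq> 0" "z \<noteq> 0" for y z :: real using that by simp
    have "e * (2 * exp (1 / 4)) * X \<le> e * (2 * exp (1 / 4)) * (X + 1)" using e by (intro mult_left_mono) auto
    also have "\<dots> = \<delta>" unfolding e_def using X(2) by (intro c) auto
    finally show ?thesis .
  qed
  have r4: "0 < \<rho> / 4" using \<rho> by simp
  obtain S where S: "0 < S" "\<And>M. \<exists>ls. length ls = M \<and>
    (\<forall>w. cmod (fourier (\<lambda>t. cis (waves ls t) * ?b t) w) \<le> S * (127 / 128) ^ M)"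
    by (rule exponential_small_fourier[OF r4, of q]) (rule that)
  \<comment> \<open>What is left of the pairing once the exponentials cancel. It depends on the bump
    only and must be nonzero, since the coefficient is divided by it.\<close>
  define J where "J = (\<integral>t. ?b t \<partial>lborel)"
  have J: "0 < cmod J"
  proof -
    have Jr: "J = of_real (\<integral>t. bump q (\<rho> / 4) t \<partial>lborel)" unfolding J_def by (rule integral_complex_of_real)
    have i: "integrable lborel (bump q (\<rho> / 4))" using schwartz_integrable[OF b] by (simp add: complex_of_real_integrable_eq)
    have "(\<integral>t. bump q (\<rho> / 4) t \<partial>lborel) \<noteq> 0"
    proof
      assume "(\<integral>t. bump q (\<rho> / 4) t \<partial>lborel) = 0"
      then have "(\<integral>t. (cmod (?b t))\<^sup>2 \<partial>lborel) = 0"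
      proof -
        assume "(\<integral>t. bump q (\<rho> / 4) t \<partial>lborel) = 0"
        then have "AE t in lborel. bump q (\<rho> / 4) t = 0"
          using integral_nonneg_eq_0_iff_AE[OF i] by (simp add: bump_nonneg)
        then have "AE t in lborel. (cmod (?b t))\<^sup>2 = 0" by eventually_elim simp
        then show ?thesis by (rule integral_eq_zero_AE)
      qed
      then show False using integral_norm_square_pos(2)[OF b bump_nonzero[OF r4]] by simp
    qed
    then show ?thesis by (simp add: Jr)
  qed
  let ?\<Gamma> = "\<lambda>s t. F (s0 + e * s, t0 + e * t)"
  have c\<Gamma>: "continuous_on UNIV (\<lambda>(s, t). ?\<Gamma> s t)"
  proof -
    have "continuous_on UNIV (\<lambda>p. Complex (s0 + e * fst p) (t0 + e * snd p))"
      unfolding complex_eq[of _] Complex_eq by (intro continuous_intros)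
    from continuous_on_compose2[OF Fc this] show ?thesis by (simp add: case_prod_unfold)
  qed
  have main: "cmod (ccoeff2 ?\<Gamma> m n) \<le> (K * S * (2 * pi) * (2 * pi) / cmod J) * (127 / 128) ^ (m + n)" for m n
  proof -
    obtain ls where ls: "length ls = m + n"
      and small: "\<And>w. cmod (fourier (\<lambda>t. cis (waves ls t) * ?b t) w) \<le> S * (127 / 128) ^ (m + n)"
      using S(2)[of "m + n"] by blast
    define v where "v t = waves ls t / real (length ls)" for t :: 'a
    have mv: "multiplier (\<lambda>t. complex_of_real (v t)) (1 / 4)" unfolding v_def by (rule multiplier_waves)
    have vle: "\<bar>v t\<bar> \<le> 2 * pi" for t
      using multiplierD(2)[OF mv, of t] pi_gt3 by simp
    have cv: "continuous_on A v" for A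
    proof (cases "ls = []")
      case False then show ?thesis unfolding v_def by (intro continuous_intros continuous_on_waves) simp
    qed (simp add: v_def)
    \<comment> \<open>Also valid for \<open>m + n = 0\<close>, where the list is empty and both
      sides vanish.\<close>
    have wv: "real (m + n) * v t = waves ls t" for t
      by (cases "ls = []") (auto simp: v_def ls[symmetric] waves_Nil)
    \<comment> \<open>The conjugate cancels \<open>cis (real (m + n) * v t)\<close> and merely
      reflects and conjugates the transform, so the small bound persists.\<close>
    define \<phi> where "\<phi> t = cnj (cis (waves ls t) * ?b t)" for t
    have w: "(\<lambda>t. cis (waves ls t) * ?b t) \<in> schwartz" by (rule waves_schwartz[OF r4])
    have \<phi>i: "integrable lborel \<phi>" unfolding \<phi>_def by (intro schwartz_integrable schwartz_cnj w)
    have \<phi>S: "\<forall>x. cmod (fourier \<phi> x) \<le> S * (127 / 128) ^ (m + n)"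
      unfolding \<phi>_def fourier_cnj using small by simp
    have I: "cmod (\<integral>t. ?\<Gamma> (cos (v t + \<alpha>)) (cos (v t + \<beta>)) * \<phi> t \<partial>lborel) \<le> K * (S * (127 / 128) ^ (m + n))" for \<alpha> \<beta>
    proof -
      let ?u = "\<lambda>t. of_real e * (complex_of_real (cos (v t + \<alpha>)) + \<i> * complex_of_real (cos (v t + \<beta>)))"
      let ?f = "\<lambda>t. ?u t * ?a t"
      have "multiplier ?u (cmod (of_real e) * (exp (1 / 4) + cmod \<i> * exp (1 / 4)))"
        by (intro multiplier_cmult multiplier_add multiplier_cos_shift mv)
      then have "multiplier ?u (e * (2 * exp (1 / 4)))" using e by simp
      from xnorm_multiplier[OF g this pa]
      have "xnorm g ?f \<le> ennreal (e * (2 * exp (1 / 4)) * X)"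
        using X e by (simp add: ennreal_mult)
      also have "\<dots> \<le> ennreal \<delta>" by (rule ennreal_leI[OF eX])
      finally have xf: "xnorm g ?f \<le> ennreal \<delta>" .
      have cf: "continuous_on UNIV ?f"
        by (intro continuous_intros cv continuous_on_bump) (use \<rho> in simp)
      have supp: "\<forall>t. 2 * \<rho> < norm (t - q) \<longrightarrow> ?f t = 0" using \<rho> by (simp add: bump_eq_0)
      have eq: "?\<Gamma> (cos (v t + \<alpha>)) (cos (v t + \<beta>)) * \<phi> t = complex_of_real (bump q \<rho> t) * F (Re (?p0 + ?f t), Im (?p0 + ?f t)) * \<phi> t" for t
      proof (cases "norm (t - q) \<le> \<rho> / 2")
        case True
        then have "bump q \<rho> t = 1" "bump q (\<rho> / 2) t = 1" using \<rho> by (auto intro!: bump_eq_1)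
        then show ?thesis by simp
      next
        case False
        then have "bump q (\<rho> / 4) t = 0" using \<rho> by (intro bump_eq_0) auto
        then show ?thesis by (simp add: \<phi>_def)
      qed
      show ?thesis unfolding eq by (rule lb[OF cf supp xf \<phi>i \<phi>S])
    qed
    have J2: "(\<integral>t. cis (real (m + n) * v t) * \<phi> t \<partial>lborel) = J"
    proof -
      have "cis (waves ls t) * \<phi> t = ?b t" for t
        unfolding \<phi>_def complex_cnj_mult cis_cnj mult.assoc[symmetric] cis_mult by simp
      then show ?thesis unfolding wv J_def by simp
    qed
    have "cmod (ccoeff2 ?\<Gamma> m n) * cmod J \<le> K * (S * (127 / 128) ^ (m + n)) * (2 * pi) * (2 * pi)"
      using ccoeff2_average[OF c\<Gamma> cv vle \<phi>i I, of m n] unfolding J2 norm_mult .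
    then have "cmod (ccoeff2 ?\<Gamma> m n) \<le> K * (S * (127 / 128) ^ (m + n)) * (2 * pi) * (2 * pi) / cmod J"
      using J by (simp only: pos_le_divide_eq)
    then show ?thesis by (simp add: mult_ac)
  qed
  show ?thesis by (rule that[OF e main])
qed

theorem operates_real_analytic:
  fixes g :: "'a::euclidean_space \<Rightarrow> complex"
  assumes g: "g \<in> schwartz" and nz: "g \<noteq> (\<lambda>_. 0)" and op: "operates_in_M11 g F"
  shows "real_analytic F"
proof (rule real_analytic_if_chebyshev_decay)
  have "continuous_on UNIV (\<lambda>p. Complex (fst p) (snd p))"
    unfolding Complex_eq by (intro continuous_intros)
  from continuous_on_compose2[OF operates_continuous[OF g nz op] this]
  show "continuous_on UNIV F" by simp
  fix s0 t0
  obtain e C where e: "0 < e"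
    "\<And>m n. cmod (ccoeff2 (\<lambda>s t. F (s0 + e * s, t0 + e * t)) m n) \<le> C * (127 / 128) ^ (m + n)"
    by (rule operates_coefficient_decay[OF g nz op, of s0 t0]) (rule that)
  have k: "(0::real) < 127 / 128" "(127 / 128 :: real) < 1" by simp_all
  show "\<exists>e C \<kappa>. 0 < e \<and> 0 < \<kappa> \<and> \<kappa> < 1 \<and>
      (\<forall>m n. cmod (ccoeff2 (\<lambda>s t. F (s0 + e * s, t0 + e * t)) m n) \<le> C * \<kappa> ^ (m + n))"
    using e k by blast
qed

theorem theorem1p3:
  fixes g :: "real ^ 'n \<Rightarrow> complex" and F :: "real \<times> real \<Rightarrow> complex"
  assumes "g \<in> schwartz" and "g \<noteq> (\<lambda>_. 0)"
  shows "operates_in_M11 g F \<longleftrightarrow> real_analytic F \<and> F (0, 0) = 0"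
  using operates_real_analytic[OF assms] operates_at_0[OF assms] real_analytic_operates[OF assms] by blast

end
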